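(* $Y_{r,n}^{d}$ is a Frobenius algebra over $\mathcal{R}$, that is, there is an isomorphism of left $Y_{r,n}^{d}$-modules $Y_{r,n}^{d}\cong \mathrm{Hom}_{\mathcal{R}}(Y_{r,n}^{d}, \mathcal{R})$ between the left regular module and the $\mathcal{R}$-linear dual of the right regular module.
   Context: Let $r,n,d\geq 1$ be integers, $\zeta=e^{2\pi i/r}$, let $q,v_1,\ldots,v_d$ be indeterminates and $\mathcal{R}=\mathbb{Z}[\tfrac1r,\zeta][q^{\pm1},v_1^{\pm1},\ldots,v_d^{\pm1}]$. The symmetric group $\mathfrak{S}_n$ acts on $\{1,\ldots,n\}$ on the right and $s_i=(i,i+1)$. The affine Yokonuma-Hecke algebra $\widehat{Y}_{r,n}$ is the associative $\mathcal{R}$-algebra generated by $t_1,\ldots,t_n,g_1,\ldots,g_{n-1},X_1^{\pm1}$ with relations: $g_ig_j=g_jg_i$ if $|i-j|\ge2$; $g_ig_{i+1}g_i=g_{i+1}g_ig_{i+1}$; $t_it_j=t_jt_i$; $g_it_j=t_{js_i}g_i$; $t_i^r=1$; $g_i^2=1+(q-q^{-1})e_ig_i$, where $e_i=\frac1r\sum_{s=0}^{r-1}t_i^st_{i+1}^{-s}$; $X_1X_1^{-1}=X_1^{-1}X_1=1$; $g_1X_1g_1X_1=X_1g_1X_1g_1$; $g_iX_1=X_1g_i$ for $i\ge2$; $t_jX_1=X_1t_j$ for all $j$. The cyclotomic Yokonuma-Hecke algebra is $Y_{r,n}^d=\widehat{Y}_{r,n}/\mathcal{J}_d$, where $\mathcal{J}_d$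 is the two-sided ideal generated by $(X_1-v_1)\cdots(X_1-v_d)$. *)

theory Defs
  imports
    Complex_Main
    "HOL-Library.Poly_Mapping"
    "HOL-Combinatorics.Transposition"
    "HOL-Algebra.Algebra"
begin

section \<open>Associative algebras and the Frobenius property\<close>

text \<open>
  The locale \<^locale>\<open>algebra\<close> of the library is restricted to commutative algebras; here the
  multiplication of \<open>A\<close> need not be commutative.
\<close>

locale assoc_algebra = module R A + A?: ring A
  for R (structure) and A (structure) +
  assumes smult_mult_left:
      "\<lbrakk>c \<in> carrier R; x \<in> carrier A; y \<in> carrier A\<rbrakk>
        \<Longrightarrow> (c \<odot>\<^bsub>A\<^esub> x) \<otimes>\<^bsub>A\<^esub> y = c \<odot>\<^bsub>A\<^esub> (x \<otimes>\<^bsub>A\<^esub> y)"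
    and smult_mult_right:
      "\<lbrakk>c \<in> carrier R; x \<in> carrier A; y \<in> carrier A\<rbrakk>
        \<Longrightarrow> x \<otimes>\<^bsub>A\<^esub> (c \<odot>\<^bsub>A\<^esub> y) = c \<odot>\<^bsub>A\<^esub> (x \<otimes>\<^bsub>A\<^esub> y)"

text \<open>
  A left module over a non-commutative ring \<open>A\<close> is represented by a record of type
  \<^typ>\<open>('a, 'm) module\<close>, whose scalars are the elements of \<open>A\<close>. The fields \<open>mult\<close> and \<open>one\<close> of
  this record play no role.
\<close>

definition left_module_iso ::
    "('a, 'x) ring_scheme \<Rightarrow> ('a, 'm, 'y) module_scheme \<Rightarrow> ('a, 'n, 'z) module_scheme \<Rightarrow> ('m \<Rightarrow> 'n) set"
  where "left_module_iso A M N =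
    {f. bij_betw f (carrier M) (carrier N) \<and>
        (\<forall>x\<in>carrier M. \<forall>y\<in>carrier M. f (x \<oplus>\<^bsub>M\<^esub> y) = f x \<oplus>\<^bsub>N\<^esub> f y) \<and>
        (\<forall>a\<in>carrier A. \<forall>x\<in>carrier M. f (a \<odot>\<^bsub>M\<^esub> x) = a \<odot>\<^bsub>N\<^esub> f x)}"

definition left_regular :: "('c, 'a, 'x) module_scheme \<Rightarrow> ('a, 'a) module"
  where "left_regular A =
    \<lparr>carrier = carrier A, monoid.mult = undefined, one = undefined,
     ring.zero = \<zero>\<^bsub>A\<^esub>, add = add A, module.smult = monoid.mult A\<rparr>"

text \<open>
  The dual \<open>Hom_R(A, R)\<close> of the right regular module, with \<open>(a \<cdot> \<phi>)(x) = \<phi>(x a)\<close>. Functionals are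
  taken to be \<^const>\<open>undefined\<close> outside of \<open>carrier A\<close>, so that they are determined by their
  values on \<open>A\<close>.
\<close>

definition right_regular_dual ::
    "('c, 'x) ring_scheme \<Rightarrow> ('c, 'a, 'y) module_scheme \<Rightarrow> ('a, 'a \<Rightarrow> 'c) module"
  where "right_regular_dual R A =
    \<lparr>carrier = {\<phi> \<in> carrier A \<rightarrow>\<^sub>E carrier R.
       (\<forall>x\<in>carrier A. \<forall>y\<in>carrier A. \<phi> (x \<oplus>\<^bsub>A\<^esub> y) = \<phi> x \<oplus>\<^bsub>R\<^esub> \<phi> y) \<and>
       (\<forall>c\<in>carrier R. \<forall>x\<in>carrier A. \<phi> (c \<odot>\<^bsub>A\<^esub> x) = c \<otimes>\<^bsub>R\<^esub> \<phi> x)},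
     monoid.mult = undefined, one = undefined,
     ring.zero = (\<lambda>x\<in>carrier A. \<zero>\<^bsub>R\<^esub>),
     add = (\<lambda>\<phi> \<psi>. \<lambda>x\<in>carrier A. \<phi> x \<oplus>\<^bsub>R\<^esub> \<psi> x),
     module.smult = (\<lambda>a \<phi>. \<lambda>x\<in>carrier A. \<phi> (x \<otimes>\<^bsub>A\<^esub> a))\<rparr>"

definition frobenius_algebra :: "('c, 'x) ring_scheme \<Rightarrow> ('c, 'a, 'y) module_scheme \<Rightarrow> bool"
  where "frobenius_algebra R A \<longleftrightarrow>
    assoc_algebra R A \<and> left_module_iso A (left_regular A) (right_regular_dual R A) \<noteq> {}"


section \<open>Quotient algebras\<close>

text \<open>The scalar action on cosets, in the style of \<^const>\<open>rcoset_mult\<close>.\<close>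

definition quot_algebra :: "('c, 'a, 'x) module_scheme \<Rightarrow> 'a set \<Rightarrow> ('c, 'a set) module"
  where "quot_algebra A I =
    ring.extend (A Quot I) (module.fields (\<lambda>c S. \<Union>x\<in>S. I +>\<^bsub>A\<^esub> (c \<odot>\<^bsub>A\<^esub> x)))"


section \<open>Free algebras\<close>

text \<open>
  The free monoid is written additively, because the convolution product on
  \<^typ>\<open>'w \<Rightarrow>\<^sub>0 'c\<close> is defined for an additive monoid of exponents. The addition is
  concatenation and is not commutative.
\<close>

datatype 'g free_monoid = Word (letters: "'g list")

instantiation free_monoid :: (type) monoid_add
begin

definition "0 = Word []"
definition "v + w = Word (letters v @ letters w)"

instance
  by standard (simp_all add: zero_free_monoid_def plus_free_monoid_def)

end

text \<open>
  The free associative algebra on the set of generators \<open>S\<close> over the subring \<open>C\<close> of the type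
  \<^typ>\<open>'c\<close>.
\<close>

definition free_algebra ::
    "'c::comm_ring_1 set \<Rightarrow> 'g set \<Rightarrow> ('c, 'g free_monoid \<Rightarrow>\<^sub>0 'c) module"
  where "free_algebra C S =
    \<lparr>carrier = {f. \<forall>w\<in>Poly_Mapping.keys f. Poly_Mapping.lookup f w \<in> C \<and> set (letters w) \<subseteq> S},
     monoid.mult = (*), one = 1, ring.zero = 0, add = (+),
     module.smult = (\<lambda>c f. Poly_Mapping.single 0 c * f)\<rparr>"

definition scalar :: "'c \<Rightarrow> 'g free_monoid \<Rightarrow>\<^sub>0 'c::comm_ring_1"
  where "scalar c = Poly_Mapping.single 0 c"

definition gen :: "'g \<Rightarrow> 'g free_monoid \<Rightarrow>\<^sub>0 'c::comm_ring_1"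
  where "gen x = Poly_Mapping.single (Word [x]) 1"


section \<open>The ground ring\<close>

datatype indet = Var_q | Var_v nat

text \<open>
  Laurent polynomials are finitely supported functions from exponent vectors in
  \<^typ>\<open>indet \<Rightarrow>\<^sub>0 int\<close> to coefficients.
\<close>

type_synonym laurent = "(indet \<Rightarrow>\<^sub>0 int) \<Rightarrow>\<^sub>0 complex"

definition laurent_const :: "complex \<Rightarrow> laurent"
  where "laurent_const a = Poly_Mapping.single 0 a"

definition indet_power :: "indet \<Rightarrow> int \<Rightarrow> laurent"
  where "indet_power x k = Poly_Mapping.single (Poly_Mapping.single x k) 1"

text \<open>The subring \<open>\<int>[1/r, \<zeta>]\<close> of the complex numbers, where \<open>\<zeta> = exp(2 \<pi> i / r)\<close>.\<close>

definition coeff_ring :: "nat \<Rightarrow> complex set"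
  where "coeff_ring r =
    generate_ring
      \<lparr>carrier = UNIV, monoid.mult = (*), one = 1, ring.zero = 0, add = (+)\<rparr>
      {1 / of_nat r, exp (2 * of_real pi * \<i> / of_nat r)}"

definition ground_ring :: "nat \<Rightarrow> nat \<Rightarrow> laurent ring"
  where "ground_ring r d =
    \<lparr>carrier = {p. \<forall>m\<in>Poly_Mapping.keys p.
        Poly_Mapping.lookup p m \<in> coeff_ring r \<and> Poly_Mapping.keys m \<subseteq> insert Var_q (Var_v ` {1..d})},
     monoid.mult = (*), one = 1, ring.zero = 0, add = (+)\<rparr>"


section \<open>Yokonuma-Hecke algebras\<close>

datatype yh_gen = Gen_t nat | Gen_g nat | Gen_X | Gen_X_inv

type_synonym yh_free = "yh_gen free_monoid \<Rightarrow>\<^sub>0 laurent"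

definition yh_gens :: "nat \<Rightarrow> yh_gen set"
  where "yh_gens n = Gen_t ` {1..n} \<union> Gen_g ` {1..<n} \<union> {Gen_X, Gen_X_inv}"

definition yh_free_algebra :: "nat \<Rightarrow> nat \<Rightarrow> nat \<Rightarrow> (laurent, yh_free) module"
  where "yh_free_algebra r n d = free_algebra (carrier (ground_ring r d)) (yh_gens n)"

abbreviation yt :: "nat \<Rightarrow> yh_free" where "yt j \<equiv> gen (Gen_t j)"
abbreviation yg :: "nat \<Rightarrow> yh_free" where "yg i \<equiv> gen (Gen_g i)"
abbreviation yX :: yh_free where "yX \<equiv> gen Gen_X"
abbreviation yX_inv :: yh_free where "yX_inv \<equiv> gen Gen_X_inv"

text \<open>
  There is no generator for the inverse of \<open>t\<^sub>j\<close>: by the relation \<open>t\<^sub>j\<^sup>r = 1\<close>, the power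
  \<open>t\<^sub>j\<^sup>-\<^sup>s\<close> is \<open>t\<^sub>j\<^sup>r\<^sup>-\<^sup>s\<close> for \<open>0 \<le> s < r\<close>.
\<close>

definition ye :: "nat \<Rightarrow> nat \<Rightarrow> yh_free"
  where "ye r i =
    scalar (laurent_const (1 / of_nat r)) * (\<Sum>s<r. yt i ^ s * yt (Suc i) ^ (r - s))"

text \<open>
  A relation \<open>a = b\<close> is represented by the element \<open>a - b\<close> of the free algebra. In
  \<open>g\<^sub>i t\<^sub>j = t\<^sub>j\<^sub>s\<^sub>i g\<^sub>i\<close>, the index is the image of \<open>j\<close> under the transposition of \<open>i\<close> and \<open>i + 1\<close>.
\<close>

definition yh_relations :: "nat \<Rightarrow> nat \<Rightarrow> yh_free set"
  where "yh_relations r n =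
      {yg i * yg j - yg j * yg i | i j. i \<in> {1..<n} \<and> j \<in> {1..<n} \<and> (i + 2 \<le> j \<or> j + 2 \<le> i)}
    \<union> {yg i * yg (Suc i) * yg i - yg (Suc i) * yg i * yg (Suc i) | i. i \<in> {1..<n} \<and> Suc i \<in> {1..<n}}
    \<union> {yt i * yt j - yt j * yt i | i j. i \<in> {1..n} \<and> j \<in> {1..n}}
    \<union> {yg i * yt j - yt (transpose i (Suc i) j) * yg i | i j. i \<in> {1..<n} \<and> j \<in> {1..n}}
    \<union> {yt i ^ r - 1 | i. i \<in> {1..n}}
    \<union> {(yg i)\<^sup>2 - (1 + scalar (indet_power Var_q 1 - indet_power Var_q (-1)) * ye r i * yg i) | i. i \<in> {1..<n}}
    \<union> {yX * yX_inv - 1, yX_inv * yX - 1}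
    \<union> (if 2 \<le> n then {yg 1 * yX * yg 1 * yX - yX * yg 1 * yX * yg 1} else {})
    \<union> {yg i * yX - yX * yg i | i. i \<in> {2..<n}}
    \<union> {yt j * yX - yX * yt j | j. j \<in> {1..n}}"

definition affine_yh :: "nat \<Rightarrow> nat \<Rightarrow> nat \<Rightarrow> (laurent, yh_free set) module"
  where "affine_yh r n d =
    quot_algebra (yh_free_algebra r n d) (Idl\<^bsub>yh_free_algebra r n d\<^esub> (yh_relations r n))"

text \<open>The image in the affine algebra of \<open>(X\<^sub>1 - v\<^sub>1) \<cdots> (X\<^sub>1 - v\<^sub>d)\<close>.\<close>

definition cyclotomic_element :: "nat \<Rightarrow> nat \<Rightarrow> nat \<Rightarrow> yh_free set"
  where "cyclotomic_element r n d =
    (Idl\<^bsub>yh_free_algebra r n d\<^esub> (yh_relations r n)) +>\<^bsub>yh_free_algebra r n d\<^esub>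
      prod_list (map (\<lambda>k. yX - scalar (indet_power (Var_v k) 1)) [1..<Suc d])"

definition cyclotomic_yh :: "nat \<Rightarrow> nat \<Rightarrow> nat \<Rightarrow> (laurent, yh_free set set) module"
  where "cyclotomic_yh r n d =
    quot_algebra (affine_yh r n d) (Idl\<^bsub>affine_yh r n d\<^esub> {cyclotomic_element r n d})"

end

theory Submission
  imports Defs "HOL-Library.Function_Algebras"
begin

text \<open>The isomorphism comes from a perfect pairing. Let $C$ be the cyclotomic algebra and
  $R$ the ground ring. For a linear form \<open>\<mu>\<close> on $C$ the map sending $a$ to the
  form \<open>\<lambda>x. \<mu> (x a)\<close> is a homomorphism of left modules from $C$ to its
  dual, and it is bijective as soon as \<open>\<mu>\<close> takes, on the products of a suitable
  spanning family with a suitable basis, an invertible matrix of values. Two families of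
  monomials, indexed by the same finite set of words of length $n$ in letters \<open>(j, a,
  b)\<close>, are used. A column is a product, over decreasing levels $m$, of $g_{j-1}^{-1}
  \cdots g_1^{-1} \, p_a(X) \, g_1 \cdots g_m \, t_{m+1}^b$, and a row is a product, over
  increasing levels, of $t_{m+1}^b \, g_m \cdots g_1 \, p_k(X) \, g_1 \cdots g_{j-1}$. Here
  $p_a$ is the product of the first $a$ factors of the polynomial that annihilates $X$, a Newton
  basis for the powers of $X$.\<close>

text \<open>Three facts carry the proof. First, columns span $C$ over $R$, and so do rows
  (\<open>columns_span\<close>, \<open>rows_span\<close>): the span of the words is shown to be
  stable under left multiplication by the generators (\<open>span_closed\<close>), the delicate
  generator being $X$, which is moved through a word by a commutation formula
  (\<open>X_g_p_g\<close>); rows are columns of the opposite ring. Second, $C$ acts on a free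
  module $V$ with a basis indexed by the words, with a vector $v$ that each column sends to the
  basis vector of the same index. Hence the columns are linearly independent and
  \<open>\<lambda>x. x v\<close> identifies $C$ with $V$. Third, $V$ carries a linear form
  \<open>\<lambda>\<close> such that a vector $z$ is determined by the values of
  \<open>\<lambda>\<close> on the row multiples of $z$, and these values can be prescribed
  arbitrarily. Then \<open>\<mu> x = \<lambda> (x v)\<close> is the required form.\<close>

text \<open>The second and third facts are proved together by induction on $n$
  (\<open>standard_module\<close>). From a module $M$ for $n$ strands one forms the layer $N =
  R[x]/(f) \otimes R[\tau]/(\tau^r - 1) \otimes M$, with $f$ the annihilating polynomial, and
  puts an action for $n+1$ strands on $n+1$ copies of $N$ by explicit formulas
  (\<open>ind_yh_module\<close>). They describe left multiplication on the summands
  $g_{j-1}^{-1} \cdots g_1^{-1} \, N \, g_1 \cdots g_n$ of the induced module. The new linear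
  form takes the coefficient of $x^{d-1} \tau^0$ in the last copy and then applies the old form.
  In a suitable order of the indices its matrix on the new rows is unitriangular
  (\<open>row_form_bijective\<close>).\<close>

section \<open>Linear maps, averages and Newton products\<close>

definition linmap ::
    "('c \<Rightarrow> 'm \<Rightarrow> 'm) \<Rightarrow> ('c \<Rightarrow> 'k \<Rightarrow> 'k) \<Rightarrow> ('m::ab_group_add \<Rightarrow> 'k::ab_group_add) \<Rightarrow> bool"
  where "linmap sc sc' f \<longleftrightarrow>
    (\<forall>x y. f (x + y) = f x + f y) \<and> (\<forall>c x. f (sc c x) = sc' c (f x))"

abbreviation "linop sc \<equiv> linmap sc sc"

lemma linmapI:
  assumes "\<And>x y. f (x + y) = f x + f y" "\<And>c x. f (sc c x) = sc' c (f x)"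
  shows "linmap sc sc' f"
  using assms by (simp add: linmap_def)

lemma linmap_add: "linmap sc sc' f \<Longrightarrow> f (x + y) = f x + f y"
  and linmap_scale: "linmap sc sc' f \<Longrightarrow> f (sc c x) = sc' c (f x)"
  by (simp_all add: linmap_def)

lemma linmap_zero: "linmap sc sc' f \<Longrightarrow> f 0 = 0"
  using linmap_add[of sc sc' f 0 0] by simp

lemma linmap_diff: "linmap sc sc' f \<Longrightarrow> f (x - y) = f x - f y"
  using linmap_add[of sc sc' f "x - y" y] by (simp add: algebra_simps)

lemma linmap_sum: "linmap sc sc' f \<Longrightarrow> f (sum h A) = (\<Sum>i\<in>A. f (h i))"
  using linmap_zero[of sc sc' f] linmap_add[of sc sc' f]
  by (induction A rule: infinite_finite_induct) simp_all

lemmas linmap_simps = linmap_add linmap_scale linmap_zero linmap_diff linmap_sum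

lemma linmap_comp: "linmap sc' sc'' f \<Longrightarrow> linmap sc sc' h \<Longrightarrow> linmap sc sc'' (\<lambda>z. f (h z))"
  by (simp add: linmap_def)

lemma linop_funpow: "linop sc f \<Longrightarrow> linop sc (f ^^ k)"
  by (induction k) (simp_all add: linmap_def)

text \<open>For commuting $a$ and $b$ with $a^r = b^r = 1$ and \<open>rho\<close> the inverse of
  $r$, this is the idempotent $\frac1r \sum_s a^s b^{-s}$, the projection to the vectors on
  which $a$ and $b$ agree. With $a = t_i$ and $b = t_{i+1}$ it is $e_i$.\<close>

definition average ::
    "('c \<Rightarrow> 'm \<Rightarrow> 'm) \<Rightarrow> 'c \<Rightarrow> nat \<Rightarrow> ('m \<Rightarrow> 'm) \<Rightarrow> ('m \<Rightarrow> 'm) \<Rightarrow> 'm \<Rightarrow> 'm::ab_group_add"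
  where "average sc rho r a b z = sc rho (\<Sum>s<r. (a ^^ s) ((b ^^ (r - s)) z))"

text \<open>The operator $p_k(X) = (X - u_0) \cdots (X - u_{k-1})$.\<close>

primrec newton ::
    "('c \<Rightarrow> 'm \<Rightarrow> 'm) \<Rightarrow> (nat \<Rightarrow> 'c) \<Rightarrow> ('m \<Rightarrow> 'm) \<Rightarrow> nat \<Rightarrow> 'm \<Rightarrow> 'm::ab_group_add"
  where
    "newton sc u X1 0 z = z"
  | "newton sc u X1 (Suc k) z = X1 (newton sc u X1 k z) - sc (u k) (newton sc u X1 k z)"

lemma funpow_intertwine:
  assumes "\<And>z. z \<in> P \<Longrightarrow> y (a z) = a' (y z)" "\<And>z. z \<in> P \<Longrightarrow> a z \<in> P" "z \<in> P"
  shows "y ((a ^^ k) z) = (a' ^^ k) (y z) \<and> (a ^^ k) z \<in> P"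
  using assms by (induction k) auto

text \<open>Most commutation rules for the idempotents $e_i$ are instances: an operator that
  carries one commuting pair to another carries the corresponding idempotents to each
  other.\<close>

lemma average_intertwine:
  assumes y: "linmap sc sc' y"
    and a: "\<And>z. z \<in> P \<Longrightarrow> y (a z) = a' (y z)" "\<And>z. z \<in> P \<Longrightarrow> a z \<in> P"
    and b: "\<And>z. z \<in> P \<Longrightarrow> y (b z) = b' (y z)" "\<And>z. z \<in> P \<Longrightarrow> b z \<in> P"
    and z: "z \<in> P"
  shows "y (average sc rho r a b z) = average sc' rho r a' b' (y z)"
proof -
  have "y ((a ^^ s) ((b ^^ k) z)) = (a' ^^ s) ((b' ^^ k) (y z))" for s k
    using funpow_intertwine[of P y a a', OF a] funpow_intertwine[of P y b b', OF b] z by metis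
  then show ?thesis by (simp add: average_def linmap_simps[OF y])
qed

lemma linop_newton:
  assumes "linop sc X1" "Modules.module sc" shows "linop sc (newton sc u X1 k)"
proof (induction k)
  case (Suc k)
  interpret Modules.module sc by (fact assms(2))
  show ?case
    by (rule linmapI) (simp_all add: linmap_simps[OF Suc] linmap_simps[OF assms(1)] algebra_simps)
qed (simp add: linmap_def)

lemma newton_intertwine:
  assumes y: "linmap sc sc' y" and a: "\<And>z. z \<in> P \<Longrightarrow> y (X1 z) = X1' (y z)" 
    and P: "\<And>l. l < k \<Longrightarrow> newton sc u X1 l z \<in> P"
  shows "y (newton sc u X1 k z) = newton sc' u X1' k (y z)"
  using P by (induction k) (simp_all add: linmap_simps[OF y] a)

text \<open>The vectors live in a module over a large ring, in the application the type of all
  Laurent polynomials, while the statements concern the lattice \<open>P\<close> over the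
  subring \<open>R\<close>. Operators are linear on the whole type, but relations between them
  are required on \<open>P\<close> only.\<close>

locale submodule_over = Modules.module scale
  for scale :: "'c::comm_ring_1 \<Rightarrow> 'm::ab_group_add \<Rightarrow> 'm" (infixr "*s" 75) +
  fixes R :: "'c set" and P :: "'m set"
  assumes R_one: "1 \<in> R" and R_uminus_one: "- 1 \<in> R"
    and P_zero[simp]: "0 \<in> P"
    and P_add[simp]: "x \<in> P \<Longrightarrow> y \<in> P \<Longrightarrow> x + y \<in> P"
    and P_scale[simp]: "c \<in> R \<Longrightarrow> x \<in> P \<Longrightarrow> c *s x \<in> P"
begin

lemma P_diff[simp]: "x \<in> P \<Longrightarrow> y \<in> P \<Longrightarrow> x - y \<in> P"
  using P_add[of x "(- 1) *s y"] P_scale[of "- 1" y] R_uminus_one by simp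

lemma P_sum[simp]: "(\<And>i. i \<in> A \<Longrightarrow> f i \<in> P) \<Longrightarrow> sum f A \<in> P"
  by (induction A rule: infinite_finite_induct) auto

lemma average_closed:
  assumes "rho \<in> R" "\<And>z. z \<in> P \<Longrightarrow> a z \<in> P" "\<And>z. z \<in> P \<Longrightarrow> b z \<in> P" "z \<in> P"
  shows "average scale rho r a b z \<in> P"
proof -
  have "(b ^^ k) z \<in> P" for k using assms by (induction k) auto
  then have "(a ^^ s) ((b ^^ k) z) \<in> P" for s k using assms by (induction s) auto
  then show ?thesis using assms(1) by (simp add: average_def)
qed

lemma linop_average:
  assumes "linop scale a" "linop scale b"
  shows "linop scale (average scale rho r a b)"
  by (rule linmapI)
     (simp_all add: average_def linmap_simps[OF linop_funpow[OF assms(1)]]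
        linmap_simps[OF linop_funpow[OF assms(2)]] sum.distrib scale_right_distrib
        scale_sum_right mult.commute)

end

locale commuting_roots = submodule_over +
  fixes r :: nat and rho :: 'a and a b :: "'b \<Rightarrow> 'b"
  assumes rho: "rho \<in> R" "rho * of_nat r = 1"
    and a_lin: "linop scale a" and b_lin: "linop scale b"
    and a_P[simp]: "z \<in> P \<Longrightarrow> a z \<in> P" and b_P[simp]: "z \<in> P \<Longrightarrow> b z \<in> P"
    and ab: "z \<in> P \<Longrightarrow> a (b z) = b (a z)"
    and a_root: "z \<in> P \<Longrightarrow> (a ^^ r) z = z" and b_root: "z \<in> P \<Longrightarrow> (b ^^ r) z = z"
begin

lemma a_pow_P[simp]: "z \<in> P \<Longrightarrow> (a ^^ k) z \<in> P"
  and b_pow_P[simp]: "z \<in> P \<Longrightarrow> (b ^^ k) z \<in> P"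
  by (induction k) auto

lemma a_b_pow: "z \<in> P \<Longrightarrow> a ((b ^^ k) z) = (b ^^ k) (a z)"
  by (induction k) (simp_all add: ab)

lemma b_a_pow: "z \<in> P \<Longrightarrow> b ((a ^^ k) z) = (a ^^ k) (b z)"
  by (induction k) (simp_all add: ab[symmetric])

lemma a_pow_b_pow: "z \<in> P \<Longrightarrow> (a ^^ k) ((b ^^ l) z) = (b ^^ l) ((a ^^ k) z)"
  by (induction k) (simp_all add: a_b_pow)

lemma sum_shift:
  fixes F :: "nat \<Rightarrow> 'b"
  shows "F r = F 0 \<Longrightarrow> (\<Sum>s<r. F (Suc s)) = (\<Sum>s<r. F s)"
  using sum.lessThan_Suc_shift[of F r] sum.lessThan_Suc[of F r] by (simp add: algebra_simps)

text \<open>Both sides are the same sum up to a cyclic shift of the summation index.\<close>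

lemma average_absorb:
  assumes z: "z \<in> P"
  shows "a (average scale rho r a b z) = b (average scale rho r a b z)"
proof -
  let ?F = "\<lambda>s. (a ^^ s) ((b ^^ (Suc r - s)) z)"
  have "a (average scale rho r a b z) = rho *s (\<Sum>s<r. ?F (Suc s))"
    by (simp add: average_def linmap_simps[OF a_lin])
  also have "(\<Sum>s<r. ?F (Suc s)) = (\<Sum>s<r. ?F s)"
    using z by (intro sum_shift) (simp add: a_root b_root)
  also have "(\<Sum>s<r. ?F s) = (\<Sum>s<r. b ((a ^^ s) ((b ^^ (r - s)) z)))"
    using z by (intro sum.cong) (simp_all add: Suc_diff_le b_a_pow)
  finally show ?thesis by (simp add: average_def linmap_simps[OF b_lin])
qed

lemma average_swap:
  assumes z: "z \<in> P"
  shows "average scale rho r a b z = average scale rho r b a z"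
proof -
  let ?F = "\<lambda>s. (a ^^ s) ((b ^^ (r - s)) z)"
  have "(\<Sum>s<r. (b ^^ s) ((a ^^ (r - s)) z)) = (\<Sum>s<r. ?F (r - s))"
    using z by (intro sum.cong) (simp_all add: a_pow_b_pow)
  also have "\<dots> = (\<Sum>s<r. ?F (Suc (r - Suc s)))"
    by (intro sum.cong) (simp_all add: Suc_diff_Suc)
  also have "\<dots> = (\<Sum>s<r. ?F (Suc s))"
    by (rule sum.nat_diff_reindex[where g = "\<lambda>k. ?F (Suc k)"])
  also have "\<dots> = (\<Sum>s<r. ?F s)"
    using z by (intro sum_shift) (simp add: a_root b_root)
  finally show ?thesis by (simp add: average_def)
qed

lemma pow_eq: "a w = b w \<Longrightarrow> w \<in> P \<Longrightarrow> (a ^^ s) w = (b ^^ s) w"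
  by (induction s) (simp_all add: a_b_pow funpow_swap1)

lemma average_fixed:
  assumes y: "y \<in> P" "a y = b y"
  shows "average scale rho r a b y = y"
proof -
  have "(a ^^ s) ((b ^^ (r - s)) y) = y" if "s < r" for s
  proof -
    have "(a ^^ s) ((b ^^ (r - s)) y) = (b ^^ s) ((b ^^ (r - s)) y)"
      by (rule pow_eq) (simp_all add: a_b_pow y funpow_swap1)
    also have "\<dots> = (b ^^ (s + (r - s))) y" by (simp only: funpow_add o_apply)
    finally show ?thesis using that y by (simp add: b_root)
  qed
  then show ?thesis
    using rho scale_sum_right[of rho "\<lambda>_. y" "{..<r}", symmetric]
    by (simp add: average_def sum_constant_scale scale_scale)
qed

text \<open>On a vector where $a$ and $b$ agree, $b$ may replace $a$ in any idempotent formed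
  with a third operator.\<close>

lemma average_transfer:
  assumes y: "y \<in> P" "a y = b y"
    and c: "\<And>z. z \<in> P \<Longrightarrow> c z \<in> P" "\<And>z. z \<in> P \<Longrightarrow> a (c z) = c (a z)"
      "\<And>z. z \<in> P \<Longrightarrow> b (c z) = c (b z)"
  shows "average scale rho r a c y = average scale rho r b c y"
proof -
  have "(a ^^ s) ((c ^^ k) y) = (b ^^ s) ((c ^^ k) y)" for s k
  proof (rule pow_eq)
    have "a ((c ^^ k) y) = (c ^^ k) (a y) \<and> b ((c ^^ k) y) = (c ^^ k) (b y) \<and> (c ^^ k) y \<in> P"
      using y(1) c by (induction k) auto
    then show "a ((c ^^ k) y) = b ((c ^^ k) y)" "(c ^^ k) y \<in> P" using y by auto
  qed
  then show ?thesis by (simp add: average_def)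
qed

end

section \<open>Modules for the Yokonuma-Hecke relations\<close>

text \<open>The scalars: \<open>Dl\<close> is $q - q^{-1}$, \<open>rho\<close> is $1/r$ and
  \<open>u\<close> lists the $d$ roots of the polynomial that annihilates $X$.\<close>

locale yh_params =
  fixes R :: "'c::comm_ring_1 set" and r d :: nat and Dl rho :: 'c and u :: "nat \<Rightarrow> 'c"
  assumes r_pos: "r > 0" and d_pos: "d > 0"
    and one_R: "1 \<in> R" and uminus_one_R: "- 1 \<in> R"
    and Dl_R[simp]: "Dl \<in> R" and rho_R[simp]: "rho \<in> R" and u_R[simp]: "k < d \<Longrightarrow> u k \<in> R"
    and rho_r: "rho * of_nat r = 1"

text \<open>A lattice with an action of the cyclotomic algebra on $n$ strands. The case $n = 0$
  is included as the start of the induction: there only $X$ acts, and only its annihilating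
  polynomial constrains it.\<close>

locale yh_module = yh_params R r d Dl rho u + submodule_over scale R P
  for R :: "'c::comm_ring_1 set" and r d :: nat and Dl rho :: 'c and u :: "nat \<Rightarrow> 'c"
    and scale :: "'c \<Rightarrow> 'm::ab_group_add \<Rightarrow> 'm" (infixr "*s" 75)
    and P :: "'m set" +
  fixes n :: nat and t g :: "nat \<Rightarrow> 'm \<Rightarrow> 'm" and X1 :: "'m \<Rightarrow> 'm"
  assumes t_lin: "linop scale (t i)" and g_lin: "linop scale (g i)" and X_lin: "linop scale X1"
    and t_P: "\<lbrakk>1 \<le> i; i \<le> n; z \<in> P\<rbrakk> \<Longrightarrow> t i z \<in> P"
    and g_P: "\<lbrakk>1 \<le> i; i < n; z \<in> P\<rbrakk> \<Longrightarrow> g i z \<in> P"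
    and X_P: "z \<in> P \<Longrightarrow> X1 z \<in> P"
    and g_far: "\<lbrakk>1 \<le> i; i + 2 \<le> j; j < n; z \<in> P\<rbrakk> \<Longrightarrow> g i (g j z) = g j (g i z)"
    and braid: "\<lbrakk>1 \<le> i; Suc i < n; z \<in> P\<rbrakk> \<Longrightarrow>
      g i (g (Suc i) (g i z)) = g (Suc i) (g i (g (Suc i) z))"
    and t_t: "\<lbrakk>1 \<le> i; i \<le> n; 1 \<le> j; j \<le> n; z \<in> P\<rbrakk> \<Longrightarrow> t i (t j z) = t j (t i z)"
    and g_t: "\<lbrakk>1 \<le> i; i < n; 1 \<le> j; j \<le> n; z \<in> P\<rbrakk> \<Longrightarrow>
      g i (t j z) = t (transpose i (Suc i) j) (g i z)"
    and t_root: "\<lbrakk>1 \<le> i; i \<le> n; z \<in> P\<rbrakk> \<Longrightarrow> (t i ^^ r) z = z"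
    and g_g: "\<lbrakk>1 \<le> i; i < n; z \<in> P\<rbrakk> \<Longrightarrow>
      g i (g i z) = z + Dl *s average scale rho r (t i) (t (Suc i)) (g i z)"
    and g_X: "\<lbrakk>2 \<le> i; i < n; z \<in> P\<rbrakk> \<Longrightarrow> g i (X1 z) = X1 (g i z)"
    and g_X_g_X: "\<lbrakk>2 \<le> n; z \<in> P\<rbrakk> \<Longrightarrow> g 1 (X1 (g 1 (X1 z))) = X1 (g 1 (X1 (g 1 z)))"
    and t_X: "\<lbrakk>1 \<le> i; i \<le> n; z \<in> P\<rbrakk> \<Longrightarrow> t i (X1 z) = X1 (t i z)"
    and X_root: "z \<in> P \<Longrightarrow> newton scale u X1 d z = 0"
begin

lemmas op_simps = linmap_simps[OF t_lin] linmap_simps[OF g_lin] linmap_simps[OF X_lin]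

definition e where "e i j = average scale rho r (t i) (t j)"

definition gi where "gi i z = g i z - Dl *s e i (Suc i) z"

lemma e_lin: "linop scale (e i j)"
  unfolding e_def by (rule linop_average[OF t_lin t_lin])

lemmas e_simps = linmap_simps[OF e_lin]

lemma gi_lin: "linop scale (gi i)"
  by (rule linmapI) (simp_all add: gi_def op_simps e_simps algebra_simps)

lemmas gi_simps = linmap_simps[OF gi_lin]

lemma e_P: "\<lbrakk>1 \<le> i; i \<le> n; 1 \<le> j; j \<le> n; z \<in> P\<rbrakk> \<Longrightarrow> e i j z \<in> P"
  unfolding e_def by (rule average_closed) (auto simp: t_P)

lemma gi_P: "\<lbrakk>1 \<le> i; i < n; z \<in> P\<rbrakk> \<Longrightarrow> gi i z \<in> P"
  by (simp add: gi_def e_P g_P)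

lemma commuting_roots_t:
  assumes "1 \<le> i" "i \<le> n" "1 \<le> j" "j \<le> n"
  shows "commuting_roots scale R P r rho (t i) (t j)"
  using assms by unfold_locales (auto simp: rho_r t_lin t_P t_root intro!: t_t)

lemma g_e:
  assumes "1 \<le> i" "i < n" "1 \<le> j" "j \<le> n" "1 \<le> k" "k \<le> n" "z \<in> P"
  shows "g i (e j k z) = e (transpose i (Suc i) j) (transpose i (Suc i) k) (g i z)"
  unfolding e_def
  by (rule average_intertwine[where P = P, OF g_lin]) (use assms in \<open>auto simp: g_t t_P\<close>)

lemma e_swap: "\<lbrakk>1 \<le> i; i \<le> n; 1 \<le> j; j \<le> n; z \<in> P\<rbrakk> \<Longrightarrow> e i j z = e j i z"
  unfolding e_def by (rule commuting_roots.average_swap[OF commuting_roots_t])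

lemma g_e_same:
  assumes "1 \<le> i" "i < n" "z \<in> P"
  shows "g i (e i (Suc i) z) = e i (Suc i) (g i z)"
  using g_e[of i i "Suc i" z] e_swap[of "Suc i" i "g i z"] assms by (simp add: g_P)

lemma g_gi: "\<lbrakk>1 \<le> i; i < n; z \<in> P\<rbrakk> \<Longrightarrow> g i (gi i z) = z"
  using g_g[of i z] g_e_same[of i z] by (simp add: gi_def op_simps e_def)

lemma gi_g: "\<lbrakk>1 \<le> i; i < n; z \<in> P\<rbrakk> \<Longrightarrow> gi i (g i z) = z"
  using g_g[of i z] by (simp add: gi_def op_simps e_def)

lemma g_gi_far:
  assumes "1 \<le> i" "i < n" "1 \<le> j" "j < n" "i + 2 \<le> j \<or> j + 2 \<le> i" "z \<in> P"
  shows "g i (g j z) = g j (g i z)" "g i (gi j z) = gi j (g i z)" "gi i (gi j z) = gi j (gi i z)"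
proof -
  have gg: "g i (g j z) = g j (g i z)" if "1 \<le> i" "i < n" "1 \<le> j" "j < n" "i + 2 \<le> j \<or> j + 2 \<le> i" "z \<in> P"
    for i j z using that g_far[of i j z] g_far[of j i z] by auto
  have ggi: "g i (gi j z) = gi j (g i z)" 
    if "1 \<le> i" "i < n" "1 \<le> j" "j < n" "i + 2 \<le> j \<or> j + 2 \<le> i" "z \<in> P" for i j z
  proof -
    have "transpose i (Suc i) j = j" "transpose i (Suc i) (Suc j) = Suc j"
      using that by (auto simp: transpose_def)
    then show ?thesis using that gg[of i j z] g_e[of i j "Suc j" z] by (simp add: gi_def op_simps)
  qed
  show "g i (g j z) = g j (g i z)" "g i (gi j z) = gi j (g i z)" using gg ggi assms by auto
  have "gi i (gi j z) = gi i (gi j (g i (gi i z)))" using assms by (simp add: g_gi)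
  also have "\<dots> = gi j (gi i z)" using assms ggi[of i j "gi i z", symmetric] by (simp add: gi_g gi_P)
  finally show "gi i (gi j z) = gi j (gi i z)" .
qed

lemma gi_t:
  assumes "1 \<le> i" "i < n" "1 \<le> j" "j \<le> n" "z \<in> P"
  shows "gi i (t j z) = t (transpose i (Suc i) j) (gi i z)"
proof -
  let ?s = "transpose i (Suc i)"
  have s: "1 \<le> ?s j" "?s j \<le> n" "?s (?s j) = j" using assms by (auto simp: transpose_def)
  have "t j z = g i (t (?s j) (gi i z))" using assms s by (simp add: g_t gi_P g_gi)
  then show ?thesis using assms s by (simp add: gi_g t_P gi_P)
qed

lemma gi_X: 
  assumes "2 \<le> i" "i < n" "z \<in> P" shows "gi i (X1 z) = X1 (gi i z)"
proof -
  have "X1 z = g i (X1 (gi i z))" using assms by (simp add: g_X gi_P g_gi)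
  then show ?thesis using assms by (simp add: gi_g X_P gi_P)
qed

text \<open>The braid relation solved for the inverse generators.\<close>

lemma gi_gi_g:
  assumes "1 \<le> i" "Suc i < n" "z \<in> P"
  shows "gi (Suc i) (gi i (g (Suc i) z)) = g i (gi (Suc i) (gi i z))"
proof -
  let ?y = "gi (Suc i) (gi i z)"
  have y: "?y \<in> P" using assms by (simp add: gi_P)
  have "g (Suc i) z = g (Suc i) (g i (g (Suc i) ?y))" using assms by (simp add: g_gi gi_P)
  also have "\<dots> = g i (g (Suc i) (g i ?y))" using assms y by (simp add: braid)
  finally show ?thesis using assms y by (simp add: gi_g g_P)
qed

lemma e_X:
  assumes "1 \<le> i" "i \<le> n" "1 \<le> j" "j \<le> n" "z \<in> P"
  shows "e i j (X1 z) = X1 (e i j z)"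
  unfolding e_def
  by (rule average_intertwine[where P = P, OF X_lin, symmetric]) (use assms in \<open>auto simp: t_X t_P\<close>)

lemma newton_P: "k \<le> d \<Longrightarrow> z \<in> P \<Longrightarrow> newton scale u X1 k z \<in> P"
  by (induction k) (simp_all add: X_P)

lemma newton_lin: "linop scale (newton scale u X1 k)"
  by (rule linop_newton[OF X_lin module_axioms])

end

text \<open>The divided difference $D_k(x, X) = (p_k(x) - p_k(X)) / (x - X)$ for commuting $x$
  and $X$.\<close>

primrec quot_newton :: "('c \<Rightarrow> 'm \<Rightarrow> 'm) \<Rightarrow> (nat \<Rightarrow> 'c) \<Rightarrow> ('m \<Rightarrow> 'm) \<Rightarrow> ('m \<Rightarrow> 'm) \<Rightarrow> nat \<Rightarrow> 'm \<Rightarrow> 'm::ab_group_add"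
  where
    "quot_newton sc u x X1 0 z = 0"
  | "quot_newton sc u x X1 (Suc k) z =
      x (quot_newton sc u x X1 k z) - sc (u k) (quot_newton sc u x X1 k z) + newton sc u X1 k z"

text \<open>The scalar action on functions, pointwise from the action on the values. It is
  iterated to reach functions of several arguments.\<close>

definition fscale :: "('c \<Rightarrow> 'm \<Rightarrow> 'm) \<Rightarrow> 'c \<Rightarrow> ('j \<Rightarrow> 'm) \<Rightarrow> 'j \<Rightarrow> 'm"
  where "fscale sc c F = (\<lambda>j. sc c (F j))"

section \<open>Layers\<close>

text \<open>The module $R[x]/(f) \otimes R[\tau]/(\tau^r - 1) \otimes M$, described
  axiomatically: the generators for $n$ strands act through $M$, the operators \<open>x\<close>
  and \<open>tau\<close> by multiplication, and \<open>pi\<close> substitutes $X$ for $x$, that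
  is $p(x) \otimes m \mapsto 1 \otimes p(X) m$. The image of \<open>pi\<close> consists of the
  elements constant in $x$, hence \<open>pi_g_pi\<close>; the operator $g_1 X g_1$ commutes with
  $X$ on $M$ and so commutes with the substitution.\<close>

locale yh_prelayer = yh_module +
  fixes tau x pi :: "'b \<Rightarrow> 'b"
  assumes tau_lin: "linop scale tau" and x_lin: "linop scale x" and pi_lin: "linop scale pi"
    and tau_P[simp]: "z \<in> P \<Longrightarrow> tau z \<in> P"
    and x_P[simp]: "z \<in> P \<Longrightarrow> x z \<in> P"
    and pi_P[simp]: "z \<in> P \<Longrightarrow> pi z \<in> P"
    and tau_root: "z \<in> P \<Longrightarrow> (tau ^^ r) z = z"
    and tau_t: "\<lbrakk>1 \<le> i; i \<le> n; z \<in> P\<rbrakk> \<Longrightarrow> tau (t i z) = t i (tau z)"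
    and tau_g: "\<lbrakk>1 \<le> i; i < n; z \<in> P\<rbrakk> \<Longrightarrow> tau (g i z) = g i (tau z)"
    and tau_X: "z \<in> P \<Longrightarrow> tau (X1 z) = X1 (tau z)"
    and tau_x: "z \<in> P \<Longrightarrow> tau (x z) = x (tau z)"
    and x_t: "\<lbrakk>1 \<le> i; i \<le> n; z \<in> P\<rbrakk> \<Longrightarrow> x (t i z) = t i (x z)"
    and x_g: "\<lbrakk>1 \<le> i; i < n; z \<in> P\<rbrakk> \<Longrightarrow> x (g i z) = g i (x z)"
    and x_X: "z \<in> P \<Longrightarrow> x (X1 z) = X1 (x z)"
    and x_root: "z \<in> P \<Longrightarrow> newton scale u x d z = 0"
    and pi_pi: "z \<in> P \<Longrightarrow> pi (pi z) = pi z"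
    and pi_x: "z \<in> P \<Longrightarrow> pi (x z) = X1 (pi z)"
    and pi_X: "z \<in> P \<Longrightarrow> pi (X1 z) = X1 (pi z)"
    and pi_tau: "z \<in> P \<Longrightarrow> pi (tau z) = tau (pi z)"
    and pi_t: "\<lbrakk>1 \<le> i; i \<le> n; z \<in> P\<rbrakk> \<Longrightarrow> pi (t i z) = t i (pi z)"
    and pi_g: "\<lbrakk>2 \<le> i; i < n; z \<in> P\<rbrakk> \<Longrightarrow> pi (g i z) = g i (pi z)"
    and pi_g_pi: "\<lbrakk>1 \<le> i; i < n; z \<in> P\<rbrakk> \<Longrightarrow> pi (g i (pi z)) = g i (pi z)"
    and pi_g_X_g: "\<lbrakk>2 \<le> n; z \<in> P\<rbrakk> \<Longrightarrow> pi (g 1 (X1 (g 1 z))) = g 1 (X1 (g 1 (pi z)))"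
begin

lemmas layer_simps = linmap_simps[OF tau_lin] linmap_simps[OF x_lin] linmap_simps[OF pi_lin]

lemma quot_newton_P:
  assumes "z \<in> P" "k \<le> d"
  shows "quot_newton scale u x X1 k z \<in> P"
  using assms by (induction k) (simp_all add: newton_P)

lemma quot_newton_lin: "linop scale (quot_newton scale u x X1 k)"
proof (induction k)
  case (Suc k)
  show ?case
    by (rule linmapI) (simp_all add: linmap_simps[OF Suc] linmap_simps[OF newton_lin] layer_simps
        algebra_simps)
qed (simp add: linmap_def)

lemmas quot_newton_simps = linmap_simps[OF quot_newton_lin]

text \<open>The defining property $(x - X) D_k(x, X) = p_k(x) - p_k(X)$.\<close>

lemma quot_newton_mult:
  assumes z: "z \<in> P" and k: "k \<le> d"
  shows "x (quot_newton scale u x X1 k z) - X1 (quot_newton scale u x X1 k z) =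
    newton scale u x k z - newton scale u X1 k z"
  using k
proof (induction k)
  case (Suc k)
  let ?q = "quot_newton scale u x X1 k z"
  have q: "?q \<in> P" using Suc.prems z by (intro quot_newton_P) auto
  have "x (quot_newton scale u x X1 (Suc k) z) - X1 (quot_newton scale u x X1 (Suc k) z) =
      x (x ?q - X1 ?q) - u k *s (x ?q - X1 ?q) + (x (newton scale u X1 k z) - X1 (newton scale u X1 k z))"
    using q by (simp add: layer_simps op_simps x_X algebra_simps)
  also have "x ?q - X1 ?q = newton scale u x k z - newton scale u X1 k z" using Suc by simp
  finally show ?case by (simp add: layer_simps op_simps algebra_simps)
qed (simp add: layer_simps op_simps)

lemma quot_newton_commute:
  assumes y: "linop scale y" and yP: "\<And>z. z \<in> P \<Longrightarrow> y (x z) = x (y z)"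
      "\<And>z. z \<in> P \<Longrightarrow> y (X1 z) = X1 (y z)"
    and z: "z \<in> P" and k: "k \<le> d"
  shows "y (quot_newton scale u x X1 k z) = quot_newton scale u x X1 k (y z)"
  using k
proof (induction k)
  case (Suc k)
  have "y (newton scale u X1 k z) = newton scale u X1 k (y z)"
    by (rule newton_intertwine[OF y, where P = P])
      (use yP Suc.prems newton_P z in \<open>auto simp: less_imp_le\<close>)
  then show ?case using Suc z yP by (simp add: linmap_simps[OF y] quot_newton_P)
qed (simp add: linmap_simps[OF y])

text \<open>Inductive step for \<open>D_d(x, X) (pi - 1) = 0\<close>: passing from $z$ to $x z$
  adds $(X - x) D_d(x, X) z = (p_d(X) - p_d(x)) z$, and both terms vanish.\<close>

lemma quot_root_x:
  assumes z: "z \<in> P" and root: "quot_newton scale u x X1 d (pi z - z) = 0"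
  shows "quot_newton scale u x X1 d (pi (x z) - x z) = 0"
proof -
  let ?q = "quot_newton scale u x X1 d"
  have "?q (pi (x z) - x z) = X1 (?q (pi z - z)) + (X1 (?q z) - x (?q z))"
    using z quot_newton_commute[OF X_lin, of "pi z"] quot_newton_commute[OF X_lin, of z]
      quot_newton_commute[OF x_lin, of z]
    by (simp add: quot_newton_simps pi_x x_X op_simps)
  also have "X1 (?q z) - x (?q z) = 0"
    using quot_newton_mult[OF z order_refl] x_root[OF z] X_root[OF z] by simp
  finally show ?thesis using root by (simp add: op_simps)
qed

end

text \<open>The last axiom says that \<open>pi - 1\<close> is divisible by $x - X$. It makes the
  annihilating polynomial of $X$ hold on the induced module.\<close>

locale yh_layer = yh_prelayer +
  assumes quot_root: "z \<in> P \<Longrightarrow> quot_newton scale u x X1 d (pi z - z) = 0"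
begin

definition E where "E k = average scale rho r tau (t k)"

text \<open>The operators that appear when $X$ is moved past $g_{j-1}^{-1} \cdots g_1^{-1}$: the
  idempotent of $\tau$ and $t_1$ followed by inverse generators, and its product with the part
  \<open>pi - 1\<close>.\<close>

primrec G where
  "G 0 z = E 1 z"
| "G (Suc m) z = gi (Suc m) (G m z)"

definition L where "L m z = G m (pi z - z)"

lemma E_lin: "linop scale (E k)"
  unfolding E_def by (rule linop_average[OF tau_lin t_lin])

lemmas E_simps = linmap_simps[OF E_lin]

lemma commuting_roots_tau: "\<lbrakk>1 \<le> i; i \<le> n\<rbrakk> \<Longrightarrow> commuting_roots scale R P r rho tau (t i)"
  by unfold_locales (auto simp: rho_r tau_lin t_lin t_P t_root tau_root tau_t)

lemma E_P[simp]: "\<lbrakk>1 \<le> i; i \<le> n; z \<in> P\<rbrakk> \<Longrightarrow> E i z \<in> P"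
  unfolding E_def by (rule average_closed) (auto simp: t_P)

lemma E_intertwine:
  assumes "linop scale y" "1 \<le> i" "i \<le> n" "z \<in> P"
    and "\<And>z. z \<in> P \<Longrightarrow> y (tau z) = a' (y z)" "\<And>z. z \<in> P \<Longrightarrow> y (t i z) = b' (y z)"
  shows "y (E i z) = average scale rho r a' b' (y z)"
  unfolding E_def by (rule average_intertwine[where P = P]) (use assms in \<open>auto simp: t_P\<close>)

lemma X_E: "\<lbrakk>1 \<le> i; i \<le> n; z \<in> P\<rbrakk> \<Longrightarrow> X1 (E i z) = E i (X1 z)"
  using E_intertwine[OF X_lin, of i z tau "t i"] by (simp add: tau_X t_X E_def)

lemma x_E: "\<lbrakk>1 \<le> i; i \<le> n; z \<in> P\<rbrakk> \<Longrightarrow> x (E i z) = E i (x z)"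
  using E_intertwine[OF x_lin, of i z tau "t i"] by (simp add: tau_x x_t E_def)

lemma pi_E: "\<lbrakk>1 \<le> i; i \<le> n; z \<in> P\<rbrakk> \<Longrightarrow> pi (E i z) = E i (pi z)"
  using E_intertwine[OF pi_lin, of i z tau "t i"] by (simp add: pi_tau pi_t E_def)

lemma t_E: "\<lbrakk>1 \<le> i; i \<le> n; 1 \<le> j; j \<le> n; z \<in> P\<rbrakk> \<Longrightarrow> t j (E i z) = E i (t j z)"
  using E_intertwine[OF t_lin, of i z j tau "t i"] by (simp add: tau_t t_t[of j] E_def)

lemma tau_E: "\<lbrakk>1 \<le> i; i \<le> n; z \<in> P\<rbrakk> \<Longrightarrow> tau (E i z) = E i (tau z)"
  using E_intertwine[OF tau_lin, of i z tau "t i"] by (simp add: tau_t E_def)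

lemma g_E:
  "\<lbrakk>1 \<le> i; i \<le> n; 1 \<le> j; j < n; z \<in> P\<rbrakk> \<Longrightarrow> g j (E i z) = E (transpose j (Suc j) i) (g j z)"
  using E_intertwine[OF g_lin, of i z j tau "t (transpose j (Suc j) i)"]
  by (simp add: tau_g g_t E_def)

lemma tau_gi: "\<lbrakk>1 \<le> i; i < n; z \<in> P\<rbrakk> \<Longrightarrow> tau (gi i z) = gi i (tau z)"
  using average_intertwine[OF tau_lin, of P "t i" "t i" "t (Suc i)" "t (Suc i)" z rho r]
  by (simp add: gi_def layer_simps e_def tau_g tau_t t_P)

lemma x_gi: "\<lbrakk>1 \<le> i; i < n; z \<in> P\<rbrakk> \<Longrightarrow> x (gi i z) = gi i (x z)"
  using average_intertwine[OF x_lin, of P "t i" "t i" "t (Suc i)" "t (Suc i)" z rho r]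
  by (simp add: gi_def layer_simps e_def x_g x_t t_P)

lemma pi_e: "\<lbrakk>1 \<le> i; i < n; z \<in> P\<rbrakk> \<Longrightarrow> pi (e i (Suc i) z) = e i (Suc i) (pi z)"
  using average_intertwine[OF pi_lin, of P "t i" "t i" "t (Suc i)" "t (Suc i)" z rho r]
  by (simp add: e_def pi_t t_P)

lemma pi_gi: "\<lbrakk>2 \<le> i; i < n; z \<in> P\<rbrakk> \<Longrightarrow> pi (gi i z) = gi i (pi z)"
  by (simp add: gi_def layer_simps pi_e pi_g)

lemma gi_E:
  assumes "1 \<le> i" "i \<le> n" "1 \<le> j" "j < n" "z \<in> P" 
  shows "gi j (E i z) = E (transpose j (Suc j) i) (gi j z)"
  using E_intertwine[OF gi_lin, of i z j tau "t (transpose j (Suc j) i)"] assms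
  by (simp add: tau_gi gi_t E_def)

lemma E_E: "\<lbrakk>1 \<le> i; i \<le> n; z \<in> P\<rbrakk> \<Longrightarrow> E i (E i z) = E i z"
  unfolding E_def
  by (intro commuting_roots.average_fixed[OF commuting_roots_tau]
        commuting_roots.average_absorb[OF commuting_roots_tau] average_closed) (auto simp: t_P)

lemma e_E:
  assumes "1 \<le> i" "i \<le> n" "1 \<le> j" "j \<le> n" "z \<in> P"
  shows "E j (E i z) = e i j (E i z)"
proof -
  interpret cr: commuting_roots scale R P r rho tau "t i"
    using assms by (rule_tac commuting_roots_tau)
  have "average scale rho r tau (t j) (E i z) = average scale rho r (t i) (t j) (E i z)"
    using assms by (intro cr.average_transfer)
      (auto simp: t_P tau_t t_t[of i j] E_def cr.average_absorb average_closed[OF rho_R])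
  then show ?thesis by (simp add: E_def e_def)
qed

lemma G_lin: "linop scale (G m)"
proof (induction m)
  case 0
  then show ?case using E_lin[of 1] by (simp add: linmap_def)
next
  case (Suc m)
  then show ?case using linmap_comp[OF gi_lin[of "Suc m"] Suc] by (simp add: linmap_def)
qed

lemmas G_simps = linmap_simps[OF G_lin]

lemma G_P[simp]: "m < n \<Longrightarrow> z \<in> P \<Longrightarrow> G m z \<in> P"
  by (induction m) (simp_all add: gi_P)

text \<open>This rule and the next three permute the commuting generators cyclically: \<open>G
  m\<close> moves $\tau$ to $t_{m+1}$, $t_1$ to $\tau$, lowers the indices $2, \ldots, m+1$ by
  one and fixes the others.\<close>

lemma G_tau: "m < n \<Longrightarrow> z \<in> P \<Longrightarrow> G m (tau z) = t (Suc m) (G m z)"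
proof (induction m)
  case 0
  then interpret cr: commuting_roots scale R P r rho tau "t 1"
    by (intro commuting_roots_tau) auto
  show ?case using 0 tau_E[of 1 z] cr.average_absorb[of z] by (simp add: E_def)
next
  case (Suc m)
  then show ?case by (simp add: gi_t)
qed

lemma G_t_high: "m < n \<Longrightarrow> m + 2 \<le> l \<Longrightarrow> l \<le> n \<Longrightarrow> z \<in> P \<Longrightarrow> G m (t l z) = t l (G m z)"
  by (induction m) (simp_all add: t_E gi_t transpose_eq_iff)

lemma G_t_1: "m < n \<Longrightarrow> z \<in> P \<Longrightarrow> G m (t 1 z) = tau (G m z)"
proof (induction m)
  case 0
  then interpret cr: commuting_roots scale R P r rho tau "t 1"
    by (intro commuting_roots_tau) auto
  show ?case using 0 t_E[of 1 1 z] cr.average_absorb[of z] by (simp add: E_def)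
next
  case (Suc m)
  then show ?case by (simp add: tau_gi)
qed

lemma G_t_low: "m < n \<Longrightarrow> 2 \<le> l \<Longrightarrow> l < m + 2 \<Longrightarrow> z \<in> P \<Longrightarrow> G m (t l z) = t (l - 1) (G m z)"
proof (induction m)
  case (Suc m)
  show ?case
  proof (cases "l = m + 2")
    case True
    then show ?thesis using Suc.prems by (simp add: G_t_high gi_t)
  next
    case False
    then have "transpose (Suc m) (Suc (Suc m)) (l - Suc 0) = l - 1" using Suc.prems
      by (auto simp: transpose_def)
    then show ?thesis using Suc False by (simp add: gi_t)
  qed
qed simp

lemma G_g_high: "m < n \<Longrightarrow> m + 2 \<le> l \<Longrightarrow> l < n \<Longrightarrow> z \<in> P \<Longrightarrow> G m (g l z) = g l (G m z)"
  by (induction m) (auto simp: g_E transpose_def g_gi_far)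

lemma G_g_low: "m < n \<Longrightarrow> 2 \<le> i \<Longrightarrow> i \<le> m \<Longrightarrow> z \<in> P \<Longrightarrow> G m (g i z) = g (i - 1) (G m z)"
proof (induction m)
  case (Suc m)
  show ?case
  proof (cases "i = Suc m")
    case True
    then obtain m' where m': "m = Suc m'" using Suc.prems by (cases m) auto
    have "G (Suc m) (g i z) = gi (Suc m) (gi m (g (Suc m) (G m' z)))"
      using Suc.prems m' True by (simp add: G_g_high)
    also have "\<dots> = g m (gi (Suc m) (gi m (G m' z)))" using Suc.prems m' by (intro gi_gi_g) auto
    finally show ?thesis using True m' by simp
  next
    case False
    then show ?thesis using Suc by (simp add: g_gi_far)
  qed
qed simp

lemma G_x: "m < n \<Longrightarrow> z \<in> P \<Longrightarrow> G m (x z) = x (G m z)"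
  by (induction m) (simp_all add: x_E x_gi)

lemma G_E: 
  assumes "m + 2 \<le> n" "z \<in> P"
  shows "G m (E (m + 2) z) = e (m + 1) (m + 2) (G m z)"
  using E_intertwine[OF G_lin, of "m + 2" z m "t (m + 1)" "t (m + 2)"] assms
  by (simp add: G_tau G_t_high e_def)

end

section \<open>The induced module\<close>

lemma module_fscale: "Modules.module sc \<Longrightarrow> Modules.module (fscale sc)"
  unfolding fscale_def Modules.module_def by (auto simp: fun_eq_iff)

lemma linmap_eval: "linmap (fscale sc) sc (\<lambda>F. F j)"
  by (rule linmapI) (simp_all add: fscale_def)

context yh_layer begin

text \<open>The induced module is the sum of the blocks $c_j N$ for $1 \le j \le n+1$, where an
  element $w$ of the layer in block $j$ stands for $g_{j-1}^{-1} \cdots g_1^{-1} \, w \, g_1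
  \cdots g_n$. The formulas for the generators are read off from this. For instance $g_j =
  g_j^{-1} + (q - q^{-1}) e_j$ maps block $j$ to block $j+1$ and adds a multiple of an
  idempotent in block $j$, and $t_k$ becomes $\tau$ in block $k$. In block $1$ the generator $X$
  acts as $x$; in a block $j > 1$ it acts through $M$ and contributes a correction to block
  $1$.\<close>

definition "indP = {F. \<forall>j. F j \<in> P \<and> (j \<in> {1..Suc n} \<or> F j = 0)}"

definition "indt k F j =
  (if j = k then tau (F j) else if k < j then t k (F j) else t (k - 1) (F j))"

definition "indg i F j =
  (if j = i then Dl *s E i (F i) + F (Suc i) else if j = Suc i then F i
   else if j < i then g (i - 1) (F j) else g i (F j))"

definition "indX F j =
  (if j = 1 then x (F 1) + Dl *s x (\<Sum>m<n. L m (F (m + 2))) else X1 (F j))"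

lemma L_lin: "linop scale (L m)"
  by (rule linmapI) (simp_all add: L_def layer_simps G_simps algebra_simps)

lemmas L_simps = linmap_simps[OF L_lin]

lemma L_P[simp]: "m < n \<Longrightarrow> z \<in> P \<Longrightarrow> L m z \<in> P"
  by (simp add: L_def)

lemma L_t:
  assumes "m < n" "z \<in> P"
  shows "L m (t 1 z) = tau (L m z)" "L m (tau z) = t (Suc m) (L m z)"
    "m + 2 \<le> l \<Longrightarrow> l \<le> n \<Longrightarrow> L m (t l z) = t l (L m z)"
    "2 \<le> l \<Longrightarrow> l < m + 2 \<Longrightarrow> L m (t l z) = t (l - 1) (L m z)"
proof -
  have 1: "pi (t l z) - t l z = t l (pi z - z)" if "1 \<le> l" "l \<le> n" for l
    using that assms by (simp add: pi_t op_simps)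
  show "L m (t 1 z) = tau (L m z)" using assms 1[of 1] G_t_1[of m "pi z - z"] by (simp add: L_def)
  show "L m (tau z) = t (Suc m) (L m z)"
    using assms G_tau[of m "pi z - z"] by (simp add: L_def pi_tau layer_simps)
  show "m + 2 \<le> l \<Longrightarrow> l \<le> n \<Longrightarrow> L m (t l z) = t l (L m z)"
    using assms 1[of l] G_t_high[of m l "pi z - z"] by (simp add: L_def)
  show "2 \<le> l \<Longrightarrow> l < m + 2 \<Longrightarrow> L m (t l z) = t (l - 1) (L m z)"
    using assms 1[of l] G_t_low[of m l "pi z - z"] by (simp add: L_def)
qed

lemma L_g:
  assumes "m < n" "z \<in> P"
  shows "m + 2 \<le> l \<Longrightarrow> l < n \<Longrightarrow> L m (g l z) = g l (L m z)"
    "2 \<le> i \<Longrightarrow> i \<le> m \<Longrightarrow> L m (g i z) = g (i - 1) (L m z)"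
proof -
  have 1: "pi (g l z) - g l z = g l (pi z - z)" if "2 \<le> l" "l < n" for l
    using that assms by (simp add: pi_g op_simps)
  show "m + 2 \<le> l \<Longrightarrow> l < n \<Longrightarrow> L m (g l z) = g l (L m z)"
    using assms 1[of l] G_g_high[of m l "pi z - z"] by (simp add: L_def)
  show "2 \<le> i \<Longrightarrow> i \<le> m \<Longrightarrow> L m (g i z) = g (i - 1) (L m z)"
    using assms 1[of i] G_g_low[of m i "pi z - z"] by (simp add: L_def)
qed

lemma L_E: 
  assumes "m + 2 \<le> n" "z \<in> P" shows "L m (E (m + 2) z) = e (m + 1) (m + 2) (L m z)"
  using assms G_E[of m "pi z - z"] by (simp add: L_def pi_E E_simps)

lemma L_Suc: "L (Suc m) z = gi (Suc m) (L m z)"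
  by (simp add: L_def)

text \<open>The operator $g_i$ acts through $M$, so it preserves the constants in $x$; so does
  its inverse.\<close>

lemma pi_gi_pi: "\<lbrakk>1 \<le> i; i < n; z \<in> P\<rbrakk> \<Longrightarrow> pi (gi i (pi z)) = gi i (pi z)"
  by (simp add: gi_def layer_simps pi_g_pi pi_e pi_pi)

lemma pi_g_X: 
  assumes "2 \<le> n" "z \<in> P" shows "pi (g 1 (X1 z)) = g 1 (X1 (g 1 (pi (gi 1 z))))"
  using pi_g_X_g[of "gi 1 z"] assms by (simp add: gi_P g_gi)

lemma g_eq: "g i z = gi i z + Dl *s e i (Suc i) z"
  by (simp add: gi_def)

lemma G_1_eq: "2 \<le> n \<Longrightarrow> z \<in> P \<Longrightarrow> G 1 z = E 2 (gi 1 z)"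
  by (simp add: gi_E numeral_2_eq_2)

lemma E_E_Suc:
  assumes "1 \<le> i" "i < n" "z \<in> P"
  shows "E i (E (Suc i) z) = E (Suc i) (e i (Suc i) z)"
proof -
  have "E i (E (Suc i) z) = e (Suc i) i (E (Suc i) z)" using assms by (intro e_E) auto
  also have "\<dots> = e i (Suc i) (E (Suc i) z)" using assms by (intro e_swap) auto
  also have "\<dots> = E (Suc i) (e i (Suc i) z)"
    unfolding e_def by (rule average_intertwine[where P = P, OF E_lin, symmetric])
      (use assms in \<open>auto simp: t_E t_P\<close>)
  finally show ?thesis .
qed

lemma E_1_E_2: "2 \<le> n \<Longrightarrow> z \<in> P \<Longrightarrow> E 1 (E 2 z) = E 2 (e 1 2 z)"
  using E_E_Suc[of 1 z] by (simp add: numeral_2_eq_2)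

text \<open>These two identities come from the relation $g_1 X g_1 X = X g_1 X g_1$ on the
  induced module: comparing the contributions of the third block to the first block leads to
  them. They are proved without the factor \<open>E 2\<close> and then multiplied by it.\<close>

lemma L_1_identities:
  assumes n: "2 \<le> n" and z: "z \<in> P"
  shows "L 1 (g 1 (X1 z)) + Dl *s E 1 (X1 (pi (L 1 z))) = X1 (L 1 (g 1 z))"
    and "X1 (L 1 z) + Dl *s E 1 (X1 (L 1 (g 1 z) - pi (L 1 (g 1 z)))) = L 1 (g 1 (X1 (g 1 z)))"
proof -
  note P = gi_P g_P X_P e_P z
  have L1: "L 1 y = E 2 (gi 1 (pi y - y))" if "y \<in> P" for y
    using that n G_1_eq[of "pi y - y"] by (simp add: L_def)
  have first: "gi 1 (pi (g 1 (X1 z)) - g 1 (X1 z)) + Dl *s e 1 2 (X1 (pi (gi 1 (pi z - z))))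
      = X1 (gi 1 (pi (g 1 z) - g 1 z))"
  proof -
    have a: "gi 1 (pi (g 1 (X1 z))) = X1 (g 1 (pi (gi 1 z)))"
      using n z by (simp add: pi_g_X gi_g P del: One_nat_def)
    have b: "g 1 (pi (gi 1 z)) = gi 1 (pi (gi 1 z)) + Dl *s e 1 2 (pi (gi 1 z))"
      using g_eq[of 1 "pi (gi 1 z)"] by (simp add: numeral_2_eq_2)
    have c: "pi (g 1 z) = pi (gi 1 z) + Dl *s e 1 2 (pi z)"
      using g_eq[of 1 z] n z pi_e[of 1 z] by (simp add: layer_simps numeral_2_eq_2)
    have d: "gi 1 (e 1 2 (pi z)) = e 1 2 (gi 1 (pi z))"
    proof -
      have "gi 1 (e 1 2 (g 1 (gi 1 (pi z)))) = gi 1 (g 1 (e 1 2 (gi 1 (pi z))))"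
        using n z g_e_same[of 1 "gi 1 (pi z)"] by (simp add: P numeral_2_eq_2)
      then show ?thesis using n z by (simp add: g_gi gi_g P)
    qed
    have f: "X1 (e 1 2 y) = e 1 2 (X1 y)" if "y \<in> P" for y using that n by (simp add: e_X)
    show ?thesis
      using n z
      by (simp add: gi_simps a b c d f layer_simps op_simps e_simps gi_g pi_gi_pi P scale_right_diff_distrib
           del: One_nat_def) 
  qed
  have second: "X1 (gi 1 (pi z - z)) +
      Dl *s e 1 2 (X1 (gi 1 (pi (g 1 z) - g 1 z) - pi (gi 1 (pi (g 1 z) - g 1 z))))
      = gi 1 (pi (g 1 (X1 (g 1 z))) - g 1 (X1 (g 1 z)))"
  proof -
    have a: "gi 1 (pi (g 1 (X1 (g 1 z)))) = X1 (g 1 (pi z))"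
      using n z by (simp add: pi_g_X_g[unfolded One_nat_def] gi_g P)
    have f: "X1 (e 1 2 y) = e 1 2 (X1 y)" if "y \<in> P" for y using that n by (simp add: e_X)
    have k: "gi 1 (pi (g 1 z) - g 1 z) - pi (gi 1 (pi (g 1 z) - g 1 z)) = pi z - z"
      using n z by (simp add: gi_simps layer_simps pi_gi_pi gi_g P)
    have "X1 (gi 1 (pi z - z)) + Dl *s e 1 2 (X1 (pi z - z)) = X1 (g 1 (pi z - z))"
      using n z g_eq[of 1 "pi z - z"] f[of "pi z - z"]
      by (simp add: op_simps numeral_2_eq_2)
    also have "\<dots> = gi 1 (pi (g 1 (X1 (g 1 z))) - g 1 (X1 (g 1 z)))"
      using n z by (simp add: gi_simps a op_simps gi_g P del: One_nat_def)
    finally show ?thesis unfolding k .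
  qed
  show "L 1 (g 1 (X1 z)) + Dl *s E 1 (X1 (pi (L 1 z))) = X1 (L 1 (g 1 z))"
    using n z arg_cong[OF first, of "E 2"]
    by (simp add: L1 P pi_E X_E E_simps e_simps E_1_E_2 layer_simps op_simps gi_simps del: One_nat_def)
  show "X1 (L 1 z) + Dl *s E 1 (X1 (L 1 (g 1 z) - pi (L 1 (g 1 z)))) = L 1 (g 1 (X1 (g 1 z)))"
    using n z arg_cong[OF second, of "E 2"]
    by (simp add: L1 P pi_E X_E E_simps e_simps E_1_E_2 layer_simps op_simps gi_simps del: One_nat_def)
qed

text \<open>The contribution of block $m+2$ to the first block. Since the inverse of $g_m$
  commutes with \<open>E 1\<close>, with $X$ and with \<open>pi\<close> for $m > 1$, each case
  follows from the previous one.\<close>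

lemma L_identities:
  assumes "1 \<le> m" "m < n" and z: "z \<in> P"
  shows "L m (g 1 (X1 z)) + Dl *s E 1 (X1 (pi (L m z))) = X1 (L m (g 1 z))"
    and "X1 (L m z) + Dl *s E 1 (X1 (L m (g 1 z) - pi (L m (g 1 z)))) = L m (g 1 (X1 (g 1 z)))"
proof -
  have "L m (g 1 (X1 z)) + Dl *s E 1 (X1 (pi (L m z))) = X1 (L m (g 1 z)) \<and>
    X1 (L m z) + Dl *s E 1 (X1 (L m (g 1 z) - pi (L m (g 1 z)))) = L m (g 1 (X1 (g 1 z)))"
    using assms
  proof (induction m)
    case (Suc m)
    show ?case
    proof (cases "m = 0")
      case True
      then show ?thesis using L_1_identities[of z] Suc.prems by simp
    next
      case False
      then have m: "1 \<le> m" "2 \<le> Suc m" "m < n" "Suc m < n" using Suc.prems by auto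
      have IH: "L m (g 1 (X1 z)) + Dl *s E 1 (X1 (pi (L m z))) = X1 (L m (g 1 z))"
        "X1 (L m z) + Dl *s E 1 (X1 (L m (g 1 z) - pi (L m (g 1 z)))) = L m (g 1 (X1 (g 1 z)))"
        using Suc.IH m z by auto
      have gE: "gi (Suc m) (E 1 y) = E 1 (gi (Suc m) y)" if "y \<in> P" for y
        using gi_E[of 1 "Suc m" y] m that by (simp add: transpose_def)
      show ?thesis using m z
        arg_cong[OF IH(1), of "gi (Suc m)"] arg_cong[OF IH(2), of "gi (Suc m)"]
        by (simp add: L_Suc gi_simps gE gi_X pi_gi X_P g_P layer_simps op_simps
            del: One_nat_def)
    qed
  qed simp
  then show "L m (g 1 (X1 z)) + Dl *s E 1 (X1 (pi (L m z))) = X1 (L m (g 1 z))"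
    and "X1 (L m z) + Dl *s E 1 (X1 (L m (g 1 z) - pi (L m (g 1 z)))) = L m (g 1 (X1 (g 1 z)))"
    by auto
qed

end

context yh_layer begin

lemma indP_P[simp]: "F \<in> indP \<Longrightarrow> F j \<in> P"
  unfolding indP_def by blast

lemma indP_zero: "F \<in> indP \<Longrightarrow> j \<notin> {1..Suc n} \<Longrightarrow> F j = 0"
  unfolding indP_def by blast

lemma indPI: "(\<And>j. F j \<in> P) \<Longrightarrow> (\<And>j. j \<notin> {1..Suc n} \<Longrightarrow> F j = 0) \<Longrightarrow> F \<in> indP"
  unfolding indP_def by blast

lemma indP_submodule: "submodule_over (fscale scale) R indP"
proof (intro submodule_over.intro submodule_over_axioms.intro module_fscale module_axioms
    one_R uminus_one_R)
  fix F H c assume F: "F \<in> indP" "H \<in> indP"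
  show "F + H \<in> indP" 
    by (rule indPI) (simp_all add: indP_zero[OF F(1)] indP_zero[OF F(2)] F del: atLeastAtMost_iff)
  assume "c \<in> R"
  then show "fscale scale c F \<in> indP"
    by (intro indPI) (simp_all add: fscale_def indP_zero[OF F(1)] F del: atLeastAtMost_iff)
qed (auto intro: indPI)

lemma indP_eqI:
  assumes "F \<in> indP" "H \<in> indP" "\<And>j. 1 \<le> j \<Longrightarrow> j \<le> Suc n \<Longrightarrow> F j = H j"
  shows "F = H"
proof
  fix j show "F j = H j"
    using assms indP_zero[of F j] indP_zero[of H j] by (cases "j \<in> {1..Suc n}") auto
qed

lemma indt_P:
  assumes "1 \<le> k" "k \<le> Suc n" and F: "F \<in> indP" shows "indt k F \<in> indP"
proof -
  have "indt k F j \<in> P \<and> (j \<in> {1..Suc n} \<or> indt k F j = 0)" for j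
    using assms indP_zero[OF F, of j]
    by (cases "j \<in> {1..Suc n}") (auto simp: indt_def layer_simps op_simps t_P)
  then show ?thesis unfolding indP_def by blast
qed

lemma indg_P: 
  assumes "1 \<le> i" "i \<le> n" and F: "F \<in> indP" shows "indg i F \<in> indP"
proof -
  have "indg i F j \<in> P \<and> (j \<in> {1..Suc n} \<or> indg i F j = 0)" for j
    using assms indP_zero[OF F, of j]
    by (cases "j \<in> {1..Suc n}") (auto simp: indg_def op_simps g_P)
  then show ?thesis unfolding indP_def by blast
qed

lemma indX_P: 
  assumes F: "F \<in> indP" shows "indX F \<in> indP"
proof -
  have [simp]: "(\<Sum>m<n. L m (F (Suc (Suc m)))) \<in> P" using F by (intro P_sum) simp
  have "indX F j \<in> P \<and> (j \<in> {1..Suc n} \<or> indX F j = 0)" for j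
    using indP_zero[OF F, of j] F
    by (cases "j \<in> {1..Suc n}") (auto simp: indX_def op_simps X_P)
  then show ?thesis unfolding indP_def by blast
qed

lemmas ind_P = indt_P indg_P indX_P

lemma ind_lin: "linop (fscale scale) (indt k)" "linop (fscale scale) (indg i)" "linop (fscale scale) indX"
  by (rule linmapI; simp add: fun_eq_iff indt_def indg_def indX_def fscale_def layer_simps
    op_simps E_simps L_simps sum.distrib scale_right_distrib scale_sum_right mult.commute)+

lemma indt_indt: 
  assumes "1 \<le> i" "i \<le> Suc n" "1 \<le> j" "j \<le> Suc n" "F \<in> indP"
  shows "indt i (indt j F) = indt j (indt i F)"
proof (rule indP_eqI)
  fix k assume "1 \<le> k" "k \<le> Suc n"
  then show "indt i (indt j F) k = indt j (indt i F) k"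
    using assms by (auto simp: indt_def tau_t intro!: t_t)
qed (use assms in \<open>auto intro!: indt_P\<close>)

text \<open>The idempotent $e_i$ on the induced module, block by block, according to where $t_i$
  and $t_{i+1}$ are carried.\<close>

lemma ind_average:
  assumes i: "1 \<le> i" "i \<le> n" and F: "F \<in> indP" and j: "1 \<le> j" "j \<le> Suc n"
  shows "average (fscale scale) rho r (indt i) (indt (Suc i)) F j =
    (if j = i \<or> j = Suc i then E i (F j) else if j < i then e (i - 1) i (F j) else e i (Suc i) (F j))"
proof -
  have *: "average (fscale scale) rho r (indt i) (indt (Suc i)) F j = average scale rho r a b (F j)"
    if "\<And>F. F \<in> indP \<Longrightarrow> indt i F j = a (F j)" "\<And>F. F \<in> indP \<Longrightarrow> indt (Suc i) F j = b (F j)"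
    for a b
    using average_intertwine[OF linmap_eval, of indP "indt i" j a "indt (Suc i)" b F] that i F
    by (auto simp: indt_P)
  consider "j = i" | "j = Suc i" | "j < i" | "Suc i < j" by linarith
  then show ?thesis
  proof cases
    case 1
    then show ?thesis using *[of tau "t i"] by (simp add: indt_def E_def)
  next
    case 2
    have "average scale rho r (t i) tau (F j) = average scale rho r tau (t i) (F j)"
      using i F by (intro commuting_roots.average_swap[OF commuting_roots_tau, symmetric]) auto
    then show ?thesis using 2 *[of "t i" tau] by (simp add: indt_def E_def)
  next
    case 3
    then show ?thesis using *[of "t (i - 1)" "t i"] by (simp add: indt_def e_def)
  next
    case 4
    then show ?thesis using *[of "t i" "t (Suc i)"] by (simp add: indt_def e_def)
  qed
qed

lemma indt_root:
  assumes k: "1 \<le> k" "k \<le> Suc n" and F: "F \<in> indP"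
  shows "(indt k ^^ r) F = F"
proof -
  have *: "(indt k ^^ r) F j = (a ^^ r) (F j)" if "\<And>F. F \<in> indP \<Longrightarrow> indt k F j = a (F j)" for a j
    using funpow_intertwine[of indP "\<lambda>F. F j" "indt k" a F r] that k F by (auto simp: indt_P)
  have P: "(indt k ^^ r) F \<in> indP"
    using k F by (induction r) (auto simp: indt_P)
  show ?thesis
  proof (rule indP_eqI[OF P F])
    fix j assume j: "1 \<le> j" "j \<le> Suc n"
    consider "j = k" | "k < j" | "j < k" by linarith
    then show "(indt k ^^ r) F j = F j"
      using *[where j = j] k j F by cases (auto simp: indt_def tau_root t_root)
  qed
qed

lemma indg_indt:
  assumes i: "1 \<le> i" "i \<le> n" and k: "1 \<le> k" "k \<le> Suc n" and F: "F \<in> indP"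
  shows "indg i (indt k F) = indt (transpose i (Suc i) k) (indg i F)"
proof (rule indP_eqI)
  have k': "1 \<le> transpose i (Suc i) k" "transpose i (Suc i) k \<le> Suc n"
    using i k by (auto simp: transpose_def)
  show "indg i (indt k F) \<in> indP" "indt (transpose i (Suc i) k) (indg i F) \<in> indP"
    using i k k' F by (auto simp: ind_P)
  fix j assume j: "1 \<le> j" "j \<le> Suc n"
  have a: "E i (tau z) = tau (E i z)" "E i (t i z) = tau (E i z)" "t i (E i z) = tau (E i z)"
    if "z \<in> P" for z
  proof -
    interpret cr: commuting_roots scale R P r rho tau "t i"
      using i by (intro commuting_roots_tau) auto
    show "E i (tau z) = tau (E i z)" "E i (t i z) = tau (E i z)" "t i (E i z) = tau (E i z)"
      using cr.average_absorb[of z] tau_E[of i z] t_E[of i i z] i that by (simp_all add: E_def)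
  qed
  have b: "E i (t k z) = t k (E i z)" if "1 \<le> k" "k \<le> n" "z \<in> P" for k z
    using t_E[of i k z] i that by simp
  consider "k = i" | "k = Suc i" | "k < i" | "Suc i < k" by linarith
  note k_cases = this
  consider "j = i" | "j = Suc i" | "j < i" | "Suc i < j" by linarith
  then show "indg i (indt k F) j = indt (transpose i (Suc i) k) (indg i F) j"
  proof cases
    case 1 from k_cases show ?thesis
      by cases (use 1 i k j F in \<open>auto simp: indg_def indt_def layer_simps op_simps a b transpose_def\<close>)
  next
    case 2 from k_cases show ?thesis
      by cases (use 2 i k j F in \<open>auto simp: indg_def indt_def layer_simps op_simps a b transpose_def\<close>)
  next
    case 3
    have "g (i - 1) (t l z) = t (transpose (i - 1) i l) (g (i - 1) z)" "g (i - 1) (tau z) = tau (g (i - 1) z)"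
      if "1 \<le> l" "l \<le> n" "z \<in> P" for l z 
      using g_t[of "i - 1" l z] tau_g[of "i - 1" z] that i j 3 by auto
    with k_cases show ?thesis
      by cases (use 3 i k j F in \<open>auto simp: indg_def indt_def transpose_def\<close>)
  next
    case 4
    have "g i (t l z) = t (transpose i (Suc i) l) (g i z)" "g i (tau z) = tau (g i z)"
      if "1 \<le> l" "l \<le> n" "z \<in> P" for l z 
      using g_t[of i l z] tau_g[of i z] that i j 4 by auto
    with k_cases show ?thesis
      by cases (use 4 i k j F in \<open>auto simp: indg_def indt_def transpose_def\<close>)
  qed
qed

lemma indg_indg:
  assumes i: "1 \<le> i" "i \<le> n" and F: "F \<in> indP"
  shows "indg i (indg i F) =
    F + fscale scale Dl (average (fscale scale) rho r (indt i) (indt (Suc i)) (indg i F))"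
    (is "_ = F + fscale scale Dl ?A")
proof
  fix j
  have gF: "indg i F \<in> indP" using i F by (simp add: indg_P)
  show "indg i (indg i F) j = (F + fscale scale Dl ?A) j"
  proof (cases "j \<in> {1..Suc n}")
    case False
    have "?A \<in> indP"
    proof -
      interpret S: submodule_over "fscale scale" R indP by (rule indP_submodule)
      show ?thesis using i gF by (intro S.average_closed) (auto simp: indt_P)
    qed
    then have "?A j = 0" using False by (intro indP_zero)
    moreover have "indg i (indg i F) j = 0" using False i F by (intro indP_zero indg_P)
    moreover have "F j = 0" using False F by (intro indP_zero)
    ultimately show ?thesis by (simp add: fscale_def)
  next
    case True
    then have j: "1 \<le> j" "j \<le> Suc n" by auto
    consider "j = i" | "j = Suc i" | "j < i" | "Suc i < j" by linarith
    then show ?thesis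
    proof cases
      case 3
      then show ?thesis using g_g[of "i - 1" "F j"] i j F
        by (simp add: fscale_def ind_average[OF i gF j]) (simp add: indg_def e_def)
    next
      case 4
      then show ?thesis using g_g[of i "F j"] i j F
        by (simp add: fscale_def ind_average[OF i gF j]) (simp add: indg_def e_def)
    qed (use i j F in \<open>simp_all add: fscale_def ind_average[OF i gF]\<close>, simp_all add: indg_def)
  qed
qed

lemma g_E': 
  assumes "1 \<le> i" "i < n" "z \<in> P"
  shows "g i (E i z) = E (Suc i) (g i z)" "g i (E (Suc i) z) = E i (g i z)"
    "\<lbrakk>1 \<le> k; k \<le> n; k \<noteq> i; k \<noteq> Suc i\<rbrakk> \<Longrightarrow> g i (E k z) = E k (g i z)"
  using assms by (auto simp: g_E)

lemma indg_far:
  assumes i: "1 \<le> i" "i + 2 \<le> k" "k \<le> n" and F: "F \<in> indP"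
  shows "indg i (indg k F) = indg k (indg i F)"
proof (rule indP_eqI)
  fix j assume j: "1 \<le> j" "j \<le> Suc n"
  consider "j < i" | "j = i" | "j = Suc i" | "Suc i < j" "j < k" | "j = k" | "j = Suc k" | "Suc k < j"
    by linarith
  then show "indg i (indg k F) j = indg k (indg i F) j"
  proof cases
    case 1
    then have "g (i - 1) (g (k - 1) (F j)) = g (k - 1) (g (i - 1) (F j))"
      using i j F by (intro g_gi_far) auto
    then show ?thesis using 1 i by (simp add: indg_def)
  qed (use i j F in \<open>auto simp: indg_def op_simps g_E' g_gi_far(1) g_P\<close>)
qed (use i F in \<open>auto intro!: indg_P\<close>)

lemma indg_braid:
  assumes i: "1 \<le> i" "i < n" and F: "F \<in> indP"
  shows "indg i (indg (Suc i) (indg i F)) = indg (Suc i) (indg i (indg (Suc i) F))"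
proof (rule indP_eqI)
  fix j assume j: "1 \<le> j" "j \<le> Suc n"
  have gg: "g i (g i z) = z + Dl *s e i (Suc i) (g i z)" if "z \<in> P" for z
    using g_g[of i z] i that by (simp add: e_def)
  have Egg: "E i (E (Suc i) z) = E (Suc i) (e i (Suc i) z)" if "z \<in> P" for z
    using i that by (intro E_E_Suc) auto
  have EEg: "E (Suc i) (E i z) = E (Suc i) (e i (Suc i) z)" if "z \<in> P" for z
  proof -
    have "E i (E (Suc i) z) = average scale rho r tau (t (Suc i)) (E i z)"
      by (rule E_intertwine[OF E_lin]) (use i that in \<open>auto simp: tau_E t_E\<close>)
    then show ?thesis using Egg[OF that] by (simp add: E_def[of "Suc i"])
  qed
  consider "j < i" | "j = i" | "j = Suc i" | "j = Suc (Suc i)" | "Suc (Suc i) < j" by linarith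
  then show "indg i (indg (Suc i) (indg i F)) j = indg (Suc i) (indg i (indg (Suc i) F)) j"
  proof cases
    case 1
    then show ?thesis using i j F braid[of "i - 1" "F j"] by (auto simp: indg_def)
  next
    case 2
    then show ?thesis using i j F 
      by (simp add: indg_def op_simps E_simps g_E' gg Egg EEg E_P g_P e_P scale_right_distrib)
  next
    case 3
    then show ?thesis using i j F
      by (simp add: indg_def op_simps E_simps g_E' gg Egg g_P e_P scale_right_distrib)
  next
    case 4
    then show ?thesis using i j F by (simp add: indg_def)
  next
    case 5
    then show ?thesis using i j F braid[of i "F j"] by (auto simp: indg_def)
  qed
qed (use i F in \<open>auto intro!: indg_P\<close>)

lemma indt_indX:
  assumes k: "1 \<le> k" "k \<le> Suc n" and F: "F \<in> indP"
  shows "indt k (indX F) = indX (indt k F)"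
proof (rule indP_eqI)
  fix j assume j: "1 \<le> j" "j \<le> Suc n"
  show "indt k (indX F) j = indX (indt k F) j"
  proof (cases "j = 1")
    case False
    then show ?thesis using k j F by (auto simp: indt_def indX_def tau_X t_X)
  next
    case True
    define y where "y = (if k = 1 then tau else t (k - 1))"
    have y: "linop scale y" using tau_lin t_lin by (simp add: y_def)
    have "L m (indt k F (m + 2)) = y (L m (F (m + 2)))" if "m < n" for m
      using that k F L_t(1,2)[of m "F (m + 2)"] L_t(3,4)[of m "F (m + 2)" k]
        L_t(3)[of m "F (m + 2)" "k - 1"]
      by (auto simp: indt_def y_def)
    then have "(\<Sum>m<n. L m (indt k F (m + 2))) = y (\<Sum>m<n. L m (F (m + 2)))"
      by (simp add: linmap_simps[OF y])
    moreover have "y (x z) = x (y z)" if "z \<in> P" for z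
      using that k x_t[of "k - 1" z] by (auto simp: tau_x y_def)
    moreover have "(\<Sum>m<n. L m (F (m + 2))) \<in> P" using F by (intro P_sum) simp
    moreover have "indt k H 1 = y (H 1)" for H using k by (auto simp: indt_def y_def)
    ultimately show ?thesis using True F
      by (simp only: indX_def if_True simp_thms linmap_simps[OF y] indP_P)
  qed
qed (use k F in \<open>auto intro!: ind_P\<close>)

lemma indg_indX:
  assumes i: "2 \<le> i" "i \<le> n" and F: "F \<in> indP"
  shows "indg i (indX F) = indX (indg i F)"
proof (rule indP_eqI)
  fix j assume j: "1 \<le> j" "j \<le> Suc n"
  show "indg i (indX F) j = indX (indg i F) j"
  proof (cases "j = 1")
    case False
    then show ?thesis using i j F
      by (auto simp: indg_def indX_def op_simps X_E[symmetric] g_X)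
  next
    case True
    obtain m where m: "i = m + 2" using i by (metis add.commute le_Suc_ex)
    have gL: "g (m + 1) (L m z) = L (Suc m) z + Dl *s L m (E (m + 2) z)"
      "g (m + 1) (L (Suc m) z) = L m z" if "z \<in> P" for z
      using that m i L_E[of m z] gi_def[of "Suc m" "L m z"] g_gi[of "Suc m" "L m z"]
      by (simp_all add: L_Suc)
    have "(\<Sum>l<n. L l (indg i F (l + 2))) = (\<Sum>l<n. g (m + 1) (L l (F (l + 2))))"
    proof -
      have split: "sum h {..<n} = h m + h (Suc m) + sum h ({..<n} - {m, Suc m})" for h :: "nat \<Rightarrow> 'b"
        using m i by (subst sum.subset_diff[of "{m, Suc m}"]) (auto simp: add.commute)
      have "L l (indg i F (l + 2)) = g (m + 1) (L l (F (l + 2)))"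
        if "l \<in> {..<n} - {m, Suc m}" for l
        using that m i F L_g[of l "F (l + 2)" i] L_g[of l "F (l + 2)" "i - 1"] by (auto simp: indg_def)
      moreover have "L m (indg i F (m + 2)) + L (Suc m) (indg i F (Suc m + 2)) =
          g (m + 1) (L m (F (m + 2))) + g (m + 1) (L (Suc m) (F (Suc m + 2)))"
        using m i F gL by (simp add: indg_def L_simps)
      ultimately show ?thesis by (simp add: split)
    qed
    then show ?thesis using True i m F
      by (simp add: indX_def indg_def op_simps x_g[symmetric] layer_simps) 
  qed
qed (use i F in \<open>auto intro!: ind_P\<close>)

text \<open>Only the first block is not immediate. There the contributions of the blocks $j \ge
  3$ are collected in sums, which \<open>L_identities\<close> relates to each other, and the
  blocks $1$ and $2$ are treated by direct calculation.\<close>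

lemma indg_indX_indg_indX:
  assumes n: "1 \<le> n" and F: "F \<in> indP"
  shows "indg 1 (indX (indg 1 (indX F))) = indX (indg 1 (indX (indg 1 F)))"
proof -
  obtain n' where n': "n = Suc n'" using n by (cases n) auto
  \<comment> \<open>The sum over the blocks from the third on; block 2 enters separately with
    index 0.\<close>
  define S where "S H = (\<Sum>m<n'. L (Suc m) (H (m + 3)))" for H
  have sum_split: "(\<Sum>m<n. L m (H (m + 2))) = L 0 (H 2) + S H" for H
    unfolding n' S_def
    by (subst sum.lessThan_Suc_shift) (simp add: numeral_2_eq_2 numeral_3_eq_3)
  have X1_row: "indX H 1 = x (H 1) + Dl *s x (L 0 (H 2) + S H)"
    "indX H 2 = X1 (H 2)" for H
    by (simp_all only: indX_def sum_split if_True simp_thms) simp_all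
  have g_row: "indg 1 H 1 = Dl *s E 1 (H 1) + H 2" "indg 1 H 2 = H 1" for H
    by (simp_all add: indg_def numeral_2_eq_2)
  have high: "indX H (m + 3) = X1 (H (m + 3))" "indg 1 H (m + 3) = g 1 (H (m + 3))" for H m
    by (simp_all add: indX_def indg_def)
  have S_P: "S H \<in> P" if "\<And>m. m < n' \<Longrightarrow> H (m + 3) \<in> P" for H
    unfolding S_def using that n' by (intro P_sum) auto
  let ?C = "\<lambda>m. F (m + 3)"
  define S0 where "S0 = (\<Sum>m<n'. L (Suc m) (?C m))"
  define SgX where "SgX = (\<Sum>m<n'. L (Suc m) (g 1 (X1 (?C m))))"
  define Sg where "Sg = (\<Sum>m<n'. L (Suc m) (g 1 (?C m)))"
  define SgXg where "SgXg = (\<Sum>m<n'. L (Suc m) (g 1 (X1 (g 1 (?C m)))))"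
  have inner: "g 1 (X1 (?C m)) \<in> P" "g 1 (?C m) \<in> P" "g 1 (X1 (g 1 (?C m))) \<in> P"
    if "m < n'" for m using that n' F by (auto intro!: g_P X_P)
  have SP: "S0 \<in> P" "SgX \<in> P" "Sg \<in> P" "SgXg \<in> P"
    unfolding S0_def SgX_def Sg_def SgXg_def using n' F by (auto intro!: P_sum L_P g_P X_P)
  have ids: "SgX + Dl *s E 1 (X1 (pi S0)) = X1 Sg"
    "X1 S0 + Dl *s E 1 (X1 (Sg - pi Sg)) = SgXg"
  proof -
    have 1: "L (Suc m) (g 1 (X1 (?C m))) + Dl *s E 1 (X1 (pi (L (Suc m) (?C m))))
        = X1 (L (Suc m) (g 1 (?C m)))" if "m < n'" for m
      using that n' F by (intro L_identities) auto
    have 2: "X1 (L (Suc m) (?C m)) +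
        Dl *s E 1 (X1 (L (Suc m) (g 1 (?C m)) - pi (L (Suc m) (g 1 (?C m)))))
        = L (Suc m) (g 1 (X1 (g 1 (?C m))))" if "m < n'" for m
      using that n' F by (intro L_identities) auto
    have "SgX + Dl *s E 1 (X1 (pi S0)) =
        (\<Sum>m<n'. L (Suc m) (g 1 (X1 (?C m))) + Dl *s E 1 (X1 (pi (L (Suc m) (?C m)))))"
      by (simp add: SgX_def S0_def layer_simps op_simps E_simps sum.distrib scale_sum_right)
    also have "\<dots> = X1 Sg" using 1 by (simp add: Sg_def op_simps)
    finally show "SgX + Dl *s E 1 (X1 (pi S0)) = X1 Sg" .
    have "X1 S0 + Dl *s E 1 (X1 (Sg - pi Sg)) =
        (\<Sum>m<n'. X1 (L (Suc m) (?C m)) +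
          Dl *s E 1 (X1 (L (Suc m) (g 1 (?C m)) - pi (L (Suc m) (g 1 (?C m))))))"
      by (simp add: Sg_def S0_def layer_simps op_simps E_simps sum.distrib sum_subtractf
          scale_sum_right scale_right_diff_distrib)
    also have "\<dots> = SgXg" using 2 by (simp add: SgXg_def)
    finally show "X1 S0 + Dl *s E 1 (X1 (Sg - pi Sg)) = SgXg" .
  qed
  let ?A = "F 1" and ?B = "F 2"
  have AB: "?A \<in> P" "?B \<in> P" using F by auto
  have L0: "L 0 z = E 1 (pi z) - E 1 z" for z by (simp add: L_def E_simps)
  have E1: "\<And>z. z \<in> P \<Longrightarrow> E 1 z \<in> P" "\<And>z. z \<in> P \<Longrightarrow> E 1 (E 1 z) = E 1 z"
    "\<And>z. z \<in> P \<Longrightarrow> X1 (E 1 z) = E 1 (X1 z)" "\<And>z. z \<in> P \<Longrightarrow> x (E 1 z) = E 1 (x z)"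
    "\<And>z. z \<in> P \<Longrightarrow> pi (E 1 z) = E 1 (pi z)"
    using n by (auto simp: E_E X_E x_E pi_E)
  note calc = layer_simps op_simps E_simps L0 E1 X_P AB SP pi_pi pi_x pi_X x_X scale_right_distrib
    scale_right_diff_distrib
  note [simp del] = One_nat_def and [simp] = n
  define y where "y = indX F 1"
  have y: "y = x ?A + Dl *s x (L 0 ?B + S0)" by (simp only: y_def X1_row S0_def S_def)
  have y_P: "y \<in> P" using y n by (simp add: calc del: One_nat_def)
  define Y where "Y = indX (indg 1 F) 1"
  have Y: "Y = x ?B + Dl *s x (E 1 (pi ?A) + Sg)"
    unfolding Y_def X1_row g_row S_def Sg_def high by (simp add: calc)
  have Y_P: "Y \<in> P" using Y n by (simp add: calc del: One_nat_def)
  have XgX: "indX (indg 1 (indX F)) 1 = X1 Y"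
  proof -
    have "indX (indg 1 (indX F)) 1 = x (Dl *s E 1 y + X1 ?B) + Dl *s x (L 0 y + SgX)"
      unfolding X1_row g_row S_def SgX_def high y_def by simp
    also have "\<dots> = x (X1 ?B) + Dl *s x (E 1 (pi y) + SgX)"
      using y_P by (simp add: calc)
    also have "E 1 (pi y) + SgX = E 1 (X1 (pi ?A)) + (SgX + Dl *s E 1 (X1 (pi S0)))"
      by (simp add: calc y)
    also have "\<dots> = E 1 (X1 (pi ?A)) + X1 Sg" by (simp only: ids)
    also have "x (X1 ?B) + Dl *s x (E 1 (X1 (pi ?A)) + X1 Sg) = X1 Y"
      by (simp add: calc Y)
    finally show ?thesis .
  qed
  have XgXg: "indX (indg 1 (indX (indg 1 F))) 1 =
      Dl *s x (E 1 (pi Y)) + x (X1 ?A) + Dl *s x SgXg"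
  proof -
    have "indX (indg 1 (indX (indg 1 F))) 1 =
        x (Dl *s E 1 Y + X1 ?A) + Dl *s x (L 0 Y + SgXg)"
      unfolding X1_row g_row S_def SgXg_def high Y_def by simp
    then show ?thesis using Y_P by (simp add: calc)
  qed
  have row1: "Dl *s E 1 (X1 Y) + X1 y = Dl *s x (E 1 (pi Y)) + x (X1 ?A) + Dl *s x SgXg"
    by (simp add: y Y calc flip: ids(2))
  show ?thesis
  proof (rule indP_eqI)
    fix j assume j: "1 \<le> j" "j \<le> Suc n"
    consider "j = 1" | "j = 2" | m where "j = m + 3"
      using j by (metis One_nat_def Suc_1 add.commute le_Suc_ex le_antisym not_less_eq_eq numeral_3_eq_3)
    then show "indg 1 (indX (indg 1 (indX F))) j = indX (indg 1 (indX (indg 1 F))) j"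
    proof cases
      case 1
      have "indg 1 (indX (indg 1 (indX F))) 1 = Dl *s E 1 (X1 Y) + X1 y"
        by (simp only: g_row XgX X1_row(2) y_def)
      then show ?thesis using row1 XgXg 1 by (simp only:)
    next
      case 2
      then show ?thesis by (simp only: g_row X1_row(2) XgX flip: Y_def)
    next
      case 3
      have "g 1 (X1 (g 1 (X1 (F j)))) = X1 (g 1 (X1 (g 1 (F j))))"
        using F j n' 3 by (intro g_X_g_X) auto
      then show ?thesis using 3 by (simp only: high)
    qed
  qed (use F n in \<open>auto intro!: ind_P\<close>)
qed

text \<open>Applying $p_k(X)$ turns the correction in the first block into a divided difference,
  as for a polynomial in a triangular matrix with diagonal entries $x$ and $X$.\<close>

lemma indX_newton:
  assumes F: "F \<in> indP" and k: "k \<le> d"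
  shows "newton (fscale scale) u indX k F \<in> indP"
    and "2 \<le> j \<Longrightarrow> newton (fscale scale) u indX k F j = newton scale u X1 k (F j)"
    and "newton (fscale scale) u indX k F 1 = newton scale u x k (F 1) +
      Dl *s x (\<Sum>m<n. G m (quot_newton scale u x X1 k (pi (F (m + 2)) - F (m + 2))))"
proof -
  interpret S: submodule_over "fscale scale" R indP by (rule indP_submodule)
  have "newton (fscale scale) u indX k F \<in> indP \<and>
    (2 \<le> j \<longrightarrow> newton (fscale scale) u indX k F j = newton scale u X1 k (F j)) \<and>
    newton (fscale scale) u indX k F 1 = newton scale u x k (F 1) +
      Dl *s x (\<Sum>m<n. G m (quot_newton scale u x X1 k (pi (F (m + 2)) - F (m + 2))))" for j
    using k
  proof (induction k arbitrary: j)
    case (Suc k)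
    let ?F = "newton (fscale scale) u indX k F"
    have IH: "?F \<in> indP" "\<And>j. 2 \<le> j \<Longrightarrow> ?F j = newton scale u X1 k (F j)"
      "?F 1 = newton scale u x k (F 1) +
        Dl *s x (\<Sum>m<n. G m (quot_newton scale u x X1 k (pi (F (m + 2)) - F (m + 2))))"
      using Suc by auto
    have L: "L m (?F (m + 2)) = G m (newton scale u X1 k (pi (F (m + 2)) - F (m + 2)))" for m
    proof -
      have "pi (newton scale u X1 k z) = newton scale u X1 k (pi z)" if "z \<in> P" for z
        using that Suc.prems newton_P[of _ z]
        by (induction k) (simp_all add: layer_simps pi_X)
      then show ?thesis using F by (simp add: IH L_def linmap_simps[OF newton_lin])
    qed
    have q: "quot_newton scale u x X1 k z \<in> P" if "z \<in> P" for z
      using that Suc.prems by (simp add: quot_newton_P)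
    have row1: "indX H 1 = x (H 1) + Dl *s x (\<Sum>m<n. L m (H (m + 2)))" for H
      by (simp add: indX_def)
    have app: "fscale scale c H j = c *s H j" for c H and j :: nat by (simp add: fscale_def)
    have "newton (fscale scale) u indX (Suc k) F 1 = newton scale u x (Suc k) (F 1) +
      Dl *s x (\<Sum>m<n. G m (quot_newton scale u x X1 (Suc k) (pi (F (m + 2)) - F (m + 2))))"
      unfolding newton.simps minus_apply app row1 L IH(3) quot_newton.simps
      using F by (simp add: G_simps layer_simps G_x q sum.distrib sum_subtractf scale_sum_right
          algebra_simps)
    moreover have "newton (fscale scale) u indX (Suc k) F j = newton scale u X1 (Suc k) (F j)"
      if "2 \<le> j"
    proof -
      have "indX H j = X1 (H j)" for H using that by (simp add: indX_def)
      then show ?thesis by (simp only: newton.simps minus_apply app IH(2)[OF that])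
    qed
    moreover have "newton (fscale scale) u indX (Suc k) F \<in> indP"
      unfolding newton.simps using Suc.prems IH(1) by (intro S.P_diff S.P_scale indX_P u_R) auto
    ultimately show ?case by blast
  qed (use F in \<open>simp add: linmap_simps[OF G_lin] layer_simps\<close>)
  then show "newton (fscale scale) u indX k F \<in> indP"
    and "2 \<le> j \<Longrightarrow> newton (fscale scale) u indX k F j = newton scale u X1 k (F j)"
    and "newton (fscale scale) u indX k F 1 = newton scale u x k (F 1) +
      Dl *s x (\<Sum>m<n. G m (quot_newton scale u x X1 k (pi (F (m + 2)) - F (m + 2))))"
    by auto
qed

text \<open>For $k = d$ the divided difference kills \<open>pi z - z\<close>, so that the
  annihilating polynomial of $X$ holds in the first block as well.\<close>

theorem ind_yh_module:
  "yh_module R r d Dl rho u (fscale scale) indP (Suc n) indt indg indX"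
proof (intro yh_module.intro yh_module_axioms.intro yh_params_axioms indP_submodule ind_lin
    indt_P indg_P indX_P indg_far indg_braid indt_indt indg_indt indt_root indg_indg indg_indX
    indg_indX_indg_indX indt_indX)
  fix F assume F: "F \<in> indP"
  have P: "newton (fscale scale) u indX d F \<in> indP" using F by (intro indX_newton) auto
  show "newton (fscale scale) u indX d F = 0"
  proof (rule indP_eqI[OF P])
    fix j assume j: "1 \<le> j" "j \<le> Suc n"
    show "newton (fscale scale) u indX d F j = 0 j"
    proof (cases "j = 1")
      case True
      then show ?thesis using indX_newton(3)[OF F order_refl] F
        by (simp add: x_root quot_root G_simps layer_simps)
    next
      case False
      then show ?thesis using indX_newton(2)[OF F order_refl, of j] F j by (simp add: X_root)
    qed
  qed (auto intro: indPI)
qed auto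

end

section \<open>The layer of a module\<close>

definition lift :: "('m \<Rightarrow> 'm) \<Rightarrow> (nat \<Rightarrow> nat \<Rightarrow> 'm) \<Rightarrow> nat \<Rightarrow> nat \<Rightarrow> 'm"
  where "lift f F = (\<lambda>a b. f (F a b))"

lemma lift_funpow: "(lift f ^^ k) F = lift (f ^^ k) F"
  by (induction k) (simp_all add: lift_def)

lemma lift_linop: "linop sc f \<Longrightarrow> linop (fscale (fscale sc)) (lift f)"
  by (rule linmapI) (simp_all add: lift_def fscale_def fun_eq_iff linmap_simps)

lemma sum_fun_apply: "(sum f A) x = (\<Sum>i\<in>A. f i x)"
  by (induction A rule: infinite_finite_induct) auto

lemma lift_average:
  "average (fscale (fscale sc)) rho r (lift a) (lift b) F = lift (average sc rho r a b) F"
  by (simp add: average_def lift_funpow fscale_def fun_eq_iff sum_fun_apply) (simp add: lift_def average_def)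

lemma lift_newton: "newton (fscale (fscale sc)) u (lift X1) k F = lift (newton sc u X1 k) F"
  by (induction k) (simp_all add: lift_def fscale_def fun_eq_iff)

context yh_module begin

text \<open>Elements of the layer are families \<open>F a b\<close> with $a < d$ and $b < r$,
  the coefficients with respect to the Newton products $p_a(x)$ and the powers $\tau^b$. Hence
  \<open>ltau\<close> is a cyclic shift in $b$, written with $r - 1$ in place of $-1$;
  \<open>lx\<close> expresses $x p_a(x) = p_{a+1}(x) + u_a p_a(x)$ with $p_d(x) = 0$; and
  \<open>lpi\<close> replaces each $p_a(x)$ by $p_a(X)$.\<close>

definition "layP = {F. (\<forall>a b. F a b \<in> P) \<and> (\<forall>a b. \<not> (a < d \<and> b < r) \<longrightarrow> F a b = 0)}"

definition ltau :: "(nat \<Rightarrow> nat \<Rightarrow> 'm) \<Rightarrow> nat \<Rightarrow> nat \<Rightarrow> 'm" where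
  "ltau F a b = (if b < r then F a ((b + (r - 1)) mod r) else 0)"

definition lx :: "(nat \<Rightarrow> nat \<Rightarrow> 'm) \<Rightarrow> nat \<Rightarrow> nat \<Rightarrow> 'm" where
  "lx F a b = (if a < d then u a *s F a b + (if a = 0 then 0 else F (a - 1) b) else 0)"

definition lpi :: "(nat \<Rightarrow> nat \<Rightarrow> 'm) \<Rightarrow> nat \<Rightarrow> nat \<Rightarrow> 'm" where
  "lpi F a b = (if a = 0 then \<Sum>k<d. newton scale u X1 k (F k b) else 0)"

abbreviation "lscale \<equiv> fscale (fscale scale)"

lemma layP_P[simp]: "F \<in> layP \<Longrightarrow> F a b \<in> P"
  and layP_zero: "F \<in> layP \<Longrightarrow> \<not> (a < d \<and> b < r) \<Longrightarrow> F a b = 0"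
  unfolding layP_def by blast+

lemma layPI: "(\<And>a b. a < d \<Longrightarrow> b < r \<Longrightarrow> F a b \<in> P) \<Longrightarrow> 
    (\<And>a b. \<not> (a < d \<and> b < r) \<Longrightarrow> F a b = 0) \<Longrightarrow> F \<in> layP"
  unfolding layP_def by (intro CollectI conjI allI impI; metis P_zero)

lemma layP_submodule: "submodule_over lscale R layP"
proof (intro submodule_over.intro submodule_over_axioms.intro module_fscale module_axioms
    one_R uminus_one_R)
  fix F H c assume F: "F \<in> layP" "H \<in> layP"
  show "F + H \<in> layP" 
    using layP_zero[OF F(1)] layP_zero[OF F(2)] F by (intro layPI) simp_all
  assume "c \<in> R"
  then show "lscale c F \<in> layP"
    using layP_zero[OF F(1)] F by (intro layPI) (simp_all add: fscale_def)
qed (auto intro: layPI)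

lemma lift_P:
  assumes "linop scale f" "\<And>z. z \<in> P \<Longrightarrow> f z \<in> P" "F \<in> layP"
  shows "lift f F \<in> layP"
  using assms layP_zero[OF assms(3)] by (intro layPI) (simp_all add: lift_def linmap_simps)

lemma ltau_P: "F \<in> layP \<Longrightarrow> ltau F \<in> layP"
  by (rule layPI) (auto simp: ltau_def layP_zero)

lemma lx_P: "F \<in> layP \<Longrightarrow> lx F \<in> layP"
  using layP_zero[of F] by (intro layPI) (auto simp: lx_def)

lemma lpi_P: "F \<in> layP \<Longrightarrow> lpi F \<in> layP"
  using layP_zero[of F] d_pos
  by (intro layPI) (auto simp: lpi_def linmap_simps[OF newton_lin] intro!: P_sum newton_P)

lemma ltau_funpow: "b < r \<Longrightarrow> (ltau ^^ k) F a b = F a ((b + k * (r - 1)) mod r)"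
proof (induction k arbitrary: b)
  case (Suc k)
  have "(ltau ^^ Suc k) F a b = (ltau ^^ k) F a ((b + (r - 1)) mod r)"
    using Suc.prems by (simp add: ltau_def)
  also have "\<dots> = F a (((b + (r - 1)) mod r + k * (r - 1)) mod r)"
    using Suc.prems by (intro Suc.IH) simp
  also have "\<dots> = F a ((b + Suc k * (r - 1)) mod r)"
    by (simp only: mod_add_left_eq mult_Suc add.assoc)
  finally show ?case .
qed simp

lemma ltau_root: "F \<in> layP \<Longrightarrow> (ltau ^^ r) F = F"
proof (intro ext)
  fix a b assume F: "F \<in> layP"
  have "(ltau ^^ k) F \<in> layP" for k using F by (induction k) (auto simp: ltau_P)
  then have "(ltau ^^ r) F \<in> layP" .
  then show "(ltau ^^ r) F a b = F a b"
    using layP_zero[OF F, of a b] layP_zero[of "(ltau ^^ r) F" a b]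
    by (cases "b < r") (auto simp: ltau_funpow)
qed

lemma lin_layer: "linop lscale ltau" "linop lscale lx" "linop lscale lpi"
  by (rule linmapI; simp add: fun_eq_iff ltau_def lx_def lpi_def fscale_def sum.distrib scale_sum_right
    linmap_simps[OF newton_lin] scale_right_distrib mult.commute)+

lemma lift_commute:
  assumes f: "linop scale f"
  shows "ltau (lift f F) = lift f (ltau F)" "lx (lift f F) = lift f (lx F)"
  using f by (auto simp: fun_eq_iff ltau_def lift_def lx_def linmap_simps)

lemma lpi_lift:
  assumes f: "linop scale f" and P: "\<And>z. z \<in> P \<Longrightarrow> f z \<in> P"
    and fX: "\<And>z. z \<in> P \<Longrightarrow> f (X1 z) = X1 (f z)" and F: "F \<in> layP"
  shows "lpi (lift f F) = lift f (lpi F)"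
proof -
  have "f (newton scale u X1 k z) = newton scale u X1 k (f z)" if "k < d" "z \<in> P" for k z
    by (rule newton_intertwine[OF f, where P = P]) (use that fX newton_P in auto)
  then show ?thesis using F by (auto simp: fun_eq_iff lpi_def lift_def linmap_simps[OF f])
qed

lemma lpi_const: "(\<And>a b. a \<noteq> 0 \<Longrightarrow> F a b = 0) \<Longrightarrow> lpi F a b = F a b"
proof -
  assume F: "\<And>a b. a \<noteq> 0 \<Longrightarrow> F a b = 0"
  have "(\<Sum>k<d. newton scale u X1 k (F k b)) = (\<Sum>k<d. if k = 0 then F 0 b else 0)"
    by (intro sum.cong) (auto simp: F linmap_simps[OF newton_lin])
  then show ?thesis using F d_pos by (simp add: lpi_def)
qed

lemma lpi_lx:
  assumes F: "F \<in> layP" shows "lpi (lx F) = lift X1 (lpi F)"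
proof (intro ext)
  fix a b
  let ?N = "newton scale u X1"
  note N = linmap_simps[OF newton_lin]
  have step: "?N k (u k *s z) = X1 (?N k z) - ?N (Suc k) z" for k z by (simp add: N)
  have Fd: "?N d (F (d - 1) b) = 0" using F by (intro X_root) simp
  obtain d' where d': "d = Suc d'" using d_pos by (cases d) auto
  have "(\<Sum>k<d. ?N k (lx F k b)) =
      (\<Sum>k<d. X1 (?N k (F k b)) - ?N (Suc k) (F k b)) + (\<Sum>k<d. if k = 0 then 0 else ?N k (F (k - 1) b))"
    by (simp add: lx_def N(1) step sum.distrib if_distrib[of "?N _"] N(3) del: newton.simps cong: if_cong)
  also have "(\<Sum>k<d. if k = 0 then 0 else ?N k (F (k - 1) b)) = (\<Sum>k<d'. ?N (Suc k) (F k b))"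
    unfolding d' by (subst sum.lessThan_Suc_shift) simp
  also have "\<dots> = (\<Sum>k<d. ?N (Suc k) (F k b))" using Fd unfolding d' by (simp del: newton.simps)
  finally have "(\<Sum>k<d. ?N k (lx F k b)) = (\<Sum>k<d. X1 (?N k (F k b)))"
    by (simp add: sum_subtractf del: newton.simps)
  then show "lpi (lx F) a b = lift X1 (lpi F) a b" by (simp add: lpi_def lift_def op_simps)
qed

text \<open>Multiplication by $p_k(x)$ produces no Newton coefficients of index below
  $k$.\<close>

lemma lx_newton_low:
  assumes "F \<in> layP" "k \<le> d" "a < k"
  shows "newton lscale u lx k F a b = 0"
  using assms
proof (induction k arbitrary: a)
  case (Suc k)
  then show ?case by (cases "a = k") (auto simp: fscale_def lx_def)
qed simp

theorem prelayer: "yh_prelayer R r d Dl rho u lscale layP n (\<lambda>i. lift (t i)) (\<lambda>i. lift (g i))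
    (lift X1) ltau lx lpi"
proof -
  have 1: "yh_module R r d Dl rho u lscale layP n (\<lambda>i. lift (t i)) (\<lambda>i. lift (g i)) (lift X1)"
  proof (intro yh_module.intro yh_module_axioms.intro yh_params_axioms layP_submodule lift_linop
      t_lin g_lin X_lin lift_P t_P g_P X_P)
    fix F i assume "F \<in> layP"
    then show "1 \<le> i \<Longrightarrow> i \<le> n \<Longrightarrow> (lift (t i) ^^ r) F = F" by (simp add: lift_funpow) (simp add: lift_def t_root)
    show "newton lscale u (lift X1) d F = 0"
      using \<open>F \<in> layP\<close> by (simp add: lift_newton) (simp add: lift_def X_root fun_eq_iff)
    show "1 \<le> i \<Longrightarrow> i < n \<Longrightarrow> lift (g i) (lift (g i) F) = F + lscale Dl (average lscale rho r
       (lift (t i)) (lift (t (Suc i))) (lift (g i) F))"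
      using \<open>F \<in> layP\<close> by (simp add: lift_average) (simp add: lift_def g_g fscale_def fun_eq_iff)
  qed (auto simp: lift_def fun_eq_iff g_far braid t_t[of _ j for j] g_t g_X g_X_g_X[unfolded One_nat_def] t_X intro!: t_t g_far)
  have gXg: "linop scale (\<lambda>z. g 1 (X1 (g 1 z)))"
    by (intro linmap_comp[OF g_lin] linmap_comp[OF X_lin] g_lin)
  have gXg_lift: "lift (g 1) (lift X1 (lift (g 1) F)) = lift (\<lambda>z. g 1 (X1 (g 1 z))) F" for F
    by (simp add: lift_def)
  show ?thesis
  proof (intro yh_prelayer.intro yh_prelayer_axioms.intro 1 lin_layer ltau_P lx_P lpi_P ltau_root
      lift_commute lpi_lx lpi_lift t_lin g_lin X_lin t_P g_P X_P)
    fix F assume F: "F \<in> layP"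
    show "newton lscale u lx d F = 0"
    proof (intro ext)
      fix a b
      interpret S: submodule_over lscale R layP by (rule layP_submodule)
      have "newton lscale u lx k F \<in> layP" if "k \<le> d" for k
        using that F by (induction k) (auto simp: lx_P)
      then show "newton lscale u lx d F a b = 0 a b"
        using lx_newton_low[OF F order_refl, of a b] layP_zero[of "newton lscale u lx d F" a b]
        by (cases "a < d") auto
    qed
    have zero: "lpi F a b = 0" if "a \<noteq> 0" for a b using that by (simp add: lpi_def)
    have "lpi (lpi F) a b = lpi F a b" for a b using zero by (rule lpi_const)
    then show "lpi (lpi F) = lpi F" by (simp add: fun_eq_iff)
    show "lpi (ltau F) = ltau (lpi F)"
      using F layP_zero[OF F] by (auto simp: fun_eq_iff lpi_def ltau_def linmap_simps[OF newton_lin])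
    show "lpi (lift (g i) (lpi F)) = lift (g i) (lpi F)" for i
      by (intro ext lpi_const) (simp add: lpi_def lift_def op_simps)
    show "lpi (lift (g 1) (lift X1 (lift (g 1) F))) = lift (g 1) (lift X1 (lift (g 1) (lpi F)))"
      if "2 \<le> n"
      unfolding gXg_lift using F that
      by (intro lpi_lift gXg) (auto intro!: g_P X_P simp: g_X_g_X[unfolded One_nat_def])
    show "ltau (lx F) = lx (ltau F)" by (auto simp: fun_eq_iff ltau_def lx_def)
  qed (auto simp: t_X g_X)
qed

text \<open>The layer is generated from its constants by the factors $x - u_k$ and sums.\<close>

lemma layP_induct[consumes 1, case_names const x add]:
  assumes F: "F \<in> layP"
    and const: "\<And>F. F \<in> layP \<Longrightarrow> (\<And>a b. a \<noteq> 0 \<Longrightarrow> F a b = 0) \<Longrightarrow> Q F"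
    and x: "\<And>F k. F \<in> layP \<Longrightarrow> k < d \<Longrightarrow> Q F \<Longrightarrow> Q (lx F - lscale (u k) F)"
    and add: "\<And>F H. F \<in> layP \<Longrightarrow> H \<in> layP \<Longrightarrow> Q F \<Longrightarrow> Q H \<Longrightarrow> Q (F + H)"
  shows "Q F"
proof -
  have single: "Q F" if "F \<in> layP" "k < d" "\<And>a b. a \<noteq> k \<Longrightarrow> F a b = 0" for F k
    using that
  proof (induction k arbitrary: F)
    case (Suc k)
    define H where "H = (\<lambda>a b. if a = k then F (Suc k) b else 0)"
    have H: "H \<in> layP" using Suc.prems layP_zero[OF Suc.prems(1)] by (intro layPI) (auto simp: H_def)
    have "Q H" using Suc.prems H by (intro Suc.IH) (auto simp: H_def)
    moreover have "F = lx H - lscale (u k) H"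
      using Suc.prems(2,3) by (auto simp: fun_eq_iff H_def lx_def fscale_def)
    ultimately show ?case using x[OF H, of k] Suc.prems(2) by (simp only: Suc_lessD)
  qed (auto intro: const)
  have "Q (\<lambda>a b. if a < k then F a b else 0)" if "k \<le> d" for k
    using that
  proof (induction k)
    case 0
    have "(\<lambda>a b. 0) \<in> layP" by (rule layPI) auto
    then show ?case using const[of "\<lambda>a b. 0"] by simp
  next
    case (Suc k)
    let ?A = "\<lambda>a b. if a < k then F a b else 0" and ?B = "\<lambda>a b. if a = k then F a b else 0"
    have "?A \<in> layP" "?B \<in> layP"
      by (rule layPI; simp add: F layP_zero[OF F])+
    then have "Q (?A + ?B)" using Suc single[of ?B k] by (intro add) auto
    also have "?A + ?B = (\<lambda>a b. if a < Suc k then F a b else 0)" by (auto simp: fun_eq_iff)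
    finally show ?case .
  qed
  from this[of d] show ?thesis using layP_zero[OF F]
    by (auto simp: fun_eq_iff elim!: back_subst[of Q])
qed

text \<open>The divisibility of \<open>pi - 1\<close> by $x - X$ holds on constants, where
  \<open>pi\<close> is the identity, and is inherited along the generation of the layer.\<close>

theorem layer: "yh_layer R r d Dl rho u lscale layP n (\<lambda>i. lift (t i)) (\<lambda>i. lift (g i))
    (lift X1) ltau lx lpi"
proof -
  interpret N: yh_prelayer R r d Dl rho u lscale layP n "\<lambda>i. lift (t i)" "\<lambda>i. lift (g i)"
    "lift X1" ltau lx lpi by (rule prelayer)
  let ?q = "quot_newton lscale u lx (lift X1) d"
  show ?thesis
  proof (intro yh_layer.intro yh_layer_axioms.intro prelayer)
    fix F assume "F \<in> layP"
    then show "?q (lpi F - F) = 0"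
    proof (induction F rule: layP_induct)
      case (const F)
      then have "lpi F - F = 0" using lpi_const[of F] by (simp add: fun_eq_iff)
      then show ?case by (simp only: linmap_zero[OF N.quot_newton_lin])
    next
      case (x F k)
      have "lpi (lx F - lscale (u k) F) - (lx F - lscale (u k) F) =
          (lpi (lx F) - lx F) - lscale (u k) (lpi F - F)"
        by (simp add: N.layer_simps N.scale_right_diff_distrib)
      then have "?q (lpi (lx F - lscale (u k) F) - (lx F - lscale (u k) F)) =
          ?q (lpi (lx F) - lx F) - lscale (u k) (?q (lpi F - F))"
        by (simp only: N.quot_newton_simps)
      also have "\<dots> = 0"
        by (simp only: x(3) N.quot_root_x[OF x(1,3)] N.scale_zero_right diff_zero)
      finally show ?case .
    next
      case (add F H)
      have "lpi (F + H) - (F + H) = (lpi F - F) + (lpi H - H)" by (simp add: N.layer_simps)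
      then show ?case using add by (simp only: N.quot_newton_simps add_0)
    qed
  qed
qed

text \<open>A module structure may be moved along an injective linear map with a linear left
  inverse. This allows all modules of the induction to live on the same type.\<close>

theorem transport:
  fixes enc :: "'m \<Rightarrow> 'k::ab_group_add"
  assumes enc: "linmap scale sc' enc" and dec: "linmap sc' scale dec"
    and inv: "\<And>z. dec (enc z) = z" and sc': "Modules.module sc'"
  shows "yh_module R r d Dl rho u sc' (enc ` P) n (\<lambda>i z. enc (t i (dec z))) (\<lambda>i z. enc (g i (dec z)))
    (\<lambda>z. enc (X1 (dec z)))"
proof -
  note lin = linmap_comp[OF enc linmap_comp[OF _ dec]]
  note encs = linmap_simps[OF enc, symmetric]
  have pow: "((\<lambda>z. enc (f (dec z))) ^^ k) (enc z) = enc ((f ^^ k) z)" for f k z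
    by (induction k) (simp_all add: inv)
  show ?thesis
  proof (intro yh_module.intro yh_module_axioms.intro yh_params_axioms submodule_over.intro
      submodule_over_axioms.intro sc' one_R uminus_one_R lin t_lin g_lin X_lin)
    show "0 \<in> enc ` P" using linmap_zero[OF enc] by (metis P_zero image_eqI)
    fix z assume "z \<in> enc ` P"
    then obtain y where y: "z = enc y" "y \<in> P" by auto
    show "newton sc' u (\<lambda>z. enc (X1 (dec z))) d z = 0"
      using newton_intertwine[OF enc, of P X1 "\<lambda>z. enc (X1 (dec z))" d u y] y
      by (simp add: inv newton_P X_root linmap_zero[OF enc])
    show "\<lbrakk>1 \<le> i; i < n\<rbrakk> \<Longrightarrow> enc (g i (dec (enc (g i (dec z))))) = z + sc' Dl
      (average sc' rho r (\<lambda>z. enc (t i (dec z))) (\<lambda>z. enc (t (Suc i) (dec z))) (enc (g i (dec z))))" for i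
      using y g_g[of i y]
        average_intertwine[OF enc, of P "t i" "\<lambda>z. enc (t i (dec z))" "t (Suc i)" 
          "\<lambda>z. enc (t (Suc i) (dec z))" "g i y" rho r, symmetric]
      by (simp add: inv g_P t_P) (simp add: encs)
    show "z' \<in> enc ` P \<Longrightarrow> z + z' \<in> enc ` P" for z' using y by (auto simp: encs)
    show "c \<in> R \<Longrightarrow> sc' c z \<in> enc ` P" for c using y by (auto simp: encs)
    show "\<lbrakk>1 \<le> i; i \<le> n\<rbrakk> \<Longrightarrow> enc (t i (dec z)) \<in> enc ` P" for i using y by (auto simp: inv t_P)
    show "\<lbrakk>1 \<le> i; i < n\<rbrakk> \<Longrightarrow> enc (g i (dec z)) \<in> enc ` P" for i using y by (auto simp: inv g_P)
    show "enc (X1 (dec z)) \<in> enc ` P" using y by (auto simp: inv X_P)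
    show "\<lbrakk>1 \<le> i; i \<le> n\<rbrakk> \<Longrightarrow> ((\<lambda>z. enc (t i (dec z))) ^^ r) z = z" for i
      using y by (simp add: pow t_root)
    show "\<lbrakk>1 \<le> i; i \<le> n; 1 \<le> j; j \<le> n\<rbrakk> \<Longrightarrow> enc (t i (dec (enc (t j (dec z))))) = enc (t j (dec (enc (t i (dec z)))))"
      for i j using y t_t[of i j y] by (simp add: inv)
    show "\<lbrakk>1 \<le> i; i + 2 \<le> j; j < n\<rbrakk> \<Longrightarrow> enc (g i (dec (enc (g j (dec z))))) = enc (g j (dec (enc (g i (dec z)))))"
      for i j using y g_far[of i j y] by (simp add: inv)
  qed (auto simp: inv braid g_t g_X g_X_g_X[unfolded One_nat_def] t_X)
qed

end

section \<open>The matrix of rows is unitriangular\<close>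

primrec gup :: "(nat \<Rightarrow> 'm \<Rightarrow> 'm) \<Rightarrow> nat \<Rightarrow> 'm \<Rightarrow> 'm" where
  "gup g 0 z = z"
| "gup g (Suc m) z = gup g m (g (Suc m) z)"

primrec gdn :: "(nat \<Rightarrow> 'm \<Rightarrow> 'm) \<Rightarrow> nat \<Rightarrow> 'm \<Rightarrow> 'm" where
  "gdn g 0 z = z"
| "gdn g (Suc m) z = g (Suc m) (gdn g m z)"

lemma gup_lin: "(\<And>i. linop sc (g i)) \<Longrightarrow> linop sc (gup g m)"
proof (induction m)
  case (Suc m)
  show ?case by (rule linmapI) (simp_all add: linmap_simps[OF Suc.IH] linmap_simps[OF Suc.prems] Suc.prems)
qed (simp add: linmap_def)

text \<open>Gaussian elimination: a system whose $i$-th equation reads $c_i = y_i$ up to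
  unknowns of lower rank has a unique solution in the lattice.\<close>

lemma unitriangular_ex1:
  fixes Psi :: "('i \<Rightarrow> 'm::ab_group_add) \<Rightarrow> 'i \<Rightarrow> 'm" and rank :: "'i \<Rightarrow> nat"
    and I :: "'i set" and P :: "'m set"
  defines "C \<equiv> {c. (\<forall>i\<in>I. c i \<in> P) \<and> (\<forall>i. i \<notin> I \<longrightarrow> c i = 0)}"
  assumes I: "finite I" and P: "0 \<in> P" "\<And>x y. x \<in> P \<Longrightarrow> y \<in> P \<Longrightarrow> x - y \<in> P"
    and Psi_P: "\<And>c i. c \<in> C \<Longrightarrow> i \<in> I \<Longrightarrow> Psi c i \<in> P"
    and Psi_diff: "\<And>c c' i. c \<in> C \<Longrightarrow> c' \<in> C \<Longrightarrow> i \<in> I \<Longrightarrow>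
      Psi (\<lambda>i. c i - c' i) i = Psi c i - Psi c' i"
    and tri: "\<And>c i. c \<in> C \<Longrightarrow> i \<in> I \<Longrightarrow> (\<And>i'. i' \<in> I \<Longrightarrow> rank i' < rank i \<Longrightarrow> c i' = 0) \<Longrightarrow>
      Psi c i = c i"
    and y: "\<And>i. i \<in> I \<Longrightarrow> y i \<in> P"
  shows "\<exists>!c. c \<in> C \<and> (\<forall>i\<in>I. Psi c i = y i)"
proof (rule ex_ex1I)
  have "\<exists>c\<in>C. \<forall>i\<in>I. rank i < N \<longrightarrow> Psi c i = y i" for N
  proof (induction N)
    case 0
    have "(\<lambda>i. 0) \<in> C" using P by (auto simp: C_def)
    then show ?case by auto
  next
    case (Suc N)
    then obtain c where c: "c \<in> C" "\<And>i. i \<in> I \<Longrightarrow> rank i < N \<Longrightarrow> Psi c i = y i" by auto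
    define b where "b i = (if i \<in> I \<and> rank i = N then Psi c i - y i else 0)" for i
    have b: "b \<in> C" using P Psi_P c y by (auto simp: C_def b_def)
    have "Psi b i = b i" if "i \<in> I" "rank i < Suc N" for i
      using that b by (intro tri) (auto simp: b_def)
    then have "Psi (\<lambda>i. c i - b i) i = y i" if "i \<in> I" "rank i < Suc N" for i
      using that c b Psi_diff[OF c(1) b that(1)] by (cases "rank i = N") (auto simp: b_def)
    moreover have "(\<lambda>i. c i - b i) \<in> C" using P b c by (auto simp: C_def)
    ultimately show ?case by blast
  qed
  from this[of "Suc (Max (rank ` I))"]
  show "\<exists>c. c \<in> C \<and> (\<forall>i\<in>I. Psi c i = y i)"
    using I by (auto simp: less_Suc_eq_le)
next
  fix c c' assume c: "c \<in> C \<and> (\<forall>i\<in>I. Psi c i = y i)" "c' \<in> C \<and> (\<forall>i\<in>I. Psi c' i = y i)"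
  let ?b = "\<lambda>i. c i - c' i"
  have b: "?b \<in> C" using P c by (auto simp: C_def)
  have "?b i = 0" if "i \<in> I" for i
    using that
  proof (induction "rank i" arbitrary: i rule: less_induct)
    case less
    have "Psi ?b i = ?b i" using less by (intro tri b) auto
    moreover have "Psi ?b i = 0" using c less Psi_diff[of c c' i] by auto
    ultimately show ?case by simp
  qed
  then have "c i = c' i" for i using c by (cases "i \<in> I") (simp_all add: C_def)
  then show "c = c'" by (rule ext)
qed

context yh_layer begin

lemma gdn_row: "gdn indg m F (Suc m) = F 1"
  by (induction m) (simp_all add: indg_def)

lemma indt_row: "(indt (Suc n) ^^ b) F (Suc n) = (tau ^^ b) (F (Suc n))"
  by (induction b) (simp_all add: indt_def)

lemma gup_indP: "m \<le> n \<Longrightarrow> F \<in> indP \<Longrightarrow> gup indg m F \<in> indP"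
  by (induction m arbitrary: F) (auto simp: indg_P)

text \<open>Read in the first block, $g_1 \cdots g_p$ picks out block $p+1$ up to contributions
  of lower blocks.\<close>

lemma gup_low:
  assumes "\<And>i. 1 \<le> i \<Longrightarrow> i \<le> p \<Longrightarrow> F i = 0"
  shows "gup indg p F 1 = F (Suc p)"
  using assms
proof (induction p arbitrary: F)
  case (Suc p)
  have "gup indg p (indg (Suc p) F) 1 = indg (Suc p) F (Suc p)"
    by (rule Suc.IH) (use Suc.prems in \<open>auto simp: indg_def op_simps\<close>)
  moreover have "indg (Suc p) F (Suc p) = F (Suc (Suc p))"
    using Suc.prems[of "Suc p"] by (simp add: indg_def E_simps)
  ultimately show ?case by simp
qed simp

text \<open>The functional that replaces the first block when, at an intermediate degree in $x$,
  the correction term of $X$ also reaches the top coefficient.\<close>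

definition "Q H = H 1 - Dl *s (\<Sum>m<n. G m (H (m + 2)))"

lemma G_gup: "p < n \<Longrightarrow> z \<in> P \<Longrightarrow> G p (gup g p z) = E (Suc p) z"
proof (induction p arbitrary: z)
  case (Suc p)
  then show ?case by (simp add: g_P gi_E gi_g)
qed simp

text \<open>In contrast to the first block, this functional sees block $p+1$ of $g_1 \cdots g_p
  F$ up to contributions of higher blocks: the idempotent terms from the quadratic relation
  cancel those of the lower blocks one by one.\<close>

lemma Q_gup:
  assumes "p \<le> n" "F \<in> indP"
  shows "Q (gup indg p F) = F (Suc p) - Dl *s (\<Sum>m=p..<n. G m (gup g p (F (m + 2))))"
  using assms
proof (induction p arbitrary: F)
  case 0
  then show ?case by (simp add: Q_def lessThan_atLeast0)
next
  case (Suc p)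
  let ?F = "indg (Suc p) F"
  have F: "?F \<in> indP" using Suc.prems by (simp add: indg_P)
  have "(\<Sum>m=p..<n. G m (gup g p (?F (m + 2)))) =
      G p (gup g p (F (Suc p))) + (\<Sum>m=Suc p..<n. G m (gup g (Suc p) (F (m + 2))))"
    using Suc.prems(1) by (subst sum.atLeast_Suc_lessThan) (auto simp: indg_def intro!: sum.cong)
  also have "G p (gup g p (F (Suc p))) = E (Suc p) (F (Suc p))"
    using Suc.prems by (intro G_gup) auto
  finally show ?case using Suc.IH[OF _ F] Suc.prems(1) by (simp add: indg_def scale_right_distrib)
qed

text \<open>The counterpart of \<open>gup_low\<close> in the opposite direction.\<close>

lemma Q_high:
  assumes "p \<le> n" "F \<in> indP" and zero: "\<And>i. Suc p < i \<Longrightarrow> i \<le> Suc n \<Longrightarrow> F i = 0"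
  shows "Q (gup indg p F) = F (Suc p)"
proof -
  have "G m (gup g p (F (m + 2))) = 0" if "m \<in> {p..<n}" for m
    using that zero[of "m + 2"] linmap_zero[OF gup_lin[OF g_lin]] by (simp add: G_simps)
  then show ?thesis using Q_gup[OF assms(1,2)] by simp
qed

context
  fixes y
  assumes y: "linop scale y" and y_tau: "\<And>z. z \<in> P \<Longrightarrow> y (tau z) = tau (y z)"
    and y_t: "\<And>i z. 1 \<le> i \<Longrightarrow> i \<le> n \<Longrightarrow> z \<in> P \<Longrightarrow> y (t i z) = t i (y z)"
    and y_g: "\<And>i z. 1 \<le> i \<Longrightarrow> i < n \<Longrightarrow> z \<in> P \<Longrightarrow> y (g i z) = g i (y z)"
begin

lemma E_commute: "1 \<le> i \<Longrightarrow> i \<le> n \<Longrightarrow> z \<in> P \<Longrightarrow> y (E i z) = E i (y z)"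
  using E_intertwine[OF y, of i z tau "t i"] by (simp add: y_tau y_t E_def)

lemma gi_commute: "1 \<le> i \<Longrightarrow> i < n \<Longrightarrow> z \<in> P \<Longrightarrow> y (gi i z) = gi i (y z)"
  using average_intertwine[OF y, of P "t i" "t i" "t (Suc i)" "t (Suc i)" z rho r]
  by (simp add: gi_def linmap_simps[OF y] e_def y_g y_t t_P)

lemma G_commute: "m < n \<Longrightarrow> z \<in> P \<Longrightarrow> y (G m z) = G m (y z)"
  by (induction m) (simp_all add: E_commute gi_commute)

lemma gup_commute:
  assumes "p \<le> n" "F \<in> indP"
  shows "y (gup indg p F j) = gup indg p (\<lambda>j. y (F j)) j"
  using assms
proof (induction p arbitrary: F)
  case (Suc p)
  have "y (indg (Suc p) F j) = indg (Suc p) (\<lambda>j. y (F j)) j" for j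
  proof (cases "j \<in> {1..Suc n}")
    case False
    then show ?thesis using Suc.prems indP_zero[OF Suc.prems(2), of j]
      by (auto simp: indg_def linmap_simps[OF y] op_simps)
  next
    case True
    then show ?thesis using Suc.prems
      by (auto simp: indg_def linmap_simps[OF y] E_commute y_g)
  qed
  then have "(\<lambda>j. y (indg (Suc p) F j)) = indg (Suc p) (\<lambda>j. y (F j))" by (rule ext)
  then show ?case using Suc.IH[of "indg (Suc p) F"] Suc.prems by (simp add: indg_P)
qed simp

end

end

text \<open>The data \<open>(j, a, b)\<close> of one level: a block, an exponent of the Newton
  basis and a power of $t$.\<close>

definition idx :: "nat \<Rightarrow> nat \<Rightarrow> nat \<Rightarrow> (nat \<times> nat \<times> nat) set"
  where "idx r d m = {1..m} \<times> {..<d} \<times> {..<r}"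

text \<open>One level of a row, $t_{n+1}^b \, g_n \cdots g_1 \, p_k(X) \, g_1 \cdots
  g_{j-1}$.\<close>

definition rowop :: "('c \<Rightarrow> 'm \<Rightarrow> 'm) \<Rightarrow> (nat \<Rightarrow> 'c) \<Rightarrow> (nat \<Rightarrow> 'm \<Rightarrow> 'm) \<Rightarrow> (nat \<Rightarrow> 'm \<Rightarrow> 'm) \<Rightarrow>
    ('m \<Rightarrow> 'm::ab_group_add) \<Rightarrow> nat \<Rightarrow> nat \<times> nat \<times> nat \<Rightarrow> 'm \<Rightarrow> 'm"
  where "rowop sc u t g X1 n = (\<lambda>(j, k, b) z.
    (t (Suc n) ^^ b) (gdn g n (newton sc u X1 k (gup g (j - 1) z))))"

context yh_module begin

text \<open>The coefficient of $p_c(x)$, kept as a constant element of the layer instead of an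
  element of the module, so that it can be compared with other elements of the layer. It
  commutes with every operator acting through $M$ and with $\tau$.\<close>

definition slice :: "nat \<Rightarrow> (nat \<Rightarrow> nat \<Rightarrow> 'm) \<Rightarrow> nat \<Rightarrow> nat \<Rightarrow> 'm"
  where "slice c F = (\<lambda>a b. if a = 0 then F c b else 0)"

lemma slice_lin: "linop lscale (slice c)"
  by (rule linmapI) (auto simp: slice_def fscale_def fun_eq_iff)

lemma slice_commute:
  "slice c (ltau F) = ltau (slice c F)"
  "linop scale f \<Longrightarrow> slice c (lift f F) = lift f (slice c F)"
  by (auto simp: slice_def ltau_def lift_def fun_eq_iff linmap_simps)

lemma newton_top:
  assumes "F \<in> layP" "\<And>a b. a0 < a \<Longrightarrow> F a b = 0" "a0 + k < d"
  shows "(\<forall>a b. a0 + k < a \<longrightarrow> newton lscale u lx k F a b = 0) \<and>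
    (\<forall>b. newton lscale u lx k F (a0 + k) b = F a0 b)"
  using assms by (induction k) (auto simp: lx_def fscale_def)

text \<open>As a polynomial in $x$ the divided difference $D_k(x, X)$ is monic of degree $k -
  1$.\<close>

lemma quot_newton_top:
  assumes "F \<in> layP" "\<And>a b. a0 < a \<Longrightarrow> F a b = 0" "a0 + k \<le> d"
  shows "(\<forall>a b. a0 + k \<le> a \<longrightarrow> quot_newton lscale u lx (lift X1) k F a b = 0) \<and>
    (k \<noteq> 0 \<longrightarrow> (\<forall>b. quot_newton lscale u lx (lift X1) k F (a0 + k - 1) b = F a0 b))"
  using assms
proof (induction k)
  case (Suc k)
  let ?q = "quot_newton lscale u lx (lift X1) k F" and ?N = "newton lscale u (lift X1) k F"
  have q: "?q a b = 0" if "a0 + k \<le> a" for a b using Suc that by auto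
  have q_top: "k \<noteq> 0 \<Longrightarrow> ?q (a0 + k - 1) b = F a0 b" for b using Suc by auto
  have N: "?N a b = newton scale u X1 k (F a b)" for a b
    by (simp only: lift_newton) (simp only: lift_def)
  have N_0: "?N a b = 0" if "a0 < a" for a b
    using Suc.prems(2)[OF that] by (simp only: N linmap_zero[OF newton_lin])
  have app: "lscale c H a b = c *s H a b" for c and H :: "nat \<Rightarrow> nat \<Rightarrow> 'm" and a b
    by (simp add: fscale_def)
  have step: "quot_newton lscale u lx (lift X1) (Suc k) F a b = lx ?q a b - u k *s ?q a b + ?N a b" for a b
    by (simp only: quot_newton.simps plus_fun_apply minus_apply app)
  have "quot_newton lscale u lx (lift X1) (Suc k) F a b = 0" if "a0 + Suc k \<le> a" for a b
    using q[of a b] q[of "a - 1" b] N_0[of a b] that unfolding step lx_def by simp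
  moreover have "quot_newton lscale u lx (lift X1) (Suc k) F (a0 + k) b = F a0 b" for b
  proof (cases "k = 0")
    case True
    then show ?thesis unfolding step lx_def by simp
  next
    case False
    then show ?thesis using q[of "a0 + k" b] q_top[of b] N_0[of "a0 + k" b] Suc.prems(3)
      unfolding step lx_def by simp
  qed
  ultimately show ?case by simp
qed simp

text \<open>The coefficient of $x^{d-1} \tau^0$ in the last block of the row $(j, k, b)$ of $F$
  is compared with the coefficient of $F$ at $(j, d-1-k, -b)$. Suppose that $F$ has degree at
  most $a = d - 1 - k$ in $x$. Then $p_k(x)$ carries the coefficient at $a$ to degree $d - 1$,
  and the correction term, a multiple of $x D_k(x, X) (\pi - 1)$, contributes at degree $d - 1$
  precisely when $k > 0$ and $a > 0$: for $k = 0$ the divided difference vanishes, and for $a =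
  0$ the factor $\pi - 1$ does. In the two exceptional cases the coefficient is therefore read
  off from the first block, which is triangular with respect to increasing $j$, and otherwise
  from the functional \<open>Q\<close>, which is triangular with respect to decreasing $j$. The
  ranking treats higher degrees in $x$ first and within a degree follows these two
  orders.\<close>

lemma row_form_bijective:
  fixes m :: "nat \<times> nat \<times> nat \<Rightarrow> 'm"
  defines "IP \<equiv> yh_layer.indP layP n" 
    and "It \<equiv> yh_layer.indt (\<lambda>i. lift (t i)) ltau"
    and "Ig \<equiv> yh_layer.indg r Dl rho lscale (\<lambda>i. lift (t i)) (\<lambda>i. lift (g i)) ltau"
    and "IX \<equiv> yh_layer.indX r Dl rho lscale n (\<lambda>i. lift (t i)) (\<lambda>i. lift (g i)) (lift X1) ltau lx lpi"
  assumes m: "\<And>\<gamma>. \<gamma> \<in> idx r d (Suc n) \<Longrightarrow> m \<gamma> \<in> P"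
  shows "\<exists>!F. F \<in> IP \<and> (\<forall>\<gamma>\<in>idx r d (Suc n).
    rowop (fscale lscale) u It Ig IX n \<gamma> F (Suc n) (d - 1) 0 = m \<gamma>)"
proof -
  interpret N: yh_layer R r d Dl rho u lscale layP n "\<lambda>i. lift (t i)" "\<lambda>i. lift (g i)"
    "lift X1" ltau lx lpi by (rule layer)
  note defs = IP_def It_def Ig_def IX_def
  let ?I = "idx r d (Suc n)"
  have slice_P: "slice c F \<in> layP" if "F \<in> layP" for c F
    using that layP_zero[OF that] d_pos by (intro layPI) (auto simp: slice_def)
  note sl = slice_lin slice_commute(1) slice_commute(2)[OF t_lin] slice_commute(2)[OF g_lin]
  note sl_simps = linmap_simps[OF slice_lin]
  \<comment> \<open>The top coefficient of a row, for a family of degree at most a0 in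
    x.\<close>
  have level: "slice (d - 1) (newton (fscale lscale) u IX k (gup Ig p F) 1) =
      (let H = (\<lambda>j. slice a0 (F j)) in
        if k = 0 \<or> a0 = 0 then gup Ig p H 1 else N.Q (gup Ig p H))"
    if F: "F \<in> IP" and low: "\<And>j a b. a0 < a \<Longrightarrow> F j a b = 0" and k: "a0 + k = d - 1" and p: "p \<le> n"
    for a0 k p F
  proof -
    define F' where "F' = gup Ig p F"
    have F': "F' \<in> IP" using F p unfolding F'_def defs by (intro N.gup_indP)
    have F'_P: "F' j \<in> layP" for j using F' unfolding defs by simp
    have slF': "slice c (F' j) = gup Ig p (\<lambda>j. slice c (F j)) j" for c j
      unfolding F'_def using F p unfolding defs by (intro N.gup_commute sl)
    have low': "F' j a b = 0" if "a0 < a" for j a b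
    proof -
      have "(\<lambda>j. slice a (F j)) = (\<lambda>j. 0)" using low[OF that] by (auto simp: slice_def fun_eq_iff)
      then have "slice a (F' j) = gup Ig p 0 j" unfolding slF' by (simp add: zero_fun_def)
      also have "gup Ig p 0 = 0" unfolding defs by (rule linmap_zero[OF gup_lin[OF N.ind_lin(2)]])
      finally have "slice a (F' j) 0 b = 0" by simp
      then show ?thesis by (simp add: slice_def)
    qed
    define chi where "chi i = quot_newton lscale u lx (lift X1) k (lpi (F' (i + 2)) - F' (i + 2))" for i
    have psi: "lpi (F' j) - F' j \<in> layP" for j using F'_P by simp
    have psi_low: "(lpi (F' j) - F' j) a b = 0" if "a0 < a" for j a b
      using low'[OF that] that by (simp add: lpi_def)
    have chi_P: "chi i \<in> layP" for i unfolding chi_def using k psi by (intro N.quot_newton_P) auto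
    have chi: "\<forall>a b. a0 + k \<le> a \<longrightarrow> chi i a b = 0"
      "k \<noteq> 0 \<Longrightarrow> chi i (d - 2) b = (lpi (F' (i + 2)) - F' (i + 2)) a0 b" for i b
    proof -
      have *: "a0 + k \<le> d" "d - 2 = a0 + k - 1" using k by auto
      show "\<forall>a b. a0 + k \<le> a \<longrightarrow> chi i a b = 0"
        "k \<noteq> 0 \<Longrightarrow> chi i (d - 2) b = (lpi (F' (i + 2)) - F' (i + 2)) a0 b"
        using quot_newton_top[OF psi[of "i + 2"] psi_low[of _ "i + 2"] *(1)]
        unfolding chi_def *(2) by blast+
    qed
    let ?Y = "\<Sum>i<n. N.G i (chi i)"
    have row1: "newton (fscale lscale) u IX k F' 1 = newton lscale u lx k (F' 1) + lscale Dl (lx ?Y)"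
      using N.indX_newton(3)[of F' k] F' k unfolding defs chi_def by simp
    have slG: "slice c ?Y = (\<Sum>i<n. N.G i (slice c (chi i)))" for c
      using chi_P by (simp add: sl_simps N.G_commute[OF sl])
    have sl1: "slice (d - 1) (newton lscale u lx k (F' 1)) = slice a0 (F' 1)"
    proof -
      have *: "a0 + k < d" using k d_pos by simp
      show ?thesis using newton_top[OF F'_P[of 1] low'[of _ 1] *] unfolding k
        by (auto simp: slice_def fun_eq_iff)
    qed
    have sl2: "slice (d - 1) (lx ?Y) =
      (if k = 0 \<or> a0 = 0 then 0 else - (\<Sum>i<n. N.G i (slice a0 (F' (i + 2)))))"
    proof -
      have "slice (d - 1) (chi i) = 0" for i
        using chi(1)[of i] k by (auto simp: slice_def fun_eq_iff)
      then have "slice (d - 1) ?Y = 0" unfolding slG by (simp add: N.G_simps)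
      then have Y: "?Y (d - 1) b = 0" for b by (simp add: slice_def fun_eq_iff) metis
      have "slice (d - 1) (lx ?Y) = (if d = 1 then 0 else slice (d - 2) ?Y)"
      proof -
        have "lx ?Y (d - 1) b = (if d = 1 then 0 else ?Y (d - 2) b)" for b
          unfolding lx_def Y using d_pos by (simp add: numeral_2_eq_2)
        then have "slice (d - 1) (lx ?Y) = (\<lambda>a b. if a = 0 then if d = 1 then 0 else ?Y (d - 2) b else 0)"
          unfolding slice_def by (simp only:)
        also have "\<dots> = (if d = 1 then 0 else slice (d - 2) ?Y)" 
          by (auto simp: slice_def fun_eq_iff)
        finally show ?thesis .
      qed
      also have "\<dots> = (if k = 0 \<or> a0 = 0 then 0 else - (\<Sum>i<n. N.G i (slice a0 (F' (i + 2)))))"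
      proof (cases "k = 0")
        case True
        then have "chi i = 0" for i by (simp add: chi_def)
        then show ?thesis using True unfolding slG by (simp add: sl_simps N.G_simps)
      next
        case False
        then have d: "d \<noteq> 1" using k by simp
        have "slice (d - 2) (chi i) = (if a0 = 0 then 0 else - slice a0 (F' (i + 2)))" for i
        proof (cases "a0 = 0")
          case True
          have "lpi (F' (i + 2)) a b = F' (i + 2) a b" for a b
            using low' True by (intro lpi_const) simp
          then show ?thesis using True chi(2)[OF False, of i] by (auto simp: slice_def fun_eq_iff)
        next
          case False
          then show ?thesis using chi(2)[OF \<open>k \<noteq> 0\<close>, of i] by (auto simp: slice_def fun_eq_iff lpi_def)
        qed
        then show ?thesis using False d unfolding slG
          by (auto simp: N.G_simps sum_negf[symmetric] linmap_diff[OF N.G_lin, of _ 0, simplified])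
      qed
      finally show ?thesis .
    qed
    have "slice (d - 1) (newton (fscale lscale) u IX k F' 1) =
        slice a0 (F' 1) + lscale Dl (slice (d - 1) (lx ?Y))"
      unfolding row1 by (simp only: sl_simps sl1)
    also have "\<dots> = (if k = 0 \<or> a0 = 0 then slice a0 (F' 1) else N.Q (\<lambda>j. slice a0 (F' j)))"
      unfolding sl2 by (simp add: N.Q_def)
    also have "(\<lambda>j. slice a0 (F' j)) = gup Ig p (\<lambda>j. slice a0 (F j))"
      by (rule ext) (rule slF')
    finally show ?thesis unfolding Let_def F'_def[symmetric] slF' .
  qed
  \<comment> \<open>The coordinate paired with a row: complementary degree and inverse power of
    t.\<close>
  define sw where "sw = (\<lambda>(j::nat, a, b). (j, d - 1 - a, (b * (r - 1)) mod r))"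
  have neg: "(b * (r - 1)) mod r = (if b = 0 then 0 else r - b)" if "b < r" for b
  proof (cases b)
    case (Suc b')
    have "b * (r - 1) = (r - b) + b' * r" using that Suc by (simp add: algebra_simps)
    then have "(b * (r - 1)) mod r = (r - b) mod r" by (simp only: mod_mult_self1)
    then show ?thesis using that Suc by simp
  qed simp
  have sw: "sw \<gamma> \<in> ?I" "sw (sw \<gamma>) = \<gamma>" if "\<gamma> \<in> ?I" for \<gamma>
  proof -
    show "sw \<gamma> \<in> ?I" using that r_pos d_pos by (auto simp: sw_def idx_def)
    obtain j a b where \<gamma>: "\<gamma> = (j, a, b)" "a < d" "b < r" using \<open>\<gamma> \<in> ?I\<close> by (auto simp: idx_def)
    show "sw (sw \<gamma>) = \<gamma>" using \<gamma> neg[of b] neg[of "r - b"] by (auto simp: sw_def)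
  qed
  define fn where "fn c = (\<lambda>j a b. c (j, a, b))" for c :: "nat \<times> nat \<times> nat \<Rightarrow> 'm"
  define C where "C = {c. (\<forall>i\<in>?I. c i \<in> P) \<and> (\<forall>i. i \<notin> ?I \<longrightarrow> c i = 0)}"
  have fn_C: "fn c \<in> IP" if "c \<in> C" for c
  proof -
    have c': "\<forall>i\<in>?I. c i \<in> P" "\<forall>i. i \<notin> ?I \<longrightarrow> c i = 0" using that unfolding C_def by blast+
    have c: "\<gamma> \<notin> ?I \<Longrightarrow> c \<gamma> = 0" "c \<gamma> \<in> P" for \<gamma>
    proof -
      show "\<gamma> \<notin> ?I \<Longrightarrow> c \<gamma> = 0" using c'(2) by blast
      have "c \<gamma> = 0 \<or> c \<gamma> \<in> P" using c' by blast
      then show "c \<gamma> \<in> P" using P_zero by metis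
    qed
    have c0: "c (j, a, b) = 0" if "\<not> (j \<in> {1..Suc n} \<and> a < d \<and> b < r)" for j a b
      using that by (intro c(1)) (auto simp: idx_def)
    show ?thesis unfolding defs
    proof (rule N.indPI)
      show "fn c j \<in> layP" for j unfolding fn_def using c(2) c0 by (intro layPI) blast+
      show "j \<notin> {1..Suc n} \<Longrightarrow> fn c j = 0" for j 
        unfolding fn_def zero_fun_def using c0 by (intro ext) blast
    qed
  qed
  have C_fn: "(\<lambda>(j, a, b). F j a b) \<in> C" "fn (\<lambda>(j, a, b). F j a b) = F" if "F \<in> IP" for F
  proof -
    have "F j \<in> layP" for j using that unfolding defs by simp
    moreover have "F j = 0" if "j \<notin> {1..Suc n}" for j using \<open>F \<in> IP\<close> that unfolding defs by (rule N.indP_zero)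
    ultimately show "(\<lambda>(j, a, b). F j a b) \<in> C" using layP_zero by (auto simp: C_def idx_def)
    show "fn (\<lambda>(j, a, b). F j a b) = F" by (simp add: fn_def)
  qed
  define Psi where "Psi c \<gamma> = rowop (fscale lscale) u It Ig IX n (sw \<gamma>) (fn c) (Suc n) (d - 1) 0" for c \<gamma>
  have Psi: "Psi c (j, a, b) = slice (d - 1) (newton (fscale lscale) u IX (d - 1 - a) (gup Ig (j - 1) (fn c)) 1) 0 b"
    if "(j, a, b) \<in> ?I" for c j a b
  proof -
    let ?W = "newton (fscale lscale) u IX (d - 1 - a) (gup Ig (j - 1) (fn c))"
    have b: "b < r" using that by (simp add: idx_def)
    have "Psi c (j, a, b) = (ltau ^^ ((b * (r - 1)) mod r)) (?W 1) (d - 1) 0"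
      unfolding Psi_def rowop_def sw_def defs by (simp add: N.indt_row N.gdn_row del: One_nat_def)
    also have "\<dots> = ?W 1 (d - 1) ((((b * (r - 1)) mod r) * (r - 1)) mod r)"
      using r_pos by (subst ltau_funpow) auto
    also have "(((b * (r - 1)) mod r) * (r - 1)) mod r = b" using sw(2)[OF that] by (simp add: sw_def)
    finally show ?thesis by (simp add: slice_def)
  qed
  \<comment> \<open>The factor n + 2 exceeds every block number, so that the degree in x
    dominates.\<close>
  define rank where "rank = (\<lambda>(j, a, b::nat). (d - 1 - a) * (n + 2) + (if a = 0 \<or> a = d - 1 then j else Suc n - j))"
  have ex1: "\<exists>!c. c \<in> C \<and> (\<forall>i\<in>?I. Psi c i = m (sw i))"
    unfolding C_def
  proof (rule unitriangular_ex1[where rank = rank], unfold C_def[symmetric])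
    show "finite ?I" by (simp add: idx_def)
    show "m (sw i) \<in> P" if "i \<in> ?I" for i using that sw m by auto
    interpret S: submodule_over "fscale lscale" R IP unfolding defs by (rule N.indP_submodule)
    have W: "newton (fscale lscale) u IX (d - 1 - a) (gup Ig (j - 1) F) \<in> IP" 
      if "F \<in> IP" "j \<le> Suc n" for F a j
      using that unfolding defs by (intro N.indX_newton N.gup_indP) auto
    show "Psi c i \<in> P" if "c \<in> C" "i \<in> ?I" for c i
    proof -
      obtain j a b where i: "i = (j, a, b)" by (cases i)
      have "newton (fscale lscale) u IX (d - 1 - a) (gup Ig (j - 1) (fn c)) 1 \<in> layP"
        using W[OF fn_C, of c j a] that i unfolding defs idx_def by auto
      then show ?thesis using that by (simp add: i Psi slice_def)
    qed
    show "Psi (\<lambda>i. c i - c' i) i = Psi c i - Psi c' i" if "i \<in> ?I" for c c' i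
    proof -
      obtain j a b where i: "i = (j, a, b)" by (cases i)
      have fn: "fn (\<lambda>i. c i - c' i) = fn c - fn c'" by (simp add: fn_def fun_eq_iff)
      have gl: "linop (fscale lscale) (gup Ig p)" for p unfolding defs by (rule gup_lin[OF N.ind_lin(2)])
      have nl: "linop (fscale lscale) (newton (fscale lscale) u IX k)" for k
        unfolding defs by (rule linop_newton[OF N.ind_lin(3) module_fscale[OF N.module_axioms]])
      show ?thesis using that unfolding i Psi[OF that[unfolded i]] fn
        by (simp add: linmap_diff[OF gl] linmap_diff[OF nl] slice_def)
    qed
    show "Psi c i = c i" if c: "c \<in> C" and i: "i \<in> ?I" 
      and zero: "\<And>i'. i' \<in> ?I \<Longrightarrow> rank i' < rank i \<Longrightarrow> c i' = 0" for c i
    proof -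
      obtain j a b where i': "i = (j, a, b)" by (cases i)
      have j: "1 \<le> j" "j \<le> Suc n" "a < d" "b < r" using i by (auto simp: idx_def i')
      have higher: "fn c j' a' b' = 0" if "a < a'" for j' a' b'
      proof (cases "(j', a', b') \<in> ?I")
        case True
        have r1: "rank (j', a', b') \<le> (d - 1 - a') * (n + 2) + Suc n" using True
          by (auto simp: rank_def idx_def)
        have "Suc (d - 1 - a') \<le> d - 1 - a" using that True by (auto simp: idx_def)
        then have r2: "Suc (d - 1 - a') * (n + 2) \<le> (d - 1 - a) * (n + 2)" by (rule mult_le_mono1)
        note r1
        also have "(d - 1 - a') * (n + 2) + Suc n < Suc (d - 1 - a') * (n + 2)" by simp
        also note r2
        also have "(d - 1 - a) * (n + 2) \<le> rank (j, a, b)" by (simp add: rank_def)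
        finally have "rank (j', a', b') < rank (j, a, b)" .
        then show ?thesis using zero[OF True] by (simp add: i' fn_def)
      next
        case False
        then show ?thesis using c by (auto simp: C_def fn_def)
      qed
      define H where "H = (\<lambda>j. slice a (fn c j))"
      have H0: "H j' = 0" if "1 \<le> j'" "j' \<le> Suc n" "rank (j', a, 0) < rank (j, a, 0)" for j'
      proof -
        have "c (j', a, b') = 0" for b'
        proof (cases "b' < r")
          case True
          then show ?thesis using that j by (intro zero) (auto simp: idx_def rank_def i')
        next
          case False
          then show ?thesis using c by (auto simp: C_def idx_def)
        qed
        then show ?thesis by (simp add: H_def slice_def fn_def fun_eq_iff)
      qed
      have H_P: "H \<in> IP" unfolding defs H_def
      proof (rule N.indPI)
        have "fn c \<in> N.indP" using fn_C[OF c] by (simp add: defs)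
        then show "slice a (fn c j) \<in> layP" "j \<notin> {1..Suc n} \<Longrightarrow> slice a (fn c j) = 0" for j
          using slice_P N.indP_zero[of "fn c" j] by (auto simp: sl_simps)
      qed
      have lv: "slice (d - 1) (newton (fscale lscale) u IX (d - 1 - a) (gup Ig (j - 1) (fn c)) 1) =
          (if d - 1 - a = 0 \<or> a = 0 then gup Ig (j - 1) H 1 else N.Q (gup Ig (j - 1) H))"
        using level[OF fn_C[OF c], of a "d - 1 - a" "j - 1"] higher j
        by (simp add: H_def Let_def del: One_nat_def)
      have "slice (d - 1) (newton (fscale lscale) u IX (d - 1 - a) (gup Ig (j - 1) (fn c)) 1) = H j"
      proof (cases "d - 1 - a = 0 \<or> a = 0")
        case True
        have "gup Ig (j - 1) H 1 = H (Suc (j - 1))" unfolding defs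
          using True j by (intro N.gup_low H0) (auto simp: rank_def)
        then show ?thesis using lv True j by simp
      next
        case False
        have "N.Q (gup Ig (j - 1) H) = H (Suc (j - 1))" unfolding Ig_def
          using False j H_P unfolding IP_def by (intro N.Q_high H0) (auto simp: rank_def)
        then show ?thesis using lv False j by simp
      qed
      then show ?thesis using i by (simp add: i' Psi) (simp add: H_def slice_def fn_def)
    qed
  qed simp_all
  show ?thesis
  proof (rule ex_ex1I)
    from ex1 obtain c where c: "c \<in> C" "\<And>i. i \<in> ?I \<Longrightarrow> Psi c i = m (sw i)" by auto
    have "rowop (fscale lscale) u It Ig IX n \<gamma> (fn c) (Suc n) (d - 1) 0 = m \<gamma>" if "\<gamma> \<in> ?I" for \<gamma>
      using c(2)[OF sw(1)[OF that]] sw(2)[OF that] by (simp add: Psi_def)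
    then show "\<exists>F. F \<in> IP \<and> (\<forall>\<gamma>\<in>?I. rowop (fscale lscale) u It Ig IX n \<gamma> F (Suc n) (d - 1) 0 = m \<gamma>)"
      using fn_C[OF c(1)] by blast
  next
    fix F F'
    assume F: "F \<in> IP \<and> (\<forall>\<gamma>\<in>?I. rowop (fscale lscale) u It Ig IX n \<gamma> F (Suc n) (d - 1) 0 = m \<gamma>)"
      and F': "F' \<in> IP \<and> (\<forall>\<gamma>\<in>?I. rowop (fscale lscale) u It Ig IX n \<gamma> F' (Suc n) (d - 1) 0 = m \<gamma>)"
    have "(\<lambda>(j, a, b). H j a b) \<in> C \<and> (\<forall>i\<in>?I. Psi (\<lambda>(j, a, b). H j a b) i = m (sw i))"
      if "H \<in> IP \<and> (\<forall>\<gamma>\<in>?I. rowop (fscale lscale) u It Ig IX n \<gamma> H (Suc n) (d - 1) 0 = m \<gamma>)" for H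
      using that C_fn[of H] sw(1) unfolding Psi_def by auto
    from this[OF F] this[OF F'] have "(\<lambda>(j, a, b). F j a b) = (\<lambda>(j, a, b). F' j a b)" using ex1 by blast
    then show "F = F'" using C_fn(2) F F' by metis
  qed
qed

end

section \<open>The standard module\<close>

definition ginv where "ginv sc Dl rho r t g i z = g i z - sc Dl (average sc rho r (t i) (t (Suc i)) z)"

text \<open>One level of a column, $g_{j-1}^{-1} \cdots g_1^{-1} \, p_a(X) \, g_1 \cdots g_n \,
  t_{n+1}^b$.\<close>

definition colop where "colop sc Dl rho r u t g X1 n = (\<lambda>(j, a, b) z.
    gdn (ginv sc Dl rho r t g) (j - 1) (newton sc u X1 a (gup g n ((t (Suc n) ^^ b) z))))"

text \<open>The letter at the head of a word belongs to the highest level, which is the length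
  of the rest. Columns apply it last, rows apply it first.\<close>

primrec colw :: "(nat \<Rightarrow> 'i \<Rightarrow> 'm \<Rightarrow> 'm) \<Rightarrow> 'i list \<Rightarrow> 'm \<Rightarrow> 'm" where
  "colw C [] z = z"
| "colw C (\<gamma> # \<beta>) z = C (length \<beta>) \<gamma> (colw C \<beta> z)"

primrec roww :: "(nat \<Rightarrow> 'i \<Rightarrow> 'm \<Rightarrow> 'm) \<Rightarrow> 'i list \<Rightarrow> 'm \<Rightarrow> 'm" where
  "roww C [] z = z"
| "roww C (\<gamma> # \<beta>) z = roww C \<beta> (C (length \<beta>) \<gamma> z)"

primrec words :: "nat \<Rightarrow> nat \<Rightarrow> nat \<Rightarrow> (nat \<times> nat \<times> nat) list set" where
  "words r d 0 = {[]}"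
| "words r d (Suc n) = {\<gamma> # \<beta> | \<gamma> \<beta>. \<gamma> \<in> idx r d (Suc n) \<and> \<beta> \<in> words r d n}"

lemma length_words: "\<beta> \<in> words r d n \<Longrightarrow> length \<beta> = n"
  by (induction n arbitrary: \<beta>) auto

lemma Cons_words: "\<gamma> # \<beta> \<in> words r d (Suc n) \<longleftrightarrow> \<gamma> \<in> idx r d (Suc n) \<and> \<beta> \<in> words r d n"
  unfolding words.simps by blast

lemma ball_words:
  "(\<forall>\<beta>\<in>words r d (Suc n). Q \<beta>) \<longleftrightarrow> (\<forall>\<gamma>\<in>idx r d (Suc n). \<forall>\<beta>\<in>words r d n. Q (\<gamma> # \<beta>))"
  unfolding words.simps by blast

lemma finite_words: "finite (words r d n)"
proof (induction n)
  case (Suc n)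
  have "words r d (Suc n) = (\<lambda>(\<gamma>, \<beta>). \<gamma> # \<beta>) ` (idx r d (Suc n) \<times> words r d n)" by auto
  then show ?case using Suc by (simp add: idx_def)
qed simp

context yh_module begin

lemma gi_ginv: "gi = ginv scale Dl rho r t g"
  by (simp add: fun_eq_iff gi_def ginv_def e_def)

lemma funpow_P: "1 \<le> k \<Longrightarrow> k \<le> n \<Longrightarrow> z \<in> P \<Longrightarrow> (t k ^^ b) z \<in> P"
  by (induction b) (auto simp: t_P)

lemma gup_P: "m < n \<Longrightarrow> z \<in> P \<Longrightarrow> gup g m z \<in> P"
  by (induction m arbitrary: z) (auto simp: g_P)

lemma gdn_P: "m < n \<Longrightarrow> z \<in> P \<Longrightarrow> gdn g m z \<in> P"
  by (induction m) (auto simp: g_P)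

lemma gdn_gi_P: "m < n \<Longrightarrow> z \<in> P \<Longrightarrow> gdn gi m z \<in> P"
  by (induction m) (auto simp: gi_P)

lemma colop_P: "\<gamma> \<in> idx r d (Suc m) \<Longrightarrow> m < n \<Longrightarrow> z \<in> P \<Longrightarrow> colop scale Dl rho r u t g X1 m \<gamma> z \<in> P"
  unfolding colop_def idx_def gi_ginv[symmetric] 
  by (auto intro!: gdn_gi_P newton_P gup_P funpow_P)

lemma rowop_P: "\<gamma> \<in> idx r d (Suc m) \<Longrightarrow> m < n \<Longrightarrow> z \<in> P \<Longrightarrow> rowop scale u t g X1 m \<gamma> z \<in> P"
  unfolding rowop_def idx_def
  by (auto intro!: gdn_P newton_P gup_P funpow_P)

text \<open>Only the first $k$ strands need to be respected for an operator to respect the words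
  of length at most $k$. This is applied to the inclusion of a module into the next one and to
  the projection in the other direction. The condition on $X$ is relaxed for $k = 0$, where
  there are no words that contain it.\<close>

context
  fixes y :: "'m \<Rightarrow> 'k::ab_group_add" and sc' and t' g' X1' k
  assumes y: "linmap scale sc' y" and k: "k \<le> n"
    and y_t: "\<And>i z. 1 \<le> i \<Longrightarrow> i \<le> k \<Longrightarrow> z \<in> P \<Longrightarrow> y (t i z) = t' i (y z)"
    and y_g: "\<And>i z. 1 \<le> i \<Longrightarrow> i < k \<Longrightarrow> z \<in> P \<Longrightarrow> y (g i z) = g' i (y z)"
    and y_X: "\<And>z. 1 \<le> k \<Longrightarrow> z \<in> P \<Longrightarrow> y (X1 z) = X1' (y z)"
begin

lemma intertwine_gup: "m < k \<Longrightarrow> z \<in> P \<Longrightarrow> y (gup g m z) = gup g' m (y z)"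
  using k by (induction m arbitrary: z) (auto simp: y_g g_P)

lemma intertwine_gdn: "m < k \<Longrightarrow> z \<in> P \<Longrightarrow> y (gdn g m z) = gdn g' m (y z)"
  using k by (induction m) (auto simp: y_g gdn_P)

lemma intertwine_gdn_gi: "m < k \<Longrightarrow> z \<in> P \<Longrightarrow> y (gdn gi m z) = gdn (ginv sc' Dl rho r t' g') m (y z)"
proof (induction m)
  case (Suc m)
  have "y (gi (Suc m) z) = ginv sc' Dl rho r t' g' (Suc m) (y z)" if "z \<in> P" for z
    using average_intertwine[OF y, of P "t (Suc m)" "t' (Suc m)" "t (Suc (Suc m))" "t' (Suc (Suc m))" z rho r]
      Suc.prems k that
    by (simp add: gi_def e_def ginv_def linmap_simps[OF y] y_g y_t t_P)
  then show ?case using Suc k by (simp add: gdn_gi_P)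
qed simp

lemma intertwine_t: "1 \<le> i \<Longrightarrow> i \<le> k \<Longrightarrow> z \<in> P \<Longrightarrow> y ((t i ^^ b) z) = (t' i ^^ b) (y z)"
  using k by (induction b) (auto simp: y_t funpow_P)

lemma intertwine_newton: "1 \<le> k \<Longrightarrow> a \<le> d \<Longrightarrow> z \<in> P \<Longrightarrow> y (newton scale u X1 a z) = newton sc' u X1' a (y z)"
  by (rule newton_intertwine[OF y, of P]) (auto simp: y_X newton_P)

lemma intertwine_colop:
  assumes "\<gamma> \<in> idx r d (Suc m)" "m < k" "z \<in> P"
  shows "y (colop scale Dl rho r u t g X1 m \<gamma> z) = colop sc' Dl rho r u t' g' X1' m \<gamma> (y z)"
proof -
  obtain j a b where \<gamma>: "\<gamma> = (j, a, b)" by (cases \<gamma>)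
  have 0: "(t (Suc m) ^^ b) z \<in> P" using assms k by (intro funpow_P) auto
  have 1: "gup g m ((t (Suc m) ^^ b) z) \<in> P" using assms k 0 by (intro gup_P) auto
  have 2: "newton scale u X1 a (gup g m ((t (Suc m) ^^ b) z)) \<in> P"
    using assms \<gamma> 1 by (intro newton_P) (auto simp: idx_def)
  show ?thesis unfolding colop_def \<gamma> gi_ginv[symmetric] using assms(1,2) \<gamma> 0 1 2 assms(3)
    by (auto simp: idx_def intertwine_gdn_gi intertwine_newton intertwine_gup intertwine_t)
qed

lemma intertwine_rowop:
  assumes "\<gamma> \<in> idx r d (Suc m)" "m < k" "z \<in> P"
  shows "y (rowop scale u t g X1 m \<gamma> z) = rowop sc' u t' g' X1' m \<gamma> (y z)"
proof -
  obtain j a b where \<gamma>: "\<gamma> = (j, a, b)" by (cases \<gamma>)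
  have 0: "gup g (j - 1) z \<in> P" using assms k \<gamma> by (intro gup_P) (auto simp: idx_def)
  have 1: "newton scale u X1 a (gup g (j - 1) z) \<in> P"
    using assms \<gamma> 0 by (intro newton_P) (auto simp: idx_def)
  have 2: "gdn g m (newton scale u X1 a (gup g (j - 1) z)) \<in> P"
    using assms k 1 by (intro gdn_P) auto
  show ?thesis unfolding rowop_def \<gamma> using assms(1,2) \<gamma> 0 1 2 assms(3)
    by (auto simp: idx_def intertwine_gdn intertwine_newton intertwine_gup intertwine_t)
qed

lemma intertwine_colw:
  assumes "\<beta> \<in> words r d m" "m \<le> k" "z \<in> P"
  shows "y (colw (colop scale Dl rho r u t g X1) \<beta> z) = colw (colop sc' Dl rho r u t' g' X1') \<beta> (y z)
    \<and> colw (colop scale Dl rho r u t g X1) \<beta> z \<in> P"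
  using assms
proof (induction m arbitrary: \<beta>)
  case (Suc m)
  then show ?case using k by (auto simp: intertwine_colop colop_P length_words)
qed auto

lemma intertwine_roww:
  assumes "\<beta> \<in> words r d m" "m \<le> k" "z \<in> P"
  shows "y (roww (rowop scale u t g X1) \<beta> z) = roww (rowop sc' u t' g' X1') \<beta> (y z)"
  using assms
proof (induction m arbitrary: \<beta> z)
  case (Suc m)
  then show ?case using k by (auto simp: intertwine_rowop rowop_P length_words)
qed auto

end
end

context yh_layer begin

definition "block j z = (\<lambda>i. if i = (j::nat) then z else (0::'b))"

lemma block_P: "1 \<le> j \<Longrightarrow> j \<le> Suc n \<Longrightarrow> z \<in> P \<Longrightarrow> block j z \<in> indP"
  by (rule indPI) (auto simp: block_def)

lemma indg_block: "1 \<le> i \<Longrightarrow> indg i (block (Suc i) z) = block i z"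
  by (auto simp: fun_eq_iff indg_def block_def op_simps E_simps)

lemma gup_block: "gup indg m (block (Suc m) z) = block 1 z"
  by (induction m) (simp_all add: indg_block)

lemma indX_block_1: "indX (block 1 z) = block 1 (x z)"
  by (auto simp: fun_eq_iff indX_def block_def L_simps op_simps layer_simps)

lemma newton_block_1: "newton (fscale scale) u indX a (block 1 z) = block 1 (newton scale u x a z)"
proof (induction a)
  case (Suc a)
  have "fscale scale c (block 1 w) = block 1 (c *s w)" "block 1 w - block 1 w' = block 1 (w - w')" for c w w'
    by (auto simp: fscale_def block_def fun_eq_iff)
  then show ?case using Suc by (simp only: newton.simps indX_block_1)
qed simp

lemma indt_block: "(indt (Suc n) ^^ b) (block (Suc n) z) = block (Suc n) ((tau ^^ b) z)"
  by (induction b) (auto simp: fun_eq_iff indt_def block_def op_simps layer_simps)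

lemma gdn_gi_block:
  assumes "m \<le> n" "z \<in> P"
  shows "gdn (ginv (fscale scale) Dl rho r indt indg) m (block 1 z) = block (Suc m) z"
proof -
  interpret I: yh_module R r d Dl rho u "fscale scale" indP "Suc n" indt indg indX
    by (rule ind_yh_module)
  have *: "I.gi i (block i z) = block (Suc i) z" if "1 \<le> i" "i \<le> n" for i
    using I.gi_g[of i "block (Suc i) z"] that assms block_P by (simp add: indg_block)
  show ?thesis unfolding I.gi_ginv[symmetric] using assms(1) by (induction m) (auto simp: *)
qed

text \<open>A column first multiplies by $\tau^b$; then the ascending generators carry the last
  block to the first one, where $X$ acts as $x$, and the inverse generators carry it on to block
  $j$.\<close>

lemma colop_block:
  assumes "1 \<le> j" "j \<le> Suc n" "a \<le> d" "z \<in> P"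
  shows "colop (fscale scale) Dl rho r u indt indg indX n (j, a, b) (block (Suc n) z) =
    block j (newton scale u x a ((tau ^^ b) z))"
proof -
  have "(tau ^^ b) z \<in> P" using assms by (induction b) auto
  then have "newton scale u x a ((tau ^^ b) z) \<in> P" using assms(3)
    by (induction a) auto
  then show ?thesis using assms
    by (simp add: colop_def indt_block gup_block newton_block_1 gdn_gi_block del: One_nat_def)
qed

end

context yh_module begin

definition "single a b z = (\<lambda>a' b'. if a' = (a::nat) \<and> b' = (b::nat) then z else (0::'m))"

lemma single_P: "a < d \<Longrightarrow> b < r \<Longrightarrow> z \<in> P \<Longrightarrow> single a b z \<in> layP"
  by (rule layPI) (auto simp: single_def)

lemma ltau_single: "b < r \<Longrightarrow> (ltau ^^ b) (single a 0 z) = single a b z"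
proof (induction b)
  case (Suc b)
  have "(b' + (r - 1)) mod r = b \<longleftrightarrow> b' = Suc b" if "b' < r" for b'
  proof (cases b')
    case 0
    then show ?thesis using Suc.prems that by auto
  next
    case (Suc c)
    then have "b' + (r - 1) = c + r" using that by simp
    then show ?thesis using Suc that by (simp only: mod_add_self2) simp
  qed
  then have "ltau (single a b z) = single a (Suc b) z"
    using Suc.prems unfolding fun_eq_iff ltau_def single_def by auto
  then show ?case using Suc by simp
qed simp

lemma newton_single: "a < d \<Longrightarrow> newton lscale u lx a (single 0 b z) = single a b z"
proof (induction a)
  case (Suc a)
  have "lx (single a b z) - lscale (u a) (single a b z) = single (Suc a) b z"
    using Suc.prems by (auto simp: fun_eq_iff lx_def single_def fscale_def)
  then show ?case using Suc by (simp only: newton.simps Suc_lessD)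
qed simp

end

text \<open>Families indexed by a letter and a word are the same as families indexed by longer
  words. The value at the empty word is a default, since the empty word does not occur at
  positive length.\<close>

definition enc :: "(nat \<Rightarrow> nat \<Rightarrow> nat \<Rightarrow> (nat \<times> nat \<times> nat) list \<Rightarrow> 'c::comm_ring_1) \<Rightarrow> (nat \<times> nat \<times> nat) list \<Rightarrow> 'c"
  where "enc F \<beta> = (case \<beta> of [] \<Rightarrow> 0 | \<gamma> # \<beta>' \<Rightarrow> F (fst \<gamma>) (fst (snd \<gamma>)) (snd (snd \<gamma>)) \<beta>')"

definition dec :: "((nat \<times> nat \<times> nat) list \<Rightarrow> 'c::comm_ring_1) \<Rightarrow> nat \<Rightarrow> nat \<Rightarrow> nat \<Rightarrow> (nat \<times> nat \<times> nat) list \<Rightarrow> 'c"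
  where "dec \<Phi> j a b \<beta> = \<Phi> ((j, a, b) # \<beta>)"

abbreviation "vsc \<equiv> fscale (*)"
abbreviation "isc \<equiv> fscale (fscale (fscale vsc))"

lemma dec_enc: "dec (enc F) = F"
  by (simp add: dec_def enc_def fun_eq_iff)

lemma enc_dec: "\<Phi> [] = 0 \<Longrightarrow> enc (dec \<Phi>) = \<Phi>"
  by (auto simp: dec_def enc_def fun_eq_iff split: list.split)

lemma enc_lin: "linmap isc vsc enc"
  and dec_lin: "linmap vsc isc dec"
  by (rule linmapI; auto simp: enc_def dec_def fscale_def fun_eq_iff split: list.split)+

lemma module_vsc: "Modules.module (vsc :: 'c \<Rightarrow> ('i \<Rightarrow> 'c) \<Rightarrow> 'i \<Rightarrow> 'c::comm_ring_1)"
  by (rule module_fscale) (simp add: Modules.module_def algebra_simps)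

text \<open>The induced module of the standard module for $n$ strands is the one for $n + 1$
  strands. The generating vector is included in the last block as a constant, and the form is
  the old form of the coefficient of $x^{d-1} \tau^0$ in the last block. Both the inclusion and
  the coefficient respect the generators for $n$ strands, so that the statements for words of
  length $n$ apply to the remaining letters; the first letter is governed by
  \<open>colop_block\<close> for columns and by \<open>row_form_bijective\<close> for
  rows.\<close>

theorem (in yh_params) standard_module:
  assumes R_add: "\<And>x y. x \<in> R \<Longrightarrow> y \<in> R \<Longrightarrow> x + y \<in> R"
    and R_mult: "\<And>x y. x \<in> R \<Longrightarrow> y \<in> R \<Longrightarrow> x * y \<in> R"
  defines "V \<equiv> \<lambda>n. {\<Phi>. \<forall>\<beta>. \<Phi> \<beta> \<in> R \<and> (\<beta> \<in> words r d n \<or> \<Phi> \<beta> = 0)}"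
  shows "\<exists>t g X1 v lam. yh_module R r d Dl rho u vsc (V n) n t g X1 \<and>
    v \<in> V n \<and> linmap vsc (*) lam \<and> (\<forall>\<Phi>\<in>V n. lam \<Phi> \<in> R) \<and>
    (\<forall>\<beta>\<in>words r d n. colw (colop vsc Dl rho r u t g X1) \<beta> v = (\<lambda>\<beta>'. if \<beta>' = \<beta> then 1 else 0)) \<and>
    (\<forall>y. (\<forall>\<beta>\<in>words r d n. y \<beta> \<in> R) \<longrightarrow>
      (\<exists>!\<Phi>. \<Phi> \<in> V n \<and> (\<forall>\<beta>\<in>words r d n. lam (roww (rowop vsc u t g X1) \<beta> \<Phi>) = y \<beta>)))"
proof (induction n)
  case 0
  have R0: "0 \<in> R" using R_add[OF one_R uminus_one_R] by simp
  have lin: "linop vsc (\<lambda>z. z)" "linop vsc (vsc c)" for c :: 'c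
    by (auto intro!: linmapI simp: fscale_def algebra_simps fun_eq_iff)
  have V0: "V 0 = {\<Phi>. \<Phi> [] \<in> R \<and> (\<forall>\<beta>. \<beta> \<noteq> [] \<longrightarrow> \<Phi> \<beta> = 0)}"
    using R0 unfolding V_def words.simps by (metis (lifting) singleton_iff)
  have sub: "submodule_over vsc R (V 0)"
    by (intro submodule_over.intro submodule_over_axioms.intro module_vsc one_R uminus_one_R)
      (auto simp: V0 R_add R_mult R0 fscale_def)
  have root: "newton vsc u (vsc (u 0)) (Suc k) z = 0" for k and z :: "(nat \<times> nat \<times> nat) list \<Rightarrow> 'c"
    by (induction k) (simp_all add: fscale_def fun_eq_iff)
  \<comment> \<open>For no strands any root of the annihilating polynomial gives an action of X
    on the ground ring.\<close>
  have "yh_module R r d Dl rho u vsc (V 0) 0 (\<lambda>i z. z) (\<lambda>i z. z) (vsc (u 0))"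
    by (intro yh_module.intro yh_module_axioms.intro yh_params_axioms sub lin
        submodule_over.P_scale[OF sub] u_R d_pos)
      (use root[of "d - 1"] d_pos in auto)
  moreover have "linmap vsc (*) (\<lambda>\<Phi>. \<Phi> [])" by (rule linmapI) (auto simp: fscale_def)
  moreover have "\<exists>!\<Phi>. \<Phi> \<in> V 0 \<and> \<Phi> [] = c" if "c \<in> R" for c
  proof (rule ex1I)
    show "(\<lambda>\<beta>. if \<beta> = [] then c else 0) \<in> V 0 \<and> (\<lambda>\<beta>. if \<beta> = [] then c else 0) [] = c"
      using that by (auto simp: V0)
    show "\<Phi> \<in> V 0 \<and> \<Phi> [] = c \<Longrightarrow> \<Phi> = (\<lambda>\<beta>. if \<beta> = [] then c else 0)" for \<Phi>
      by (auto simp: V0 fun_eq_iff)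
  qed
  moreover have "(\<lambda>\<beta>. if \<beta> = [] then 1 else 0) \<in> V 0" using one_R by (auto simp: V0)
  ultimately show ?case
    by (intro exI[of _ "\<lambda>i z. z"] exI[of _ "vsc (u 0)"]
        exI[of _ "\<lambda>\<beta>. if \<beta> = [] then 1 else 0"] exI[of _ "\<lambda>\<Phi>. \<Phi> []"]) (auto simp: V0)
next
  case (Suc n)
  then obtain t g X1 v lam where M: "yh_module R r d Dl rho u vsc (V n) n t g X1"
    and v: "v \<in> V n" and lam: "linmap vsc (*) lam" and lam_R: "\<forall>\<Phi>\<in>V n. lam \<Phi> \<in> R"
    and col: "\<forall>\<beta>\<in>words r d n. colw (colop vsc Dl rho r u t g X1) \<beta> v = (\<lambda>\<beta>'. if \<beta>' = \<beta> then 1 else 0)"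
    and row: "\<forall>y. (\<forall>\<beta>\<in>words r d n. y \<beta> \<in> R) \<longrightarrow>
      (\<exists>!\<Phi>. \<Phi> \<in> V n \<and> (\<forall>\<beta>\<in>words r d n. lam (roww (rowop vsc u t g X1) \<beta> \<Phi>) = y \<beta>))"
    by blast
  interpret M: yh_module R r d Dl rho u vsc "V n" n t g X1 by (rule M)
  interpret N: yh_layer R r d Dl rho u M.lscale M.layP n "\<lambda>i. lift (t i)" "\<lambda>i. lift (g i)"
    "lift X1" M.ltau M.lx M.lpi by (rule M.layer)
  interpret I: yh_module R r d Dl rho u isc N.indP "Suc n" N.indt N.indg N.indX
    by (rule N.ind_yh_module)
  let ?t = "\<lambda>i z. enc (N.indt i (dec z))" and ?g = "\<lambda>i z. enc (N.indg i (dec z))"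
    and ?X = "\<lambda>z. enc (N.indX (dec z))"
  have P: "enc ` N.indP = V (Suc n)"
  proof (intro equalityI subsetI)
    fix \<Phi> assume "\<Phi> \<in> enc ` N.indP"
    then obtain F where F: "\<Phi> = enc F" "F \<in> N.indP" by blast
    have "F j a b \<beta> \<in> R \<and> ((j, a, b) # \<beta> \<in> words r d (Suc n) \<or> F j a b \<beta> = 0)" for j a b \<beta>
    proof -
      have lay: "F j \<in> M.layP" using F by simp
      have "F j a b \<in> V n" using lay by simp
      then have 1: "F j a b \<beta> \<in> R" "\<beta> \<in> words r d n \<or> F j a b \<beta> = 0" by (auto simp: V_def)
      have 2: "j \<in> {1..Suc n} \<or> F j a b \<beta> = 0"
      proof (cases "j \<in> {1..Suc n}")
        case False
        then have "F j = 0" by (rule N.indP_zero[OF F(2)])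
        then show ?thesis by simp
      qed simp
      have 3: "a < d \<and> b < r \<or> F j a b \<beta> = 0"
      proof (cases "a < d \<and> b < r")
        case False
        then have "F j a b = 0" by (rule M.layP_zero[OF lay])
        then show ?thesis by simp
      qed simp
      show ?thesis using 1 2 3 by (auto simp: idx_def)
    qed
    moreover have "0 \<in> R" using R_add[OF one_R uminus_one_R] by simp
    ultimately show "\<Phi> \<in> V (Suc n)" unfolding V_def F(1) enc_def
      by (auto split: list.split)
  next
    fix \<Phi> assume \<Phi>: "\<Phi> \<in> V (Suc n)"
    then have \<Phi>': "\<Phi> \<beta> \<in> R" "\<beta> \<in> words r d (Suc n) \<or> \<Phi> \<beta> = 0" for \<beta> unfolding V_def by blast+
    have "dec \<Phi> \<in> N.indP"
    proof (rule N.indPI)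
      fix j
      show "dec \<Phi> j \<in> M.layP"
      proof (rule M.layPI)
        show "dec \<Phi> j a b \<in> V n" for a b
          using \<Phi>'(1)[of "(j, a, b) # \<beta>" for \<beta>] \<Phi>'(2)[of "(j, a, b) # \<beta>" for \<beta>]
          unfolding V_def dec_def by auto
        show "\<not> (a < d \<and> b < r) \<Longrightarrow> dec \<Phi> j a b = 0" for a b
          using \<Phi>'(2)[of "(j, a, b) # \<beta>" for \<beta>] by (auto simp: dec_def fun_eq_iff idx_def)
      qed
      show "j \<notin> {1..Suc n} \<Longrightarrow> dec \<Phi> j = 0"
        using \<Phi>'(2)[of "(j, a, b) # \<beta>" for a b \<beta>] by (auto simp: dec_def fun_eq_iff idx_def)
    qed
    moreover have "\<Phi> [] = 0" using \<Phi>'(2)[of "[]"] by simp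
    ultimately show "\<Phi> \<in> enc ` N.indP" using enc_dec[of \<Phi>] by (metis image_eqI)
  qed
  have V: "yh_module R r d Dl rho u vsc (V (Suc n)) (Suc n) ?t ?g ?X"
    using I.transport[OF enc_lin dec_lin dec_enc module_vsc] unfolding P .
  have el: "linmap isc vsc (enc :: _ \<Rightarrow> _ \<Rightarrow> 'c)" by (rule enc_lin)
  have colVI: "enc (colw (colop isc Dl rho r u N.indt N.indg N.indX) \<beta> F) =
      colw (colop vsc Dl rho r u ?t ?g ?X) \<beta> (enc F)"
    if "\<beta> \<in> words r d (Suc n)" "F \<in> N.indP" for \<beta> F
    using I.intertwine_colw[where y = enc and sc' = vsc and t' = ?t and g' = ?g and X1' = ?X
      and k = "Suc n" and m = "Suc n" and \<beta> = \<beta> and z = F] el that by (simp add: dec_enc)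
  have rowVI: "enc (roww (rowop isc u N.indt N.indg N.indX) \<beta> F) =
      roww (rowop vsc u ?t ?g ?X) \<beta> (enc F)"
    if "\<beta> \<in> words r d (Suc n)" "F \<in> N.indP" for \<beta> F
    using I.intertwine_roww[where y = enc and sc' = vsc and t' = ?t and g' = ?g and X1' = ?X
      and k = "Suc n" and m = "Suc n" and \<beta> = \<beta> and z = F] el that by (simp add: dec_enc)
  \<comment> \<open>The inclusion of the old module into the last block.\<close>
  define iota where "iota z = N.block (Suc n) (M.single 0 0 z)" for z
  have iota: "linmap vsc isc iota"
    by (rule linmapI) (auto simp: iota_def N.block_def M.single_def fscale_def fun_eq_iff)
  have iota_P: "z \<in> V n \<Longrightarrow> iota z \<in> N.indP" for z
    unfolding iota_def using d_pos r_pos by (intro N.block_P M.single_P) auto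
  have iota_t: "iota (t i z) = N.indt i (iota z)" if "1 \<le> i" "i \<le> n" for i z
    using that by (auto simp: iota_def fun_eq_iff N.indt_def N.block_def M.single_def lift_def
        N.layer_simps M.op_simps)
  have iota_g: "iota (g i z) = N.indg i (iota z)" if "1 \<le> i" "i < n" for i z
    using that by (auto simp: iota_def fun_eq_iff N.indg_def N.block_def M.single_def lift_def
        N.E_simps M.op_simps)
  have iota_X: "iota (X1 z) = N.indX (iota z)" if "1 \<le> n" for z
  proof
    fix j
    have "M.lpi (M.single 0 0 z) = M.single 0 0 z" 
      by (intro ext M.lpi_const) (auto simp: M.single_def)
    then have L: "N.L m (M.single 0 0 z) = 0" for m by (simp add: N.L_def N.G_simps)
    then have "N.L m (iota z (m + 2)) = 0" for m by (simp add: iota_def N.block_def N.L_simps)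
    then have "N.indX (iota z) j = (if j = 1 then M.lx (iota z 1) else lift X1 (iota z j))"
      by (simp only: N.indX_def sum.neutral_const N.layer_simps N.scale_zero_right add_0_right)
    then show "iota (X1 z) j = N.indX (iota z) j" using that
      by (auto simp: iota_def N.block_def M.single_def lift_def N.layer_simps M.op_simps fun_eq_iff)
  qed
  \<comment> \<open>The coefficient on which the new form is built.\<close>
  define Th where "Th F = F (Suc n) (d - 1) 0" for F :: "nat \<Rightarrow> nat \<Rightarrow> nat \<Rightarrow> (nat \<times> nat \<times> nat) list \<Rightarrow> 'c"
  have Th: "linmap isc vsc Th" by (rule linmapI) (auto simp: Th_def fscale_def)
  have Th_t: "Th (N.indt i F) = t i (Th F)" if "1 \<le> i" "i \<le> n" for i F
    using that by (simp add: Th_def N.indt_def lift_def)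
  have Th_g: "Th (N.indg i F) = g i (Th F)" if "1 \<le> i" "i < n" for i F
    using that by (simp add: Th_def N.indg_def lift_def)
  have Th_X: "Th (N.indX F) = X1 (Th F)" if "1 \<le> n" for F
    using that by (simp add: Th_def N.indX_def lift_def)
  have Th_P: "Th F \<in> V n" if "F \<in> N.indP" for F using that by (simp add: Th_def)
  let ?colV = "colop vsc Dl rho r u ?t ?g ?X" and ?colI = "colop isc Dl rho r u N.indt N.indg N.indX"
    and ?colM = "colop vsc Dl rho r u t g X1"
  let ?rowV = "rowop vsc u ?t ?g ?X" and ?rowI = "rowop isc u N.indt N.indg N.indX"
    and ?rowM = "rowop vsc u t g X1"
  have colV: "colw ?colV \<beta> (enc (iota v)) = (\<lambda>\<beta>'. if \<beta>' = \<beta> then 1 else 0)"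
    if \<beta>: "\<beta> \<in> words r d (Suc n)" for \<beta>
  proof -
    obtain \<gamma> \<beta>' where \<beta>': "\<beta> = \<gamma> # \<beta>'" "\<gamma> \<in> idx r d (Suc n)" "\<beta>' \<in> words r d n" using \<beta> by auto
    obtain j a b where \<gamma>: "\<gamma> = (j, a, b)" by (cases \<gamma>)
    let ?e = "\<lambda>\<beta>''. if \<beta>'' = \<beta>' then 1 else 0 :: 'c"
    have e: "?e \<in> V n" using \<beta>' one_R R_add[OF one_R uminus_one_R] by (auto simp: V_def)
    have 1: "colw ?colI \<beta>' (iota v) = iota ?e"
    proof -
      have "iota (colw ?colM \<beta>' v) = colw ?colI \<beta>' (iota v)"
        using M.intertwine_colw[where y = iota and sc' = isc and t' = N.indt and g' = N.indg
            and X1' = N.indX and k = n and m = n and \<beta> = \<beta>' and z = v]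
          iota iota_t iota_g iota_X \<beta>'(3) v by simp
      then show ?thesis using col \<beta>'(3) by simp
    qed
    have A: "colw ?colV \<beta> (enc (iota v)) = enc (colw ?colI \<beta> (iota v))"
      by (rule colVI[OF \<beta> iota_P[OF v], symmetric])
    have B: "colw ?colI \<beta> (iota v) = ?colI n \<gamma> (iota ?e)"
      unfolding \<beta>'(1) colw.simps 1 length_words[OF \<beta>'(3)] ..
    have j: "1 \<le> j" "j \<le> Suc n" "a < d" "b < r" using \<beta>'(2) \<gamma> by (auto simp: idx_def)
    have C: "?colI n \<gamma> (iota ?e) =
        N.block j (newton M.lscale u M.lx a ((M.ltau ^^ b) (M.single 0 0 ?e)))"
      unfolding \<gamma> iota_def using j less_imp_le[OF j(3)]
      by (intro N.colop_block M.single_P d_pos r_pos e)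
    have D: "newton M.lscale u M.lx a ((M.ltau ^^ b) (M.single 0 0 ?e)) = M.single a b ?e"
      using j by (simp only: M.ltau_single M.newton_single)
    have E: "enc (N.block j (M.single a b ?e)) = (\<lambda>\<beta>'. if \<beta>' = \<beta> then 1 else 0)"
      unfolding \<beta>'(1) \<gamma> by (auto simp: enc_def N.block_def M.single_def fun_eq_iff split: list.split)
    show ?thesis unfolding A B C D by (rule E)
  qed
  define lam' where "lam' \<Phi> = lam (Th (dec \<Phi>))" for \<Phi>
  have lam': "linmap vsc (*) lam'" 
    unfolding lam'_def by (intro linmap_comp[OF lam] linmap_comp[OF Th] dec_lin)
  have rowV: "lam' (roww ?rowV (\<gamma> # \<beta>) (enc F)) = lam (roww ?rowM \<beta> (Th (?rowI n \<gamma> F)))"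
    if "\<gamma> \<in> idx r d (Suc n)" "\<beta> \<in> words r d n" "F \<in> N.indP" for \<gamma> \<beta> F
  proof -
    have w: "\<gamma> # \<beta> \<in> words r d (Suc n)" unfolding words.simps using that by blast
    have F': "?rowI n \<gamma> F \<in> N.indP" using that by (intro I.rowop_P) auto
    have A: "roww ?rowV (\<gamma> # \<beta>) (enc F) = enc (roww ?rowI (\<gamma> # \<beta>) F)"
      by (rule rowVI[OF w that(3), symmetric])
    have B: "roww ?rowI (\<gamma> # \<beta>) F = roww ?rowI \<beta> (?rowI n \<gamma> F)"
      unfolding roww.simps length_words[OF that(2)] ..
    have C: "Th (roww ?rowI \<beta> (?rowI n \<gamma> F)) = roww ?rowM \<beta> (Th (?rowI n \<gamma> F))"
      using I.intertwine_roww[where y = Th and sc' = vsc and t' = t and g' = g and X1' = X1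
        and k = n and m = n and \<beta> = \<beta> and z = "?rowI n \<gamma> F"] Th Th_t Th_g Th_X that(2) F' by simp
    show ?thesis unfolding A B lam'_def dec_enc C ..
  qed
  have ex1: "\<exists>!\<Phi>. \<Phi> \<in> V (Suc n) \<and> (\<forall>\<beta>\<in>words r d (Suc n). lam' (roww ?rowV \<beta> \<Phi>) = y \<beta>)"
    if y: "\<forall>\<beta>\<in>words r d (Suc n). y \<beta> \<in> R" for y
  proof -
    have "\<exists>!z. z \<in> V n \<and> (\<forall>\<beta>\<in>words r d n. lam (roww ?rowM \<beta> z) = y (\<gamma> # \<beta>))"
      if "\<gamma> \<in> idx r d (Suc n)" for \<gamma>
      using y that unfolding ball_words by (intro row[rule_format]) blast
    then have "\<forall>\<gamma>\<in>idx r d (Suc n). \<exists>z. z \<in> V n \<and> (\<forall>\<beta>\<in>words r d n. lam (roww ?rowM \<beta> z) = y (\<gamma> # \<beta>)) \<and>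
      (\<forall>z'. z' \<in> V n \<and> (\<forall>\<beta>\<in>words r d n. lam (roww ?rowM \<beta> z') = y (\<gamma> # \<beta>)) \<longrightarrow> z' = z)" by blast
    from bchoice[OF this] obtain m where m': "\<forall>\<gamma>\<in>idx r d (Suc n). m \<gamma> \<in> V n \<and>
      (\<forall>\<beta>\<in>words r d n. lam (roww ?rowM \<beta> (m \<gamma>)) = y (\<gamma> # \<beta>)) \<and>
      (\<forall>z'. z' \<in> V n \<and> (\<forall>\<beta>\<in>words r d n. lam (roww ?rowM \<beta> z') = y (\<gamma> # \<beta>)) \<longrightarrow> z' = m \<gamma>)" ..
    have m: "m \<gamma> \<in> V n" "\<forall>\<beta>\<in>words r d n. lam (roww ?rowM \<beta> (m \<gamma>)) = y (\<gamma> # \<beta>)"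
      "\<And>z. z \<in> V n \<Longrightarrow> \<forall>\<beta>\<in>words r d n. lam (roww ?rowM \<beta> z) = y (\<gamma> # \<beta>) \<Longrightarrow> z = m \<gamma>"
      if "\<gamma> \<in> idx r d (Suc n)" for \<gamma> using m'[rule_format, OF that] by blast+
    have iff: "(\<forall>\<beta>\<in>words r d (Suc n). lam' (roww ?rowV \<beta> (enc F)) = y \<beta>) \<longleftrightarrow>
      (\<forall>\<gamma>\<in>idx r d (Suc n). Th (?rowI n \<gamma> F) = m \<gamma>)" if F: "F \<in> N.indP" for F
    proof -
      have "(\<forall>\<beta>\<in>words r d (Suc n). lam' (roww ?rowV \<beta> (enc F)) = y \<beta>) \<longleftrightarrow>
        (\<forall>\<gamma>\<in>idx r d (Suc n). \<forall>\<beta>\<in>words r d n. lam (roww ?rowM \<beta> (Th (?rowI n \<gamma> F))) = y (\<gamma> # \<beta>))"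
        unfolding ball_words using rowV[OF _ _ F] by (intro ball_cong refl) (simp only:)
      also have "\<dots> \<longleftrightarrow> (\<forall>\<gamma>\<in>idx r d (Suc n). Th (?rowI n \<gamma> F) = m \<gamma>)"
      proof (intro ball_cong refl iffI)
        fix \<gamma> assume \<gamma>: "\<gamma> \<in> idx r d (Suc n)"
        have T: "Th (?rowI n \<gamma> F) \<in> V n" using \<gamma> F by (intro Th_P I.rowop_P) auto
        show "\<forall>\<beta>\<in>words r d n. lam (roww ?rowM \<beta> (Th (?rowI n \<gamma> F))) = y (\<gamma> # \<beta>) \<Longrightarrow>
          Th (?rowI n \<gamma> F) = m \<gamma>" using m(3)[OF \<gamma> T] .
        show "Th (?rowI n \<gamma> F) = m \<gamma> \<Longrightarrow>
          \<forall>\<beta>\<in>words r d n. lam (roww ?rowM \<beta> (Th (?rowI n \<gamma> F))) = y (\<gamma> # \<beta>)" using m(2)[OF \<gamma>] by simp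
      qed
      finally show ?thesis .
    qed
    from M.row_form_bijective[of m, OF m(1)]
    have "\<exists>!F. F \<in> N.indP \<and> (\<forall>\<gamma>\<in>idx r d (Suc n). Th (?rowI n \<gamma> F) = m \<gamma>)" unfolding Th_def .
    then obtain F where F: "F \<in> N.indP" "\<forall>\<gamma>\<in>idx r d (Suc n). Th (?rowI n \<gamma> F) = m \<gamma>"
      "\<And>F'. F' \<in> N.indP \<Longrightarrow> \<forall>\<gamma>\<in>idx r d (Suc n). Th (?rowI n \<gamma> F') = m \<gamma> \<Longrightarrow> F' = F" by blast
    show ?thesis
    proof (rule ex1I[of _ "enc F"])
      show "enc F \<in> V (Suc n) \<and> (\<forall>\<beta>\<in>words r d (Suc n). lam' (roww ?rowV \<beta> (enc F)) = y \<beta>)"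
        using F(1,2) iff[OF F(1)] P by blast
      show "\<Phi> = enc F" if "\<Phi> \<in> V (Suc n) \<and> (\<forall>\<beta>\<in>words r d (Suc n). lam' (roww ?rowV \<beta> \<Phi>) = y \<beta>)" for \<Phi>
        using that F(3) iff unfolding P[symmetric] by blast
    qed
  qed
  have 1: "enc (iota v) \<in> V (Suc n)" unfolding P[symmetric] using iota_P[OF v] by blast
  have 2: "\<forall>\<Phi>\<in>V (Suc n). lam' \<Phi> \<in> R" 
    unfolding P[symmetric] using lam_R Th_P by (auto simp: lam'_def dec_enc)
  show ?case using V 1 2 lam' colV ex1 by blast
qed

section \<open>Spanning words in a ring\<close>

text \<open>Spans over a central subring \<open>Z\<close>, given as a set of ring elements, so
  that no separate scalar action has to be carried along.\<close>

locale central_span = ring A for A (structure) +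
  fixes Z :: "'a set"
  assumes Z_carrier: "Z \<subseteq> carrier A" and Z_one: "\<one> \<in> Z" and Z_zero: "\<zero> \<in> Z"
    and Z_mult: "\<lbrakk>x \<in> Z; y \<in> Z\<rbrakk> \<Longrightarrow> x \<otimes> y \<in> Z"
    and Z_minus: "x \<in> Z \<Longrightarrow> \<ominus> x \<in> Z"
    and central: "\<lbrakk>z \<in> Z; a \<in> carrier A\<rbrakk> \<Longrightarrow> z \<otimes> a = a \<otimes> z"
begin

lemma Z_closed[simp]: "z \<in> Z \<Longrightarrow> z \<in> carrier A"
  using Z_carrier by blast

definition "zsub S \<longleftrightarrow> S \<subseteq> carrier A \<and> \<zero> \<in> S \<and> (\<forall>x\<in>S. \<forall>y\<in>S. x \<oplus> y \<in> S) \<and>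
  (\<forall>z\<in>Z. \<forall>x\<in>S. z \<otimes> x \<in> S)"

definition "zspan B = \<Inter>{S. zsub S \<and> B \<subseteq> S}"

lemma zsub_carrier: "zsub (carrier A)"
  by (simp add: zsub_def)

lemma zsub_zspan: "B \<subseteq> carrier A \<Longrightarrow> zsub (zspan B)"
  using zsub_carrier unfolding zspan_def zsub_def by auto

lemma zspan_base: "b \<in> B \<Longrightarrow> b \<in> zspan B"
  by (auto simp: zspan_def)

lemma zspan_least: "zsub S \<Longrightarrow> B \<subseteq> S \<Longrightarrow> zspan B \<subseteq> S"
  by (auto simp: zspan_def)

lemma zsubD:
  assumes "zsub S"
  shows "x \<in> S \<Longrightarrow> x \<in> carrier A" "\<zero> \<in> S" "x \<in> S \<Longrightarrow> y \<in> S \<Longrightarrow> x \<oplus> y \<in> S"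
    "z \<in> Z \<Longrightarrow> x \<in> S \<Longrightarrow> z \<otimes> x \<in> S" "x \<in> S \<Longrightarrow> \<ominus> x \<in> S"
    "x \<in> S \<Longrightarrow> y \<in> S \<Longrightarrow> x \<ominus> y \<in> S"
proof -
  have neg: "\<ominus> x \<in> S" if "x \<in> S" for x
  proof -
    have "\<ominus> x = (\<ominus> \<one>) \<otimes> x" using that assms by (auto simp: zsub_def l_minus)
    then show ?thesis using that assms Z_minus[OF Z_one] by (auto simp: zsub_def)
  qed
  show "x \<in> S \<Longrightarrow> x \<in> carrier A" "\<zero> \<in> S" "x \<in> S \<Longrightarrow> y \<in> S \<Longrightarrow> x \<oplus> y \<in> S"
    "z \<in> Z \<Longrightarrow> x \<in> S \<Longrightarrow> z \<otimes> x \<in> S" "x \<in> S \<Longrightarrow> \<ominus> x \<in> S"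
    "x \<in> S \<Longrightarrow> y \<in> S \<Longrightarrow> x \<ominus> y \<in> S"
    using assms neg unfolding zsub_def a_minus_def by auto
qed

lemma zsub_preimage:
  assumes y: "y \<in> carrier A" and S: "zsub S"
  shows "zsub {x \<in> carrier A. y \<otimes> x \<in> S}"
proof -
  have "y \<otimes> (z \<otimes> x) = z \<otimes> (y \<otimes> x)" if "z \<in> Z" "x \<in> carrier A" for z x
    using that y central[of z y] by (simp add: m_assoc[symmetric])
  then show ?thesis using zsubD[OF S] y by (auto simp: zsub_def r_distr)
qed

lemma zspan_mult:
  assumes "y \<in> carrier A" "B \<subseteq> carrier A" "zsub S" "\<And>b. b \<in> B \<Longrightarrow> y \<otimes> b \<in> S" "x \<in> zspan B"
  shows "y \<otimes> x \<in> S"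
  using zspan_least[OF zsub_preimage[OF assms(1,3)], of B] assms by auto

text \<open>Moving $x$ to the right through $p$ turns it into $x'$.\<close>

definition "pass x p x' \<longleftrightarrow> x \<otimes> p = p \<otimes> x'"

lemma pass_one: "x \<in> carrier A \<Longrightarrow> pass x \<one> x"
  by (simp add: pass_def)

lemma pass_mult:
  assumes "pass x p x1" "pass x1 q x2" "x \<in> carrier A" "x1 \<in> carrier A" "x2 \<in> carrier A"
    "p \<in> carrier A" "q \<in> carrier A"
  shows "pass x (p \<otimes> q) x2"
proof -
  have "x \<otimes> (p \<otimes> q) = (x \<otimes> p) \<otimes> q" using assms by (simp add: m_assoc)
  also have "\<dots> = p \<otimes> (x1 \<otimes> q)" using assms by (simp add: pass_def m_assoc)
  also have "\<dots> = (p \<otimes> q) \<otimes> x2" using assms by (simp add: pass_def m_assoc)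
  finally show ?thesis by (simp add: pass_def)
qed

lemma pass_pow:
  assumes "pass x p x" "x \<in> carrier A" "p \<in> carrier A"
  shows "pass x (p [^] (b::nat)) x"
  by (induction b) (use assms in \<open>auto intro!: pass_one pass_mult[of x _ x p x]\<close>)

lemma pass_mult4:
  assumes "pass x p1 y" "pass y p2 y" "pass y p3 z" "pass z p4 z"
    and c: "x \<in> carrier A" "y \<in> carrier A" "z \<in> carrier A"
      "p1 \<in> carrier A" "p2 \<in> carrier A" "p3 \<in> carrier A" "p4 \<in> carrier A"
  shows "pass x (p1 \<otimes> (p2 \<otimes> (p3 \<otimes> p4))) z"
  by (rule pass_mult[OF assms(1) pass_mult[OF assms(2) pass_mult[OF assms(3,4)]]]) (simp_all add: c)

lemma passD: "pass x p x' \<Longrightarrow> x \<in> carrier A \<Longrightarrow> p \<in> carrier A \<Longrightarrow> x' \<in> carrier A \<Longrightarrow> z \<in> carrier A \<Longrightarrow>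
    x \<otimes> (p \<otimes> z) = p \<otimes> (x' \<otimes> z)"
  by (simp add: pass_def m_assoc[symmetric])

end

text \<open>The relations of the cyclotomic algebra. They are stated so that the opposite ring
  satisfies them as well. Of the idempotents only those properties are required which the
  spanning argument uses: they commute with $g_i$ and $X$, and they preserve every span that
  $t_i$ and $t_{i+1}$ preserve. The product in the last assumption is written as a recursion in
  order to coincide with the Newton products.\<close>

locale yh_ring = central_span A Z for A (structure) and Z +
  fixes n r d :: nat and Dl :: 'a and u t g e :: "nat \<Rightarrow> 'a" and X1 :: 'a
  assumes r_pos: "r > 0" and d_pos: "d > 0" and Dl_Z: "Dl \<in> Z" and u_Z: "k < d \<Longrightarrow> u k \<in> Z"
    and t_closed[simp]: "t i \<in> carrier A" and g_closed[simp]: "g i \<in> carrier A"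
    and e_closed[simp]: "e i \<in> carrier A" and X_closed[simp]: "X1 \<in> carrier A"
    and g_far: "\<lbrakk>1 \<le> i; i + 2 \<le> j; j < n\<rbrakk> \<Longrightarrow> g i \<otimes> g j = g j \<otimes> g i"
    and braid: "\<lbrakk>1 \<le> i; Suc i < n\<rbrakk> \<Longrightarrow> g i \<otimes> g (Suc i) \<otimes> g i = g (Suc i) \<otimes> g i \<otimes> g (Suc i)"
    and t_t: "\<lbrakk>1 \<le> i; i \<le> n; 1 \<le> j; j \<le> n\<rbrakk> \<Longrightarrow> t i \<otimes> t j = t j \<otimes> t i"
    and g_t: "\<lbrakk>1 \<le> i; i < n; 1 \<le> j; j \<le> n\<rbrakk> \<Longrightarrow> g i \<otimes> t j = t (transpose i (Suc i) j) \<otimes> g i"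
    and t_root: "\<lbrakk>1 \<le> i; i \<le> n\<rbrakk> \<Longrightarrow> t i [^] r = \<one>"
    and g_g: "\<lbrakk>1 \<le> i; i < n\<rbrakk> \<Longrightarrow> g i \<otimes> g i = \<one> \<oplus> Dl \<otimes> (e i \<otimes> g i)"
    and e_g: "\<lbrakk>1 \<le> i; i < n\<rbrakk> \<Longrightarrow> e i \<otimes> g i = g i \<otimes> e i"
    and e_X: "\<lbrakk>1 \<le> i; i < n\<rbrakk> \<Longrightarrow> e i \<otimes> X1 = X1 \<otimes> e i"
    and e_absorb: "\<lbrakk>1 \<le> i; i < n; zsub S; \<And>x. x \<in> S \<Longrightarrow> t i \<otimes> x \<in> S;
      \<And>x. x \<in> S \<Longrightarrow> t (Suc i) \<otimes> x \<in> S; x \<in> S\<rbrakk> \<Longrightarrow> e i \<otimes> x \<in> S"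
    and g_X: "\<lbrakk>2 \<le> i; i < n\<rbrakk> \<Longrightarrow> g i \<otimes> X1 = X1 \<otimes> g i"
    and g_X_g_X: "2 \<le> n \<Longrightarrow> g 1 \<otimes> X1 \<otimes> g 1 \<otimes> X1 = X1 \<otimes> g 1 \<otimes> X1 \<otimes> g 1"
    and t_X: "\<lbrakk>1 \<le> i; i \<le> n\<rbrakk> \<Longrightarrow> t i \<otimes> X1 = X1 \<otimes> t i"
    and X_root: "rec_nat \<one> (\<lambda>k y. (X1 \<ominus> u k) \<otimes> y) d = \<zero>"
begin

lemma u_closed[simp]: "k < d \<Longrightarrow> u k \<in> carrier A"
  using u_Z by simp

lemma Dl_closed[simp]: "Dl \<in> carrier A"
  using Dl_Z by simp

definition "nw = rec_nat \<one> (\<lambda>k y. (X1 \<ominus> u k) \<otimes> y)"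

lemma nw_simps[simp]: "nw 0 = \<one>" "nw (Suc k) = (X1 \<ominus> u k) \<otimes> nw k"
  by (simp_all add: nw_def)

lemma nw_d: "nw d = \<zero>"
  using X_root by (simp add: nw_def)

lemma nw_closed[simp]: "k \<le> d \<Longrightarrow> nw k \<in> carrier A"
  by (induction k) simp_all

lemma pass_nw:
  assumes y: "y \<in> carrier A" "pass y X1 y" and k: "k \<le> d"
  shows "pass y (nw k) y"
  using k
proof (induction k)
  case (Suc k)
  have "y \<otimes> u k = u k \<otimes> y" using Suc.prems y central[OF u_Z, of k y] by simp
  then have "pass y (X1 \<ominus> u k) y" using y Suc.prems
    by (simp add: pass_def a_minus_def l_distr r_distr l_minus r_minus)
  then show ?case using Suc y by (auto intro!: pass_mult[of y _ y])
qed (use y in \<open>simp add: pass_one\<close>)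

definition "gi i = g i \<ominus> Dl \<otimes> e i"

lemma gi_closed[simp]: "gi i \<in> carrier A"
  by (simp add: gi_def)

lemma Dl_move: "x \<in> carrier A \<Longrightarrow> y \<in> carrier A \<Longrightarrow> x \<otimes> (Dl \<otimes> y) = Dl \<otimes> (x \<otimes> y)"
  using central[OF Dl_Z, of x] by (simp add: m_assoc[symmetric])

lemma gi_g: assumes "1 \<le> i" "i < n" shows "gi i \<otimes> g i = \<one>" "g i \<otimes> gi i = \<one>"
proof -
  let ?q = "Dl \<otimes> (e i \<otimes> g i)"
  have q: "\<one> \<oplus> ?q \<ominus> ?q = \<one>" by (simp add: a_minus_def a_assoc r_neg)
  have 1: "gi i \<otimes> g i = g i \<otimes> g i \<ominus> ?q"
    by (simp add: gi_def a_minus_def l_distr l_minus m_assoc)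
  show "gi i \<otimes> g i = \<one>" unfolding 1 g_g[OF assms] by (rule q)
  have 2: "g i \<otimes> gi i = g i \<otimes> g i \<ominus> ?q"
    using e_g[OF assms] by (simp add: gi_def a_minus_def r_distr r_minus Dl_move)
  show "g i \<otimes> gi i = \<one>" unfolding 2 g_g[OF assms] by (rule q)
qed

primrec up where "up 0 = \<one>" | "up (Suc m) = up m \<otimes> g (Suc m)"

primrec dn where "dn s 0 = \<one>" | "dn s (Suc m) = s (Suc m) \<otimes> dn s m"

lemma up_closed[simp]: "up m \<in> carrier A"
  by (induction m) simp_all

definition "col s m = (\<lambda>(j, a, b::nat). dn s (j - 1) \<otimes> (nw a \<otimes> (up m \<otimes> t (Suc m) [^] b)))"

primrec word where
  "word s [] = \<one>"
| "word s (\<gamma> # \<beta>) = col s (length \<beta>) \<gamma> \<otimes> word s \<beta>"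

definition "S s m = zspan (word s ` words r d m)"

text \<open>What the generators and their inverses have in common, in the roles of the factors
  $s_{j-1} \cdots s_1$ at the left end of a word: $s_i$ differs from $g_i$ by a multiple of
  $e_i$, and $g_i s_i$ differs from $1$ by a multiple of $e_i g_i$. It allows columns with
  $g^{-1}$ and with $g$ to be treated at the same time.\<close>

definition "good s \<longleftrightarrow> (\<forall>i. s i \<in> carrier A) \<and>
  (\<forall>i j. 1 \<le> i \<and> i < n \<and> 1 \<le> j \<and> j < n \<and> (i + 2 \<le> j \<or> j + 2 \<le> i) \<longrightarrow> pass (g i) (s j) (g i)) \<and>
  (\<forall>i. 1 \<le> i \<and> Suc i < n \<longrightarrow> pass (g i) (s (Suc i) \<otimes> s i) (g (Suc i))) \<and>
  (\<forall>i j. 1 \<le> i \<and> i < n \<and> 1 \<le> j \<and> j \<le> n \<longrightarrow> pass (t j) (s i) (t (transpose i (Suc i) j))) \<and>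
  (\<exists>z\<in>Z. \<forall>i. 1 \<le> i \<and> i < n \<longrightarrow> g i = s i \<oplus> z \<otimes> e i) \<and>
  (\<exists>z\<in>Z. \<forall>i. 1 \<le> i \<and> i < n \<longrightarrow> g i \<otimes> s i = \<one> \<oplus> z \<otimes> (e i \<otimes> g i))"

lemma g_far_pass: "\<lbrakk>1 \<le> i; i < n; 1 \<le> j; j < n; i + 2 \<le> j \<or> j + 2 \<le> i\<rbrakk> \<Longrightarrow> pass (g i) (g j) (g i)"
  using g_far[of i j] g_far[of j i] by (auto simp: pass_def)

lemma t_g_pass: "\<lbrakk>1 \<le> i; i < n; 1 \<le> j; j \<le> n\<rbrakk> \<Longrightarrow> pass (t j) (g i) (t (transpose i (Suc i) j))"
  using g_t[of i "transpose i (Suc i) j"] by (auto simp: pass_def transpose_def split: if_splits)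

lemma pass_inverse:
  assumes "pass x p x'" "q \<otimes> p = \<one>" "p \<otimes> q = \<one>"
    and c: "x \<in> carrier A" "x' \<in> carrier A" "p \<in> carrier A" "q \<in> carrier A"
  shows "pass x' q x"
proof -
  have "x' \<otimes> q = (q \<otimes> p) \<otimes> (x' \<otimes> q)" using assms by simp
  also have "\<dots> = q \<otimes> ((p \<otimes> x') \<otimes> q)" using c by (simp only: m_assoc m_closed)
  also have "p \<otimes> x' = x \<otimes> p" using assms by (simp add: pass_def)
  also have "q \<otimes> ((x \<otimes> p) \<otimes> q) = (q \<otimes> x) \<otimes> (p \<otimes> q)" using c by (simp only: m_assoc m_closed)
  also have "\<dots> = q \<otimes> x" using assms by simp
  finally show ?thesis by (simp add: pass_def)
qed

lemma good_g: "good g"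
proof -
  have "pass (g i) (g (Suc i) \<otimes> g i) (g (Suc i))" if "1 \<le> i" "Suc i < n" for i
    using braid[OF that] by (simp add: pass_def m_assoc)
  moreover have "\<exists>z\<in>Z. \<forall>i. 1 \<le> i \<and> i < n \<longrightarrow> g i = g i \<oplus> z \<otimes> e i"
    using Z_zero by (intro bexI[of _ \<zero>]) auto
  ultimately show ?thesis unfolding good_def using g_far_pass t_g_pass g_g Dl_Z by auto
qed

lemma good_gi: "good gi"
proof -
  have 1: "pass (g i) (gi j) (g i)"
    if "1 \<le> i" "i < n" "1 \<le> j" "j < n" "i + 2 \<le> j \<or> j + 2 \<le> i" for i j
    using that by (intro pass_inverse[OF g_far_pass]) (auto simp: gi_g)
  have 2: "pass (g i) (gi (Suc i) \<otimes> gi i) (g (Suc i))" if "1 \<le> i" "Suc i < n" for i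
  proof (rule pass_inverse)
    show "pass (g (Suc i)) (g i \<otimes> g (Suc i)) (g i)"
      using braid[OF that] by (simp add: pass_def m_assoc)
    have "gi (Suc i) \<otimes> gi i \<otimes> (g i \<otimes> g (Suc i)) = gi (Suc i) \<otimes> ((gi i \<otimes> g i) \<otimes> g (Suc i))"
      by (simp only: m_assoc m_closed gi_closed g_closed)
    then show "gi (Suc i) \<otimes> gi i \<otimes> (g i \<otimes> g (Suc i)) = \<one>" using that by (simp add: gi_g)
    have "g i \<otimes> g (Suc i) \<otimes> (gi (Suc i) \<otimes> gi i) = g i \<otimes> ((g (Suc i) \<otimes> gi (Suc i)) \<otimes> gi i)"
      by (simp only: m_assoc m_closed gi_closed g_closed)
    then show "g i \<otimes> g (Suc i) \<otimes> (gi (Suc i) \<otimes> gi i) = \<one>" using that by (simp add: gi_g)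
  qed simp_all
  have 3: "pass (t j) (gi i) (t (transpose i (Suc i) j))" if "1 \<le> i" "i < n" "1 \<le> j" "j \<le> n" for i j
  proof -
    have "pass (t (transpose i (Suc i) j)) (g i) (t j)"
      using t_g_pass[of i "transpose i (Suc i) j"] that by (auto simp: transpose_def split: if_splits)
    then show ?thesis by (rule pass_inverse) (use that in \<open>simp_all add: gi_g\<close>)
  qed
  have 4: "\<exists>z\<in>Z. \<forall>i. 1 \<le> i \<and> i < n \<longrightarrow> g i = gi i \<oplus> z \<otimes> e i"
    using Dl_Z by (intro bexI[of _ Dl]) (auto simp: gi_def a_minus_def a_assoc l_neg)
  have 5: "\<exists>z\<in>Z. \<forall>i. 1 \<le> i \<and> i < n \<longrightarrow> g i \<otimes> gi i = \<one> \<oplus> z \<otimes> (e i \<otimes> g i)"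
    using Z_zero by (intro bexI[of _ \<zero>]) (auto simp: gi_g)
  show ?thesis unfolding good_def using 1 2 3 4 5 gi_closed by blast
qed

lemma pass_t_nw: "\<lbrakk>1 \<le> k; k \<le> n; a \<le> d\<rbrakk> \<Longrightarrow> pass (t k) (nw a) (t k)"
  by (rule pass_nw) (auto simp: pass_def t_X)

lemma pass_g_nw: "\<lbrakk>2 \<le> i; i < n; a \<le> d\<rbrakk> \<Longrightarrow> pass (g i) (nw a) (g i)"
  by (rule pass_nw) (auto simp: pass_def g_X)

lemma pass_t_up:
  assumes "1 \<le> l" "l \<le> n" "m < n"
  shows "pass (t l) (up m) (t (if l = 1 then Suc m else if l \<le> Suc m then l - 1 else l))"
  using assms(3)
proof (induction m)
  case 0
  then show ?case using assms by (simp add: pass_one)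
next
  case (Suc m)
  define l' where "l' = (if l = 1 then Suc m else if l \<le> Suc m then l - 1 else l)"
  have "pass (t l) (up (Suc m)) (t (transpose (Suc m) (Suc (Suc m)) l'))"
    using Suc assms unfolding up.simps
    by (intro pass_mult[where ?x1.0 = "t l'"] t_g_pass) (auto simp: l'_def)
  also have "transpose (Suc m) (Suc (Suc m)) l' =
      (if l = 1 then Suc (Suc m) else if l \<le> Suc (Suc m) then l - 1 else l)"
    using assms by (auto simp: l'_def transpose_def)
  finally show ?case .
qed

lemma pass_g_up_high: "m + 2 \<le> l \<Longrightarrow> l < n \<Longrightarrow> pass (g l) (up m) (g l)"
  by (induction m) (auto simp: pass_one intro!: pass_mult[where ?x1.0 = "g l"] g_far_pass)

lemma pass_g_up: "2 \<le> l \<Longrightarrow> l \<le> m \<Longrightarrow> m < n \<Longrightarrow> pass (g l) (up m) (g (l - 1))"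
proof (induction m)
  case (Suc m)
  show ?case
  proof (cases "l = Suc m")
    case True
    then obtain m' where m': "m = Suc m'" using Suc.prems by (cases m) auto
    have "pass (g (Suc (Suc m'))) (g (Suc m') \<otimes> g (Suc (Suc m'))) (g (Suc m'))"
      using braid[of "Suc m'"] Suc.prems m' by (simp add: pass_def m_assoc)
    then have "pass (g l) (up m' \<otimes> (g (Suc m') \<otimes> g (Suc (Suc m')))) (g (l - 1))"
      using True m' Suc.prems by (intro pass_mult[OF pass_g_up_high]) auto
    then show ?thesis using m' by (simp add: m_assoc)
  next
    case False
    then show ?thesis using Suc unfolding up.simps
      by (intro pass_mult[where ?x1.0 = "g (l - 1)"] g_far_pass) auto
  qed
qed simp

context
  fixes s assumes s: "good s"
begin

lemma s_closed[simp]: "s i \<in> carrier A"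
  using s by (simp add: good_def)

lemma s_pass:
  "\<lbrakk>1 \<le> i; i < n; 1 \<le> j; j < n; i + 2 \<le> j \<or> j + 2 \<le> i\<rbrakk> \<Longrightarrow> pass (g i) (s j) (g i)"
  "\<lbrakk>1 \<le> i; Suc i < n\<rbrakk> \<Longrightarrow> pass (g i) (s (Suc i) \<otimes> s i) (g (Suc i))"
  "\<lbrakk>1 \<le> i; i < n; 1 \<le> j; j \<le> n\<rbrakk> \<Longrightarrow> pass (t j) (s i) (t (transpose i (Suc i) j))"
  using s by (auto simp: good_def)

lemma dn_closed[simp]: "dn s p \<in> carrier A"
  by (induction p) simp_all

lemma pass_t_dn:
  assumes "1 \<le> k" "k \<le> n" "p < n"
  shows "pass (t k) (dn s p) (t (if k = Suc p then 1 else if k \<le> p then Suc k else k))"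
  using assms
proof (induction p arbitrary: k)
  case (Suc p)
  define k' where "k' = transpose (Suc p) (Suc (Suc p)) k"
  have k': "1 \<le> k'" "k' \<le> n" using Suc.prems by (auto simp: k'_def transpose_def)
  have "pass (t k) (dn s (Suc p)) (t (if k' = Suc p then 1 else if k' \<le> p then Suc k' else k'))"
    unfolding dn.simps using Suc.prems k' s_pass(3)[of "Suc p" k]
    by (intro pass_mult[where ?x1.0 = "t k'"] Suc.IH) (auto simp: k'_def)
  also have "(if k' = Suc p then 1 else if k' \<le> p then Suc k' else k') =
      (if k = Suc (Suc p) then 1 else if k \<le> Suc p then Suc k else k)"
    by (auto simp: k'_def transpose_def)
  finally show ?case .
qed (use pass_one in auto)

lemma pass_g_dn_high: "p + 2 \<le> i \<Longrightarrow> i < n \<Longrightarrow> pass (g i) (dn s p) (g i)"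
  by (induction p) (auto simp: pass_one intro!: pass_mult[where ?x1.0 = "g i"] s_pass)

lemma pass_g_dn: "1 \<le> i \<Longrightarrow> i < p \<Longrightarrow> p < n \<Longrightarrow> pass (g i) (dn s p) (g (Suc i))"
proof (induction p)
  case (Suc p)
  show ?case
  proof (cases "p = i")
    case True
    then obtain p' where p': "p = Suc p'" using Suc.prems by (cases p) auto
    have "pass (g i) ((s (Suc i) \<otimes> s i) \<otimes> dn s p') (g (Suc i))"
      using True p' Suc.prems by (intro pass_mult[OF s_pass(2) pass_g_dn_high]) auto
    then show ?thesis using p' True by (simp add: m_assoc)
  next
    case False
    then show ?thesis using Suc unfolding dn.simps
      by (intro pass_mult[where ?x1.0 = "g i"] s_pass) auto
  qed
qed simp

lemma col_closed[simp]: "\<gamma> \<in> idx r d m' \<Longrightarrow> col s m \<gamma> \<in> carrier A"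
  by (auto simp: col_def idx_def)

lemma word_closed: "\<beta> \<in> words r d m \<Longrightarrow> word s \<beta> \<in> carrier A"
  by (induction m arbitrary: \<beta>) auto

lemma zsub_S: "zsub (S s m)"
  unfolding S_def by (rule zsub_zspan) (auto intro: word_closed)

lemma S_carrier: "x \<in> S s m \<Longrightarrow> x \<in> carrier A"
  using zsubD[OF zsub_S] by blast

lemma col_S:
  assumes "\<gamma> \<in> idx r d (Suc m)" "w \<in> S s m"
  shows "col s m \<gamma> \<otimes> w \<in> S s (Suc m)"
proof (rule zspan_mult[OF _ _ zsub_S _ assms(2)[unfolded S_def]])
  fix b assume "b \<in> word s ` words r d m"
  then obtain \<beta> where \<beta>: "b = word s \<beta>" "\<beta> \<in> words r d m" by auto
  then have "col s m \<gamma> \<otimes> b = word s (\<gamma> # \<beta>)" by (simp add: length_words)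
  then show "col s m \<gamma> \<otimes> b \<in> S s (Suc m)"
    unfolding S_def using \<beta> assms Cons_words[of \<gamma> \<beta> r d m]
    by (simp only:) (intro zspan_base imageI, blast)
qed (use assms word_closed in auto)

text \<open>To show that multiplication by $y$ maps the span of words into a given span, it
  suffices to multiply a single level times an element of the lower span.\<close>

lemma S_Suc_mult:
  assumes y: "y \<in> carrier A" and zs: "zsub T"
    and step: "\<And>\<gamma> w. \<gamma> \<in> idx r d (Suc m) \<Longrightarrow> w \<in> S s m \<Longrightarrow> y \<otimes> (col s m \<gamma> \<otimes> w) \<in> T"
    and x: "x \<in> S s (Suc m)"
  shows "y \<otimes> x \<in> T"
proof (rule zspan_mult[OF y _ zs _ x[unfolded S_def]])
  fix b assume "b \<in> word s ` words r d (Suc m)"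
  then obtain \<gamma> \<beta> where *: "b = word s (\<gamma> # \<beta>)" "\<gamma> \<in> idx r d (Suc m)" "\<beta> \<in> words r d m" by auto
  then have "word s \<beta> \<in> S s m" unfolding S_def by (intro zspan_base) auto
  then show "y \<otimes> b \<in> T" using step[of \<gamma> "word s \<beta>"] * by (simp add: length_words)
qed (use word_closed in auto)

text \<open>A level permutes the elements $t_k$ cyclically, and the last of them is absorbed by
  its power of $t$.\<close>

lemma t_col:
  assumes "1 \<le> k" "k \<le> Suc m" "m < n" "(j, a, b) \<in> idx r d (Suc m)"
  shows "pass (t k) (col s m (j, a, b)) (t (if k = j then Suc m else if k < j then k else k - 1))"
proof -
  define k1 where "k1 = (if k = j then 1 else if k < j then Suc k else k)"
  define k2 where "k2 = (if k1 = 1 then Suc m else if k1 \<le> Suc m then k1 - 1 else k1)"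
  have idx: "1 \<le> j" "j \<le> Suc m" "a \<le> d" using assms by (auto simp: idx_def)
  have k1: "1 \<le> k1" "k1 \<le> Suc m" using assms idx by (auto simp: k1_def)
  have k2: "1 \<le> k2" "k2 \<le> Suc m" using k1 by (auto simp: k2_def)
  have "pass (t k) (dn s (j - 1)) (t k1)"
  proof -
    have "k1 = (if k = Suc (j - 1) then 1 else if k \<le> j - 1 then Suc k else k)"
      using idx by (auto simp: k1_def)
    then show ?thesis using pass_t_dn[of k "j - 1"] assms idx by simp
  qed
  moreover have "pass (t k1) (up m) (t k2)"
    using pass_t_up[of k1 m] k1 assms by (simp add: k2_def)
  moreover have "pass (t k1) (nw a) (t k1)" using k1 idx assms by (intro pass_t_nw) auto
  moreover have "pass (t k2) (t (Suc m) [^] b) (t k2)"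
    using k2 assms by (intro pass_pow) (auto simp: pass_def t_t[of k2 "Suc m"])
  ultimately have "pass (t k) (col s m (j, a, b)) (t k2)"
    unfolding col_def prod.case using idx by (intro pass_mult4[where y = "t k1"]) simp_all
  also have "k2 = (if k = j then Suc m else if k < j then k else k - 1)"
    using idx assms by (auto simp: k2_def k1_def)
  finally show ?thesis .
qed

lemma t_S: "\<lbrakk>m \<le> n; 1 \<le> k; k \<le> m; x \<in> S s m\<rbrakk> \<Longrightarrow> t k \<otimes> x \<in> S s m"
proof (induction m arbitrary: k x)
  case (Suc m)
  show ?case
  proof (rule S_Suc_mult[OF _ zsub_S _ Suc.prems(4)])
    fix \<gamma> w assume \<gamma>: "\<gamma> \<in> idx r d (Suc m)" and w: "w \<in> S s m"
    obtain j a b where \<gamma>': "\<gamma> = (j, a, b)" by (cases \<gamma>)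
    have wc: "w \<in> carrier A" using w by (rule S_carrier)
    have idx: "1 \<le> j" "j \<le> Suc m" "a < d" "b < r" using \<gamma> \<gamma>' by (auto simp: idx_def)
    let ?k = "if k = j then Suc m else if k < j then k else k - 1"
    have eq: "t k \<otimes> (col s m \<gamma> \<otimes> w) = col s m \<gamma> \<otimes> (t ?k \<otimes> w)"
      using t_col[of k m j a b] Suc.prems \<gamma> wc unfolding \<gamma>' by (intro passD) auto
    show "t k \<otimes> (col s m \<gamma> \<otimes> w) \<in> S s (Suc m)"
    proof (cases "k = j")
      case True
      have eq2: "t k \<otimes> (col s m \<gamma> \<otimes> w) =
          dn s (j - 1) \<otimes> (nw a \<otimes> (up m \<otimes> (t (Suc m) [^] Suc b))) \<otimes> w"
        using eq True wc idx unfolding \<gamma>' by (simp add: col_def m_assoc)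
      show ?thesis
      proof (cases "Suc b < r")
        case True
        then have "col s m (j, a, Suc b) \<otimes> w \<in> S s (Suc m)"
          using idx w by (intro col_S) (auto simp: idx_def)
        then show ?thesis unfolding eq2 by (simp add: col_def)
      next
        case False
        then have "Suc b = r" using idx by simp
        then have "t (Suc m) [^] Suc b = \<one>" using t_root[of "Suc m"] Suc.prems by simp
        then have "t k \<otimes> (col s m \<gamma> \<otimes> w) = col s m (j, a, 0) \<otimes> w"
          unfolding eq2 by (simp add: col_def)
        then show ?thesis using col_S[of "(j, a, 0)" m w] idx w r_pos by (simp add: idx_def)
      qed
    next
      case False
      have "t ?k \<otimes> w \<in> S s m" using False Suc.prems idx w by (intro Suc.IH) auto
      then show ?thesis unfolding eq by (intro col_S \<gamma>)
    qed
  qed simp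
qed simp

lemma e_S: "\<lbrakk>m \<le> n; 1 \<le> i; i < m; x \<in> S s m\<rbrakk> \<Longrightarrow> e i \<otimes> x \<in> S s m"
  by (rule e_absorb[OF _ _ zsub_S]) (auto intro!: t_S)

text \<open>The generator $g_i$ meets block $j$ of the top level. If $j$ is neither $i$ nor
  $i+1$, it passes through the level and acts on the lower span; otherwise it exchanges the
  blocks $i$ and $i+1$ up to a term with $e_i$, which the span absorbs.\<close>

lemma g_S: "\<lbrakk>m \<le> n; 1 \<le> i; i < m; x \<in> S s m\<rbrakk> \<Longrightarrow> g i \<otimes> x \<in> S s m"
proof (induction m arbitrary: i x)
  case (Suc m)
  have pow: "pass (g l) (t (Suc m) [^] b) (g l)" if "1 \<le> l" "l < m" for l and b :: nat
    using g_t[of l "Suc m"] that Suc.prems by (intro pass_pow) (auto simp: pass_def transpose_def)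
  from s obtain z z' where z: "z \<in> Z" "\<And>i. 1 \<le> i \<Longrightarrow> i < n \<Longrightarrow> g i = s i \<oplus> z \<otimes> e i"
    and z': "z' \<in> Z" "\<And>i. 1 \<le> i \<Longrightarrow> i < n \<Longrightarrow> g i \<otimes> s i = \<one> \<oplus> z' \<otimes> (e i \<otimes> g i)"
    unfolding good_def by blast
  have same: "g j \<otimes> (col s m (j, a, b) \<otimes> w) \<in> S s (Suc m)"
    if j: "1 \<le> j" "j \<le> m" "a < d" "b < r" and w: "w \<in> S s m" for j a b w
  proof -
    have wc: "w \<in> carrier A" using w by (rule S_carrier)
    let ?c = "col s m (j, a, b) \<otimes> w"
    have c: "?c \<in> S s (Suc m)" using j w by (intro col_S) (auto simp: idx_def)
    have cc: "?c \<in> carrier A" using c by (rule S_carrier)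
    have "s j \<otimes> dn s (j - 1) = dn s j" using j by (cases j) auto
    then have sc: "s j \<otimes> ?c = col s m (Suc j, a, b) \<otimes> w"
      using j wc by (simp add: col_def m_assoc[symmetric])
    have "g j \<otimes> ?c = s j \<otimes> ?c \<oplus> z \<otimes> (e j \<otimes> ?c)"
      using z j Suc.prems cc by (subst z(2)) (auto simp: l_distr m_assoc)
    moreover have "s j \<otimes> ?c \<in> S s (Suc m)" unfolding sc using j w by (intro col_S) (auto simp: idx_def)
    moreover have "e j \<otimes> ?c \<in> S s (Suc m)" using j c Suc.prems by (intro e_S) auto
    ultimately show ?thesis using zsubD[OF zsub_S] z by simp
  qed
  show ?case
  proof (rule S_Suc_mult[OF _ zsub_S _ Suc.prems(4)])
    fix \<gamma> w assume \<gamma>: "\<gamma> \<in> idx r d (Suc m)" and w: "w \<in> S s m"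
    obtain j a b where \<gamma>': "\<gamma> = (j, a, b)" by (cases \<gamma>)
    have wc: "w \<in> carrier A" using w by (rule S_carrier)
    have idx: "1 \<le> j" "j \<le> Suc m" "a < d" "b < r" using \<gamma> \<gamma>' by (auto simp: idx_def)
    have through: "g i \<otimes> (col s m \<gamma> \<otimes> w) \<in> S s (Suc m)"
      if "pass (g i) (dn s (j - 1)) (g l)" "2 \<le> l" "l \<le> m" for l
    proof -
      have "pass (g i) (col s m \<gamma>) (g (l - 1))"
        unfolding col_def \<gamma>' prod.case using that idx Suc.prems
        by (intro pass_mult4[where y = "g l"] pass_g_nw pass_g_up pow) auto
      then have "g i \<otimes> (col s m \<gamma> \<otimes> w) = col s m \<gamma> \<otimes> (g (l - 1) \<otimes> w)"
        using \<gamma> wc by (intro passD) auto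
      moreover have "g (l - 1) \<otimes> w \<in> S s m" using that Suc.prems w by (intro Suc.IH) auto
      ultimately show ?thesis using col_S[OF \<gamma>] by simp
    qed
    consider "j < i" | "j = i" | "j = Suc i" | "Suc i < j" by linarith
    then show "g i \<otimes> (col s m \<gamma> \<otimes> w) \<in> S s (Suc m)"
    proof cases
      case 1
      then show ?thesis using idx Suc.prems by (intro through[of i] pass_g_dn_high) auto
    next
      case 2
      then show ?thesis using same[of j a b w] idx Suc.prems w \<gamma>' by simp
    next
      case 3
      let ?c = "col s m (i, a, b) \<otimes> w"
      have c: "?c \<in> S s (Suc m)" using 3 idx Suc.prems w by (intro col_S) (auto simp: idx_def)
      have cc: "?c \<in> carrier A" using c by (rule S_carrier)
      have "dn s i = s i \<otimes> dn s (i - 1)" using Suc.prems by (cases i) auto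
      then have "col s m \<gamma> \<otimes> w = s i \<otimes> ?c"
        using 3 \<gamma>' wc idx by (simp add: col_def m_assoc)
      then have "g i \<otimes> (col s m \<gamma> \<otimes> w) = (g i \<otimes> s i) \<otimes> ?c" using cc by (simp add: m_assoc)
      also have "\<dots> = ?c \<oplus> z' \<otimes> (e i \<otimes> (g i \<otimes> ?c))"
        using z' Suc.prems cc by (subst z'(2)) (auto simp: l_distr m_assoc)
      finally have eq: "g i \<otimes> (col s m \<gamma> \<otimes> w) = ?c \<oplus> z' \<otimes> (e i \<otimes> (g i \<otimes> ?c))" .
      have "g i \<otimes> ?c \<in> S s (Suc m)" using same[of i a b w] 3 idx Suc.prems w by simp
      then have "e i \<otimes> (g i \<otimes> ?c) \<in> S s (Suc m)" using Suc.prems by (intro e_S) auto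
      then show ?thesis unfolding eq using c z' zsubD[OF zsub_S] by simp
    next
      case 4
      then show ?thesis using idx Suc.prems by (intro through[of "Suc i"] pass_g_dn) auto
    qed
  qed simp
qed simp

end

end

section \<open>Multiplication by X\<close>

context yh_ring begin

text \<open>Since $g_1 X g_1$ commutes with $p$, one has $g_1^{-1} p \, g_1 X = X g_1 \, p \,
  g_1^{-1}$; replacing $g_1^{-1}$ by $g_1 - (q - q^{-1}) e_1$ on both sides gives the formula.
  It is used for $p = p_a(X)$.\<close>

lemma X_g_p_g:
  assumes n: "2 \<le> n" and p: "p \<in> carrier A" "pass X1 p X1" "pass (e 1) p (e 1)"
    "pass (g 1 \<otimes> X1 \<otimes> g 1) p (g 1 \<otimes> X1 \<otimes> g 1)"
  shows "X1 \<otimes> (g 1 \<otimes> (p \<otimes> g 1)) = g 1 \<otimes> (p \<otimes> (g 1 \<otimes> X1))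
    \<ominus> Dl \<otimes> (e 1 \<otimes> (p \<otimes> (g 1 \<otimes> X1))) \<oplus> Dl \<otimes> (e 1 \<otimes> (X1 \<otimes> (g 1 \<otimes> p)))"
proof -
  let ?g = "g 1" and ?gi = "gi 1" and ?e = "e 1"
  have gg: "?gi \<otimes> ?g = \<one>" "?g \<otimes> ?gi = \<one>" using gi_g[of 1] n by auto
  have eg: "?e \<otimes> ?g = ?g \<otimes> ?e" and eX: "?e \<otimes> X1 = X1 \<otimes> ?e" using e_g[of 1] e_X[of 1] n by auto
  have ep: "?e \<otimes> p = p \<otimes> ?e" using p by (simp add: pass_def)
  have gpgX: "?gi \<otimes> (p \<otimes> (?g \<otimes> X1)) = X1 \<otimes> (?g \<otimes> (p \<otimes> ?gi))"
  proof -
    have "?gi \<otimes> (p \<otimes> (?g \<otimes> X1)) = ?gi \<otimes> (p \<otimes> (?g \<otimes> (X1 \<otimes> (?g \<otimes> ?gi))))" using gg by simp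
    also have "\<dots> = ?gi \<otimes> ((p \<otimes> (?g \<otimes> X1 \<otimes> ?g)) \<otimes> ?gi)"
      using p by (simp only: m_assoc m_closed g_closed gi_closed X_closed)
    also have "p \<otimes> (?g \<otimes> X1 \<otimes> ?g) = (?g \<otimes> X1 \<otimes> ?g) \<otimes> p" using p(4) by (simp only: pass_def)
    also have "?gi \<otimes> ((?g \<otimes> X1 \<otimes> ?g) \<otimes> p \<otimes> ?gi) = (?gi \<otimes> ?g) \<otimes> (X1 \<otimes> (?g \<otimes> (p \<otimes> ?gi)))"
      using p by (simp only: m_assoc m_closed g_closed gi_closed X_closed)
    finally show ?thesis using gg p by simp
  qed
  let ?A = "?g \<otimes> (p \<otimes> (?g \<otimes> X1))" and ?B = "Dl \<otimes> (?e \<otimes> (p \<otimes> (?g \<otimes> X1)))"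
    and ?C = "X1 \<otimes> (?g \<otimes> (p \<otimes> ?g))" and ?D = "Dl \<otimes> (?e \<otimes> (X1 \<otimes> (?g \<otimes> p)))"
  have c: "?A \<in> carrier A" "?B \<in> carrier A" "?C \<in> carrier A" "?D \<in> carrier A" using p by simp_all
  have 1: "?gi \<otimes> (p \<otimes> (?g \<otimes> X1)) = ?A \<ominus> ?B"
    using p by (simp add: gi_def a_minus_def l_distr l_minus m_assoc)
  have "?e \<otimes> (X1 \<otimes> (?g \<otimes> p)) = X1 \<otimes> (?g \<otimes> (p \<otimes> ?e))"
  proof -
    have "?e \<otimes> (X1 \<otimes> (?g \<otimes> p)) = (?e \<otimes> X1) \<otimes> (?g \<otimes> p)" using p by (simp add: m_assoc)
    also have "\<dots> = X1 \<otimes> ((?e \<otimes> ?g) \<otimes> p)" unfolding eX using p by (simp add: m_assoc)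
    also have "\<dots> = X1 \<otimes> (?g \<otimes> (?e \<otimes> p))" unfolding eg using p by (simp add: m_assoc)
    finally show ?thesis unfolding ep .
  qed
  then have 2: "X1 \<otimes> (?g \<otimes> (p \<otimes> ?gi)) = ?C \<ominus> ?D"
    using p by (simp add: gi_def a_minus_def r_distr r_minus Dl_move)
  have "?C = (?C \<ominus> ?D) \<oplus> ?D" using c by (simp add: a_minus_def a_assoc l_neg)
  also have "?C \<ominus> ?D = ?A \<ominus> ?B" using gpgX unfolding 1 2 by simp
  finally show ?thesis .
qed

text \<open>The products $g_{p+1} \cdots g_2$ and $g_2 \cdots g_{m+1}$, which commute with $X$.\<close>

primrec dn2 where "dn2 0 = \<one>" | "dn2 (Suc p) = g (Suc (Suc p)) \<otimes> dn2 p"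
primrec up2 where "up2 0 = \<one>" | "up2 (Suc m) = up2 m \<otimes> g (Suc (Suc m))"

lemma dn2_closed[simp]: "dn2 p \<in> carrier A"
  by (induction p) simp_all

lemma up2_closed[simp]: "up2 m \<in> carrier A"
  by (induction m) simp_all

lemma dn_g_closed[simp]: "dn g p \<in> carrier A"
  by (rule dn_closed[OF good_g])

lemma dn_dn2: "dn g (Suc p) = dn2 p \<otimes> g 1"
  by (induction p) (simp_all add: m_assoc)

lemma up_up2: "up (Suc m) = g 1 \<otimes> up2 m"
  by (induction m) (simp_all add: m_assoc)

lemma pass_X_dn2: "Suc p < n \<Longrightarrow> pass X1 (dn2 p) X1"
proof (induction p)
  case (Suc p)
  then show ?case unfolding dn2.simps
    by (intro pass_mult[where ?x1.0 = X1]) (auto simp: pass_def g_X)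
qed (simp add: pass_one)

lemma pass_X_up2: "Suc m < n \<Longrightarrow> pass X1 (up2 m) X1"
proof (induction m)
  case (Suc p)
  then show ?case unfolding up2.simps
    by (intro pass_mult[where ?x1.0 = X1]) (auto simp: pass_def g_X)
qed (simp add: pass_one)

lemma dn2_S: "\<lbrakk>m \<le> n; Suc p < m; x \<in> S g m\<rbrakk> \<Longrightarrow> dn2 p \<otimes> x \<in> S g m"
proof (induction p)
  case 0
  then show ?case using S_carrier[OF good_g] by simp
next
  case (Suc p)
  then have "g (Suc (Suc p)) \<otimes> (dn2 p \<otimes> x) \<in> S g m" by (intro g_S[OF good_g]) auto
  then show ?case using Suc.prems S_carrier[OF good_g, of x m] by (simp add: m_assoc)
qed

lemma nw_S:
  assumes X: "\<And>x. x \<in> S g m \<Longrightarrow> X1 \<otimes> x \<in> S g m" and "x \<in> S g m" "k \<le> d"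
  shows "nw k \<otimes> x \<in> S g m"
  using assms(3)
proof (induction k)
  case 0
  then show ?case using assms S_carrier[OF good_g] by simp
next
  case (Suc k)
  note z = zsubD[OF zsub_S[OF good_g]]
  have y: "nw k \<otimes> x \<in> S g m" "nw k \<otimes> x \<in> carrier A" "x \<in> carrier A"
    using Suc assms S_carrier[OF good_g] by auto
  have "(X1 \<ominus> u k) \<otimes> (nw k \<otimes> x) = X1 \<otimes> (nw k \<otimes> x) \<ominus> u k \<otimes> (nw k \<otimes> x)"
    using y Suc.prems by (simp add: a_minus_def l_distr l_minus)
  also have "\<dots> \<in> S g m" using Suc.prems by (intro z(6)[OF X[OF y(1)] z(4)[OF u_Z y(1)]]) simp
  finally show ?case using y Suc.prems by (simp add: m_assoc)
qed

text \<open>In block $1$ the factor $X$ is absorbed by the Newton product. In a higher block it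
  passes the generators $g_i$ with $i \ge 2$ and then meets $g_1 p_a(X) g_1$. The commutation
  formula expresses the result by words followed by $X$, which acts on the lower span, and by
  $X$ times a word in block $1$.\<close>

lemma X_S: "\<lbrakk>m \<le> n; 1 \<le> m; x \<in> S g m\<rbrakk> \<Longrightarrow> X1 \<otimes> x \<in> S g m"
proof (induction m arbitrary: x)
  case (Suc m)
  note z = zsubD[OF zsub_S[OF good_g]]
  note carr = S_carrier[OF good_g]
  have block1: "X1 \<otimes> (col g m (1, a, b) \<otimes> w) \<in> S g (Suc m)"
    if "a < d" "b < r" and w: "w \<in> S g m" for a b w
  proof -
    have wc: "w \<in> carrier A" using w by (rule carr)
    let ?y = "up m \<otimes> t (Suc m) [^] b \<otimes> w"
    have eq: "X1 \<otimes> nw a = nw (Suc a) \<oplus> u a \<otimes> nw a"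
      using that by (simp add: a_minus_def l_distr l_minus a_assoc l_neg)
    have "X1 \<otimes> (col g m (1, a, b) \<otimes> w) = (X1 \<otimes> nw a) \<otimes> ?y"
      using that wc by (simp add: col_def m_assoc)
    also have "\<dots> = nw (Suc a) \<otimes> ?y \<oplus> u a \<otimes> (col g m (1, a, b) \<otimes> w)"
      unfolding eq using that wc by (simp add: l_distr col_def m_assoc del: nw_simps(2))
    also have "\<dots> \<in> S g (Suc m)"
    proof (rule z(3)[OF _ z(4)])
      show "u a \<in> Z" using that u_Z by simp
      show "col g m (1, a, b) \<otimes> w \<in> S g (Suc m)"
        using that by (intro col_S[OF good_g]) (auto simp: idx_def)
      show "nw (Suc a) \<otimes> ?y \<in> S g (Suc m)"
      proof (cases "Suc a < d")
        case True
        then have "col g m (1, Suc a, b) \<otimes> w \<in> S g (Suc m)"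
          using that by (intro col_S[OF good_g]) (auto simp: idx_def)
        then show ?thesis using True wc by (simp add: col_def m_assoc del: nw_simps(2))
      next
        case False
        then have "Suc a = d" using that by simp
        then show ?thesis using nw_d wc z(2) by (simp del: nw_simps(2))
      qed
    qed
    finally show ?thesis .
  qed
  show ?case
  proof (rule S_Suc_mult[OF good_g _ zsub_S[OF good_g] _ Suc.prems(3)])
    fix \<gamma> w assume \<gamma>: "\<gamma> \<in> idx r d (Suc m)" and w: "w \<in> S g m"
    obtain j a b where \<gamma>': "\<gamma> = (j, a, b)" by (cases \<gamma>)
    have idx: "1 \<le> j" "j \<le> Suc m" "a < d" "b < r" using \<gamma> \<gamma>' by (auto simp: idx_def)
    have wc: "w \<in> carrier A" using w by (rule carr)
    show "X1 \<otimes> (col g m \<gamma> \<otimes> w) \<in> S g (Suc m)"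
    proof (cases "j = 1")
      case True
      then show ?thesis using block1 idx w \<gamma>' by simp
    next
      case False
      then obtain p where p: "j = Suc (Suc p)" using idx by (metis One_nat_def Suc_le_D le_SucE)
      then obtain m' where m': "m = Suc m'" "p \<le> m'" using idx by (cases m) auto
      have n: "2 \<le> n" "Suc m' < n" "Suc p < n" using m' Suc.prems by auto
      let ?g = "g 1" and ?e = "e 1" and ?nw = "nw a"
      define T where "T = t (Suc m) [^] b"
      have Tc: "T \<in> carrier A" by (simp add: T_def)
      have XT: "pass X1 T X1" unfolding T_def using Suc.prems
        by (intro pass_pow) (auto simp: pass_def t_X)
      have nwT: "pass ?nw T ?nw"
      proof -
        have "pass T ?nw T" using Tc idx XT by (intro pass_nw) (auto simp: pass_def)
        then show ?thesis by (simp add: pass_def)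
      qed
      have nw_up2: "pass ?nw (up2 m') ?nw"
      proof -
        have "pass (up2 m') ?nw (up2 m')"
          using idx pass_X_up2[OF n(2)] by (intro pass_nw) (auto simp: pass_def)
        then show ?thesis by (simp add: pass_def)
      qed
      have c: "T \<in> carrier A" "w \<in> carrier A" "?nw \<in> carrier A" using Tc wc idx by auto
      define Y where "Y = up2 m' \<otimes> (T \<otimes> w)"
      have Yc: "Y \<in> carrier A" using c by (simp add: Y_def)
      have XY: "X1 \<otimes> Y = up2 m' \<otimes> (T \<otimes> (X1 \<otimes> w))"
        unfolding Y_def using c pass_X_up2[OF n(2)] XT by (simp add: passD)
      have nwY: "?nw \<otimes> Y = up2 m' \<otimes> (T \<otimes> (?nw \<otimes> w))"
        unfolding Y_def using c nw_up2 nwT by (simp add: passD)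
      have colY: "col g m (j, a, b) \<otimes> v = dn g (j - 1) \<otimes> (?nw \<otimes> (?g \<otimes> (up2 m' \<otimes> (T \<otimes> v))))"
        if "v \<in> carrier A" "1 \<le> j" for v j
        using that c unfolding col_def prod.case m'(1) up_up2 T_def[symmetric, unfolded m'(1)]
        by (simp add: m_assoc)
      have Xw: "X1 \<otimes> w \<in> S g m" using m' w Suc.prems by (intro Suc.IH) auto
      have Xwc: "X1 \<otimes> w \<in> carrier A" using c by simp
      have nww: "?nw \<otimes> w \<in> S g m" using m' w Suc.prems Suc.IH idx by (intro nw_S) auto
      have comm: "X1 \<otimes> (?g \<otimes> (?nw \<otimes> ?g)) = ?g \<otimes> (?nw \<otimes> (?g \<otimes> X1))
        \<ominus> Dl \<otimes> (?e \<otimes> (?nw \<otimes> (?g \<otimes> X1))) \<oplus> Dl \<otimes> (?e \<otimes> (X1 \<otimes> (?g \<otimes> ?nw)))"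
      proof (rule X_g_p_g[OF n(1) c(3)])
        show "pass X1 ?nw X1" using idx by (intro pass_nw) (auto simp: pass_def)
        show "pass ?e ?nw ?e" using idx n e_X[of 1] by (intro pass_nw) (auto simp: pass_def)
        show "pass (?g \<otimes> X1 \<otimes> ?g) ?nw (?g \<otimes> X1 \<otimes> ?g)"
          using idx n g_X_g_X by (intro pass_nw) (auto simp: pass_def m_assoc)
      qed
      let ?D = "dn2 p"
      define c2 where "c2 = col g m (j, a, b) \<otimes> (X1 \<otimes> w)"
      define c1 where "c1 = col g m (1, a, b) \<otimes> (X1 \<otimes> w)"
      define c0 where "c0 = X1 \<otimes> (col g m (1, 0, b) \<otimes> (?nw \<otimes> w))"
      have cS: "c2 \<in> S g (Suc m)" "c1 \<in> S g (Suc m)" "c0 \<in> S g (Suc m)"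
        unfolding c2_def c1_def c0_def using idx Xw nww block1[OF d_pos idx(4) nww]
        by (auto intro!: col_S[OF good_g] simp: idx_def)
      have cc: "c2 \<in> carrier A" "c1 \<in> carrier A" "c0 \<in> carrier A" using cS carr by auto
      have c2_eq: "?D \<otimes> (?g \<otimes> (?nw \<otimes> (?g \<otimes> (X1 \<otimes> Y)))) = c2"
        unfolding c2_def XY colY[OF Xwc idx(1)] using c p by (simp add: dn_dn2 m_assoc del: dn.simps)
      have c1_eq: "?nw \<otimes> (?g \<otimes> (X1 \<otimes> Y)) = c1"
        unfolding c1_def XY colY[OF Xwc order_refl] using c by simp
      have c0_eq: "X1 \<otimes> (?g \<otimes> (?nw \<otimes> Y)) = c0"
      proof -
        have "col g m (1, 0, b) \<otimes> (?nw \<otimes> w) = ?g \<otimes> (up2 m' \<otimes> (T \<otimes> (?nw \<otimes> w)))"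
          using c unfolding col_def prod.case m'(1) up_up2 T_def[symmetric, unfolded m'(1)]
          by (simp add: m_assoc)
        then show ?thesis unfolding c0_def nwY by simp
      qed
      have "X1 \<otimes> (col g m \<gamma> \<otimes> w) = X1 \<otimes> (?D \<otimes> (?g \<otimes> (?nw \<otimes> (?g \<otimes> Y))))"
        unfolding \<gamma>' colY[OF wc idx(1)] Y_def using c p by (simp add: dn_dn2 m_assoc del: dn.simps)
      also have "\<dots> = ?D \<otimes> (X1 \<otimes> (?g \<otimes> (?nw \<otimes> (?g \<otimes> Y))))"
        using c Yc n by (intro passD pass_X_dn2) auto
      also have "X1 \<otimes> (?g \<otimes> (?nw \<otimes> (?g \<otimes> Y))) = (X1 \<otimes> (?g \<otimes> (?nw \<otimes> ?g))) \<otimes> Y"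
        using c Yc by (simp add: m_assoc)
      also have "\<dots> = ?g \<otimes> (?nw \<otimes> (?g \<otimes> (X1 \<otimes> Y))) \<ominus> Dl \<otimes> (?e \<otimes> c1) \<oplus> Dl \<otimes> (?e \<otimes> c0)"
        unfolding comm c1_eq[symmetric] c0_eq[symmetric]
        using c Yc by (simp add: a_minus_def l_distr l_minus m_assoc)
      also have "?D \<otimes> \<dots> = c2 \<ominus> ?D \<otimes> (Dl \<otimes> (?e \<otimes> c1)) \<oplus> ?D \<otimes> (Dl \<otimes> (?e \<otimes> c0))"
        unfolding c2_eq[symmetric] using c Yc cc by (simp add: a_minus_def r_distr r_minus)
      also have "\<dots> \<in> S g (Suc m)"
      proof (rule z(3)[OF z(6)])
        have *: "?D \<otimes> (Dl \<otimes> (?e \<otimes> v)) \<in> S g (Suc m)" if "v \<in> S g (Suc m)" for v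
          using that Suc.prems m' by (intro dn2_S z(4)[OF Dl_Z] e_S[OF good_g]) auto
        show "c2 \<in> S g (Suc m)" "?D \<otimes> (Dl \<otimes> (?e \<otimes> c1)) \<in> S g (Suc m)"
          "?D \<otimes> (Dl \<otimes> (?e \<otimes> c0)) \<in> S g (Suc m)" using cS * by auto
      qed
      finally show ?thesis .
    qed
  qed simp
qed simp

lemma dn_S:
  assumes s: "good s" and s': "good s'" and "m \<le> n" "p < m" "x \<in> S s' m"
  shows "dn s p \<otimes> x \<in> S s' m"
  using assms(4)
proof (induction p)
  case 0
  then show ?case using S_carrier[OF s'] assms by simp
next
  case (Suc p)
  note z = zsubD[OF zsub_S[OF s']]
  from s obtain y where y: "y \<in> Z" "\<And>i. 1 \<le> i \<Longrightarrow> i < n \<Longrightarrow> g i = s i \<oplus> y \<otimes> e i"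
    unfolding good_def by blast
  let ?x = "dn s p \<otimes> x"
  have x: "?x \<in> S s' m" "?x \<in> carrier A" "x \<in> carrier A" using Suc S_carrier[OF s'] assms by auto
  have sc: "s (Suc p) \<in> carrier A" using s by (simp add: good_def)
  have "s (Suc p) = (s (Suc p) \<oplus> y \<otimes> e (Suc p)) \<ominus> y \<otimes> e (Suc p)"
    using sc y(1) by (simp add: a_minus_def a_assoc r_neg)
  also have "\<dots> = g (Suc p) \<ominus> y \<otimes> e (Suc p)" using y(2)[of "Suc p"] Suc.prems assms by simp
  finally have "s (Suc p) \<otimes> ?x = (g (Suc p) \<ominus> y \<otimes> e (Suc p)) \<otimes> ?x" by (rule arg_cong)
  also have "\<dots> = g (Suc p) \<otimes> ?x \<ominus> y \<otimes> (e (Suc p) \<otimes> ?x)"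
    using x y by (simp add: a_minus_def l_distr l_minus m_assoc)
  also have "\<dots> \<in> S s' m"
    using x Suc.prems assms by (intro z(6)[OF _ z(4)[OF y(1)]] g_S[OF s'] e_S[OF s']) auto
  finally show ?case using x sc dn_closed[OF s] by (simp add: m_assoc)
qed

text \<open>The two kinds of columns have the same span, because $g_i$ and its inverse differ by
  a multiple of $e_i$, which the span absorbs.\<close>

lemma S_mono:
  assumes s: "good s" and s': "good s'" and "m \<le> n"
  shows "S s m \<subseteq> S s' m"
  using assms(3)
proof (induction m)
  case 0
  then show ?case by (simp add: S_def)
next
  case (Suc m)
  have "\<one> \<otimes> x \<in> S s' (Suc m)" if "x \<in> S s (Suc m)" for x
  proof (rule S_Suc_mult[OF s _ zsub_S[OF s'] _ that])
    fix \<gamma> w assume \<gamma>: "\<gamma> \<in> idx r d (Suc m)" and w: "w \<in> S s m"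
    obtain j a b where \<gamma>': "\<gamma> = (j, a, b)" by (cases \<gamma>)
    have idx: "1 \<le> j" "j \<le> Suc m" "a < d" "b < r" using \<gamma> \<gamma>' by (auto simp: idx_def)
    have w': "w \<in> S s' m" "w \<in> carrier A" using w Suc S_carrier[OF s] by auto
    have "col s' m (1, a, b) \<otimes> w \<in> S s' (Suc m)"
      using w' idx by (intro col_S[OF s']) (auto simp: idx_def)
    then have "dn s (j - 1) \<otimes> (col s' m (1, a, b) \<otimes> w) \<in> S s' (Suc m)"
      using Suc.prems idx by (intro dn_S[OF s s']) auto
    also have "dn s (j - 1) \<otimes> (col s' m (1, a, b) \<otimes> w) = col s m \<gamma> \<otimes> w"
      using w' idx dn_closed[OF s] by (simp add: \<gamma>' col_def m_assoc)
    finally show "\<one> \<otimes> (col s m \<gamma> \<otimes> w) \<in> S s' (Suc m)"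
      using w' \<gamma> col_closed[OF s \<gamma>] by simp
  qed simp
  then show ?case using S_carrier[OF s] by auto
qed

text \<open>The unit is the word of blocks $m+1$ at every level $m$: the inverse generators
  cancel $g_1 \cdots g_m$. This is visible only for the columns with inverses.\<close>

lemma one_S: assumes "m \<le> n" shows "\<one> \<in> S gi m"
  using assms
proof (induction m)
  case 0
  then show ?case by (auto simp: S_def intro: zspan_base)
next
  case (Suc m)
  have "dn gi p \<otimes> up p = \<one>" if "p < n" for p
    using that
  proof (induction p)
    case (Suc p)
    have "dn gi (Suc p) \<otimes> up (Suc p) = gi (Suc p) \<otimes> ((dn gi p \<otimes> up p) \<otimes> g (Suc p))"
      using dn_closed[OF good_gi] by (simp add: m_assoc)
    then show ?case using Suc gi_g[of "Suc p"] by simp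
  qed simp
  then have "col gi m (Suc m, 0, 0) = \<one>" using Suc.prems dn_closed[OF good_gi] by (simp add: col_def)
  moreover have "col gi m (Suc m, 0, 0) \<otimes> \<one> \<in> S gi (Suc m)"
    using Suc d_pos r_pos by (intro col_S[OF good_gi]) (auto simp: idx_def)
  ultimately show ?case by simp
qed

theorem span_closed:
  assumes n: "1 \<le> n" and s: "s = g \<or> s = gi"
  shows "zsub (S s n)" "\<one> \<in> S s n"
    "\<And>k x. 1 \<le> k \<Longrightarrow> k \<le> n \<Longrightarrow> x \<in> S s n \<Longrightarrow> t k \<otimes> x \<in> S s n"
    "\<And>i x. 1 \<le> i \<Longrightarrow> i < n \<Longrightarrow> x \<in> S s n \<Longrightarrow> g i \<otimes> x \<in> S s n"
    "\<And>x. x \<in> S s n \<Longrightarrow> X1 \<otimes> x \<in> S s n"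
proof -
  have eq: "S s n = S g n"
    using s S_mono[OF good_g good_gi order_refl] S_mono[OF good_gi good_g order_refl] by auto
  have "\<one> \<in> S g n" using S_mono[OF good_gi good_g order_refl] one_S by auto
  then show "zsub (S s n)" "\<one> \<in> S s n"
    "\<And>k x. 1 \<le> k \<Longrightarrow> k \<le> n \<Longrightarrow> x \<in> S s n \<Longrightarrow> t k \<otimes> x \<in> S s n"
    "\<And>i x. 1 \<le> i \<Longrightarrow> i < n \<Longrightarrow> x \<in> S s n \<Longrightarrow> g i \<otimes> x \<in> S s n"
    "\<And>x. x \<in> S s n \<Longrightarrow> X1 \<otimes> x \<in> S s n"
    unfolding eq using zsub_S[OF good_g] t_S[OF good_g] g_S[OF good_g] X_S n by auto
qed

end

section \<open>The ground ring and the free algebra\<close>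

lemma ring_of_subset:
  fixes S :: "('s::ring_1, 'm) ring_scheme"
  assumes ops: "monoid.mult S = (*)" "one S = 1" "ring.zero S = 0" "add S = (+)"
    and closed: "1 \<in> carrier S" "\<And>x y. x \<in> carrier S \<Longrightarrow> y \<in> carrier S \<Longrightarrow> x + y \<in> carrier S"
      "\<And>x y. x \<in> carrier S \<Longrightarrow> y \<in> carrier S \<Longrightarrow> x * y \<in> carrier S"
      "\<And>x. x \<in> carrier S \<Longrightarrow> - x \<in> carrier S"
  shows "ring S" and "x \<in> carrier S \<Longrightarrow> y \<in> carrier S \<Longrightarrow> x \<ominus>\<^bsub>S\<^esub> y = x - y"
    "x \<in> carrier S \<Longrightarrow> \<ominus>\<^bsub>S\<^esub> x = - x"
proof -
  have zero: "0 \<in> carrier S" using closed(2)[OF closed(1) closed(4)[OF closed(1)]] by simp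
  have "abelian_group S"
    by (rule abelian_groupI) (auto simp: ops closed zero algebra_simps intro: bexI[of _ "- x" for x])
  moreover have "monoid S" by (rule monoidI) (auto simp: ops closed algebra_simps)
  ultimately show R: "ring S" by (rule ringI) (auto simp: ops algebra_simps)
  interpret ring S by (rule R)
  have minus: "\<ominus>\<^bsub>S\<^esub> x = - x" if "x \<in> carrier S" for x
    using that closed(4) by (intro minus_equality) (auto simp: ops)
  then show "x \<in> carrier S \<Longrightarrow> \<ominus>\<^bsub>S\<^esub> x = - x" .
  show "x \<in> carrier S \<Longrightarrow> y \<in> carrier S \<Longrightarrow> x \<ominus>\<^bsub>S\<^esub> y = x - y"
    by (simp add: a_minus_def minus ops)
qed

definition subring_set :: "'s::ring_1 set \<Rightarrow> bool"
  where "subring_set C \<longleftrightarrow> 1 \<in> C \<and> (\<forall>x\<in>C. \<forall>y\<in>C. x + y \<in> C \<and> x * y \<in> C) \<and> (\<forall>x\<in>C. - x \<in> C)"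

lemma subring_setD:
  assumes "subring_set C"
  shows "1 \<in> C" "0 \<in> C" "x \<in> C \<Longrightarrow> y \<in> C \<Longrightarrow> x + y \<in> C" "x \<in> C \<Longrightarrow> y \<in> C \<Longrightarrow> x * y \<in> C"
    "x \<in> C \<Longrightarrow> - x \<in> C" "x \<in> C \<Longrightarrow> y \<in> C \<Longrightarrow> x - y \<in> C"
proof -
  have n: "x - y \<in> C" if "x \<in> C" "y \<in> C" for x y
    using assms that unfolding subring_set_def diff_conv_add_uminus by blast
  show "0 \<in> C" using n[of 1 1] assms by (auto simp: subring_set_def)
qed (use assms in \<open>auto simp: subring_set_def simp flip: diff_conv_add_uminus\<close>,
  metis diff_conv_add_uminus)

lemma ring_of_subring_set:
  fixes S :: "('s::ring_1, 'm) ring_scheme"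
  assumes ops: "monoid.mult S = (*)" "one S = 1" "ring.zero S = 0" "add S = (+)"
    and sub: "subring_set (carrier S)"
  shows "ring S" and "x \<in> carrier S \<Longrightarrow> y \<in> carrier S \<Longrightarrow> x \<ominus>\<^bsub>S\<^esub> y = x - y"
  using ring_of_subset(1,2)[OF ops subring_setD(1,3,4,5)[OF sub]] by blast+

lemma subring_set_sum: "subring_set C \<Longrightarrow> (\<And>i. i \<in> I \<Longrightarrow> f i \<in> C) \<Longrightarrow> sum f I \<in> C"
  by (induction I rule: infinite_finite_induct) (auto simp: subring_setD)

lemma subring_set_power: "subring_set C \<Longrightarrow> x \<in> C \<Longrightarrow> x ^ k \<in> C"
  by (induction k) (auto simp: subring_setD)

text \<open>Both the ground ring and the free algebra consist of the finitely supported
  functions with coefficients in a subring and support in a submonoid.\<close>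

definition pm_over :: "'c::ring_1 set \<Rightarrow> 'w set \<Rightarrow> ('w::monoid_add \<Rightarrow>\<^sub>0 'c) set"
  where "pm_over C S = {f. \<forall>w\<in>Poly_Mapping.keys f. Poly_Mapping.lookup f w \<in> C \<and> w \<in> S}"

lemma pm_overD:
  assumes "subring_set C"
  shows "f \<in> pm_over C S \<longleftrightarrow> (\<forall>w. Poly_Mapping.lookup f w \<in> C) \<and> Poly_Mapping.keys f \<subseteq> S"
  using subring_setD(2)[OF assms] by (force simp: pm_over_def in_keys_iff)

lemma pm_over_single: "subring_set C \<Longrightarrow> c \<in> C \<Longrightarrow> w \<in> S \<Longrightarrow> Poly_Mapping.single w c \<in> pm_over C S"
  by (auto simp: pm_over_def)

lemma pm_sum_monomials:
  "finite A \<Longrightarrow> Poly_Mapping.keys f \<subseteq> A \<Longrightarrow> f = (\<Sum>w\<in>A. Poly_Mapping.single w (Poly_Mapping.lookup f w))"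
proof (rule poly_mapping_eqI)
  fix v assume A: "finite A" "Poly_Mapping.keys f \<subseteq> A"
  have "Poly_Mapping.lookup (\<Sum>w\<in>A. Poly_Mapping.single w (Poly_Mapping.lookup f w)) v =
      (\<Sum>w\<in>A. if w = v then Poly_Mapping.lookup f v else 0)"
    by (simp add: lookup_sum lookup_single when_def) (rule sum.cong, auto)
  also have "\<dots> = Poly_Mapping.lookup f v" using A by (auto simp: in_keys_iff)
  finally show "Poly_Mapping.lookup f v = 
    Poly_Mapping.lookup (\<Sum>w\<in>A. Poly_Mapping.single w (Poly_Mapping.lookup f w)) v" ..
qed

lemma subring_pm_over:
  assumes C: "subring_set C" and S: "0 \<in> S" "\<And>v w. v \<in> S \<Longrightarrow> w \<in> S \<Longrightarrow> v + w \<in> S"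
  shows "subring_set (pm_over C S)"
proof -
  note D = pm_overD[OF C] and sd = subring_setD[OF C]
  have add: "f + h \<in> pm_over C S" if "f \<in> pm_over C S" "h \<in> pm_over C S" for f h
    using that Poly_Mapping.keys_add[of f h] by (auto simp: D lookup_add sd)
  have sum: "sum F I \<in> pm_over C S" if "\<And>i. i \<in> I \<Longrightarrow> F i \<in> pm_over C S" for F and I :: "'x set"
    using that by (induction I rule: infinite_finite_induct) (auto simp: add, auto simp: D sd)
  have mult: "f * h \<in> pm_over C S" if f: "f \<in> pm_over C S" and h: "h \<in> pm_over C S" for f h
  proof -
    let ?l = Poly_Mapping.lookup
    have "f * h = (\<Sum>w\<in>Poly_Mapping.keys f. Poly_Mapping.single w (?l f w)) *
        (\<Sum>v\<in>Poly_Mapping.keys h. Poly_Mapping.single v (?l h v))"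
      by (rule arg_cong2[where f = "(*)", OF pm_sum_monomials pm_sum_monomials]) auto
    also have "\<dots> = (\<Sum>w\<in>Poly_Mapping.keys f. \<Sum>v\<in>Poly_Mapping.keys h.
        Poly_Mapping.single (w + v) (?l f w * ?l h v))"
      by (simp add: sum_product mult_single)
    also have "\<dots> \<in> pm_over C S"
      using f h by (intro sum pm_over_single C S(2)) (auto simp: D intro!: sd)
    finally show ?thesis .
  qed
  have "(1 :: 'b \<Rightarrow>\<^sub>0 'a) \<in> pm_over C S" using pm_over_single[OF C sd(1) S(1)] by simp
  moreover have "- f \<in> pm_over C S" if "f \<in> pm_over C S" for f
    using that by (auto simp: D sd)
  ultimately show ?thesis by (simp add: subring_set_def add mult)
qed

lemma subring_coeff_ring: "subring_set (coeff_ring r)"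
proof -
  let ?R = "\<lparr>carrier = UNIV, monoid.mult = (*), one = 1, ring.zero = 0, add = (+)\<rparr> :: complex ring"
  let ?H = "{1 / of_nat r, exp (2 * of_real pi * \<i> / of_nat r)} :: complex set"
  have minus: "\<ominus>\<^bsub>?R\<^esub> x = - x" for x by (rule ring_of_subset(3)) simp_all
  let ?C = "generate_ring ?R ?H"
  have "1 \<in> ?C" using generate_ring.one[of ?R ?H] by simp
  moreover have "x + y \<in> ?C" if "x \<in> ?C" "y \<in> ?C" for x y
    using generate_ring.eng_add[OF that] by simp
  moreover have "x * y \<in> ?C" if "x \<in> ?C" "y \<in> ?C" for x y
    using generate_ring.eng_mult[OF that] by simp
  moreover have "- x \<in> ?C" if "x \<in> ?C" for x
    using generate_ring.a_inv[OF that] by (simp only: minus)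
  ultimately show ?thesis unfolding subring_set_def coeff_ring_def by blast
qed

lemma inverse_r_coeff_ring: "1 / of_nat r \<in> coeff_ring r"
  unfolding coeff_ring_def by (rule generate_ring.incl) simp

lemma ground_ring_pm_over: "carrier (ground_ring r d) =
    pm_over (coeff_ring r) {m. Poly_Mapping.keys m \<subseteq> insert Var_q (Var_v ` {1..d})}"
  by (auto simp: ground_ring_def pm_over_def)

lemma subring_ground_ring: "subring_set (carrier (ground_ring r d))"
  unfolding ground_ring_pm_over
proof (rule subring_pm_over[OF subring_coeff_ring], simp)
  fix v w :: "indet \<Rightarrow>\<^sub>0 int"
  let ?S = "{m. Poly_Mapping.keys m \<subseteq> insert Var_q (Var_v ` {1..d})} :: (indet \<Rightarrow>\<^sub>0 int) set"
  show "v \<in> ?S \<Longrightarrow> w \<in> ?S \<Longrightarrow> v + w \<in> ?S" using Poly_Mapping.keys_add[of v w] by auto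
qed

lemma cring_ground_ring: "cring (ground_ring r d)"
proof -
  have "ring (ground_ring r d)"
    by (rule ring_of_subring_set[OF _ _ _ _ subring_ground_ring]) (simp_all add: ground_ring_def)
  then show ?thesis
    by (intro cring.intro comm_monoid.intro comm_monoid_axioms.intro ring.is_monoid)
      (simp_all add: ground_ring_def mult.commute)
qed

lemma yh_free_algebra_pm_over: "carrier (yh_free_algebra r n d) =
    pm_over (carrier (ground_ring r d)) {w. set (letters w) \<subseteq> yh_gens n}"
  by (auto simp: yh_free_algebra_def free_algebra_def pm_over_def)

lemma subring_yh_free_algebra: "subring_set (carrier (yh_free_algebra r n d))"
  unfolding yh_free_algebra_pm_over
  by (rule subring_pm_over[OF subring_ground_ring])
    (auto simp: zero_free_monoid_def plus_free_monoid_def)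

lemma yh_free_algebra_ops:
  "monoid.mult (yh_free_algebra r n d) = (*)" "one (yh_free_algebra r n d) = 1"
  "ring.zero (yh_free_algebra r n d) = 0" "add (yh_free_algebra r n d) = (+)"
  "module.smult (yh_free_algebra r n d) = (\<lambda>c f. scalar c * f)"
  by (simp_all add: yh_free_algebra_def free_algebra_def scalar_def fun_eq_iff)

lemma ring_yh_free_algebra: "ring (yh_free_algebra r n d)"
  and minus_yh_free_algebra: "x \<in> carrier (yh_free_algebra r n d) \<Longrightarrow> y \<in> carrier (yh_free_algebra r n d) \<Longrightarrow>
    x \<ominus>\<^bsub>yh_free_algebra r n d\<^esub> y = x - y"
  using ring_of_subring_set[OF yh_free_algebra_ops(1-4) subring_yh_free_algebra] by blast+

lemma scalar_closed: "c \<in> carrier (ground_ring r d) \<Longrightarrow> scalar c \<in> carrier (yh_free_algebra r n d)"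
  unfolding yh_free_algebra_pm_over scalar_def
  by (rule pm_over_single[OF subring_ground_ring]) (simp_all add: zero_free_monoid_def)

lemma gen_closed: "x \<in> yh_gens n \<Longrightarrow> gen x \<in> carrier (yh_free_algebra r n d)"
  unfolding yh_free_algebra_pm_over gen_def
  by (rule pm_over_single[OF subring_ground_ring])
    (simp_all add: subring_setD[OF subring_ground_ring])

lemma scalar_hom: "scalar (a + b) = scalar a + scalar b" "scalar (a * b) = scalar a * scalar b"
  "scalar 1 = 1" "scalar 0 = 0" "scalar (- a) = - scalar a"
  by (simp_all add: scalar_def single_add mult_single single_uminus)

lemma scalar_central:
  fixes f :: "'g free_monoid \<Rightarrow>\<^sub>0 'c::comm_ring_1"
  shows "scalar c * f = f * scalar c"
proof -
  have "scalar c * Poly_Mapping.single w b = Poly_Mapping.single w b * scalar c"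
    for w :: "'g free_monoid" and b
    by (simp add: scalar_def mult_single mult.commute)
  then have "scalar c * (\<Sum>w\<in>A. Poly_Mapping.single w (h w)) = (\<Sum>w\<in>A. Poly_Mapping.single w (h w)) * scalar c"
    for A :: "'g free_monoid set" and h by (simp add: sum_distrib_left sum_distrib_right)
  then show ?thesis using pm_sum_monomials[of "Poly_Mapping.keys f" f] by (metis finite_keys order_refl)
qed

lemma assoc_yh_free_algebra: "assoc_algebra (ground_ring r d) (yh_free_algebra r n d)"
proof -
  note sd = subring_setD[OF subring_yh_free_algebra]
  have "module (ground_ring r d) (yh_free_algebra r n d)"
    by (rule moduleI[OF cring_ground_ring ring.is_abelian_group[OF ring_yh_free_algebra]])
      (auto simp: yh_free_algebra_ops ground_ring_def scalar_hom algebra_simps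
        intro!: sd scalar_closed[unfolded ground_ring_def])
  then show ?thesis
    by (intro assoc_algebra.intro assoc_algebra_axioms.intro ring_yh_free_algebra)
      (auto simp: yh_free_algebra_ops mult.assoc, metis mult.assoc scalar_central)
qed

section \<open>Quotients\<close>

lemma ring_fields_cong:
  assumes T: "ring T"
    and eq: "carrier S = carrier T" "monoid.mult S = monoid.mult T" "one S = one T"
      "ring.zero S = ring.zero T" "add S = add T"
  shows "ring S"
proof -
  interpret T: ring T by (rule T)
  have "abelian_group S"
    by (rule abelian_groupI) (auto simp: eq T.a_ac T.l_neg intro!: bexI[of _ "\<ominus>\<^bsub>T\<^esub> x" for x])
  moreover have "monoid S" by (rule monoidI) (auto simp: eq T.m_assoc)
  ultimately show ?thesis by (rule ringI) (auto simp: eq T.l_distr T.r_distr)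
qed

lemma quot_algebra_fields:
  "carrier (quot_algebra A I) = carrier (A Quot I)" "monoid.mult (quot_algebra A I) = monoid.mult (A Quot I)"
  "one (quot_algebra A I) = one (A Quot I)" "ring.zero (quot_algebra A I) = ring.zero (A Quot I)"
  "add (quot_algebra A I) = add (A Quot I)"
  "module.smult (quot_algebra A I) = (\<lambda>c S. \<Union>x\<in>S. I +>\<^bsub>A\<^esub> (c \<odot>\<^bsub>A\<^esub> x))"
  by (simp_all add: quot_algebra_def ring.defs module.defs)

text \<open>Scalars act on cosets through multiples of the unit, and an ideal is stable under
  these.\<close>

lemma quot_algebra:
  fixes S (structure) and A (structure)
  assumes A: "assoc_algebra S A" and I: "ideal I A"
  defines "B \<equiv> quot_algebra A I" and "p \<equiv> (\<lambda>x. I +>\<^bsub>A\<^esub> x)"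
  shows "assoc_algebra S B" "p \<in> ring_hom A B" "carrier B = p ` carrier A"
    "\<And>c x. c \<in> carrier S \<Longrightarrow> x \<in> carrier A \<Longrightarrow> c \<odot>\<^bsub>B\<^esub> p x = p (c \<odot>\<^bsub>A\<^esub> x)"
    "\<And>x y. x \<in> carrier A \<Longrightarrow> y \<in> carrier A \<Longrightarrow> p x = p y \<longleftrightarrow> x \<ominus>\<^bsub>A\<^esub> y \<in> I"
proof -
  interpret A: assoc_algebra S A by (rule A)
  interpret I: ideal I A by (rule I)
  have rB: "ring B" unfolding B_def
    by (rule ring_fields_cong[OF I.quotient_is_ring quot_algebra_fields(1-5)])
  have hom: "p \<in> ring_hom A (A Quot I)" unfolding p_def by (rule I.rcos_ring_hom)
  then show hom': "p \<in> ring_hom A B"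
    by (simp add: ring_hom_def B_def quot_algebra_fields)
  show carr: "carrier B = p ` carrier A"
    by (auto simp: B_def quot_algebra_fields FactRing_def A_RCOSETS_def' p_def)
  show eq: "p x = p y \<longleftrightarrow> x \<ominus>\<^bsub>A\<^esub> y \<in> I" if "x \<in> carrier A" "y \<in> carrier A" for x y
    unfolding p_def using A.quotient_eq_iff_same_a_r_cos[OF I that] by simp
  show sm: "c \<odot>\<^bsub>B\<^esub> p x = p (c \<odot>\<^bsub>A\<^esub> x)" if c: "c \<in> carrier S" and x: "x \<in> carrier A" for c x
  proof -
    have "p (c \<odot>\<^bsub>A\<^esub> y) = p (c \<odot>\<^bsub>A\<^esub> x)" if y: "y \<in> p x" for y
    proof -
      have yc: "y \<in> carrier A" using y x A.a_r_coset_subset_G[OF I.a_subset] unfolding p_def by blast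
      have "p y = p x" unfolding p_def using I.a_repr_independence'[of y x] y x unfolding p_def by simp
      then have "y \<ominus>\<^bsub>A\<^esub> x \<in> I" using eq yc x by simp
      then have "(c \<odot>\<^bsub>A\<^esub> \<one>\<^bsub>A\<^esub>) \<otimes>\<^bsub>A\<^esub> (y \<ominus>\<^bsub>A\<^esub> x) \<in> I" using c by (intro I.I_l_closed) auto
      also have "(c \<odot>\<^bsub>A\<^esub> \<one>\<^bsub>A\<^esub>) \<otimes>\<^bsub>A\<^esub> (y \<ominus>\<^bsub>A\<^esub> x) = c \<odot>\<^bsub>A\<^esub> (y \<ominus>\<^bsub>A\<^esub> x)"
        using c yc x by (simp add: A.smult_mult_left)
      also have "\<dots> = (c \<odot>\<^bsub>A\<^esub> y) \<ominus>\<^bsub>A\<^esub> (c \<odot>\<^bsub>A\<^esub> x)"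
      proof -
        have "c \<odot>\<^bsub>A\<^esub> (\<ominus>\<^bsub>A\<^esub> x) = \<ominus>\<^bsub>A\<^esub> (c \<odot>\<^bsub>A\<^esub> x)"
          using c x by (rule A.smult_r_minus)
        then show ?thesis using c yc x by (simp add: a_minus_def A.smult_r_distr)
      qed
      finally show ?thesis using eq c yc x by simp
    qed
    moreover have "x \<in> p x" unfolding p_def using I.a_rcos_self x by simp
    ultimately show ?thesis unfolding B_def quot_algebra_fields p_def by blast
  qed
  interpret B: ring B by (rule rB)
  interpret h: ring_hom_ring A B p
    by (intro ring_hom_ringI2 A.ring_axioms rB hom')
  have "module S B"
  proof (rule moduleI)
    show "cring S" by (rule A.R.cring_axioms)
    show "abelian_group B" by (rule B.abelian_group_axioms)
  qed (auto simp: carr sm simp flip: h.hom_add simp: A.smult_l_distr A.smult_r_distr A.smult_assoc1)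
  then show "assoc_algebra S B"
    by (intro assoc_algebra.intro assoc_algebra_axioms.intro rB)
      (auto simp: carr sm simp flip: h.hom_mult simp: A.smult_mult_left A.smult_mult_right)
qed

lemma ideal_image:
  assumes h: "ring_hom_ring A B p" and surj: "carrier B = p ` carrier A" and K: "ideal K A"
  shows "ideal (p ` K) B"
proof -
  interpret h: ring_hom_ring A B p by (rule h)
  interpret K: ideal K A by (rule K)
  show ?thesis
  proof (rule idealI[OF h.S.ring_axioms])
    show "subgroup (p ` K) (add_monoid B)"
    proof (rule h.S.add.subgroupI)
      show "p ` K \<subseteq> carrier B" using K.a_subset by auto
      show "p ` K \<noteq> {}" using subgroup.one_closed[OF K.a_subgroup] by blast
      show "a \<in> p ` K \<Longrightarrow> \<ominus>\<^bsub>B\<^esub> a \<in> p ` K" for a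
        using K.a_subset by (auto simp flip: h.hom_a_inv)
      show "a \<in> p ` K \<Longrightarrow> b \<in> p ` K \<Longrightarrow> a \<oplus>\<^bsub>B\<^esub> b \<in> p ` K" for a b
        using K.a_subset by (auto simp: subset_iff simp flip: h.hom_add)
    qed
    show "x \<otimes>\<^bsub>B\<^esub> a \<in> p ` K" "a \<otimes>\<^bsub>B\<^esub> x \<in> p ` K" if "a \<in> p ` K" "x \<in> carrier B" for a x
      using that K.a_subset K.I_l_closed K.I_r_closed unfolding surj
      by (auto simp: subset_iff simp flip: h.hom_mult)
  qed
qed

section \<open>The cyclotomic algebra as a quotient of the free algebra\<close>

abbreviation cycl :: "nat \<Rightarrow> yh_free"
  where "cycl d \<equiv> prod_list (map (\<lambda>k. yX - scalar (indet_power (Var_v k) 1)) [1..<Suc d])"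

lemma laurent_const_ground_ring: "c \<in> coeff_ring r \<Longrightarrow> laurent_const c \<in> carrier (ground_ring r d)"
  unfolding ground_ring_pm_over laurent_const_def by (rule pm_over_single[OF subring_coeff_ring]) simp_all

lemma indet_power_ground_ring:
  "x \<in> insert Var_q (Var_v ` {1..d}) \<Longrightarrow> indet_power x k \<in> carrier (ground_ring r d)"
  unfolding ground_ring_pm_over indet_power_def
  by (rule pm_over_single[OF subring_coeff_ring]) (auto simp: subring_setD[OF subring_coeff_ring])

lemma ye_closed:
  assumes "1 \<le> i" "i < n" shows "ye r i \<in> carrier (yh_free_algebra r n d)"
  unfolding ye_def using assms
  by (intro subring_setD(4)[OF subring_yh_free_algebra] subring_set_sum[OF subring_yh_free_algebra]
      subring_set_power[OF subring_yh_free_algebra] scalar_closed laurent_const_ground_ring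
      inverse_r_coeff_ring gen_closed) (auto simp: yh_gens_def)

lemma yh_gens_simps[simp]:
  "Gen_t i \<in> yh_gens n \<longleftrightarrow> 1 \<le> i \<and> i \<le> n" "Gen_g i \<in> yh_gens n \<longleftrightarrow> 1 \<le> i \<and> i < n"
  "Gen_X \<in> yh_gens n" "Gen_X_inv \<in> yh_gens n"
  by (auto simp: yh_gens_def)

lemma yh_relations_closed: "yh_relations r n \<subseteq> carrier (yh_free_algebra r n d)"
proof -
  note sd = subring_setD[OF subring_yh_free_algebra[of r n d]]
  have q: "scalar (indet_power Var_q 1 - indet_power Var_q (- 1)) \<in> carrier (yh_free_algebra r n d)"
    by (intro scalar_closed subring_setD(6)[OF subring_ground_ring] indet_power_ground_ring) auto
  have t: "1 \<le> i \<Longrightarrow> i \<le> n \<Longrightarrow> yt i \<in> carrier (yh_free_algebra r n d)"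
    and g: "1 \<le> i \<Longrightarrow> i < n \<Longrightarrow> yg i \<in> carrier (yh_free_algebra r n d)"
    and X: "yX \<in> carrier (yh_free_algebra r n d)" "yX_inv \<in> carrier (yh_free_algebra r n d)" for i
    by (auto intro!: gen_closed)
  note P = subring_set_power[OF subring_yh_free_algebra[of r n d]]
  show ?thesis unfolding yh_relations_def
    by (auto simp: transpose_def intro!: sd q t g X P ye_closed split: if_splits)
qed

lemma prod_list_closed: "subring_set C \<Longrightarrow> (\<And>x. x \<in> set xs \<Longrightarrow> x \<in> C) \<Longrightarrow> prod_list xs \<in> C"
  by (induction xs) (auto simp: subring_setD)

lemma cycl_closed: "cycl d \<in> carrier (yh_free_algebra r n d)"
  by (rule prod_list_closed[OF subring_yh_free_algebra])
    (auto intro!: subring_setD(6)[OF subring_yh_free_algebra] gen_closed scalar_closed indet_power_ground_ring)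

text \<open>The algebra arises from the free algebra in two steps, first by the affine relations
  and then by the cyclotomic element. The composite quotient map is described by the properties
  that determine it; in particular its kernel lies in every ideal that contains the relations
  and the cyclotomic element, so that a representation of the free algebra which satisfies them
  factors through the quotient.\<close>

lemma cyclotomic_quotient:
  fixes r n d
  defines "FA \<equiv> yh_free_algebra r n d" and "C \<equiv> cyclotomic_yh r n d"
  obtains h where "assoc_algebra (ground_ring r d) C" "h \<in> ring_hom FA C" "carrier C = h ` carrier FA"
    "\<And>c x. c \<in> carrier (ground_ring r d) \<Longrightarrow> x \<in> carrier FA \<Longrightarrow> c \<odot>\<^bsub>C\<^esub> h x = h (scalar c * x)"
    "\<And>x y. x \<in> carrier FA \<Longrightarrow> y \<in> carrier FA \<Longrightarrow> x - y \<in> yh_relations r n \<Longrightarrow> h x = h y"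
    "h (cycl d) = \<zero>\<^bsub>C\<^esub>"
    "\<And>K x. ideal K FA \<Longrightarrow> yh_relations r n \<subseteq> K \<Longrightarrow> cycl d \<in> K \<Longrightarrow> x \<in> carrier FA \<Longrightarrow> 
      h x = \<zero>\<^bsub>C\<^esub> \<Longrightarrow> x \<in> K"
proof -
  define I where "I = Idl\<^bsub>FA\<^esub> (yh_relations r n)"
  define B where "B = quot_algebra FA I"
  define p where "p x = I +>\<^bsub>FA\<^esub> x" for x
  have FA: "assoc_algebra (ground_ring r d) FA" unfolding FA_def by (rule assoc_yh_free_algebra)
  interpret FA: ring FA unfolding FA_def by (rule ring_yh_free_algebra)
  have rel: "yh_relations r n \<subseteq> carrier FA" unfolding FA_def by (rule yh_relations_closed)
  have I: "ideal I FA" unfolding I_def by (rule FA.genideal_ideal[OF rel])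
  note q1 = quot_algebra[OF FA I, folded B_def p_def]
  define J where "J = Idl\<^bsub>B\<^esub> {p (cycl d)}"
  define p2 where "p2 y = J +>\<^bsub>B\<^esub> y" for y
  have B: "B = affine_yh r n d" by (simp add: B_def affine_yh_def I_def FA_def)
  have ce: "cyclotomic_element r n d = p (cycl d)"
    by (simp add: cyclotomic_element_def p_def I_def FA_def)
  have C: "C = quot_algebra B J" by (simp add: C_def cyclotomic_yh_def J_def ce B)
  interpret B: ring B using q1(1) by (simp add: assoc_algebra_def)
  have cyc: "cycl d \<in> carrier FA" unfolding FA_def by (rule cycl_closed)
  have pc: "p (cycl d) \<in> carrier B" using cyc q1(3) by blast
  have J: "ideal J B" unfolding J_def by (rule B.genideal_ideal) (use pc in simp)
  note q2 = quot_algebra[OF q1(1) J, folded C p2_def]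
  interpret C: ring C using q2(1) by (simp add: assoc_algebra_def)
  interpret p: ring_hom_ring FA B p by (rule ring_hom_ringI2[OF FA.ring_axioms B.ring_axioms q1(2)])
  interpret p2: ring_hom_ring B C p2 by (rule ring_hom_ringI2[OF B.ring_axioms C.ring_axioms q2(2)])
  have zero: "p2 y = \<zero>\<^bsub>C\<^esub> \<longleftrightarrow> y \<in> J" if "y \<in> carrier B" for y
    using q2(5)[OF that B.zero_closed] that by (simp add: a_minus_def)
  show thesis
  proof (rule that[of "\<lambda>x. p2 (p x)"])
    show "assoc_algebra (ground_ring r d) C" by (rule q2(1))
    show "(\<lambda>x. p2 (p x)) \<in> ring_hom FA C" by (rule ring_hom_memI) auto
    show "carrier C = (\<lambda>x. p2 (p x)) ` carrier FA" unfolding q2(3) q1(3) by auto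
    show "c \<odot>\<^bsub>C\<^esub> p2 (p x) = p2 (p (scalar c * x))" if "c \<in> carrier (ground_ring r d)" "x \<in> carrier FA" for c x
      using that q1(4)[OF that] q2(4)[of c "p x"] by (simp add: FA_def yh_free_algebra_ops)
    show "p2 (p x) = p2 (p y)" if "x \<in> carrier FA" "y \<in> carrier FA" "x - y \<in> yh_relations r n" for x y
    proof -
      have "x \<ominus>\<^bsub>FA\<^esub> y \<in> I" unfolding I_def using that FA.genideal_self[OF rel] minus_yh_free_algebra[of x r n d y]
        by (auto simp: FA_def)
      then show ?thesis using q1(5)[OF that(1,2)] by simp
    qed
    show "p2 (p (cycl d)) = \<zero>\<^bsub>C\<^esub>" using zero[OF pc] B.genideal_self'[OF pc] by (simp add: J_def)
    fix K x assume K: "ideal K FA" "yh_relations r n \<subseteq> K" "cycl d \<in> K" and x: "x \<in> carrier FA" 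
      and 0: "p2 (p x) = \<zero>\<^bsub>C\<^esub>"
    interpret K: ideal K FA by (rule K)
    have IK: "I \<subseteq> K" unfolding I_def by (rule FA.genideal_minimal[OF K(1,2)])
    have "ideal (p ` K) B" by (rule ideal_image[OF p.ring_hom_ring_axioms q1(3) K(1)])
    then have "J \<subseteq> p ` K" unfolding J_def using K(3) by (intro B.genideal_minimal) auto
    moreover have "p x \<in> J" using zero[of "p x"] 0 x by simp
    ultimately obtain k where k: "k \<in> K" "p x = p k" by blast
    have kc: "k \<in> carrier FA" using k K.a_subset by blast
    have "x \<ominus>\<^bsub>FA\<^esub> k \<in> K" using q1(5)[OF x kc] k IK by blast
    then have "(x \<ominus>\<^bsub>FA\<^esub> k) \<oplus>\<^bsub>FA\<^esub> k \<in> K" using k by (intro K.a_closed)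
    also have "(x \<ominus>\<^bsub>FA\<^esub> k) \<oplus>\<^bsub>FA\<^esub> k = x" using x kc by (simp add: a_minus_def FA.a_assoc FA.l_neg)
    finally show "x \<in> K" .
  qed
qed

section \<open>Evaluation of free algebra elements\<close>

text \<open>The action of the free algebra in which the generator $x$ acts as the operator
  \<open>op x\<close>.\<close>

definition ev :: "('g \<Rightarrow> ('i \<Rightarrow> 'c) \<Rightarrow> 'i \<Rightarrow> 'c) \<Rightarrow> ('g free_monoid \<Rightarrow>\<^sub>0 'c::comm_ring_1) \<Rightarrow> ('i \<Rightarrow> 'c) \<Rightarrow> 'i \<Rightarrow> 'c"
  where "ev op f z = (\<Sum>w\<in>Poly_Mapping.keys f. vsc (Poly_Mapping.lookup f w) (foldr op (letters w) z))"

locale evaluation =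
  fixes op :: "'g \<Rightarrow> ('i \<Rightarrow> 'c::comm_ring_1) \<Rightarrow> 'i \<Rightarrow> 'c"
  assumes op_lin: "linop vsc (op x)"
begin

sublocale V: Modules.module "vsc :: 'c \<Rightarrow> ('i \<Rightarrow> 'c) \<Rightarrow> 'i \<Rightarrow> 'c" by (rule module_vsc)

lemma foldr_lin: "linop vsc (foldr op ws)"
proof (induction ws)
  case (Cons x ws)
  have "foldr op (x # ws) = (\<lambda>z. op x (foldr op ws z))" by (simp add: fun_eq_iff)
  then show ?case using linmap_comp[OF op_lin Cons] by (simp only:)
qed (simp add: linmap_def)

lemma ev_superset:
  assumes "finite A" "Poly_Mapping.keys f \<subseteq> A"
  shows "ev op f z = (\<Sum>w\<in>A. vsc (Poly_Mapping.lookup f w) (foldr op (letters w) z))"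
  unfolding ev_def using assms by (intro sum.mono_neutral_left) (auto simp: in_keys_iff)

lemma ev_add: "ev op (f + h) z = ev op f z + ev op h z"
proof -
  let ?A = "Poly_Mapping.keys f \<union> Poly_Mapping.keys h"
  have A: "finite ?A" "Poly_Mapping.keys f \<subseteq> ?A" "Poly_Mapping.keys h \<subseteq> ?A" "Poly_Mapping.keys (f + h) \<subseteq> ?A"
    using Poly_Mapping.keys_add[of f h] by auto
  show ?thesis
    by (simp add: ev_superset[OF A(1,2)] ev_superset[OF A(1,3)] ev_superset[OF A(1,4)] lookup_add
        V.scale_left_distrib sum.distrib)
qed

lemma ev_zero: "ev op 0 z = 0"
  by (simp add: ev_def)

lemma ev_sum: "ev op (sum F I) z = (\<Sum>i\<in>I. ev op (F i) z)"
  by (induction I rule: infinite_finite_induct) (simp_all add: ev_zero ev_add)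

lemma ev_diff: "ev op (f - h) z = ev op f z - ev op h z"
  using ev_add[of "f - h" h z] by simp

lemma ev_single: "ev op (Poly_Mapping.single w c) z = vsc c (foldr op (letters w) z)"
  by (cases "c = 0") (simp_all add: ev_def)

lemma ev_lin: "linop vsc (ev op f)"
  by (rule linmapI) (simp_all add: ev_def linmap_simps[OF foldr_lin] V.scale_right_distrib sum.distrib
    V.scale_sum_right mult.commute)

lemmas ev_simps = linmap_simps[OF ev_lin]

lemma ev_mult: "ev op (f * h) z = ev op f (ev op h z)"
proof -
  let ?l = Poly_Mapping.lookup and ?k = Poly_Mapping.keys
  have "f * h = (\<Sum>w\<in>?k f. Poly_Mapping.single w (?l f w)) * (\<Sum>v\<in>?k h. Poly_Mapping.single v (?l h v))"
    by (rule arg_cong2[where f = "(*)", OF pm_sum_monomials pm_sum_monomials]) auto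
  also have "\<dots> = (\<Sum>w\<in>?k f. \<Sum>v\<in>?k h. Poly_Mapping.single (w + v) (?l f w * ?l h v))"
    by (simp add: sum_product mult_single)
  finally have "ev op (f * h) z = (\<Sum>w\<in>?k f. \<Sum>v\<in>?k h. vsc (?l f w * ?l h v) (foldr op (letters w) (foldr op (letters v) z)))"
    by (simp add: ev_sum ev_single plus_free_monoid_def)
  also have "\<dots> = ev op f (ev op h z)"
    by (simp add: ev_def linmap_simps[OF foldr_lin] V.scale_sum_right)
  finally show ?thesis .
qed

lemma ev_scalar: "ev op (scalar c) z = vsc c z"
  by (simp add: scalar_def ev_single zero_free_monoid_def)

lemma ev_one: "ev op 1 z = z"
  using ev_scalar[of 1 z] by (simp add: scalar_hom)

lemma ev_gen: "ev op (gen x) z = op x z"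
  by (simp add: gen_def ev_single)

lemma ev_power: "ev op (f ^ k) z = (ev op f ^^ k) z"
  by (induction k) (simp_all add: ev_one ev_mult)

end

section \<open>The opposite ring\<close>

definition opposite :: "('a, 'm) ring_scheme \<Rightarrow> ('a, 'm) ring_scheme"
  where "opposite A = A\<lparr>monoid.mult := \<lambda>x y. y \<otimes>\<^bsub>A\<^esub> x\<rparr>"

lemma opposite_simps[simp]:
  "carrier (opposite A) = carrier A" "x \<otimes>\<^bsub>opposite A\<^esub> y = y \<otimes>\<^bsub>A\<^esub> x" "one (opposite A) = one A"
  "ring.zero (opposite A) = ring.zero A" "add (opposite A) = add A"
  by (simp_all add: opposite_def)

lemma opposite_mult: "monoid.mult (opposite A) = (\<lambda>x y. y \<otimes>\<^bsub>A\<^esub> x)"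
  by (simp add: opposite_def)

lemma ring_opposite: assumes "ring A" shows "ring (opposite A)"
proof -
  interpret ring A by (rule assms)
  have "abelian_group (opposite A)"
    by (rule abelian_groupI) (auto simp: a_ac l_neg intro!: bexI[of _ "\<ominus>\<^bsub>A\<^esub> x" for x])
  moreover have "monoid (opposite A)" by (rule monoidI) (auto simp: m_assoc)
  ultimately show ?thesis by (rule ringI) (auto simp: l_distr r_distr)
qed

lemma minus_opposite: "\<ominus>\<^bsub>opposite A\<^esub> x = \<ominus>\<^bsub>A\<^esub> x" "x \<ominus>\<^bsub>opposite A\<^esub> y = x \<ominus>\<^bsub>A\<^esub> y"
  by (simp_all add: a_inv_def a_minus_def)

lemma pow_opposite:
  assumes "ring A" "x \<in> carrier A" shows "x [^]\<^bsub>opposite A\<^esub> (k::nat) = x [^]\<^bsub>A\<^esub> k"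
proof -
  interpret ring A by (rule assms)
  interpret O: ring "opposite A" by (rule ring_opposite[OF assms(1)])
  show ?thesis using nat_pow_Suc2[OF assms(2)] by (induction k) simp_all
qed

lemma (in central_span) central_span_opposite: "central_span (opposite A) Z"
  by (intro central_span.intro ring_opposite ring_axioms central_span_axioms.intro)
    (auto simp: minus_opposite Z_one Z_zero Z_minus Z_mult intro: central[symmetric])

lemma (in central_span) zsub_opposite: "central_span.zsub (opposite A) Z S = zsub S"
  unfolding central_span.zsub_def[OF central_span_opposite] zsub_def using central
  by (auto simp: subset_iff) metis+

text \<open>The relations are symmetric under reversal of products. Two of the assumptions are
  not: the factors of the annihilating polynomial appear in the reverse order, but they commute;
  and the absorption of idempotents has to be known for multiplication on the right.\<close>

lemma (in yh_ring) opposite: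
  assumes absorb: "\<And>i S x. \<lbrakk>1 \<le> i; i < n; zsub S; \<And>x. x \<in> S \<Longrightarrow> x \<otimes> t i \<in> S;
    \<And>x. x \<in> S \<Longrightarrow> x \<otimes> t (Suc i) \<in> S; x \<in> S\<rbrakk> \<Longrightarrow> x \<otimes> e i \<in> S"
  shows "yh_ring (opposite A) Z n r d Dl u t g e X1"
proof -
  have nw: "rec_nat \<one> (\<lambda>k y. y \<otimes> (X1 \<ominus> u k)) k = nw k" if "k \<le> d" for k
    using that
  proof (induction k)
    case (Suc k)
    have "pass (X1 \<ominus> u k) (nw k) (X1 \<ominus> u k)"
    proof (rule pass_nw)
      have "X1 \<otimes> u k = u k \<otimes> X1" using central[OF u_Z, of k X1] Suc.prems by simp
      then show "pass (X1 \<ominus> u k) X1 (X1 \<ominus> u k)" using Suc.prems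
        by (simp add: pass_def a_minus_def l_distr r_distr l_minus r_minus)
    qed (use Suc.prems in auto)
    then show ?case using Suc by (simp add: pass_def)
  qed simp
  show ?thesis
  proof (intro yh_ring.intro central_span_opposite yh_ring_axioms.intro)
    show "rec_nat \<one>\<^bsub>opposite A\<^esub> (\<lambda>k. (\<otimes>\<^bsub>opposite A\<^esub>) (X1 \<ominus>\<^bsub>opposite A\<^esub> u k)) d = \<zero>\<^bsub>opposite A\<^esub>"
      using nw[of d] nw_d by (simp add: minus_opposite opposite_mult)
    show "\<lbrakk>1 \<le> i; i < n; 1 \<le> j; j \<le> n\<rbrakk> \<Longrightarrow>
      g i \<otimes>\<^bsub>opposite A\<^esub> t j = t (transpose i (Suc i) j) \<otimes>\<^bsub>opposite A\<^esub> g i" for i j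
      using t_g_pass[of i j] by (simp add: pass_def)
    show "\<lbrakk>1 \<le> i; i < n\<rbrakk> \<Longrightarrow> g i \<otimes>\<^bsub>opposite A\<^esub> g i = \<one>\<^bsub>opposite A\<^esub> \<oplus>\<^bsub>opposite A\<^esub>
      Dl \<otimes>\<^bsub>opposite A\<^esub> (e i \<otimes>\<^bsub>opposite A\<^esub> g i)" for i
      using g_g[of i] e_g[of i] central[OF Dl_Z, of "e i \<otimes> g i"] by simp
    show "\<lbrakk>1 \<le> i; i < n; central_span.zsub (opposite A) Z S; \<And>x. x \<in> S \<Longrightarrow> t i \<otimes>\<^bsub>opposite A\<^esub> x \<in> S;
      \<And>x. x \<in> S \<Longrightarrow> t (Suc i) \<otimes>\<^bsub>opposite A\<^esub> x \<in> S; x \<in> S\<rbrakk> \<Longrightarrow> e i \<otimes>\<^bsub>opposite A\<^esub> x \<in> S" for i S x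
      using absorb[of i S x] unfolding zsub_opposite by simp
    show "\<lbrakk>1 \<le> i; Suc i < n\<rbrakk> \<Longrightarrow> g i \<otimes>\<^bsub>opposite A\<^esub> g (Suc i) \<otimes>\<^bsub>opposite A\<^esub> g i =
      g (Suc i) \<otimes>\<^bsub>opposite A\<^esub> g i \<otimes>\<^bsub>opposite A\<^esub> g (Suc i)" for i
      using braid[of i] by (simp add: m_assoc)
    show "\<lbrakk>1 \<le> i; i + 2 \<le> j; j < n\<rbrakk> \<Longrightarrow> g i \<otimes>\<^bsub>opposite A\<^esub> g j = g j \<otimes>\<^bsub>opposite A\<^esub> g i" for i j
      using g_far[of i j] by simp
    show "2 \<le> n \<Longrightarrow> g 1 \<otimes>\<^bsub>opposite A\<^esub> X1 \<otimes>\<^bsub>opposite A\<^esub> g 1 \<otimes>\<^bsub>opposite A\<^esub> X1 =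
      X1 \<otimes>\<^bsub>opposite A\<^esub> g 1 \<otimes>\<^bsub>opposite A\<^esub> X1 \<otimes>\<^bsub>opposite A\<^esub> g 1"
      using g_X_g_X by (simp add: m_assoc)
    show "\<lbrakk>1 \<le> i; i \<le> n; 1 \<le> j; j \<le> n\<rbrakk> \<Longrightarrow> t i \<otimes>\<^bsub>opposite A\<^esub> t j = t j \<otimes>\<^bsub>opposite A\<^esub> t i" for i j
      using t_t[of i j] by simp
  qed (simp_all add: r_pos d_pos Dl_Z u_Z pow_opposite[OF ring_axioms] t_root e_g e_X g_X t_X)
qed

lemma linmap_diff_ops:
  assumes "Modules.module sc" "linop sc f" "linop sc h"
  shows "linop sc (\<lambda>z. f z - h z)" "linop sc (\<lambda>z. sc c (f z))" "linop sc (\<lambda>z. 0)"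
proof -
  interpret Modules.module sc by (rule assms(1))
  show "linop sc (\<lambda>z. f z - h z)" "linop sc (\<lambda>z. sc c (f z))" "linop sc (\<lambda>z. 0)"
    using assms(2,3) by (auto simp: linmap_def algebra_simps)
qed

section \<open>The representation of the free algebra\<close>

text \<open>The parameters of the cyclotomic algebra. The roots are numbered from $v_d$ down to
  $v_1$, so that the Newton product of degree $d$, whose new factors are added on the left, is
  the cyclotomic element with its factors in the order of the definition.\<close>

definition "cR r d = carrier (ground_ring r d)"
definition "cDl = indet_power Var_q 1 - indet_power Var_q (- 1)"
definition "crho r = laurent_const (1 / of_nat r)"
definition "cu d k = indet_power (Var_v (d - k)) 1"

lemma cu_inverse: "cu d k * indet_power (Var_v (d - k)) (- 1) = 1"
  by (simp add: cu_def indet_power_def mult_single flip: single_add)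

lemma ground_ring_params: assumes "r \<ge> 1" "d \<ge> 1" shows "yh_params (cR r d) r d cDl (crho r) (cu d)"
proof
  note sd = subring_setD[OF subring_ground_ring[of r d], folded cR_def]
  show "1 \<in> cR r d" "- 1 \<in> cR r d" by (simp_all add: sd)
  show "cDl \<in> cR r d" unfolding cDl_def
    by (intro sd(6)) (auto simp: cR_def intro!: indet_power_ground_ring)
  show "crho r \<in> cR r d" unfolding crho_def cR_def
    by (intro laurent_const_ground_ring inverse_r_coeff_ring)
  show "cu d k \<in> cR r d" if "k < d" for k
    unfolding cu_def cR_def using that by (intro indet_power_ground_ring) auto
  have "of_nat r = (laurent_const (of_nat r) :: laurent)" by (simp add: laurent_const_def single_of_nat)
  then have "crho r * of_nat r = (Poly_Mapping.single (0 + 0) (1 / of_nat r * of_nat r) :: laurent)"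
    by (simp only: crho_def laurent_const_def mult_single)
  then show "crho r * of_nat r = 1" using assms by simp
qed (use assms in auto)

text \<open>Words are built in the free algebra, so that they can be evaluated both in the
  cyclotomic algebra and on the standard module. The elements \<open>qF d k\<close> are the
  divided differences $D_k(0, X) = (p_k(X) - p_k(0)) / X$.\<close>

primrec nwF :: "nat \<Rightarrow> nat \<Rightarrow> yh_free" where
  "nwF d 0 = 1" | "nwF d (Suc k) = (yX - scalar (cu d k)) * nwF d k"
primrec upF :: "nat \<Rightarrow> yh_free" where
  "upF 0 = 1" | "upF (Suc m) = upF m * yg (Suc m)"
primrec dnF :: "(nat \<Rightarrow> yh_free) \<Rightarrow> nat \<Rightarrow> yh_free" where
  "dnF s 0 = 1" | "dnF s (Suc m) = s (Suc m) * dnF s m"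
primrec qF :: "nat \<Rightarrow> nat \<Rightarrow> yh_free" where
  "qF d 0 = 0" | "qF d (Suc k) = nwF d k - scalar (cu d k) * qF d k"

definition "giF r i = yg i - scalar cDl * ye r i"
definition "colF r d m = (\<lambda>(j, a, b::nat). dnF (giF r) (j - 1) * (nwF d a * (upF m * yt (Suc m) ^ b)))"
definition "rowF d m = (\<lambda>(j, k, b::nat). ((yt (Suc m) ^ b * dnF yg m) * nwF d k) * upF (j - 1))"

primrec cwF where "cwF r d [] = 1" | "cwF r d (\<gamma> # \<beta>) = colF r d (length \<beta>) \<gamma> * cwF r d \<beta>"
primrec rwF where "rwF d [] = 1" | "rwF d (\<gamma> # \<beta>) = rwF d \<beta> * rowF d (length \<beta>) \<gamma>"

definition "cc d k = (\<Prod>l<k. - cu d l)"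

text \<open>The constant term of $p_d$ is a unit, the product of the $-v_k$. Therefore $X$ is
  invertible modulo $p_d(X)$, with the inverse $-p_d(0)^{-1} D_d(0, X)$.\<close>

lemma nwF_qF: "nwF d k = yX * qF d k + scalar (cc d k)"
proof (induction k)
  case (Suc k)
  have "nwF d (Suc k) = yX * nwF d k - scalar (cu d k) * (yX * qF d k + scalar (cc d k))"
    by (simp add: left_diff_distrib flip: Suc)
  also have "\<dots> = yX * nwF d k - yX * (scalar (cu d k) * qF d k) - scalar (cu d k * cc d k)"
    using scalar_central[of "cu d k" yX] scalar_central[of "cc d k" "scalar (cu d k)"] by (simp add: algebra_simps scalar_hom flip: mult.assoc)
  finally show ?case by (simp add: cc_def algebra_simps scalar_hom)
qed (simp add: cc_def scalar_hom)

lemma nwF_d: "nwF d d = cycl d"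
proof -
  have "nwF d k = prod_list (map (\<lambda>k. yX - scalar (indet_power (Var_v k) 1)) [Suc (d - k)..<Suc d])"
    if "k \<le> d" for k
    using that
  proof (induction k)
    case (Suc k)
    have "[Suc (d - Suc k)..<Suc d] = (d - k) # [Suc (d - k)..<Suc d]"
      using Suc.prems by (subst upt_conv_Cons) (auto simp: Suc_diff_Suc)
    then show ?case using Suc by (simp add: cu_def)
  qed simp
  from this[of d] show ?thesis by simp
qed

definition "cinv d = (\<Prod>l<d. - indet_power (Var_v (d - l)) (- 1))"

lemma cc_cinv: "cc d d * cinv d = 1"
  unfolding cc_def cinv_def by (simp add: cu_inverse flip: prod.distrib)

lemma cinv_closed: "cinv d \<in> carrier (ground_ring r d)"
proof -
  note sd = subring_setD[OF subring_ground_ring[of r d]]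
  have "(\<Prod>l<k. - indet_power (Var_v (d - l)) (- 1)) \<in> carrier (ground_ring r d)" if "k \<le> d" for k
    using that
  proof (induction k)
    case (Suc k)
    have "indet_power (Var_v (d - k)) (- 1) \<in> carrier (ground_ring r d)"
      using Suc.prems by (intro indet_power_ground_ring) auto
    then show ?case using Suc by (auto intro!: sd)
  qed (simp add: sd)
  then show ?thesis by (simp add: cinv_def)
qed

definition "stdV r d n = {\<Phi>. \<forall>\<beta>. \<Phi> \<beta> \<in> cR r d \<and> (\<beta> \<in> words r d n \<or> \<Phi> \<beta> = 0)}"

definition "unitV \<beta> = (\<lambda>\<beta>'. if \<beta>' = \<beta> then 1 else 0)"

text \<open>The standard module becomes a representation of the free algebra when $X^{-1}$ acts
  as $-p_d(0)^{-1} D_d(0, X)$. The elements that act as zero form an ideal, which contains the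
  relations and the cyclotomic element.\<close>

lemma representation:
  fixes r n d :: nat
  assumes rd: "r \<ge> 1" "d \<ge> 1"
  defines "FA \<equiv> yh_free_algebra r n d" and "V \<equiv> stdV r d n"
  obtains op v lam where "evaluation op"
    "\<And>f z. f \<in> carrier FA \<Longrightarrow> z \<in> V \<Longrightarrow> ev op f z \<in> V"
    "ideal {f \<in> carrier FA. \<forall>z\<in>V. ev op f z = 0} FA"
    "yh_relations r n \<subseteq> {f \<in> carrier FA. \<forall>z\<in>V. ev op f z = 0}"
    "cycl d \<in> {f \<in> carrier FA. \<forall>z\<in>V. ev op f z = 0}"
    "v \<in> V" "linmap vsc (*) lam" "\<And>z. z \<in> V \<Longrightarrow> lam z \<in> cR r d"
    "\<And>\<beta>. \<beta> \<in> words r d n \<Longrightarrow> ev op (cwF r d \<beta>) v = unitV \<beta>"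
    "\<And>y. (\<And>\<beta>. \<beta> \<in> words r d n \<Longrightarrow> y \<beta> \<in> cR r d) \<Longrightarrow>
      \<exists>!z. z \<in> V \<and> (\<forall>\<beta>\<in>words r d n. lam (ev op (rwF d \<beta>) z) = y \<beta>)"
proof -
  note sd = subring_setD[OF subring_ground_ring[of r d], folded cR_def]
  interpret yh_params "cR r d" r d cDl "crho r" "cu d" by (rule ground_ring_params[OF rd])
  obtain t g X1 v lam where M: "yh_module (cR r d) r d cDl (crho r) (cu d) vsc V n t g X1"
    and v: "v \<in> V" and lam: "linmap vsc (*) lam" "\<forall>\<Phi>\<in>V. lam \<Phi> \<in> cR r d"
    and col: "\<forall>\<beta>\<in>words r d n. colw (colop vsc cDl (crho r) r (cu d) t g X1) \<beta> v = (\<lambda>\<beta>'. if \<beta>' = \<beta> then 1 else 0)"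
    and row: "\<forall>y. (\<forall>\<beta>\<in>words r d n. y \<beta> \<in> cR r d) \<longrightarrow>
      (\<exists>!\<Phi>. \<Phi> \<in> V \<and> (\<forall>\<beta>\<in>words r d n. lam (roww (rowop vsc (cu d) t g X1) \<beta> \<Phi>) = y \<beta>))"
    using standard_module[OF sd(3,4), of n] unfolding V_def stdV_def by blast
  interpret M: yh_module "cR r d" r d cDl "crho r" "cu d" vsc V n t g X1 by (rule M)
  define Q where "Q k = quot_newton vsc (cu d) (\<lambda>_. 0) X1 k" for k
  have Q_lin: "linop vsc (Q k)" for k
  proof (induction k)
    case (Suc k)
    have "Q (Suc k) = (\<lambda>z. newton vsc (cu d) X1 k z - vsc (cu d k) (Q k z))"
      by (simp add: Q_def fun_eq_iff)
    then show ?case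
      using linmap_diff_ops(1)[OF module_vsc M.newton_lin linmap_diff_ops(2)[OF module_vsc Suc Suc]]
      by (simp only:)
  next
    case 0
    have "Q 0 = (\<lambda>z. 0)" by (simp add: Q_def fun_eq_iff)
    then show ?case using linmap_diff_ops(3)[OF module_vsc M.newton_lin M.newton_lin] by (simp only:)
  qed
  define op where "op = (\<lambda>x. case x of Gen_t i \<Rightarrow> t i | Gen_g i \<Rightarrow> g i | Gen_X \<Rightarrow> X1 
    | Gen_X_inv \<Rightarrow> (\<lambda>z. vsc (- cinv d) (Q d z)))"
  have op_lin: "linop vsc (op x)" for x
  proof (cases x)
    case Gen_X_inv
    show ?thesis unfolding Gen_X_inv op_def yh_gen.case
      by (rule linmap_diff_ops(2)[OF module_vsc Q_lin Q_lin])
  qed (simp_all add: op_def M.t_lin M.g_lin M.X_lin)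
  interpret E: evaluation op by unfold_locales (rule op_lin)
  have op_simps: "op (Gen_t i) = t i" "op (Gen_g i) = g i" "op Gen_X = X1"
    "op Gen_X_inv = (\<lambda>z. vsc (- cinv d) (Q d z))" for i by (simp_all add: op_def)
  note evs = E.ev_mult E.ev_add E.ev_diff E.ev_scalar E.ev_one E.ev_gen E.ev_power E.ev_sum op_simps
  have ev_fun: "ev op (gen x) = op x" for x :: yh_gen by (simp add: fun_eq_iff E.ev_gen)
  have ev_ye: "ev op (ye r i) z = average vsc (crho r) r (t i) (t (Suc i)) z" for i z
    by (simp add: ye_def evs average_def crho_def ev_fun)
  have ev_nw: "ev op (nwF d k) z = newton vsc (cu d) X1 k z" for k z
    by (induction k) (simp_all add: evs)
  have ev_q: "ev op (qF d k) z = Q k z" for k z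
    by (induction k) (simp_all add: evs Q_def ev_nw E.ev_zero)
  have X_Q: "X1 (Q k z) = newton vsc (cu d) X1 k z - vsc (cc d k) z" for k z
  proof -
    have "ev op (nwF d k) z = ev op (yX * qF d k + scalar (cc d k)) z" by (simp only: nwF_qF)
    then show ?thesis by (simp add: ev_nw evs ev_q)
  qed
  have vsc_vsc: "vsc a (vsc b z) = vsc (a * b) z" for a b and z :: "(nat \<times> nat \<times> nat) list \<Rightarrow> laurent" by simp
  have X_inv: "X1 (op Gen_X_inv z) = z" if "z \<in> V" for z
  proof -
    have "X1 (op Gen_X_inv z) = vsc (- cinv d) (X1 (Q d z))" unfolding op_simps by (rule linmap_simps(2)[OF M.X_lin])
    also have "\<dots> = vsc (- cinv d) (0 - vsc (cc d d) z)" by (simp only: X_Q M.X_root[OF that])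
    also have "\<dots> = vsc (cinv d * cc d d) z" by (simp add: fscale_def mult.assoc)
    also have "\<dots> = z" using cc_cinv[of d] by (simp add: mult.commute)
    finally show ?thesis .
  qed
  have Q_X: "Q k (X1 z) = X1 (Q k z)" for k z
  proof -
    have N: "newton vsc (cu d) X1 k (X1 z) = X1 (newton vsc (cu d) X1 k z)" for k
      by (induction k) (simp_all only: newton.simps linmap_simps[OF M.X_lin])
    show ?thesis by (induction k) (simp_all only: Q_def quot_newton.simps N linmap_simps[OF M.X_lin])
  qed
  have inv_X: "op Gen_X_inv (X1 z) = z" if "z \<in> V" for z
    using X_inv[OF that] by (simp only: op_simps Q_X linmap_simps[OF M.X_lin])
  have Q_V: "Q k z \<in> V" if "k \<le> d" "z \<in> V" for k z
    using that by (induction k) (simp_all add: Q_def M.newton_P)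
  have op_V: "op x z \<in> V" if "x \<in> yh_gens n" "z \<in> V" for x z
  proof (cases x)
    case Gen_X_inv
    have "- cinv d \<in> cR r d" using cinv_closed[of d r] by (auto simp: cR_def[symmetric] intro: sd)
    then show ?thesis unfolding Gen_X_inv op_simps using that Q_V[of d z] by (intro M.P_scale) auto
  qed (use that in \<open>simp_all add: op_simps M.t_P M.g_P M.X_P\<close>)
  have foldr_V: "foldr op ws z \<in> V" if "set ws \<subseteq> yh_gens n" "z \<in> V" for ws z
    using that by (induction ws) (auto intro: op_V)
  have ev_V: "ev op f z \<in> V" if "f \<in> carrier FA" "z \<in> V" for f z
    unfolding ev_def using that
    by (intro M.P_sum M.P_scale foldr_V) (auto simp: FA_def yh_free_algebra_pm_over pm_over_def cR_def)
  interpret FA: ring FA unfolding FA_def by (rule ring_yh_free_algebra)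
  note FA_sd = subring_setD[OF subring_yh_free_algebra[of r n d], folded FA_def]
  note FA_ops = yh_free_algebra_ops[of r n d, folded FA_def]
  let ?K = "{f \<in> carrier FA. \<forall>z\<in>V. ev op f z = 0}"
  have ideal: "ideal ?K FA"
  proof (rule idealI[OF FA.ring_axioms])
    show "subgroup ?K (add_monoid FA)"
    proof (rule FA.add.subgroupI)
      have "0 \<in> ?K" by (simp add: FA_sd E.ev_zero)
      then show "?K \<noteq> {}" by blast
      show "\<ominus>\<^bsub>FA\<^esub> f \<in> ?K" if "f \<in> ?K" for f
      proof -
        have "\<ominus>\<^bsub>FA\<^esub> f = 0 - f" using minus_yh_free_algebra[of 0 r n d f] that FA_sd(2)
          by (simp add: a_minus_def FA_def[symmetric] FA_ops)
        then show ?thesis using that FA_sd by (simp add: E.ev_diff E.ev_zero del: diff_0)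
      qed
    qed (auto simp: FA_ops E.ev_add FA_sd)
  qed (auto simp: FA_ops E.ev_mult FA_sd ev_V E.ev_simps)
  have rel: "yh_relations r n \<subseteq> ?K"
  proof (intro subsetI CollectI conjI ballI)
    show "f \<in> carrier FA" if "f \<in> yh_relations r n" for f
      using that yh_relations_closed by (auto simp: FA_def)
    fix f z assume f: "f \<in> yh_relations r n" and z: "z \<in> V"
    show "ev op f z = 0"
    proof -
      have far: "g i (g j z) = g j (g i z)" if "1 \<le> i" "1 \<le> j" "i < n" "j < n" "i + 2 \<le> j \<or> j + 2 \<le> i" for i j
        using that z M.g_far[of i j z] M.g_far[of j i z] by auto
      have eq: "(f1 = f2) \<Longrightarrow> f1 - f2 = 0" for f1 f2 :: "(nat \<times> nat \<times> nat) list \<Rightarrow> laurent" by simp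
      from f show ?thesis unfolding yh_relations_def Un_iff mem_Collect_eq
      proof (elim disjE exE conjE)
        fix i j assume "f = yg i * yg j - yg j * yg i" "i \<in> {1..<n}" "j \<in> {1..<n}" "i + 2 \<le> j"
        then show ?thesis using far[of i j] by (simp add: evs del: One_nat_def)
      next
        fix i j assume "f = yg i * yg j - yg j * yg i" "i \<in> {1..<n}" "j \<in> {1..<n}" "j + 2 \<le> i"
        then show ?thesis using far[of i j] by (simp add: evs del: One_nat_def)
      next
        fix i assume "f = yg i * yg (Suc i) * yg i - yg (Suc i) * yg i * yg (Suc i)" "i \<in> {1..<n}" "Suc i \<in> {1..<n}"
        then show ?thesis using z M.braid[of i z] by (simp add: evs del: One_nat_def)
      next
        fix i j assume "f = yt i * yt j - yt j * yt i" "i \<in> {1..n}" "j \<in> {1..n}"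
        then show ?thesis using z M.t_t[of i j z] by (simp add: evs del: One_nat_def)
      next
        fix i j assume "f = yg i * yt j - yt (transpose i (Suc i) j) * yg i" "i \<in> {1..<n}" "j \<in> {1..n}"
        then show ?thesis using z M.g_t[of i j z] by (simp add: evs del: One_nat_def)
      next
        fix i assume "f = yt i ^ r - 1" "i \<in> {1..n}"
        then show ?thesis using z M.t_root[of i z] by (simp add: evs ev_fun del: One_nat_def)
      next
        fix i assume f: "f = (yg i)\<^sup>2 - (1 + scalar (indet_power Var_q 1 - indet_power Var_q (- 1)) * ye r i * yg i)"
          and i: "i \<in> {1..<n}"
        have "ev op f z = g i (g i z) - (z + vsc cDl (average vsc (crho r) r (t i) (t (Suc i)) (g i z)))"
          unfolding f cDl_def[symmetric] power2_eq_square E.ev_diff E.ev_mult E.ev_add E.ev_one E.ev_scalar E.ev_gen op_simps ev_ye by (rule refl)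
        then show ?thesis using z i M.g_g[of i z] by simp
      next
        assume "f \<in> {yX * yX_inv - 1, yX_inv * yX - 1}"
        then show ?thesis
          using X_inv[OF z] inv_X[OF z] 
          by (elim insertE emptyE) (simp_all only: E.ev_diff E.ev_mult E.ev_one E.ev_gen op_simps(3) eq)
      next
        assume "f \<in> (if 2 \<le> n then {yg 1 * yX * yg 1 * yX - yX * yg 1 * yX * yg 1} else {})"
        then have n: "2 \<le> n" and f: "f = yg 1 * yX * yg 1 * yX - yX * yg 1 * yX * yg 1" by (simp_all split: if_splits)
        show ?thesis unfolding f using z n M.g_X_g_X[of z] by (simp only: E.ev_diff E.ev_mult E.ev_gen op_simps eq)
      next
        fix i assume "f = yg i * yX - yX * yg i" "i \<in> {2..<n}"
        then show ?thesis using z M.g_X[of i z] by (simp add: evs del: One_nat_def)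
      next
        fix j assume "f = yt j * yX - yX * yt j" "j \<in> {1..n}"
        then show ?thesis using z M.t_X[of j z] by (simp add: evs del: One_nat_def)
      qed
    qed
  qed
  have cyc: "cycl d \<in> ?K"
    using cycl_closed[of d r n] M.X_root unfolding nwF_d[symmetric] by (simp add: FA_def ev_nw)
  have ev_up: "ev op (upF m) z = gup g m z" for m z
    by (induction m arbitrary: z) (simp_all add: evs)
  have ev_dn: "ev op (dnF s m) z = gdn (\<lambda>i. ev op (s i)) m z" for s m z
    by (induction m) (simp_all add: evs)
  have ev_gi: "ev op (giF r i) = ginv vsc cDl (crho r) r t g i" for i
    by (simp add: fun_eq_iff giF_def ginv_def evs ev_ye)
  have ev_col: "ev op (colF r d m \<gamma>) z = colop vsc cDl (crho r) r (cu d) t g X1 m \<gamma> z" for m \<gamma> z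
    by (cases \<gamma>) (simp add: colF_def colop_def evs ev_dn ev_gi[abs_def] ev_nw ev_up ev_fun)
  have ev_row: "ev op (rowF d m \<gamma>) z = rowop vsc (cu d) t g X1 m \<gamma> z" for m \<gamma> z
    by (cases \<gamma>) (simp add: rowF_def rowop_def evs ev_dn ev_nw ev_up ev_fun)
  have ev_cw: "ev op (cwF r d \<beta>) z = colw (colop vsc cDl (crho r) r (cu d) t g X1) \<beta> z" for \<beta> z
    by (induction \<beta>) (simp_all add: evs ev_col)
  have ev_rw: "ev op (rwF d \<beta>) z = roww (rowop vsc (cu d) t g X1) \<beta> z" for \<beta> z
    by (induction \<beta> arbitrary: z) (simp_all add: evs ev_row)
  show thesis
  proof (rule that[OF E.evaluation_axioms ev_V ideal rel cyc v lam(1)])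
    show "z \<in> V \<Longrightarrow> lam z \<in> cR r d" for z using lam(2) by blast
    show "\<beta> \<in> words r d n \<Longrightarrow> ev op (cwF r d \<beta>) v = unitV \<beta>" for \<beta>
      using col by (simp add: ev_cw unitV_def)
    show "\<exists>!z. z \<in> V \<and> (\<forall>\<beta>\<in>words r d n. lam (ev op (rwF d \<beta>) z) = y \<beta>)"
      if "\<And>\<beta>. \<beta> \<in> words r d n \<Longrightarrow> y \<beta> \<in> cR r d" for y
      unfolding ev_rw using row[rule_format, of y] that by blast
  qed
qed

section \<open>Columns and rows span the cyclotomic algebra\<close>

lemma
  fixes r n :: nat
  shows far_rel: "1 \<le> i \<Longrightarrow> i + 2 \<le> j \<Longrightarrow> j < n \<Longrightarrow> yg i * yg j - yg j * yg i \<in> yh_relations r n"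
    and braid_rel: "1 \<le> i \<Longrightarrow> Suc i < n \<Longrightarrow>
      yg i * yg (Suc i) * yg i - yg (Suc i) * yg i * yg (Suc i) \<in> yh_relations r n"
    and tt_rel: "1 \<le> i \<Longrightarrow> i \<le> n \<Longrightarrow> 1 \<le> j \<Longrightarrow> j \<le> n \<Longrightarrow> yt i * yt j - yt j * yt i \<in> yh_relations r n"
    and gt_rel: "1 \<le> i \<Longrightarrow> i < n \<Longrightarrow> 1 \<le> j \<Longrightarrow> j \<le> n \<Longrightarrow>
      yg i * yt j - yt (transpose i (Suc i) j) * yg i \<in> yh_relations r n"
    and root_rel: "1 \<le> i \<Longrightarrow> i \<le> n \<Longrightarrow> yt i ^ r - 1 \<in> yh_relations r n"
    and quad_rel: "1 \<le> i \<Longrightarrow> i < n \<Longrightarrow> (yg i)\<^sup>2 - (1 + scalar cDl * ye r i * yg i) \<in> yh_relations r n"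
    and inv_rel: "yX_inv * yX - 1 \<in> yh_relations r n"
    and gXgX_rel: "2 \<le> n \<Longrightarrow> yg 1 * yX * yg 1 * yX - yX * yg 1 * yX * yg 1 \<in> yh_relations r n"
    and gX_rel: "2 \<le> i \<Longrightarrow> i < n \<Longrightarrow> yg i * yX - yX * yg i \<in> yh_relations r n"
    and tX_rel: "1 \<le> i \<Longrightarrow> i \<le> n \<Longrightarrow> yt i * yX - yX * yt i \<in> yh_relations r n"
proof -
  have g: "i \<in> {1..<n}" if "1 \<le> i" "i < n" for i using that by simp
  have g2: "i \<in> {2..<n}" if "2 \<le> i" "i < n" for i using that by simp
  have t: "i \<in> {1..n}" if "1 \<le> i" "i \<le> n" for i using that by simp
  note u = yh_relations_def Un_iff mem_Collect_eq
  show "yg i * yg j - yg j * yg i \<in> yh_relations r n" if "1 \<le> i" "i + 2 \<le> j" "j < n" for i j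
    using g[of i] g[of j] that unfolding u by (metis add_leD1 le_trans less_imp_le order.strict_trans1 le_add1 add_lessD1 le_less_trans)
  show "yg i * yg (Suc i) * yg i - yg (Suc i) * yg i * yg (Suc i) \<in> yh_relations r n" if "1 \<le> i" "Suc i < n" for i
    using g[of i] g[of "Suc i"] that unfolding u by (metis Suc_lessD le_SucI)
  show "yt i * yt j - yt j * yt i \<in> yh_relations r n" if "1 \<le> i" "i \<le> n" "1 \<le> j" "j \<le> n" for i j
    using t[of i] t[of j] that unfolding u by blast
  show "yg i * yt j - yt (transpose i (Suc i) j) * yg i \<in> yh_relations r n" if "1 \<le> i" "i < n" "1 \<le> j" "j \<le> n" for i j
    using g[of i] t[of j] that unfolding u by blast
  show "yt i ^ r - 1 \<in> yh_relations r n" if "1 \<le> i" "i \<le> n" for i using t[OF that] unfolding u by blast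
  show "(yg i)\<^sup>2 - (1 + scalar cDl * ye r i * yg i) \<in> yh_relations r n" if "1 \<le> i" "i < n" for i
    using g[OF that] unfolding u cDl_def by blast
  show "yX_inv * yX - 1 \<in> yh_relations r n" unfolding u by blast
  show "2 \<le> n \<Longrightarrow> yg 1 * yX * yg 1 * yX - yX * yg 1 * yX * yg 1 \<in> yh_relations r n"
    unfolding u by (simp del: One_nat_def)
  show "yg i * yX - yX * yg i \<in> yh_relations r n" if "2 \<le> i" "i < n" for i
    using g2[OF that] unfolding u by blast
  show "yt i * yX - yX * yt i \<in> yh_relations r n" if "1 \<le> i" "i \<le> n" for i
    using t[OF that] unfolding u by blast
qed

text \<open>A ring with a surjection from the free algebra that respects the relations. The
  scalar action is represented by the central elements that are images of scalars.\<close>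

locale cyclotomic =
  fixes r n d :: nat and C :: "('b, 'e) ring_scheme" and h :: "yh_free \<Rightarrow> 'b"
  assumes r_pos: "r \<ge> 1" and n_pos: "n \<ge> 1" and d_pos: "d \<ge> 1"
    and ring_C: "ring C" and h_hom: "h \<in> ring_hom (yh_free_algebra r n d) C"
    and h_surj: "carrier C = h ` carrier (yh_free_algebra r n d)"
    and h_rel: "\<lbrakk>x \<in> carrier (yh_free_algebra r n d); y \<in> carrier (yh_free_algebra r n d);
      x - y \<in> yh_relations r n\<rbrakk> \<Longrightarrow> h x = h y"
    and h_cycl: "h (cycl d) = \<zero>\<^bsub>C\<^esub>"
begin

abbreviation "FA \<equiv> carrier (yh_free_algebra r n d)"

sublocale C: ring C by (rule ring_C)

lemmas FA_sd = subring_setD[OF subring_yh_free_algebra[of r n d]]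
lemmas FA_ops = yh_free_algebra_ops[of r n d]

sublocale H: ring_hom_ring "yh_free_algebra r n d" C h
  by (rule ring_hom_ringI2[OF ring_yh_free_algebra ring_C h_hom])

lemma h_closed[simp]: "f \<in> FA \<Longrightarrow> h f \<in> carrier C"
  by (rule H.hom_closed)

lemma h_add: "f \<in> FA \<Longrightarrow> f' \<in> FA \<Longrightarrow> h (f + f') = h f \<oplus>\<^bsub>C\<^esub> h f'"
  using H.hom_add[of f f'] by (simp add: FA_ops)

lemma h_mult: "f \<in> FA \<Longrightarrow> f' \<in> FA \<Longrightarrow> h (f * f') = h f \<otimes>\<^bsub>C\<^esub> h f'"
  using H.hom_mult[of f f'] by (simp add: FA_ops)

lemma h_one: "h 1 = \<one>\<^bsub>C\<^esub>"
  using H.hom_one by (simp add: FA_ops)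

lemma h_zero: "h 0 = \<zero>\<^bsub>C\<^esub>"
  using H.hom_zero by (simp add: FA_ops)

lemma h_diff: "f \<in> FA \<Longrightarrow> f' \<in> FA \<Longrightarrow> h (f - f') = h f \<ominus>\<^bsub>C\<^esub> h f'"
  using H.hom_add[of f "\<ominus>\<^bsub>yh_free_algebra r n d\<^esub> f'"] H.R.a_inv_closed[of f'] H.hom_a_inv[of f']
    minus_yh_free_algebra[of f r n d f'] by (simp only: a_minus_def)

lemma h_pow: "f \<in> FA \<Longrightarrow> h (f ^ k) = h f [^]\<^bsub>C\<^esub> (k::nat)"
  by (induction k) (auto simp: h_one h_mult subring_set_power[OF subring_yh_free_algebra] power_commutes[symmetric] power_Suc2 simp del: power_Suc)

lemmas FA_sum = subring_set_sum[OF subring_yh_free_algebra[of r n d]]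
lemmas FA_power = subring_set_power[OF subring_yh_free_algebra[of r n d]]

lemma FA_scalar: "c \<in> cR r d \<Longrightarrow> scalar c \<in> FA"
  unfolding cR_def by (rule scalar_closed)

lemma FA_gens[simp]: "1 \<le> i \<Longrightarrow> i \<le> n \<Longrightarrow> yt i \<in> FA" "1 \<le> i \<Longrightarrow> i < n \<Longrightarrow> yg i \<in> FA"
  "1 \<le> i \<Longrightarrow> i < n \<Longrightarrow> ye r i \<in> FA" "yX \<in> FA" "yX_inv \<in> FA"
  by (auto intro!: gen_closed ye_closed)

definition "Z = h ` scalar ` cR r d"
text \<open>Outside of the range of their indices the generators are set to the unit, since they
  have to lie in the ring for every index.\<close>

definition "T i = (if 1 \<le> i \<and> i \<le> n then h (yt i) else \<one>\<^bsub>C\<^esub>)"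
definition "G i = (if 1 \<le> i \<and> i < n then h (yg i) else \<one>\<^bsub>C\<^esub>)"
definition "E i = (if 1 \<le> i \<and> i < n then h (ye r i) else \<one>\<^bsub>C\<^esub>)"
abbreviation "U k \<equiv> h (scalar (cu d k))"

lemma TGE[simp]: "1 \<le> i \<Longrightarrow> i \<le> n \<Longrightarrow> T i = h (yt i)" "1 \<le> i \<Longrightarrow> i < n \<Longrightarrow> G i = h (yg i)"
  "1 \<le> i \<Longrightarrow> i < n \<Longrightarrow> E i = h (ye r i)"
  by (auto simp: T_def G_def E_def)

lemma TGE_closed[simp]: "T i \<in> carrier C" "G i \<in> carrier C" "E i \<in> carrier C"
  by (simp_all add: T_def G_def E_def del: One_nat_def)

lemma cR_sd: "1 \<in> cR r d" "0 \<in> cR r d" "x \<in> cR r d \<Longrightarrow> y \<in> cR r d \<Longrightarrow> x + y \<in> cR r d"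
  "x \<in> cR r d \<Longrightarrow> y \<in> cR r d \<Longrightarrow> x * y \<in> cR r d" "x \<in> cR r d \<Longrightarrow> - x \<in> cR r d"
  using subring_setD[OF subring_ground_ring[of r d]] by (auto simp: cR_def)

sublocale cs: central_span C Z
proof
  show "Z \<subseteq> carrier C" by (auto simp: Z_def FA_scalar)
  show "\<one>\<^bsub>C\<^esub> \<in> Z" unfolding Z_def h_one[symmetric] scalar_hom(3)[symmetric] by (intro imageI cR_sd)
  show "\<zero>\<^bsub>C\<^esub> \<in> Z" unfolding Z_def h_zero[symmetric] scalar_hom(4)[symmetric] by (intro imageI cR_sd)
  show "x \<otimes>\<^bsub>C\<^esub> y \<in> Z" if xy: "x \<in> Z" "y \<in> Z" for x y
  proof -
    obtain a b where ab: "a \<in> cR r d" "b \<in> cR r d" "x = h (scalar a)" "y = h (scalar b)"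
      using xy by (auto simp: Z_def)
    then have "x \<otimes>\<^bsub>C\<^esub> y = h (scalar (a * b))" by (simp add: scalar_hom h_mult FA_scalar)
    then show ?thesis using ab by (auto simp: Z_def cR_sd)
  qed
  show "\<ominus>\<^bsub>C\<^esub> x \<in> Z" if x: "x \<in> Z" for x
  proof -
    obtain a where a: "a \<in> cR r d" "x = h (scalar a)" using x by (auto simp: Z_def)
    then have "\<ominus>\<^bsub>C\<^esub> x = h (0 - scalar a)" by (simp only: h_diff FA_sd FA_scalar h_zero) (simp add: FA_scalar a_minus_def)
    then show ?thesis using a cR_sd(5)[of a] by (auto simp: Z_def scalar_hom(5)[symmetric])
  qed
  show "z \<otimes>\<^bsub>C\<^esub> a = a \<otimes>\<^bsub>C\<^esub> z" if z: "z \<in> Z" and a: "a \<in> carrier C" for z a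
    using z a unfolding Z_def h_surj
    by (auto simp: h_mult[symmetric] FA_scalar) (simp only: scalar_central)
qed

text \<open>The elements which map a given span to itself form a subring; thus a span stable
  under generators is stable under everything that they generate.\<close>

lemma absorb_left:
  assumes "cs.zsub S"
  shows "subring_set {f \<in> FA. \<forall>x\<in>S. h f \<otimes>\<^bsub>C\<^esub> x \<in> S}" "\<And>c. c \<in> cR r d \<Longrightarrow> scalar c \<in> {f \<in> FA. \<forall>x\<in>S. h f \<otimes>\<^bsub>C\<^esub> x \<in> S}"
proof -
  note S = cs.zsubD[OF assms]
  have neg: "h (- f) = \<ominus>\<^bsub>C\<^esub> h f" if "f \<in> FA" for f
    using h_diff[OF FA_sd(2) that] that by (simp add: h_zero a_minus_def)
  show "subring_set {f \<in> FA. \<forall>x\<in>S. h f \<otimes>\<^bsub>C\<^esub> x \<in> S}"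
    unfolding subring_set_def using S
    by (auto simp: h_one h_add h_mult neg FA_sd C.l_distr C.m_assoc C.l_minus)
  show "scalar c \<in> {f \<in> FA. \<forall>x\<in>S. h f \<otimes>\<^bsub>C\<^esub> x \<in> S}" if "c \<in> cR r d" for c
    using that S(4) by (auto simp: FA_scalar Z_def)
qed

lemma absorb_right:
  assumes "cs.zsub S"
  shows "subring_set {f \<in> FA. \<forall>x\<in>S. x \<otimes>\<^bsub>C\<^esub> h f \<in> S}" "\<And>c. c \<in> cR r d \<Longrightarrow> scalar c \<in> {f \<in> FA. \<forall>x\<in>S. x \<otimes>\<^bsub>C\<^esub> h f \<in> S}"
proof -
  note S = cs.zsubD[OF assms]
  have neg: "h (- f) = \<ominus>\<^bsub>C\<^esub> h f" if "f \<in> FA" for f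
    using h_diff[OF FA_sd(2) that] that by (simp add: h_zero a_minus_def)
  show "subring_set {f \<in> FA. \<forall>x\<in>S. x \<otimes>\<^bsub>C\<^esub> h f \<in> S}"
    unfolding subring_set_def using S
    by (auto simp: h_one h_add h_mult neg FA_sd C.r_distr C.m_assoc[symmetric] C.r_minus)
  have "x \<otimes>\<^bsub>C\<^esub> h (scalar c) \<in> S" if c: "c \<in> cR r d" and x: "x \<in> S" for c x
  proof -
    have z: "h (scalar c) \<in> Z" using c by (auto simp: Z_def)
    show ?thesis using S(4)[OF z x] cs.central[OF z S(1)[OF x]] by simp
  qed
  then show "scalar c \<in> {f \<in> FA. \<forall>x\<in>S. x \<otimes>\<^bsub>C\<^esub> h f \<in> S}" if "c \<in> cR r d" for c
    using that by (auto simp: FA_scalar)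
qed

lemma ye_in:
  assumes L: "subring_set L" "\<And>c. c \<in> cR r d \<Longrightarrow> scalar c \<in> L" and t: "yt i \<in> L" "yt (Suc i) \<in> L"
  shows "ye r i \<in> L"
  unfolding ye_def
  by (intro subring_setD(4)[OF L(1)] subring_set_sum[OF L(1)] subring_set_power[OF L(1)] t L(2))
    (auto simp: cR_def intro!: laurent_const_ground_ring inverse_r_coeff_ring)

lemma pass_sum:
  fixes m :: nat
  assumes "\<And>s. s < m \<Longrightarrow> a s \<in> FA \<and> b s \<in> FA \<and> h (y * a s) = h (b s * y)" "y \<in> FA"
  shows "h (y * (\<Sum>s<m. a s)) = h ((\<Sum>s<m. b s) * y)"
  using assms(1)
proof (induction m)
  case (Suc m)
  have c: "(\<Sum>s<m. a s) \<in> FA" "(\<Sum>s<m. b s) \<in> FA" "a m \<in> FA" "b m \<in> FA"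
    using Suc.prems by (auto intro: FA_sum)
  then show ?case using Suc c assms(2) by (simp add: distrib_left distrib_right h_add FA_sd)
qed simp

text \<open>An element that permutes $t_i$ and $t_{i+1}$ commutes with $e_i$. If it exchanges
  them, the sum has to be reversed, which shifts its range from $0 \le s < r$ to $0 < s \le r$;
  the end terms agree because $t^r = 1$.\<close>

lemma pass_ye:
  assumes y: "y \<in> FA" and i: "1 \<le> i" "i < n" and j: "{j, j'} = {i, Suc i}"
    and p: "h (y * yt i) = h (yt j * y)" "h (y * yt (Suc i)) = h (yt j' * y)"
  shows "h (y * ye r i) = h (ye r i * y)"
proof -
  have jn: "1 \<le> j" "j \<le> n" "1 \<le> j'" "j' \<le> n" using i j by (auto simp: doubleton_eq_iff)
  have pw: "h (y * yt k ^ s) = h (yt l ^ s * y)" 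
    if "h (y * yt k) = h (yt l * y)" "1 \<le> k" "k \<le> n" "1 \<le> l" "l \<le> n" for k l s
  proof (induction s)
    case (Suc s)
    have "h (y * yt k ^ Suc s) = h (y * yt k) \<otimes>\<^bsub>C\<^esub> h (yt k ^ s)"
      using that(2-) y by (simp add: h_mult FA_power FA_sd C.m_assoc)
    also have "\<dots> = h (yt l * y) \<otimes>\<^bsub>C\<^esub> h (yt k ^ s)" by (simp only: that(1))
    also have "\<dots> = h (yt l) \<otimes>\<^bsub>C\<^esub> h (y * yt k ^ s)"
      using that(2-) y by (simp add: h_mult FA_power FA_sd C.m_assoc)
    also have "\<dots> = h (yt l ^ Suc s * y)"
      using that(2-) y by (simp only: Suc) (simp add: h_mult FA_power FA_sd C.m_assoc)
    finally show ?case .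
  qed simp
  let ?a = "\<lambda>s. yt i ^ s * yt (Suc i) ^ (r - s)" and ?b = "\<lambda>s. yt j ^ s * yt j' ^ (r - s)"
  have ab: "?a s \<in> FA" "?b s \<in> FA" for s using i jn by (auto intro!: FA_sd FA_power)
  have 1: "h (y * (\<Sum>s<r. ?a s)) = h ((\<Sum>s<r. ?b s) * y)"
  proof (rule pass_sum[OF _ y], intro conjI ab)
    fix s
    have "h (y * ?a s) = h (y * yt i ^ s) \<otimes>\<^bsub>C\<^esub> h (yt (Suc i) ^ (r - s))"
      using i y by (simp add: h_mult FA_power FA_sd C.m_assoc)
    also have "\<dots> = h (yt j ^ s) \<otimes>\<^bsub>C\<^esub> h (y * yt (Suc i) ^ (r - s))"
      using i jn y by (simp add: pw[OF p(1)]) (simp add: h_mult FA_power FA_sd C.m_assoc)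
    also have "\<dots> = h (?b s * y)"
      using i jn y by (simp add: pw[OF p(2)]) (simp add: h_mult FA_power FA_sd C.m_assoc)
    finally show "h (y * ?a s) = h (?b s * y)" .
  qed
  have 2: "h (\<Sum>s<r. ?b s) = h (\<Sum>s<r. ?a s)"
  proof (cases "j = i")
    case True
    then show ?thesis using j by (auto simp: doubleton_eq_iff)
  next
    case False
    then have jj: "j = Suc i" "j' = i" using j by (auto simp: doubleton_eq_iff)
    have c: "h (yt i * yt (Suc i)) = h (yt (Suc i) * yt i)"
      using i by (intro h_rel FA_sd tt_rel) auto
    have comm: "h (yt (Suc i) ^ s * yt i ^ k) = h (yt i ^ k * yt (Suc i) ^ s)" for s k
    proof -
      have "h (yt i) \<otimes>\<^bsub>C\<^esub> h (yt (Suc i)) = h (yt (Suc i)) \<otimes>\<^bsub>C\<^esub> h (yt i)"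
        using c i by (simp add: h_mult)
      then have "cs.pass (h (yt i)) (h (yt (Suc i)) [^]\<^bsub>C\<^esub> s) (h (yt i))"
        using i by (intro cs.pass_pow) (auto simp: cs.pass_def)
      then have "cs.pass (h (yt (Suc i)) [^]\<^bsub>C\<^esub> s) (h (yt i) [^]\<^bsub>C\<^esub> k) (h (yt (Suc i)) [^]\<^bsub>C\<^esub> s)"
        using i by (intro cs.pass_pow) (auto simp: cs.pass_def)
      then show ?thesis using i by (simp add: h_mult h_pow FA_power cs.pass_def)
    qed
    have root: "h (yt k ^ r) = h 1" if "1 \<le> k" "k \<le> n" for k
      using that by (intro h_rel FA_sd FA_power root_rel) auto
    have "yt i ^ k * yt (Suc i) ^ s \<in> FA" for k s using i by (auto intro!: FA_sd FA_power)
    then have "h (\<Sum>s<r. ?b s) = h (\<Sum>s<r. ?a (r - s))"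
      using pass_sum[of r ?b "\<lambda>s. ?a (r - s)" 1] comm ab by (simp add: jj FA_sd)
    also have "(\<Sum>s<r. ?a (r - s)) = (\<Sum>s<r. ?a (Suc s))"
      using sum.nat_diff_reindex[of "\<lambda>s. ?a (Suc s)" r] by (simp add: Suc_diff_Suc)
    also have "\<dots> = (\<Sum>s<r. ?a s) + (yt i ^ r - yt (Suc i) ^ r)"
      using sum.lessThan_Suc[of ?a r] sum.lessThan_Suc_shift[of ?a r] by (simp add: algebra_simps)
    also have "h \<dots> = h (\<Sum>s<r. ?a s)"
    proof -
      have c: "(\<Sum>s<r. ?a s) \<in> FA" "yt i ^ r \<in> FA" "yt (Suc i) ^ r \<in> FA" using ab i by (auto intro!: FA_sum FA_power)
      then have "h ((\<Sum>s<r. ?a s) + (yt i ^ r - yt (Suc i) ^ r)) = h (\<Sum>s<r. ?a s) \<oplus>\<^bsub>C\<^esub> (h (yt i ^ r) \<ominus>\<^bsub>C\<^esub> h (yt (Suc i) ^ r))"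
        by (simp add: h_add h_diff FA_sd)
      then show ?thesis using c i root[of i] root[of "Suc i"] by (simp add: C.r_neg a_minus_def h_one)
    qed
    finally show ?thesis .
  qed
  let ?c = "scalar (laurent_const (1 / of_nat r))"
  have sc: "?c \<in> FA" by (intro scalar_closed laurent_const_ground_ring inverse_r_coeff_ring)
  have s: "(\<Sum>s<r. ?a s) \<in> FA" "(\<Sum>s<r. ?b s) \<in> FA" using ab by (auto intro: FA_sum)
  have "h (y * ye r i) = h (?c * (y * (\<Sum>s<r. ?a s)))"
    using scalar_central[of "laurent_const (1 / of_nat r)" y] by (simp add: ye_def flip: mult.assoc)
  also have "\<dots> = h ?c \<otimes>\<^bsub>C\<^esub> (h (\<Sum>s<r. ?b s) \<otimes>\<^bsub>C\<^esub> h y)"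
    using 1 sc s y by (simp add: h_mult[of ?c] FA_sd) (simp add: h_mult)
  also have "\<dots> = h (ye r i * y)"
    using 2 sc s y by (simp add: ye_def mult.assoc h_mult[of ?c] FA_sd) (simp add: h_mult)
  finally show ?thesis .
qed

lemma nwF_closed: "k \<le> d \<Longrightarrow> nwF d k \<in> FA"
  and cu_closed: "k < d \<Longrightarrow> cu d k \<in> cR r d"
proof -
  show cu: "k < d \<Longrightarrow> cu d k \<in> cR r d" for k
    by (rule yh_params.u_R[OF ground_ring_params[OF r_pos d_pos]])
  show "k \<le> d \<Longrightarrow> nwF d k \<in> FA"
    by (induction k) (auto intro!: FA_sd gen_closed FA_scalar cu)
qed

lemma cDl_closed: "cDl \<in> cR r d"
  by (rule yh_params.Dl_R[OF ground_ring_params[OF r_pos d_pos]])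

lemma yh_ring_left: "yh_ring C Z n r d (h (scalar cDl)) U T G E (h yX)"
proof (intro yh_ring.intro yh_ring_axioms.intro cs.central_span_axioms)
  show "0 < r" "0 < d" using r_pos d_pos by simp_all
  show "h (scalar cDl) \<in> Z" using cDl_closed by (auto simp: Z_def)
  show "U k \<in> Z" if "k < d" for k using that cu_closed by (auto simp: Z_def)
  show "T i \<in> carrier C" "G i \<in> carrier C" "E i \<in> carrier C" "h yX \<in> carrier C" for i by simp_all
  show "G i \<otimes>\<^bsub>C\<^esub> G j = G j \<otimes>\<^bsub>C\<^esub> G i" if "1 \<le> i" "i + 2 \<le> j" "j < n" for i j
  proof -
    have "h (yg i * yg j) = h (yg j * yg i)"
      using that by (intro h_rel FA_sd FA_gens far_rel) auto
    then show ?thesis using that by (simp add: h_mult)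
  qed
  show "G i \<otimes>\<^bsub>C\<^esub> G (Suc i) \<otimes>\<^bsub>C\<^esub> G i = G (Suc i) \<otimes>\<^bsub>C\<^esub> G i \<otimes>\<^bsub>C\<^esub> G (Suc i)" if "1 \<le> i" "Suc i < n" for i
  proof -
    have "h (yg i * yg (Suc i) * yg i) = h (yg (Suc i) * yg i * yg (Suc i))"
      using that by (intro h_rel FA_sd FA_gens braid_rel) auto
    then show ?thesis using that by (simp add: h_mult FA_sd)
  qed
  show tt: "T i \<otimes>\<^bsub>C\<^esub> T j = T j \<otimes>\<^bsub>C\<^esub> T i" if "1 \<le> i" "i \<le> n" "1 \<le> j" "j \<le> n" for i j
  proof -
    have "h (yt i * yt j) = h (yt j * yt i)"
      using that by (intro h_rel FA_sd FA_gens tt_rel) auto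
    then show ?thesis using that by (simp add: h_mult)
  qed
  have gt: "h (yg i * yt j) = h (yt (transpose i (Suc i) j) * yg i)" if "1 \<le> i" "i < n" "1 \<le> j" "j \<le> n" for i j
    using that by (intro h_rel FA_sd FA_gens gt_rel) (auto simp: transpose_def)
  show "G i \<otimes>\<^bsub>C\<^esub> T j = T (transpose i (Suc i) j) \<otimes>\<^bsub>C\<^esub> G i" if "1 \<le> i" "i < n" "1 \<le> j" "j \<le> n" for i j
  proof -
    have "1 \<le> transpose i (Suc i) j" "transpose i (Suc i) j \<le> n" using that by (auto simp: transpose_def)
    then show ?thesis using gt[OF that] that by (simp add: h_mult)
  qed
  show "T i [^]\<^bsub>C\<^esub> r = \<one>\<^bsub>C\<^esub>" if "1 \<le> i" "i \<le> n" for i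
  proof -
    have "h (yt i ^ r) = h 1"
      using that by (intro h_rel FA_sd FA_gens FA_power root_rel) auto
    then show ?thesis using that by (simp add: h_pow h_one)
  qed
  show "G i \<otimes>\<^bsub>C\<^esub> G i = \<one>\<^bsub>C\<^esub> \<oplus>\<^bsub>C\<^esub> h (scalar cDl) \<otimes>\<^bsub>C\<^esub> (E i \<otimes>\<^bsub>C\<^esub> G i)" if "1 \<le> i" "i < n" for i
  proof -
    have "h ((yg i)\<^sup>2) = h (1 + scalar cDl * ye r i * yg i)"
      using that by (intro h_rel FA_sd FA_gens FA_power FA_scalar cDl_closed quad_rel) auto
    then show ?thesis using that 
      by (simp add: power2_eq_square h_mult h_add h_one FA_sd FA_scalar cDl_closed C.m_assoc)
  qed
  show "E i \<otimes>\<^bsub>C\<^esub> G i = G i \<otimes>\<^bsub>C\<^esub> E i" if "1 \<le> i" "i < n" for i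
  proof -
    have "h (yg i * ye r i) = h (ye r i * yg i)"
      using that gt[of i i] gt[of i "Suc i"] by (intro pass_ye[where j = "Suc i" and j' = i]) auto
    then show ?thesis using that by (simp add: h_mult)
  qed
  have tX: "h (yX * yt i) = h (yt i * yX)" if "1 \<le> i" "i \<le> n" for i
    using that by (intro h_rel[symmetric] FA_sd FA_gens tX_rel) auto
  show "T i \<otimes>\<^bsub>C\<^esub> h yX = h yX \<otimes>\<^bsub>C\<^esub> T i" if "1 \<le> i" "i \<le> n" for i
    using tX[OF that] that by (simp add: h_mult)
  show "E i \<otimes>\<^bsub>C\<^esub> h yX = h yX \<otimes>\<^bsub>C\<^esub> E i" if "1 \<le> i" "i < n" for i
  proof -
    have "h (yX * ye r i) = h (ye r i * yX)"
      using that tX[of i] tX[of "Suc i"] by (intro pass_ye[where j = i and j' = "Suc i"]) auto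
    then show ?thesis using that by (simp add: h_mult)
  qed
  show "E i \<otimes>\<^bsub>C\<^esub> x \<in> S" if "1 \<le> i" "i < n" "cs.zsub S" "\<And>x. x \<in> S \<Longrightarrow> T i \<otimes>\<^bsub>C\<^esub> x \<in> S"
    "\<And>x. x \<in> S \<Longrightarrow> T (Suc i) \<otimes>\<^bsub>C\<^esub> x \<in> S" "x \<in> S" for i S x
    using ye_in[OF absorb_left[OF that(3)], of i] that by auto
  show "G i \<otimes>\<^bsub>C\<^esub> h yX = h yX \<otimes>\<^bsub>C\<^esub> G i" if "2 \<le> i" "i < n" for i
  proof -
    have "h (yg i * yX) = h (yX * yg i)"
      using that by (intro h_rel FA_sd FA_gens gX_rel) auto
    then show ?thesis using that by (simp add: h_mult)
  qed
  show "G 1 \<otimes>\<^bsub>C\<^esub> h yX \<otimes>\<^bsub>C\<^esub> G 1 \<otimes>\<^bsub>C\<^esub> h yX = h yX \<otimes>\<^bsub>C\<^esub> G 1 \<otimes>\<^bsub>C\<^esub> h yX \<otimes>\<^bsub>C\<^esub> G 1" if "2 \<le> n"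
  proof -
    have "h (yg 1 * yX * yg 1 * yX) = h (yX * yg 1 * yX * yg 1)"
      using that by (intro h_rel FA_sd FA_gens gXgX_rel) auto
    then show ?thesis using that by (simp add: h_mult FA_sd)
  qed
  have "rec_nat \<one>\<^bsub>C\<^esub> (\<lambda>k. (\<otimes>\<^bsub>C\<^esub>) (h yX \<ominus>\<^bsub>C\<^esub> U k)) k = h (nwF d k)" if "k \<le> d" for k
    using that by (induction k) (simp_all add: h_one h_mult h_diff nwF_closed FA_sd FA_scalar cu_closed)
  then show "rec_nat \<one>\<^bsub>C\<^esub> (\<lambda>k. (\<otimes>\<^bsub>C\<^esub>) (h yX \<ominus>\<^bsub>C\<^esub> U k)) d = \<zero>\<^bsub>C\<^esub>"
    by (simp only: nwF_d h_cycl order_refl)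
qed

lemma yh_ring_right: "yh_ring (opposite C) Z n r d (h (scalar cDl)) U T G E (h yX)"
proof (rule yh_ring.opposite[OF yh_ring_left])
  show "x \<otimes>\<^bsub>C\<^esub> E i \<in> S" if "1 \<le> i" "i < n" "cs.zsub S" "\<And>x. x \<in> S \<Longrightarrow> x \<otimes>\<^bsub>C\<^esub> T i \<in> S"
    "\<And>x. x \<in> S \<Longrightarrow> x \<otimes>\<^bsub>C\<^esub> T (Suc i) \<in> S" "x \<in> S" for i S x
    using ye_in[OF absorb_right[OF that(3)], of i] that by auto
qed

end

context cyclotomic
begin

lemma qF_closed: "k \<le> d \<Longrightarrow> qF d k \<in> FA"
  by (induction k) (auto intro!: FA_sd nwF_closed FA_scalar cu_closed)

text \<open>Multiplication of $p_d(X) = 0$ by $X^{-1}$ gives $D_d(0, X) = -p_d(0)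
  X^{-1}$.\<close>

lemma h_X_inv: "h yX_inv = h (scalar (- cinv d) * qF d d)"
proof -
  have "(\<Prod>l<k. - cu d l) \<in> cR r d" if "k \<le> d" for k
    using that by (induction k) (auto simp: cu_closed intro!: cR_sd(1,4,5))
  then have ci: "cinv d \<in> cR r d" "cc d d \<in> cR r d"
    using cinv_closed[of d r] by (simp_all add: cc_def cR_def)
  note cl = FA_sd(3-6) FA_scalar ci cR_sd(5) qF_closed FA_gens nwF_closed order_refl
  have "cc d d * cinv d = 1" by (rule cc_cinv)
  then have one: "scalar (cinv d) * scalar (cc d d) = (1 :: yh_free)"
    by (simp add: mult.commute flip: scalar_hom)
  have "scalar (- cinv d) * qF d d - yX_inv = 
      scalar (- cinv d) * (yX_inv * (yX * qF d d + scalar (cc d d)) - (yX_inv * yX - 1) * qF d d)"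
  proof -
    have "scalar (cinv d) * (yX_inv * scalar (cc d d)) = (scalar (cinv d) * scalar (cc d d)) * yX_inv"
      by (simp add: mult.assoc scalar_central[of "cc d d" yX_inv])
    then have "scalar (cinv d) * (yX_inv * scalar (cc d d)) = yX_inv" by (simp add: one)
    then show ?thesis by (simp add: scalar_hom algebra_simps)
  qed
  also have "yX * qF d d + scalar (cc d d) = nwF d d" by (rule nwF_qF[symmetric])
  also have "h (scalar (- cinv d) * (yX_inv * nwF d d - (yX_inv * yX - 1) * qF d d)) = 
     h (scalar (- cinv d)) \<otimes>\<^bsub>C\<^esub> (h yX_inv \<otimes>\<^bsub>C\<^esub> h (nwF d d) \<ominus>\<^bsub>C\<^esub> (h (yX_inv * yX) \<ominus>\<^bsub>C\<^esub> h 1) \<otimes>\<^bsub>C\<^esub> h (qF d d))"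
    by (simp only: h_mult[of "scalar (- cinv d)"] h_diff h_mult[of yX_inv "nwF d d"] h_mult[of "yX_inv * yX - 1"] 
       cl FA_sd(1))
  also have "h (nwF d d) = \<zero>\<^bsub>C\<^esub>" by (simp only: nwF_d h_cycl)
  also have "h (yX_inv * yX) = h 1" by (intro h_rel inv_rel cl FA_sd(1))
  also have "h (scalar (- cinv d)) \<otimes>\<^bsub>C\<^esub> (h yX_inv \<otimes>\<^bsub>C\<^esub> \<zero>\<^bsub>C\<^esub> \<ominus>\<^bsub>C\<^esub> (h 1 \<ominus>\<^bsub>C\<^esub> h 1) \<otimes>\<^bsub>C\<^esub> h (qF d d)) = \<zero>\<^bsub>C\<^esub>"
    by (simp add: cl h_one a_minus_def C.r_neg)
  finally have "h (scalar (- cinv d) * qF d d) \<ominus>\<^bsub>C\<^esub> h yX_inv = \<zero>\<^bsub>C\<^esub>"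
    by (simp only: h_diff cl)
  then show ?thesis by (simp add: cl)
qed

text \<open>In the quotient the inverse of $X$ is a polynomial in $X$, so it is generated by the
  other elements.\<close>

lemma generated:
  assumes L: "subring_set L" "\<And>c. c \<in> cR r d \<Longrightarrow> scalar c \<in> L"
    and gens: "\<And>k. 1 \<le> k \<Longrightarrow> k \<le> n \<Longrightarrow> yt k \<in> L" "\<And>i. 1 \<le> i \<Longrightarrow> i < n \<Longrightarrow> yg i \<in> L" "yX \<in> L"
    and cong: "\<And>f f'. f \<in> L \<Longrightarrow> f' \<in> FA \<Longrightarrow> h f = h f' \<Longrightarrow> f' \<in> L"
  shows "FA \<subseteq> L"
proof
  note sd = subring_setD[OF L(1)]
  have nw: "nwF d k \<in> L" if "k \<le> d" for k
    using that by (induction k) (auto intro!: sd gens L(2) cu_closed)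
  have q: "qF d k \<in> L" if "k \<le> d" for k
    using that by (induction k) (auto intro!: sd nw L(2) cu_closed)
  have "scalar (- cinv d) * qF d d \<in> L"
    using cinv_closed[of d r] by (intro sd L(2) q cR_sd) (auto simp: cR_def)
  then have X: "yX_inv \<in> L" by (rule cong) (simp_all add: h_X_inv)
  have gen: "gen x \<in> L" if "x \<in> yh_gens n" for x
    using that gens X by (auto simp: yh_gens_def)
  have word: "Poly_Mapping.single (Word ws) c \<in> L" if "set ws \<subseteq> yh_gens n" "c \<in> cR r d" for ws c
    using that(1)
  proof (induction ws)
    case Nil
    then show ?case using L(2)[OF that(2)] by (simp add: scalar_def zero_free_monoid_def)
  next
    case (Cons x ws)
    have "Poly_Mapping.single (Word (x # ws)) c = gen x * Poly_Mapping.single (Word ws) c"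
      by (simp add: gen_def mult_single plus_free_monoid_def)
    then show ?case using Cons gen sd(4) by simp
  qed
  fix f assume f: "f \<in> FA"
  have "(\<Sum>w\<in>Poly_Mapping.keys f. Poly_Mapping.single w (Poly_Mapping.lookup f w)) \<in> L"
  proof (rule subring_set_sum[OF L(1)])
    fix w assume "w \<in> Poly_Mapping.keys f"
    then show "Poly_Mapping.single w (Poly_Mapping.lookup f w) \<in> L"
      using f word[of "letters w" "Poly_Mapping.lookup f w"]
      by (auto simp: yh_free_algebra_pm_over pm_over_def cR_def)
  qed
  then show "f \<in> L" using pm_sum_monomials[of "Poly_Mapping.keys f" f] by simp
qed

lemma left_generated:
  assumes S: "cs.zsub S" "\<one>\<^bsub>C\<^esub> \<in> S"
    and gens: "\<And>k x. 1 \<le> k \<Longrightarrow> k \<le> n \<Longrightarrow> x \<in> S \<Longrightarrow> T k \<otimes>\<^bsub>C\<^esub> x \<in> S"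
    "\<And>i x. 1 \<le> i \<Longrightarrow> i < n \<Longrightarrow> x \<in> S \<Longrightarrow> G i \<otimes>\<^bsub>C\<^esub> x \<in> S" "\<And>x. x \<in> S \<Longrightarrow> h yX \<otimes>\<^bsub>C\<^esub> x \<in> S"
  shows "carrier C \<subseteq> S"
proof -
  have "FA \<subseteq> {f \<in> FA. \<forall>x\<in>S. h f \<otimes>\<^bsub>C\<^esub> x \<in> S}"
    by (rule generated[OF absorb_left[OF S(1)]]) (use gens in auto)
  then show ?thesis using S(2) unfolding h_surj by (force dest: bspec[of _ _ "\<one>\<^bsub>C\<^esub>"])
qed

lemma right_generated:
  assumes S: "cs.zsub S" "\<one>\<^bsub>C\<^esub> \<in> S"
    and gens: "\<And>k x. 1 \<le> k \<Longrightarrow> k \<le> n \<Longrightarrow> x \<in> S \<Longrightarrow> x \<otimes>\<^bsub>C\<^esub> T k \<in> S"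
    "\<And>i x. 1 \<le> i \<Longrightarrow> i < n \<Longrightarrow> x \<in> S \<Longrightarrow> x \<otimes>\<^bsub>C\<^esub> G i \<in> S" "\<And>x. x \<in> S \<Longrightarrow> x \<otimes>\<^bsub>C\<^esub> h yX \<in> S"
  shows "carrier C \<subseteq> S"
proof -
  have "FA \<subseteq> {f \<in> FA. \<forall>x\<in>S. x \<otimes>\<^bsub>C\<^esub> h f \<in> S}"
    by (rule generated[OF absorb_right[OF S(1)]]) (use gens in auto)
  then show ?thesis using S(2) unfolding h_surj by (force dest: bspec[of _ _ "\<one>\<^bsub>C\<^esub>"])
qed

lemma upF_closed: "m < n \<Longrightarrow> upF m \<in> FA"
  by (induction m) (auto intro!: FA_sd)

lemma dnF_closed: "(\<And>i. 1 \<le> i \<Longrightarrow> i \<le> m \<Longrightarrow> s i \<in> FA) \<Longrightarrow> dnF s m \<in> FA"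
  by (induction m) (auto intro!: FA_sd)

lemma giF_closed: "1 \<le> i \<Longrightarrow> i < n \<Longrightarrow> giF r i \<in> FA"
  unfolding giF_def by (intro FA_sd FA_gens FA_scalar cDl_closed)

lemma col_row_closed:
  assumes "\<gamma> \<in> idx r d (Suc m)" "m < n"
  shows "colF r d m \<gamma> \<in> FA" "rowF d m \<gamma> \<in> FA"
  using assms
  by (auto simp: colF_def rowF_def idx_def intro!: FA_sd FA_power dnF_closed nwF_closed upF_closed giF_closed)

lemma words_closed:
  assumes "\<beta> \<in> words r d m" "m \<le> n" shows "cwF r d \<beta> \<in> FA" "rwF d \<beta> \<in> FA"
proof -
  have "cwF r d \<beta> \<in> FA \<and> rwF d \<beta> \<in> FA"
    using assms by (induction m arbitrary: \<beta>) (auto simp: length_words FA_sd col_row_closed)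
  then show "cwF r d \<beta> \<in> FA" "rwF d \<beta> \<in> FA" by simp_all
qed

lemma columns_span:
  assumes S: "cs.zsub S" and cw: "\<And>\<beta>. \<beta> \<in> words r d n \<Longrightarrow> h (cwF r d \<beta>) \<in> S"
  shows "carrier C \<subseteq> S"
proof -
  interpret Y: yh_ring C Z n r d "h (scalar cDl)" U T G E "h yX" by (rule yh_ring_left)
  have nw: "Y.nw k = h (nwF d k)" if "k \<le> d" for k
    using that by (induction k) (simp_all add: h_one h_mult h_diff nwF_closed FA_sd FA_scalar cu_closed)
  have up: "Y.up m = h (upF m)" if "m < n" for m
    using that by (induction m) (simp_all add: h_one h_mult upF_closed)
  have gi: "Y.gi i = h (giF r i)" if "1 \<le> i" "i < n" for i
    using that by (simp add: Y.gi_def giF_def h_diff h_mult FA_sd FA_scalar cDl_closed)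
  have dn: "Y.dn Y.gi m = h (dnF (giF r) m)" if "m < n" for m
    using that by (induction m) (simp_all add: h_one h_mult dnF_closed giF_closed gi)
  have col: "Y.col Y.gi m \<gamma> = h (colF r d m \<gamma>)" if "\<gamma> \<in> idx r d (Suc m)" "m < n" for m \<gamma>
    using that by (auto simp: Y.col_def colF_def idx_def nw up dn h_mult h_pow FA_sd FA_power dnF_closed
        nwF_closed upF_closed giF_closed)
  have word: "Y.word Y.gi \<beta> = h (cwF r d \<beta>)" if "\<beta> \<in> words r d m" "m \<le> n" for \<beta> m
    using that
    by (induction m arbitrary: \<beta>) (auto simp: length_words h_one h_mult col col_row_closed words_closed)
  have "carrier C \<subseteq> Y.S Y.gi n"
    by (rule left_generated) (use Y.span_closed[OF n_pos, of Y.gi] in auto)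
  also have "\<dots> \<subseteq> S" unfolding Y.S_def using word cw by (intro cs.zspan_least S) auto
  finally show ?thesis .
qed

text \<open>A row is a column of the opposite ring with all $g^{-1}$ replaced by $g$.\<close>

lemma rows_span:
  assumes S: "cs.zsub S" and cw: "\<And>\<beta>. \<beta> \<in> words r d n \<Longrightarrow> h (rwF d \<beta>) \<in> S"
  shows "carrier C \<subseteq> S"
proof -
  interpret Y: yh_ring "opposite C" Z n r d "h (scalar cDl)" U T G E "h yX" by (rule yh_ring_right)
  have comm: "nwF d k * yX = yX * nwF d k" for k
  proof (induction k)
    case (Suc k)
    have "nwF d (Suc k) * yX = (yX - scalar (cu d k)) * yX * nwF d k" by (simp add: mult.assoc Suc)
    also have "\<dots> = yX * nwF d (Suc k)"
      using scalar_central[of "cu d k" yX] by (simp add: algebra_simps flip: mult.assoc)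
    finally show ?case .
  qed simp
  have nw: "Y.nw k = h (nwF d k)" if "k \<le> d" for k
    using that
  proof (induction k)
    case (Suc k)
    have "nwF d (Suc k) = nwF d k * (yX - scalar (cu d k))"
      using comm[of k] scalar_central[of "cu d k" "nwF d k"] by (simp add: algebra_simps)
    then have "h (nwF d (Suc k)) = h (nwF d k) \<otimes>\<^bsub>C\<^esub> (h yX \<ominus>\<^bsub>C\<^esub> U k)"
      using Suc.prems by (simp only: h_mult h_diff nwF_closed FA_sd(6) FA_scalar cu_closed FA_gens Suc_leD Suc_le_lessD)
    then show ?case using Suc by (simp add: minus_opposite)
  qed (simp add: h_one)
  have up: "Y.up m = h (dnF yg m)" if "m < n" for m
    using that by (induction m) (simp_all add: h_one h_mult dnF_closed)
  have dn: "Y.dn G m = h (upF m)" if "m < n" for m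
    using that by (induction m) (simp_all add: h_one h_mult upF_closed)
  have col: "Y.col G m \<gamma> = h (rowF d m \<gamma>)" if "\<gamma> \<in> idx r d (Suc m)" "m < n" for m \<gamma>
    using that by (auto simp: Y.col_def rowF_def idx_def nw up dn h_mult h_pow FA_sd FA_power dnF_closed
        nwF_closed upF_closed pow_opposite[OF ring_C])
  have word: "Y.word G \<beta> = h (rwF d \<beta>)" if "\<beta> \<in> words r d m" "m \<le> n" for \<beta> m
    using that
    by (induction m arbitrary: \<beta>) (auto simp: length_words h_one h_mult col col_row_closed words_closed)
  have "carrier C \<subseteq> Y.S G n"
    by (rule right_generated) (use Y.span_closed[OF n_pos, of G] in \<open>auto simp: cs.zsub_opposite\<close>)
  also have "\<dots> \<subseteq> S" unfolding Y.S_def using word cw S by (intro Y.zspan_least) (auto simp: cs.zsub_opposite)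
  finally show ?thesis .
qed

end

section \<open>The Frobenius isomorphism\<close>

theorem corollary4p5:
  fixes r n d :: nat
  assumes "r \<ge> 1" and "n \<ge> 1" and "d \<ge> 1"
  shows "frobenius_algebra (ground_ring r d) (cyclotomic_yh r n d)"
proof -
  define C where "C = cyclotomic_yh r n d"
  obtain h where C: "assoc_algebra (ground_ring r d) C" "h \<in> ring_hom (yh_free_algebra r n d) C"
      "carrier C = h ` carrier (yh_free_algebra r n d)"
    and smult: "\<And>c x. c \<in> carrier (ground_ring r d) \<Longrightarrow> x \<in> carrier (yh_free_algebra r n d) \<Longrightarrow> c \<odot>\<^bsub>C\<^esub> h x = h (scalar c * x)"
    and rel: "\<And>x y. x \<in> carrier (yh_free_algebra r n d) \<Longrightarrow> y \<in> carrier (yh_free_algebra r n d) \<Longrightarrow>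
      x - y \<in> yh_relations r n \<Longrightarrow> h x = h y"
    and cyc: "h (cycl d) = \<zero>\<^bsub>C\<^esub>"
    and kernel: "\<And>K x. ideal K (yh_free_algebra r n d) \<Longrightarrow> yh_relations r n \<subseteq> K \<Longrightarrow> cycl d \<in> K \<Longrightarrow>
      x \<in> carrier (yh_free_algebra r n d) \<Longrightarrow> h x = \<zero>\<^bsub>C\<^esub> \<Longrightarrow> x \<in> K"
    by (rule cyclotomic_quotient[of r d n, folded C_def]) blast
  have "ring C" using C(1) by (simp add: assoc_algebra_def)
  then interpret cyclotomic r n d C h by (rule cyclotomic.intro[OF assms _ C(2,3) rel cyc])
  obtain op v lam where ev: "evaluation op"
    and ev_V: "\<And>f z. f \<in> FA \<Longrightarrow> z \<in> stdV r d n \<Longrightarrow> ev op f z \<in> stdV r d n"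
    and K: "ideal {f \<in> FA. \<forall>z\<in>stdV r d n. ev op f z = 0} (yh_free_algebra r n d)"
      "yh_relations r n \<subseteq> {f \<in> FA. \<forall>z\<in>stdV r d n. ev op f z = 0}"
      "cycl d \<in> {f \<in> FA. \<forall>z\<in>stdV r d n. ev op f z = 0}"
    and v: "v \<in> stdV r d n" and lam: "linmap vsc (*) lam" "\<And>z. z \<in> stdV r d n \<Longrightarrow> lam z \<in> cR r d"
    and col: "\<And>\<beta>. \<beta> \<in> words r d n \<Longrightarrow> ev op (cwF r d \<beta>) v = unitV \<beta>"
    and row: "\<And>y. (\<And>\<beta>. \<beta> \<in> words r d n \<Longrightarrow> y \<beta> \<in> cR r d) \<Longrightarrow>
      \<exists>!z. z \<in> stdV r d n \<and> (\<forall>\<beta>\<in>words r d n. lam (ev op (rwF d \<beta>) z) = y \<beta>)"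
    using representation[OF assms(1,3), of n] by blast
  interpret E: evaluation op by (rule ev)
  \<comment> \<open>The orbit map of v; it is well defined on the quotient.\<close>
  define \<alpha> where "\<alpha> x = ev op (SOME f. f \<in> FA \<and> h f = x) v" for x
  have \<alpha>: "\<alpha> (h f) = ev op f v" if f: "f \<in> FA" for f
  proof -
    define f' where "f' = (SOME f'. f' \<in> FA \<and> h f' = h f)"
    have f': "f' \<in> FA \<and> h f' = h f" unfolding f'_def by (rule someI[of _ f]) (use f in simp)
    then have "h (f' - f) = \<zero>\<^bsub>C\<^esub>" using f by (simp add: h_diff a_minus_def C.r_neg)
    then have "f' - f \<in> {f \<in> FA. \<forall>z\<in>stdV r d n. ev op f z = 0}"
      using kernel[OF K] f f' by (simp add: FA_sd)
    then show ?thesis using v by (simp add: E.ev_diff \<alpha>_def f'_def)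
  qed
  have lift: "\<exists>f\<in>FA. x = h f" if "x \<in> carrier C" for x using that by (auto simp: h_surj)
  have cR: "cR r d = carrier (ground_ring r d)" by (simp add: cR_def)
  define \<mu> where "\<mu> x = lam (\<alpha> x)" for x
  have \<alpha>_add: "\<alpha> (x \<oplus>\<^bsub>C\<^esub> y) = \<alpha> x + \<alpha> y" if "x \<in> carrier C" "y \<in> carrier C" for x y
    using lift[OF that(1)] lift[OF that(2)] by (auto simp: \<alpha> E.ev_add FA_sd simp flip: h_add)
  have \<alpha>_smult: "\<alpha> (c \<odot>\<^bsub>C\<^esub> x) = vsc c (\<alpha> x)" if "c \<in> cR r d" "x \<in> carrier C" for c x
    using lift[OF that(2)] that(1) by (auto simp: \<alpha> smult cR E.ev_mult E.ev_scalar FA_sd scalar_closed)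
  have \<alpha>_V: "\<alpha> x \<in> stdV r d n" if "x \<in> carrier C" for x
    using lift[OF that] v by (auto simp: \<alpha> ev_V)
  have \<mu>_add: "\<mu> (x \<oplus>\<^bsub>C\<^esub> y) = \<mu> x + \<mu> y" if "x \<in> carrier C" "y \<in> carrier C" for x y
    by (simp only: \<mu>_def \<alpha>_add[OF that] linmap_simps[OF lam(1)])
  have \<mu>_smult: "\<mu> (c \<odot>\<^bsub>C\<^esub> x) = c * \<mu> x" if "c \<in> cR r d" "x \<in> carrier C" for c x
    by (simp only: \<mu>_def \<alpha>_smult[OF that] linmap_simps[OF lam(1)])
  have \<mu>_R: "\<mu> x \<in> cR r d" if "x \<in> carrier C" for x using lam(2)[OF \<alpha>_V[OF that]] by (simp add: \<mu>_def)
  have \<mu>_row: "\<mu> (h f \<otimes>\<^bsub>C\<^esub> a) = lam (ev op f (\<alpha> a))" if "f \<in> FA" "a \<in> carrier C" for f a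
    using lift[OF that(2)] that(1) by (auto simp: \<mu>_def \<alpha> E.ev_mult FA_sd simp flip: h_mult)
  have smult_Z: "c \<odot>\<^bsub>C\<^esub> x = h (scalar c) \<otimes>\<^bsub>C\<^esub> x" if "c \<in> cR r d" "x \<in> carrier C" for c x
    using lift[OF that(2)] that(1) by (auto simp: smult cR h_mult scalar_closed)
  \<comment> \<open>Linear combinations of columns exhaust the algebra and have the prescribed
    coordinates on V.\<close>
  define comb where "comb k = (\<Sum>\<beta>\<in>words r d n. scalar (k \<beta>) * cwF r d \<beta>)" for k
  have comb_FA: "comb k \<in> FA" if "\<And>\<beta>. \<beta> \<in> words r d n \<Longrightarrow> k \<beta> \<in> cR r d" for k
    unfolding comb_def by (intro FA_sum FA_sd FA_scalar that words_closed) auto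
  have ev_comb: "ev op (comb k) v = (\<lambda>\<beta>. if \<beta> \<in> words r d n then k \<beta> else 0)" for k
  proof (rule ext)
    fix \<beta>
    have "ev op (comb k) v \<beta> = (\<Sum>\<beta>'\<in>words r d n. k \<beta>' * unitV \<beta>' \<beta>)"
      by (simp add: comb_def E.ev_sum E.ev_mult E.ev_scalar col sum_fun_apply fscale_def)
    also have "\<dots> = (\<Sum>\<beta>'\<in>words r d n. if \<beta> = \<beta>' then k \<beta>' else 0)"
      by (rule sum.cong) (auto simp: unitV_def)
    also have "\<dots> = (if \<beta> \<in> words r d n then k \<beta> else 0)" by (simp add: finite_words)
    finally show "ev op (comb k) v \<beta> = (if \<beta> \<in> words r d n then k \<beta> else 0)" .
  qed
  define S where "S = {h (comb k) | k. \<forall>\<beta>\<in>words r d n. k \<beta> \<in> cR r d}"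
  have SI: "h (comb k) \<in> S" if "\<And>\<beta>. \<beta> \<in> words r d n \<Longrightarrow> k \<beta> \<in> cR r d" for k
    using that by (auto simp: S_def)
  have comb_C: "carrier C \<subseteq> S"
  proof (rule columns_span)
    have add: "h (comb k) \<oplus>\<^bsub>C\<^esub> h (comb l) = h (comb (\<lambda>\<beta>. k \<beta> + l \<beta>))" 
      if "\<forall>\<beta>\<in>words r d n. k \<beta> \<in> cR r d" "\<forall>\<beta>\<in>words r d n. l \<beta> \<in> cR r d" for k l
    proof -
      have "comb (\<lambda>\<beta>. k \<beta> + l \<beta>) = comb k + comb l"
        by (simp add: comb_def scalar_hom distrib_right sum.distrib)
      then show ?thesis using that by (simp add: h_add comb_FA)
    qed
    have mult: "h (scalar c) \<otimes>\<^bsub>C\<^esub> h (comb k) = h (comb (\<lambda>\<beta>. c * k \<beta>))"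
      if "\<forall>\<beta>\<in>words r d n. k \<beta> \<in> cR r d" "c \<in> cR r d" for k c
    proof -
      have "comb (\<lambda>\<beta>. c * k \<beta>) = scalar c * comb k"
        by (simp add: comb_def scalar_hom sum_distrib_left mult.assoc)
      then show ?thesis using that by (simp add: h_mult comb_FA FA_scalar)
    qed
    have "\<zero>\<^bsub>C\<^esub> = h (comb (\<lambda>\<beta>. 0))" by (simp add: comb_def scalar_hom h_zero)
    then have zero: "\<zero>\<^bsub>C\<^esub> \<in> S" using SI[of "\<lambda>\<beta>. 0"] cR_sd(2) by simp
    have "x \<oplus>\<^bsub>C\<^esub> y \<in> S" if xy: "x \<in> S" "y \<in> S" for x y
    proof -
      obtain k l where "x = h (comb k)" "y = h (comb l)" "\<forall>\<beta>\<in>words r d n. k \<beta> \<in> cR r d" "\<forall>\<beta>\<in>words r d n. l \<beta> \<in> cR r d"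
        using xy by (auto simp: S_def)
      then show ?thesis using SI[of "\<lambda>\<beta>. k \<beta> + l \<beta>"] cR_sd(3) by (simp add: add)
    qed
    moreover have "z \<otimes>\<^bsub>C\<^esub> x \<in> S" if zx: "z \<in> Z" "x \<in> S" for z x
    proof -
      obtain k c where "x = h (comb k)" "z = h (scalar c)" "\<forall>\<beta>\<in>words r d n. k \<beta> \<in> cR r d" "c \<in> cR r d"
        using zx by (auto simp: S_def Z_def)
      then show ?thesis using SI[of "\<lambda>\<beta>. c * k \<beta>"] cR_sd(4) by (simp add: mult)
    qed
    moreover have "S \<subseteq> carrier C" by (auto simp: S_def comb_FA)
    ultimately show "cs.zsub S" using zero unfolding cs.zsub_def by blast
    fix \<beta> assume \<beta>: "\<beta> \<in> words r d n"
    have "comb (\<lambda>\<beta>'. if \<beta>' = \<beta> then 1 else 0) = (\<Sum>\<beta>'\<in>words r d n. if \<beta>' = \<beta> then cwF r d \<beta>' else 0)"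
      unfolding comb_def by (rule sum.cong) (auto simp: scalar_hom)
    also have "\<dots> = cwF r d \<beta>" using \<beta> by (simp add: finite_words)
    finally show "h (cwF r d \<beta>) \<in> S" using SI[of "\<lambda>\<beta>'. if \<beta>' = \<beta> then 1 else 0"] cR_sd(1,2) by auto
  qed
  \<comment> \<open>By the span and the coordinates, the orbit map is bijective onto V.\<close>
  have \<alpha>_inj: "x = y" if xy: "x \<in> carrier C" "y \<in> carrier C" "\<alpha> x = \<alpha> y" for x y
  proof -
    obtain k l where k: "x = h (comb k)" "\<forall>\<beta>\<in>words r d n. k \<beta> \<in> cR r d"
      and l: "y = h (comb l)" "\<forall>\<beta>\<in>words r d n. l \<beta> \<in> cR r d"
      using subsetD[OF comb_C xy(1)] subsetD[OF comb_C xy(2)] by (auto simp: S_def)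
    have "(\<lambda>\<beta>. if \<beta> \<in> words r d n then k \<beta> else 0) = (\<lambda>\<beta>. if \<beta> \<in> words r d n then l \<beta> else 0)"
      using xy(3) k l by (simp add: \<alpha> comb_FA ev_comb)
    then have "k \<beta> = l \<beta>" if "\<beta> \<in> words r d n" for \<beta> using that by (auto dest: fun_cong[where x = \<beta>])
    then have "comb k = comb l" by (simp add: comb_def)
    then show ?thesis using k l by simp
  qed
  have \<alpha>_surj: "\<exists>a\<in>carrier C. \<alpha> a = z" if z: "z \<in> stdV r d n" for z
  proof -
    have zz: "z \<beta> \<in> cR r d" "\<beta> \<notin> words r d n \<Longrightarrow> z \<beta> = 0" for \<beta> using z by (auto simp: stdV_def)
    have "ev op (comb z) v = z" using zz by (auto simp: ev_comb)
    then show ?thesis using comb_FA[of z] zz by (intro bexI[of _ "h (comb z)"]) (auto simp: \<alpha>)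
  qed
  let ?R = "ground_ring r d"
  let ?N = "right_regular_dual ?R C"
  have R_ops: "x \<oplus>\<^bsub>?R\<^esub> y = x + y" "x \<otimes>\<^bsub>?R\<^esub> y = x * y" for x y by (simp_all add: ground_ring_def)
  have smult_C: "c \<odot>\<^bsub>C\<^esub> x \<in> carrier C" if "c \<in> cR r d" "x \<in> carrier C" for c x
    using that by (simp add: smult_Z FA_scalar)
  define f where "f a = (\<lambda>x\<in>carrier C. \<mu> (x \<otimes>\<^bsub>C\<^esub> a))" for a
  have f_N: "f a \<in> carrier ?N" if "a \<in> carrier C" for a
  proof -
    have "(c \<odot>\<^bsub>C\<^esub> x) \<otimes>\<^bsub>C\<^esub> a = c \<odot>\<^bsub>C\<^esub> (x \<otimes>\<^bsub>C\<^esub> a)" if "c \<in> cR r d" "x \<in> carrier C" for c x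
      using that \<open>a \<in> carrier C\<close> by (simp add: smult_Z C.m_assoc FA_scalar)
    then show ?thesis using that
      by (auto simp: right_regular_dual_def f_def R_ops C.l_distr \<mu>_add \<mu>_smult \<mu>_R smult_C cR[symmetric])
  qed
  \<comment> \<open>Rows determine the vector of a, hence a.\<close>
  have f_inj: "inj_on f (carrier C)"
  proof (rule inj_onI)
    fix a b assume ab: "a \<in> carrier C" "b \<in> carrier C" "f a = f b"
    have eq: "lam (ev op (rwF d \<beta>) (\<alpha> a)) = lam (ev op (rwF d \<beta>) (\<alpha> b))" if "\<beta> \<in> words r d n" for \<beta>
    proof -
      have w: "rwF d \<beta> \<in> FA" using words_closed(2)[OF that order_refl] .
      have "f a (h (rwF d \<beta>)) = f b (h (rwF d \<beta>))" by (simp only: ab(3))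
      then show ?thesis using w ab by (simp add: f_def \<mu>_row)
    qed
    have "lam (ev op (rwF d \<beta>) (\<alpha> b)) \<in> cR r d" if "\<beta> \<in> words r d n" for \<beta>
      using ev_V[OF words_closed(2)[OF that order_refl] \<alpha>_V[OF ab(2)]] by (rule lam(2))
    from row[of "\<lambda>\<beta>. lam (ev op (rwF d \<beta>) (\<alpha> b))", OF this] have "\<alpha> a = \<alpha> b"
      using eq \<alpha>_V[OF ab(1)] \<alpha>_V[OF ab(2)] by blast
    then show "a = b" using ab \<alpha>_inj by blast
  qed
  \<comment> \<open>A functional is determined by its values on the rows, and these are values
    of the form.\<close>
  have f_surj: "\<exists>a\<in>carrier C. f a = \<phi>" if \<phi>: "\<phi> \<in> carrier ?N" for \<phi>
  proof -
    have \<phi>_add: "\<phi> (x \<oplus>\<^bsub>C\<^esub> y) = \<phi> x + \<phi> y" if "x \<in> carrier C" "y \<in> carrier C" for x y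
      using \<phi> that by (auto simp: right_regular_dual_def R_ops cR[symmetric])
    have \<phi>_smult: "\<phi> (c \<odot>\<^bsub>C\<^esub> x) = c * \<phi> x" if "x \<in> carrier C" "c \<in> cR r d" for x c
      using \<phi> that by (auto simp: right_regular_dual_def R_ops cR[symmetric])
    have \<phi>E: "\<phi> \<in> carrier C \<rightarrow>\<^sub>E cR r d"
      using \<phi> by (simp add: right_regular_dual_def cR)
    have w: "h (rwF d \<beta>) \<in> carrier C" if "\<beta> \<in> words r d n" for \<beta>
      using words_closed(2)[OF that order_refl] by simp
    have "\<phi> (h (rwF d \<beta>)) \<in> cR r d" if "\<beta> \<in> words r d n" for \<beta>
      using \<phi>E w[OF that] by (auto simp: PiE_iff)
    from row[of "\<lambda>\<beta>. \<phi> (h (rwF d \<beta>))", OF this]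
    obtain z where z: "z \<in> stdV r d n" "\<forall>\<beta>\<in>words r d n. lam (ev op (rwF d \<beta>) z) = \<phi> (h (rwF d \<beta>))" by blast
    obtain a where a: "a \<in> carrier C" "\<alpha> a = z" using \<alpha>_surj[OF z(1)] by blast
    have zero: "\<phi> \<zero>\<^bsub>C\<^esub> = 0" "\<mu> \<zero>\<^bsub>C\<^esub> = 0"
      using \<phi>_add[of "\<zero>\<^bsub>C\<^esub>" "\<zero>\<^bsub>C\<^esub>"] \<mu>_add[of "\<zero>\<^bsub>C\<^esub>" "\<zero>\<^bsub>C\<^esub>"] by simp_all
    have "carrier C \<subseteq> {x \<in> carrier C. \<phi> x = \<mu> (x \<otimes>\<^bsub>C\<^esub> a)}"
    proof (rule rows_span)
      have "\<phi> (h (scalar c) \<otimes>\<^bsub>C\<^esub> x) = \<mu> (h (scalar c) \<otimes>\<^bsub>C\<^esub> x \<otimes>\<^bsub>C\<^esub> a)"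
        if "x \<in> carrier C" "\<phi> x = \<mu> (x \<otimes>\<^bsub>C\<^esub> a)" "c \<in> cR r d" for c x
        using that a \<phi>_smult[of x c] \<mu>_smult[of c "x \<otimes>\<^bsub>C\<^esub> a"] by (simp add: smult_Z C.m_assoc FA_scalar)
      then show "cs.zsub {x \<in> carrier C. \<phi> x = \<mu> (x \<otimes>\<^bsub>C\<^esub> a)}"
        unfolding cs.zsub_def using a zero by (auto simp: \<phi>_add \<mu>_add C.l_distr Z_def FA_scalar)
      show "h (rwF d \<beta>) \<in> {x \<in> carrier C. \<phi> x = \<mu> (x \<otimes>\<^bsub>C\<^esub> a)}" if "\<beta> \<in> words r d n" for \<beta>
        using z(2) that w[OF that] a \<mu>_row[OF words_closed(2)[OF that order_refl] a(1)] by simp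
    qed
    then have "f a = \<phi>" using \<phi>E by (auto simp: f_def fun_eq_iff PiE_iff extensional_def)
    then show ?thesis using a by blast
  qed
  have "f \<in> left_module_iso C (left_regular C) ?N"
  proof -
    have "bij_betw f (carrier C) (carrier ?N)"
      using f_inj f_N f_surj by (auto simp: bij_betw_def image_iff)
    moreover have "f (x \<oplus>\<^bsub>C\<^esub> y) = f x \<oplus>\<^bsub>?N\<^esub> f y" if "x \<in> carrier C" "y \<in> carrier C" for x y
      using that by (auto simp: f_def right_regular_dual_def fun_eq_iff R_ops C.r_distr \<mu>_add)
    moreover have "f (a \<otimes>\<^bsub>C\<^esub> x) = a \<odot>\<^bsub>?N\<^esub> f x" if "a \<in> carrier C" "x \<in> carrier C" for a x
      using that by (auto simp: f_def right_regular_dual_def fun_eq_iff C.m_assoc)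
    ultimately show ?thesis by (simp add: left_module_iso_def left_regular_def)
  qed
  then show ?thesis using C(1) unfolding frobenius_algebra_def C_def by blast
qed

end
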